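(* Let $A\colon \mathrm{dom}(A)\subset H\to H$ be linear, densely defined, self-adjoint and positive definite with compact inverse, with eigenvalues $0<\lambda_1\le\lambda_2\le\cdots$. Let $\tau>0$ and let $f\colon\mathbb{R}\times H\to H$ and $g\colon\mathbb{R}\times H\to\mathcal{L}_2^0$ be continuous and periodic in time with period $\tau$, and suppose there exist $\kappa\in(0,1/2]$ and $C_f,C_g,C_{f,g}\in(0,\infty)$ such that for all $u,u_1,u_2\in H$ and $t,t_1,t_2\in[0,\tau)$ $$\|f(t,u_1)-f(t,u_2)\|\le C_f\|u_1-u_2\|,\qquad \|f(t_1,u)-f(t_2,u)\|\le C_f(1+\|u\|)|t_1-t_2|^{\kappa},$$ $$\|g(t,u_1)-g(t,u_2)\|_{\mathcal{L}_2^0}\le C_g\|u_1-u_2\|,\qquad \|g(t_1,u)-g(t_2,u)\|_{\mathcal{L}_2^0}\le C_g(1+\|u\|)|t_1-t_2|^{\kappa},$$ $$2\big(f(t,u_1)-f(t,u_2),u_1-u_2\big)+\|g(t,u_1)-g(t,u_2)\|_{\mathcal{L}_2^0}^2\le-C_{f,g}\|u_1-u_2\|^2.$$ Put $L_{f,g}:=\|f(0,0)\|+\|g(0,0)\|_{\mathcal{L}_2^0}+(C_f+C_g)(1+\tau^{1/2})$ and assume $C_f<\lambda_1$, $L_{f,g}<2\lambda_1$ and $\frac{C_f}{\lambda_1}+\frac{C_g}{\sqrt{\lambda_1}}<1$. Assume there is a standard $\mathbb{P}$-preserving ergodic Wiener shift $\theta=(\theta_s)_{s\in\mathbb{R}}$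 on $\Omega$ with $W(t,\theta_s\omega)=W(t+s,\omega)-W(s,\omega)$ for $s,t\in\mathbb{R}$. Let $\xi\in L^2(\Omega,\mathcal{F}_{-k\tau},\mathbb{P};H)$ for every $k\in\mathbb{N}$. Put $C_n:=3(\lambda_n^2+4L_{f,g}^2)$ and $c_n:=3(\lambda_n^2+C_f^2+C_g^2)$. Then for any stepsize $h\in(0,1)$ satisfying $$2C_f(\sqrt h\,\lambda_n+\sqrt{c_n})\sqrt h\le C_{f,g}\quad\text{and}\quad\big(5L_{f,g}\sqrt{h\lambda_n}(1+C_nh)+2C_f\sqrt{C_n}\big)\sqrt h\le2C_{f,g},$$ the (continuous version of the) Galerkin discrete exponential integrator scheme admits a unique random periodic solution $\hat X^{n,*}_t\in L^2(\Omega;H)$ such that $$\lim_{k\to\infty}\mathbb{E}\big[\|\hat X^{n,-k\tau}_t(\xi)-\hat X^{n,*}_t\|^2\big]=0,$$ where $\hat X^{n,-k\tau}_\cdot(\xi)$ is the numerical approximation started from $P_n\xi$ at time $-k\tau$.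
   Context: $(H,(\cdot,\cdot),\|\cdot\|)$ and $(U,(\cdot,\cdot)_U,\|\cdot\|_U)$ are separable real Hilbert spaces. $(\Omega,\mathcal{F},(\mathcal{F}_t)_{t\in\mathbb{R}},\mathbb{P})$ is a filtered probability space satisfying the usual conditions, and $W=(W(t))_{t\in\mathbb{R}}$ is a two-sided $(\mathcal{F}_t)$-Wiener process on $U$ with covariance operator $Q\in\mathcal{L}(U)$ (not necessarily of finite trace). $\mathcal{L}_2^0=\mathcal{L}_2(Q^{1/2}(U),H)$ is the space of Hilbert–Schmidt operators from $Q^{1/2}(U)$ to $H$. $(e_i)_{i\ge1}$ is an orthonormal basis of $H$ with $Ae_i=\lambda_ie_i$, $\lambda_i\to\infty$. $(S(t))_{t\ge0}$ is the analytic semigroup of contractions on $H$ generated by $-A$. Numerical scheme (for the equation $\mathrm{d}X_t=[-AX_t+f(t,X_t)]\mathrm{d}t+g(t,X_t)\mathrm{d}W(t)$): $H_n=\mathrm{span}\{e_1,\dots,e_n\}$, $P_n\colon H\to H_n$ is the orthogonal projection, $f_n=P_nf$, $g_n=P_ng$, $S_n(t)=P_nS(t)$. The scheme runs on the equidistant partition $\mathcal{T}^h=\{jh:j\in\mathbb{Z}\}$ of $\mathbb{R}$, so that the starting times $-k\tau$ are points of $\mathcal{T}^h$ (i.e. $\tau$ is an integer multiple of $h$). Started at time $-k\tau$: $\hat X^{n,-k\tau}_{-k\tau}=P_n\xi$ and for $j=0,1,2,\dots$, with $t_j=-k\tau+jh$ and $\Delta W_{t_j}=W(t_{j+1})-W(t_j)$,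 $$\hat X^{n,-k\tau}_{t_{j+1}}=S_n(h)\big(\hat X^{n,-k\tau}_{t_j}+hf_n(t_j,\hat X^{n,-k\tau}_{t_j})+g_n(t_j,\hat X^{n,-k\tau}_{t_j})\Delta W_{t_j}\big).$$ For $t\in[t_j,t_{j+1})$ put $\Lambda(t)=t_j$ and $\bar X^{n,-k\tau}_t=\hat X^{n,-k\tau}_{t_j}$. The continuous version of the scheme is, for $t\ge-k\tau$, $$\hat X^{n,-k\tau}_t=S(t+k\tau)P_n\xi+\int_{-k\tau}^tS(t-\Lambda(s))f_n(\Lambda(s),\bar X^{n,-k\tau}_s)\,\mathrm{d}s+\int_{-k\tau}^tS(t-\Lambda(s))g_n(\Lambda(s),\bar X^{n,-k\tau}_s)\,\mathrm{d}W(s).$$ The scheme is started analogously at any $s\in\mathcal{T}^h$; write $\hat u(t,s,x,\omega)$ for its value at time $t\ge s$ when started from $x\in H_n$ at time $s\in\mathcal{T}^h$. A random periodic solution of period $\tau$ of the scheme is an $\mathcal{F}$-measurable map $y\colon\mathbb{R}\times\Omega\to H_n\subset H$ such that for a.e. $\omega$: $\hat u(t,s,y(s,\omega),\omega)=y(t,\omega)$ for all $s\in\mathcal{T}^h$, $t\ge s$, and $y(s+\tau,\omega)=y(s,\theta_\tau\omega)$ for all $s\in\mathbb{R}$. *)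

theory Defs
  imports "HOL-Probability.Probability"
begin

section \<open>Operators on a real Hilbert space\<close>

text \<open>An unbounded operator is given by its domain \<open>D\<close> and a total function \<open>A\<close> whose values
  outside \<open>D\<close> are irrelevant.\<close>

definition linear_on_domain :: "'h::real_vector set \<Rightarrow> ('h \<Rightarrow> 'h) \<Rightarrow> bool" where
  "linear_on_domain D A \<longleftrightarrow> subspace D \<and>
     (\<forall>x\<in>D. \<forall>y\<in>D. A (x + y) = A x + A y) \<and> (\<forall>c. \<forall>x\<in>D. A (c *\<^sub>R x) = c *\<^sub>R A x)"

text \<open>The first conjunct says \<open>dom(A\<^sup>*) = dom(A)\<close>, the second that \<open>A\<^sup>*\<close> and \<open>A\<close> agree there.\<close>

definition self_adjoint_on_domain :: "'h::real_inner set \<Rightarrow> ('h \<Rightarrow> 'h) \<Rightarrow> bool" where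
  "self_adjoint_on_domain D A \<longleftrightarrow>
     {y. \<exists>z. \<forall>x\<in>D. inner (A x) y = inner x z} = D \<and>
     (\<forall>x\<in>D. \<forall>y\<in>D. inner (A x) y = inner x (A y))"

definition positive_definite_on_domain :: "'h::real_inner set \<Rightarrow> ('h \<Rightarrow> 'h) \<Rightarrow> bool" where
  "positive_definite_on_domain D A \<longleftrightarrow> (\<forall>x\<in>D. x \<noteq> 0 \<longrightarrow> 0 < inner (A x) x)"

definition has_compact_inverse :: "'h::real_normed_vector set \<Rightarrow> ('h \<Rightarrow> 'h) \<Rightarrow> bool" where
  "has_compact_inverse D A \<longleftrightarrow> bij_betw A D UNIV \<and>
     (\<forall>B. bounded B \<longrightarrow> compact (closure (inv_into D A ` B)))"

text \<open>\<open>S\<close> is only meaningful on nonnegative times.  For \<open>B = -A\<close> with \<open>A\<close> self-adjoint and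
  positive, analyticity of the semigroup is automatic.\<close>

definition generates_contraction_semigroup ::
    "'h::real_normed_vector set \<Rightarrow> ('h \<Rightarrow> 'h) \<Rightarrow> (real \<Rightarrow> 'h \<Rightarrow>\<^sub>L 'h) \<Rightarrow> bool" where
  "generates_contraction_semigroup D B S \<longleftrightarrow>
     S 0 = id_blinfun \<and>
     (\<forall>s\<ge>0. \<forall>t\<ge>0. S (s + t) = S s o\<^sub>L S t) \<and>
     (\<forall>x. ((\<lambda>t. blinfun_apply (S t) x) \<longlongrightarrow> x) (at_right 0)) \<and>
     (\<forall>t\<ge>0. norm (S t) \<le> 1) \<and>
     D = {x. \<exists>y. ((\<lambda>t. (blinfun_apply (S t) x - x) /\<^sub>R t) \<longlongrightarrow> y) (at_right 0)} \<and>
     (\<forall>x\<in>D. ((\<lambda>t. (blinfun_apply (S t) x - x) /\<^sub>R t) \<longlongrightarrow> B x) (at_right 0))"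

text \<open>Bases are indexed from 1; the value at index 0 plays no role.\<close>

definition orthonormal_basis :: "(nat \<Rightarrow> 'h::real_inner) \<Rightarrow> bool" where
  "orthonormal_basis e \<longleftrightarrow>
     (\<forall>i\<ge>1. \<forall>j\<ge>1. inner (e i) (e j) = (if i = j then 1 else 0)) \<and>
     closure (span (e ` {1..})) = UNIV"

definition galerkin_space :: "(nat \<Rightarrow> 'h::real_inner) \<Rightarrow> nat \<Rightarrow> 'h set" where
  "galerkin_space e n = span (e ` {1..n})"

definition galerkin_proj :: "(nat \<Rightarrow> 'h::real_inner) \<Rightarrow> nat \<Rightarrow> 'h \<Rightarrow> 'h" where
  "galerkin_proj e n x = (\<Sum>i=1..n. inner x (e i) *\<^sub>R e i)"


section \<open>The space of Hilbert-Schmidt operators on the range of the root of the covariance\<close>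

definition positive_op :: "('u::real_inner \<Rightarrow>\<^sub>L 'u) \<Rightarrow> bool" where
  "positive_op Q \<longleftrightarrow>
     (\<forall>x y. inner (blinfun_apply Q x) y = inner x (blinfun_apply Q y)) \<and>
     (\<forall>x. 0 \<le> inner (blinfun_apply Q x) x)"

definition op_sqrt :: "('u::real_inner \<Rightarrow>\<^sub>L 'u) \<Rightarrow> ('u \<Rightarrow>\<^sub>L 'u)" where
  "op_sqrt Q = (THE R. positive_op R \<and> R o\<^sub>L R = Q)"

text \<open>\<open>U\<^sub>0 = Q\<^sup>1\<^sup>/\<^sup>2(U)\<close> carries the inner product
  \<open>(x, y)\<^sub>0 = (Q\<^sup>-\<^sup>1\<^sup>/\<^sup>2 x, Q\<^sup>-\<^sup>1\<^sup>/\<^sup>2 y)\<^sub>U\<close> with the pseudo-inverse of \<open>Q\<^sup>1\<^sup>/\<^sup>2\<close>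
  (which need not be injective).\<close>

definition U0 :: "('u::real_inner \<Rightarrow>\<^sub>L 'u) \<Rightarrow> 'u set" where
  "U0 Q = range (blinfun_apply (op_sqrt Q))"

definition pseudo_inverse :: "('u::real_inner \<Rightarrow>\<^sub>L 'u) \<Rightarrow> 'u \<Rightarrow> 'u" where
  "pseudo_inverse R x =
     (THE y. blinfun_apply R y = x \<and> (\<forall>z. blinfun_apply R z = 0 \<longrightarrow> inner y z = 0))"

definition U0_inner :: "('u::real_inner \<Rightarrow>\<^sub>L 'u) \<Rightarrow> 'u \<Rightarrow> 'u \<Rightarrow> real" where
  "U0_inner Q x y = inner (pseudo_inverse (op_sqrt Q) x) (pseudo_inverse (op_sqrt Q) y)"

definition U0_orthonormal_basis :: "('u::real_inner \<Rightarrow>\<^sub>L 'u) \<Rightarrow> 'u set \<Rightarrow> bool" where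
  "U0_orthonormal_basis Q B \<longleftrightarrow> B \<subseteq> U0 Q \<and>
     (\<forall>b\<in>B. \<forall>c\<in>B. U0_inner Q b c = (if b = c then 1 else 0)) \<and>
     (\<forall>x\<in>U0 Q. (\<forall>b\<in>B. U0_inner Q x b = 0) \<longrightarrow> x = 0)"

text \<open>The Hilbert-Schmidt norm does not depend on the basis, so one is chosen.\<close>

definition U0_basis :: "('u::real_inner \<Rightarrow>\<^sub>L 'u) \<Rightarrow> 'u set" where
  "U0_basis Q = (SOME B. U0_orthonormal_basis Q B)"

text \<open>An element of \<open>\<L>\<^sub>2(U\<^sub>0, H)\<close> is a total function of which only the restriction to
  \<open>U\<^sub>0\<close> matters.\<close>

definition L20 :: "('u::real_inner \<Rightarrow>\<^sub>L 'u) \<Rightarrow> ('u \<Rightarrow> 'h::real_normed_vector) set" where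
  "L20 Q = {T.
     (\<forall>x\<in>U0 Q. \<forall>y\<in>U0 Q. T (x + y) = T x + T y) \<and>
     (\<forall>c. \<forall>x\<in>U0 Q. T (c *\<^sub>R x) = c *\<^sub>R T x) \<and>
     (\<exists>K. \<forall>x\<in>U0 Q. norm (T x) \<le> K * sqrt (U0_inner Q x x)) \<and>
     (\<lambda>b. (norm (T b))\<^sup>2) summable_on U0_basis Q}"

definition L20_norm :: "('u::real_inner \<Rightarrow>\<^sub>L 'u) \<Rightarrow> ('u \<Rightarrow> 'h::real_normed_vector) \<Rightarrow> real" where
  "L20_norm Q T = sqrt (\<Sum>\<^sub>\<infinity>b\<in>U0_basis Q. (norm (T b))\<^sup>2)"

abbreviation L20_dist ::
    "('u::real_inner \<Rightarrow>\<^sub>L 'u) \<Rightarrow> ('u \<Rightarrow> 'h::real_normed_vector) \<Rightarrow> ('u \<Rightarrow> 'h) \<Rightarrow> real" where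
  "L20_dist Q T T' \<equiv> L20_norm Q (\<lambda>v. T v - T' v)"


section \<open>Probabilistic setting\<close>

definition usual_filtration :: "'w measure \<Rightarrow> (real \<Rightarrow> 'w measure) \<Rightarrow> bool" where
  "usual_filtration M F \<longleftrightarrow> filtration (space M) F \<and> (\<forall>t. subalgebra M (F t)) \<and>
     complete_measure M \<and> (\<forall>t. null_sets M \<subseteq> sets (F t)) \<and>
     (\<forall>t. sets (F t) = (\<Inter>s\<in>{t<..}. sets (F s)))"

definition square_integrable :: "'w measure \<Rightarrow> ('w \<Rightarrow> 'h::real_normed_vector) \<Rightarrow> bool" where
  "square_integrable M X \<longleftrightarrow>
     X \<in> borel_measurable M \<and> integrable M (\<lambda>\<omega>. (norm (X \<omega>))\<^sup>2)"

definition centered_gaussian :: "'w measure \<Rightarrow> ('w \<Rightarrow> real) \<Rightarrow> real \<Rightarrow> bool" where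
  "centered_gaussian M X v \<longleftrightarrow> X \<in> borel_measurable M \<and>
     (if v = 0 then AE \<omega> in M. X \<omega> = 0
      else distributed M lborel X (\<lambda>x. ennreal (normal_density 0 (sqrt v) x)))"

text \<open>Since \<open>Q\<close> need not have finite trace, \<open>W\<close> is a generalized Wiener process:
  \<open>W t u\<close> is the real random variable \<open>(W(t), u)\<^sub>U\<close>, and \<open>W t\<close> is linear as a map into
  \<open>L\<^sup>2(\<Omega>)\<close>, i.e. up to null sets.  For a two-sided process it is the increments, not the
  values \<open>W(t)\<close>, that are adapted: for \<open>t < 0\<close>, \<open>W(t) = -(W(0) - W(t))\<close> is independent of
  \<open>\<F>\<^sub>t\<close>.\<close>

definition two_sided_wiener ::
    "'w measure \<Rightarrow> (real \<Rightarrow> 'w measure) \<Rightarrow> ('u::real_inner \<Rightarrow>\<^sub>L 'u) \<Rightarrow>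
     (real \<Rightarrow> 'u \<Rightarrow> 'w \<Rightarrow> real) \<Rightarrow> bool" where
  "two_sided_wiener M F Q W \<longleftrightarrow>
     (\<forall>t u. W t u \<in> borel_measurable M) \<and>
     (\<forall>t a b u v. AE \<omega> in M. W t (a *\<^sub>R u + b *\<^sub>R v) \<omega> = a * W t u \<omega> + b * W t v \<omega>) \<and>
     (\<forall>u. AE \<omega> in M. W 0 u \<omega> = 0) \<and>
     (\<forall>u. AE \<omega> in M. continuous_on UNIV (\<lambda>t. W t u \<omega>)) \<and>
     (\<forall>s t u. s < t \<longrightarrow>
        (\<lambda>\<omega>. W t u \<omega> - W s u \<omega>) \<in> borel_measurable (F t) \<and>
        prob_space.indep_set M (sets (F s))
          (sets (vimage_algebra (space M) (\<lambda>\<omega>. W t u \<omega> - W s u \<omega>) borel)) \<and>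
        centered_gaussian M (\<lambda>\<omega>. W t u \<omega> - W s u \<omega>) ((t - s) * inner (blinfun_apply Q u) u))"

text \<open>As \<open>W\<close> is only given up to null sets for each time and direction, so is the shift
  identity.\<close>

definition ergodic_wiener_shift ::
    "'w measure \<Rightarrow> (real \<Rightarrow> 'u \<Rightarrow> 'w \<Rightarrow> real) \<Rightarrow> (real \<Rightarrow> 'w \<Rightarrow> 'w) \<Rightarrow> bool" where
  "ergodic_wiener_shift M W \<theta> \<longleftrightarrow>
     (\<forall>s. \<theta> s \<in> measurable M M \<and> distr M M (\<theta> s) = M) \<and>
     (\<forall>\<omega>\<in>space M. \<theta> 0 \<omega> = \<omega>) \<and>
     (\<forall>s t. \<forall>\<omega>\<in>space M. \<theta> (s + t) \<omega> = \<theta> s (\<theta> t \<omega>)) \<and>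
     (\<forall>A\<in>sets M. (\<forall>s. \<theta> s -` A \<inter> space M = A) \<longrightarrow> measure M A = 0 \<or> measure M A = 1) \<and>
     (\<forall>s t u. AE \<omega> in M. W t u (\<theta> s \<omega>) = W (t + s) u \<omega> - W s u \<omega>)"


section \<open>The stochastic integral\<close>

text \<open>A simple integrand is a list of tuples \<open>(\<alpha>, \<beta>, \<psi>, u, x)\<close>, each standing for the process
  that on \<open>(\<alpha>, \<beta>]\<close> equals \<open>\<psi>\<close> times the rank-one operator \<open>v \<mapsto> (u, v)\<^sub>U x\<close>.\<close>

type_synonym ('w, 'u, 'h) simple = "(real \<times> real \<times> ('w \<Rightarrow> real) \<times> 'u \<times> 'h) list"

definition simple_integrand ::
    "'w measure \<Rightarrow> (real \<Rightarrow> 'w measure) \<Rightarrow> real \<Rightarrow> real \<Rightarrow> ('w, 'u, 'h) simple \<Rightarrow> bool" where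
  "simple_integrand M F a b E \<longleftrightarrow> (\<forall>(\<alpha>, \<beta>, \<psi>, u, x) \<in> set E.
     a \<le> \<alpha> \<and> \<alpha> \<le> \<beta> \<and> \<beta> \<le> b \<and> \<psi> \<in> borel_measurable (F \<alpha>) \<and>
     (\<exists>K. \<forall>\<omega>\<in>space M. \<bar>\<psi> \<omega>\<bar> \<le> K))"

definition simple_process ::
    "('w, 'u::real_inner, 'h::real_vector) simple \<Rightarrow> real \<Rightarrow> 'w \<Rightarrow> 'u \<Rightarrow> 'h" where
  "simple_process E s \<omega> v =
     (\<Sum>(\<alpha>, \<beta>, \<psi>, u, x)\<leftarrow>E. (indicator {\<alpha><..\<beta>} s * \<psi> \<omega> * inner u v) *\<^sub>R x)"

definition simple_integral ::
    "(real \<Rightarrow> 'u \<Rightarrow> 'w \<Rightarrow> real) \<Rightarrow> ('w, 'u, 'h::real_vector) simple \<Rightarrow> 'w \<Rightarrow> 'h" where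
  "simple_integral W E \<omega> = (\<Sum>(\<alpha>, \<beta>, \<psi>, u, x)\<leftarrow>E. (\<psi> \<omega> * (W \<beta> u \<omega> - W \<alpha> u \<omega>)) *\<^sub>R x)"

text \<open>\<open>Z = \<integral>\<^sub>a\<^sup>b \<Phi>(s) dW(s)\<close> almost surely, as the \<open>L\<^sup>2\<close>-limit of the integrals of simple
  integrands approximating \<open>\<Phi>\<close> in \<open>L\<^sup>2((a,b] \<times> \<Omega>; \<L>\<^sub>2\<^sup>0)\<close>.\<close>

definition has_ito_integral ::
    "'w measure \<Rightarrow> (real \<Rightarrow> 'w measure) \<Rightarrow> ('u::real_inner \<Rightarrow>\<^sub>L 'u) \<Rightarrow>
     (real \<Rightarrow> 'u \<Rightarrow> 'w \<Rightarrow> real) \<Rightarrow> real \<Rightarrow> real \<Rightarrow>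
     (real \<Rightarrow> 'w \<Rightarrow> 'u \<Rightarrow> 'h::real_normed_vector) \<Rightarrow> ('w \<Rightarrow> 'h) \<Rightarrow> bool" where
  "has_ito_integral M F Q W a b \<Phi> Z \<longleftrightarrow>
     Z \<in> borel_measurable M \<and>
     (\<forall>s\<in>{a<..b}. \<forall>\<omega>\<in>space M. \<Phi> s \<omega> \<in> L20 Q) \<and>
     (\<exists>E. (\<forall>m. simple_integrand M F a b (E m)) \<and>
        (\<forall>m. (\<lambda>(s, \<omega>). L20_dist Q (\<Phi> s \<omega>) (simple_process (E m) s \<omega>))
               \<in> borel_measurable (restrict_space lborel {a<..b} \<Otimes>\<^sub>M M)) \<and>
        (\<lambda>m. \<integral>\<^sup>+ (s, \<omega>). ennreal ((L20_dist Q (\<Phi> s \<omega>) (simple_process (E m) s \<omega>))\<^sup>2)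
               \<partial>(restrict_space lborel {a<..b} \<Otimes>\<^sub>M M)) \<longlonglongrightarrow> 0 \<and>
        (\<lambda>m. \<integral>\<^sup>+ \<omega>. ennreal ((norm (Z \<omega> - simple_integral W (E m) \<omega>))\<^sup>2) \<partial>M) \<longlonglongrightarrow> 0)"


section \<open>The Galerkin discrete exponential integrator scheme\<close>

definition time_grid :: "real \<Rightarrow> real set" where
  "time_grid h = {of_int j * h | j. True}"

text \<open>\<open>Y j\<close> is the value of the discrete scheme at \<open>s + j h\<close>, started at time \<open>s\<close> from
  the \<open>\<F>\<^sub>s\<close>-measurable random variable \<open>\<eta>\<close>; \<open>Z\<close> is the noise term
  \<open>g\<^sub>n(t\<^sub>j, Y\<^sub>j) \<Delta>W\<close> over the \<open>j\<close>-th step.  When \<open>Q\<close> has infinite trace, \<open>T \<Delta>W\<close> for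
  \<open>T \<in> \<L>\<^sub>2\<^sup>0\<close> is the stochastic integral of the integrand that is constantly \<open>T\<close> in time.\<close>

definition discrete_scheme ::
    "'w measure \<Rightarrow> (real \<Rightarrow> 'w measure) \<Rightarrow> ('u::real_inner \<Rightarrow>\<^sub>L 'u) \<Rightarrow>
     (real \<Rightarrow> 'u \<Rightarrow> 'w \<Rightarrow> real) \<Rightarrow> (real \<Rightarrow> 'h::real_inner \<Rightarrow>\<^sub>L 'h) \<Rightarrow> (nat \<Rightarrow> 'h) \<Rightarrow>
     (real \<Rightarrow> 'h \<Rightarrow> 'h) \<Rightarrow> (real \<Rightarrow> 'h \<Rightarrow> 'u \<Rightarrow> 'h) \<Rightarrow> nat \<Rightarrow> real \<Rightarrow>
     real \<Rightarrow> ('w \<Rightarrow> 'h) \<Rightarrow> (nat \<Rightarrow> 'w \<Rightarrow> 'h) \<Rightarrow> bool" where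
  "discrete_scheme M F Q W S e f g n h s \<eta> Y \<longleftrightarrow>
     (let t = (\<lambda>j. s + real j * h);
          P = galerkin_proj e n;
          Sn = (\<lambda>r x. P (blinfun_apply (S r) x));
          fn = (\<lambda>r x. P (f r x));
          gn = (\<lambda>r x v. P (g r x v))
      in (\<forall>\<omega>\<in>space M. Y 0 \<omega> = \<eta> \<omega>) \<and>
         (\<forall>j. Y j \<in> borel_measurable (F (t j))) \<and>
         (\<forall>j. \<exists>Z.
            has_ito_integral M F Q W (t j) (t (Suc j)) (\<lambda>r \<omega>. gn (t j) (Y j \<omega>)) Z \<and>
            (AE \<omega> in M. Y (Suc j) \<omega> = Sn h (Y j \<omega> + h *\<^sub>R fn (t j) (Y j \<omega>) + Z \<omega>))))"

text \<open>\<open>X\<close> is a pathwise continuous version of the continuous scheme started at time \<open>s\<close> from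
  \<open>\<eta>\<close> (unique up to indistinguishability); \<open>Ybar r = Y j\<close> and \<open>\<Lambda> r = s + j h\<close> for
  \<open>r \<in> [s + j h, s + (j + 1) h)\<close>.  \<open>X t\<close> is unconstrained for \<open>t < s\<close>.\<close>

definition continuous_scheme ::
    "'w measure \<Rightarrow> (real \<Rightarrow> 'w measure) \<Rightarrow> ('u::real_inner \<Rightarrow>\<^sub>L 'u) \<Rightarrow>
     (real \<Rightarrow> 'u \<Rightarrow> 'w \<Rightarrow> real) \<Rightarrow>
     (real \<Rightarrow> 'h::{real_inner, banach, second_countable_topology} \<Rightarrow>\<^sub>L 'h) \<Rightarrow> (nat \<Rightarrow> 'h) \<Rightarrow>
     (real \<Rightarrow> 'h \<Rightarrow> 'h) \<Rightarrow> (real \<Rightarrow> 'h \<Rightarrow> 'u \<Rightarrow> 'h) \<Rightarrow> nat \<Rightarrow> real \<Rightarrow>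
     real \<Rightarrow> ('w \<Rightarrow> 'h) \<Rightarrow> (real \<Rightarrow> 'w \<Rightarrow> 'h) \<Rightarrow> bool" where
  "continuous_scheme M F Q W S e f g n h s \<eta> X \<longleftrightarrow>
     (\<exists>Y. discrete_scheme M F Q W S e f g n h s \<eta> Y \<and>
       (AE \<omega> in M. continuous_on {s..} (\<lambda>t. X t \<omega>)) \<and>
       (let P = galerkin_proj e n;
            fn = (\<lambda>r x. P (f r x));
            gn = (\<lambda>r x v. P (g r x v));
            \<Lambda> = (\<lambda>r. s + of_int \<lfloor>(r - s) / h\<rfloor> * h);
            Ybar = (\<lambda>r. Y (nat \<lfloor>(r - s) / h\<rfloor>))
        in \<forall>t\<ge>s. \<exists>Z.
             has_ito_integral M F Q W s t
               (\<lambda>r \<omega> v. blinfun_apply (S (t - \<Lambda> r)) (gn (\<Lambda> r) (Ybar r \<omega>) v)) Z \<and>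
             (AE \<omega> in M. X t \<omega> =
                blinfun_apply (S (t - s)) (\<eta> \<omega>) +
                (LINT r:{s..t}|lborel. blinfun_apply (S (t - \<Lambda> r)) (fn (\<Lambda> r) (Ybar r \<omega>))) +
                Z \<omega>)))"

text \<open>The value at time \<open>t\<close> of the scheme started at time \<open>s\<close> from the state \<open>y(s, \<omega>)\<close> is
  read as the scheme \<open>X s t\<close> started from the random variable \<open>y s\<close>, because stochastic
  integrals are not defined path by path.  In particular \<open>y s\<close> is \<open>\<F>\<^sub>s\<close>-measurable for
  grid times \<open>s\<close> (part of \<open>discrete_scheme\<close>).\<close>

definition random_periodic_solution ::
    "'w measure \<Rightarrow> (real \<Rightarrow> 'w measure) \<Rightarrow> ('u::real_inner \<Rightarrow>\<^sub>L 'u) \<Rightarrow>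
     (real \<Rightarrow> 'u \<Rightarrow> 'w \<Rightarrow> real) \<Rightarrow> (real \<Rightarrow> 'w \<Rightarrow> 'w) \<Rightarrow>
     (real \<Rightarrow> 'h::{real_inner, banach, second_countable_topology} \<Rightarrow>\<^sub>L 'h) \<Rightarrow> (nat \<Rightarrow> 'h) \<Rightarrow>
     (real \<Rightarrow> 'h \<Rightarrow> 'h) \<Rightarrow> (real \<Rightarrow> 'h \<Rightarrow> 'u \<Rightarrow> 'h) \<Rightarrow> nat \<Rightarrow> real \<Rightarrow>
     real \<Rightarrow> (real \<Rightarrow> 'w \<Rightarrow> 'h) \<Rightarrow> bool" where
  "random_periodic_solution M F Q W \<theta> S e f g n h \<tau> y \<longleftrightarrow>
     (\<lambda>(t, \<omega>). y t \<omega>) \<in> borel_measurable (borel \<Otimes>\<^sub>M M) \<and>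
     (\<forall>t. \<forall>\<omega>\<in>space M. y t \<omega> \<in> galerkin_space e n) \<and>
     (\<exists>X. (\<forall>s\<in>time_grid h. continuous_scheme M F Q W S e f g n h s (y s) (X s)) \<and>
          (AE \<omega> in M. \<forall>s\<in>time_grid h. \<forall>t\<ge>s. X s t \<omega> = y t \<omega>)) \<and>
     (AE \<omega> in M. \<forall>s. y (s + \<tau>) \<omega> = y s (\<theta> \<tau> \<omega>))"

end

theory Submission
  imports Defs
begin

text \<open>Let \<open>\<Delta>\<close> be the difference of two solutions of the scheme driven by the same noise.  Since
  \<open>P\<^sub>n S(h)\<close> is a contraction, the Ito isometry and the one-sided Lipschitz condition give
  \<open>E |\<Delta>\<^sub>j\<^sub>+\<^sub>1|\<^sup>2 \<le> (1 - C\<^sub>f\<^sub>g h + C\<^sub>f\<^sup>2 h\<^sup>2) E |\<Delta>\<^sub>j|\<^sup>2\<close>, and the first step size condition makes the factor at most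
  \<open>\<rho> = 1 - C\<^sub>f\<^sub>g h / 2 < 1\<close>.  Hence the solutions started from \<open>0\<close> at the times \<open>-k\<tau>\<close> form a sequence whose
  successive differences decay geometrically in \<open>L\<^sup>2\<close>, because by the Wiener shift the second moments
  of the initial differences do not depend on \<open>k\<close>.  The limit is random periodic, and it attracts, by
  the same contraction, every solution started at \<open>-k\<tau>\<close> from square integrable data; uniqueness follows since a
  random periodic solution has the same second moment at all the times \<open>-k\<tau>\<close>.\<close>

section \<open>Hilbert space preliminaries\<close>

text \<open>Two obstacles shape the proof. Stochastic integrals are given only up to null sets,
  through some unspecified approximation, and nothing says that \<theta> maps events of one
  \<open>F t\<close> to events of another; composing an adapted approximant with \<theta> may thus
  destroy adaptedness. The noise of a step has an integrand constant in time, and for these the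
  integral is recovered from canonical approximants that look at the operator alone, so that
  \<theta> merely moves the increments of W. The second obstacle is that a random periodic solution
  must be adapted at grid times and satisfy its identities at all times outside one null set. Hence
  continuous versions of partial steps are glued along the grid, corrections are made on null sets,
  which lie in every \<open>F t\<close>, and limits in mean square are realised as pointwise limits.
  The comparison of integrals needs the constant 1: dissipativity weighs the squared Hilbert-Schmidt
  distance against the drift with exactly this factor.\<close>

lemma subspace_closure:
  fixes K :: "'a::real_normed_vector set"
  assumes "subspace K" shows "subspace (closure K)"
  unfolding subspace_def
proof (intro conjI ballI allI)
  show "0 \<in> closure K" using assms subspace_0 closure_subset by blast
  fix x y c assume x: "x \<in> closure K" and y: "y \<in> closure K"
  obtain a b where ab: "\<forall>n. a n \<in> K" "a \<longlonglongrightarrow> x" "\<forall>n. b n \<in> K" "b \<longlonglongrightarrow> y"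
    using x y unfolding closure_sequential by blast
  have "(\<lambda>n. a n + b n) \<longlonglongrightarrow> x + y" by (intro tendsto_add ab)
  moreover have "\<forall>n. a n + b n \<in> K" using ab assms by (auto intro: subspace_add)
  ultimately show "x + y \<in> closure K"
    unfolding closure_sequential by (intro exI[of _ "\<lambda>n. a n + b n"]) simp
  have "(\<lambda>n. c *\<^sub>R a n) \<longlonglongrightarrow> c *\<^sub>R x" for c by (intro tendsto_intros ab)
  moreover have "\<forall>n. c *\<^sub>R a n \<in> K" for c using ab assms by (auto intro: subspace_scale)
  ultimately show "c *\<^sub>R x \<in> closure K" for c
    unfolding closure_sequential by (intro exI[of _ "\<lambda>n. c *\<^sub>R a n"]) simp
qed

text \<open>A minimising sequence for the distance to \<open>K\<close> is Cauchy by the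
  parallelogram law, because midpoints stay in \<open>K\<close>. Orthogonality says that the
  distance cannot drop along any direction of \<open>K\<close>.\<close>

lemma closed_subspace_projection:
  fixes K :: "'a::{real_inner, complete_space} set" and x :: 'a
  assumes K: "subspace K" "closed K"
  obtains p where "p \<in> K" "\<And>k. k \<in> K \<Longrightarrow> inner (x - p) k = 0"
proof -
  define d where "d = (INF k\<in>K. (norm (x - k))\<^sup>2)"
  have ne: "K \<noteq> {}" using K(1) subspace_0 by blast
  have bdd: "bdd_below ((\<lambda>k. (norm (x - k))\<^sup>2) ` K)" by (rule bdd_belowI[of _ 0]) auto
  have dle: "d \<le> (norm (x - k))\<^sup>2" if "k \<in> K" for k
    unfolding d_def using bdd that by (rule cINF_lower)
  have "\<exists>k\<in>K. (norm (x - k))\<^sup>2 < d + 1 / real (Suc i)" for i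
  proof -
    have "d < d + 1 / real (Suc i)" by simp
    then show ?thesis using cINF_less_iff[OF ne bdd, folded d_def] by metis
  qed
  then obtain k where k: "\<And>i. k i \<in> K" "\<And>i. (norm (x - k i))\<^sup>2 < d + 1 / real (Suc i)"
    by metis
  have par: "(norm (k i - k j))\<^sup>2 \<le> 2 / real (Suc i) + 2 / real (Suc j)" for i j
  proof -
    have mid: "(1/2) *\<^sub>R (k i + k j) \<in> K" using K(1) k(1) by (simp add: subspace_add subspace_scale)
    have "(norm (k i - k j))\<^sup>2 + 4 * (norm (x - (1/2) *\<^sub>R (k i + k j)))\<^sup>2
        = 2 * (norm (x - k i))\<^sup>2 + 2 * (norm (x - k j))\<^sup>2"
      by (simp add: power2_norm_eq_inner inner_simps inner_commute algebra_simps)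
    moreover have "2 / real (Suc i) = 2 * (1 / real (Suc i))" "2 / real (Suc j) = 2 * (1 / real (Suc j))" by simp_all
    ultimately show ?thesis using dle[OF mid] k(2)[of i] k(2)[of j] by linarith
  qed
  have "Cauchy k"
  proof (rule CauchyI)
    fix e :: real assume e: "0 < e"
    obtain N where N: "inverse (real (Suc N)) < e\<^sup>2 / 4" using reals_Archimedean[of "e\<^sup>2/4"] e by auto
    have "norm (k i - k j) < e" if "i \<ge> N" "j \<ge> N" for i j
    proof -
      have "2 / real (Suc i) \<le> 2 / real (Suc N)" "2 / real (Suc j) \<le> 2 / real (Suc N)"
        using that by (auto intro!: divide_left_mono)
      moreover have "2 / real (Suc N) = 2 * inverse (real (Suc N))" by (simp add: divide_inverse)
      ultimately have "(norm (k i - k j))\<^sup>2 < e\<^sup>2" using par[of i j] N by linarith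
      then show ?thesis using e by (simp add: power2_less_imp_less)
    qed
    then show "\<exists>N. \<forall>i\<ge>N. \<forall>j\<ge>N. norm (k i - k j) < e" by blast
  qed
  then obtain p where p: "k \<longlonglongrightarrow> p" using Cauchy_convergent convergent_def by blast
  have pK: "p \<in> K" using closed_sequentially[OF K(2)] k(1) p by blast
  have "(\<lambda>i. d + 1 / real (Suc i)) \<longlonglongrightarrow> d + 0"
    by (intro tendsto_add tendsto_const) (use lim_inverse_n' LIMSEQ_Suc in fastforce)
  moreover have "(\<lambda>i. (norm (x - k i))\<^sup>2) \<longlonglongrightarrow> (norm (x - p))\<^sup>2" by (intro tendsto_intros p)
  ultimately have pd: "(norm (x - p))\<^sup>2 \<le> d"
    using k(2) by (intro LIMSEQ_le[of "\<lambda>i. (norm (x - k i))\<^sup>2" _ "\<lambda>i. d + 1 / real (Suc i)"]) (auto intro: less_imp_le)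
  have "inner (x - p) m = 0" if m: "m \<in> K" for m
  proof (rule ccontr)
    assume ne0: "inner (x - p) m \<noteq> 0"
    then have m0: "m \<noteq> 0" by auto
    \<comment> \<open>The coefficient for which \<open>x - p - t *\<^sub>R m\<close> is orthogonal
      to \<open>m\<close>; a nonzero inner product would then lower the distance.\<close>
    define t where "t = inner (x - p) m / (norm m)\<^sup>2"
    have "p + t *\<^sub>R m \<in> K" using K(1) pK m by (simp add: subspace_add subspace_scale)
    from dle[OF this] pd have "(norm (x - p))\<^sup>2 \<le> (norm (x - (p + t *\<^sub>R m)))\<^sup>2" by linarith
    also have "\<dots> = (norm (x - p))\<^sup>2 - 2 * t * inner (x - p) m + t\<^sup>2 * (norm m)\<^sup>2"
      unfolding power2_norm_eq_inner
      by (simp add: inner_simps inner_commute algebra_simps power2_eq_square)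
    also have "t\<^sup>2 * (norm m)\<^sup>2 = t * inner (x - p) m"
      using m0 by (simp add: t_def power2_eq_square field_simps)
    finally have "t * inner (x - p) m \<le> 0" by simp
    moreover have "t * inner (x - p) m = (inner (x - p) m)\<^sup>2 / (norm m)\<^sup>2"
      by (simp add: t_def power2_eq_square)
    moreover have "(inner (x - p) m)\<^sup>2 / (norm m)\<^sup>2 > 0" using ne0 m0 by simp
    ultimately show False by linarith
  qed
  with pK that show ?thesis by blast
qed

lemma orthonormal_family_defect:
  fixes c :: "'b \<Rightarrow> 'a::real_inner"
  assumes on: "\<And>b b'. b \<in> B \<Longrightarrow> b' \<in> B \<Longrightarrow> inner (c b) (c b') = (if b = b' then 1 else 0)"
    and F: "finite F" "F \<subseteq> B"
  shows "(norm (x - (\<Sum>b\<in>F. r b *\<^sub>R c b)))\<^sup>2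
           = (norm x)\<^sup>2 - (\<Sum>b\<in>F. (inner x (c b))\<^sup>2) + (\<Sum>b\<in>F. (r b - inner x (c b))\<^sup>2)"
proof -
  have 1: "inner (\<Sum>b\<in>F. r b *\<^sub>R c b) (\<Sum>b\<in>F. r b *\<^sub>R c b) = (\<Sum>b\<in>F. (r b)\<^sup>2)"
  proof -
    have "inner (\<Sum>b\<in>F. r b *\<^sub>R c b) (\<Sum>b\<in>F. r b *\<^sub>R c b)
        = (\<Sum>b\<in>F. \<Sum>b'\<in>F. r b * (r b' * (if b = b' then 1 else 0)))"
      unfolding inner_sum_left inner_sum_right using on F(2)
      by (intro sum.cong refl) (auto simp: subset_iff)
    also have "\<dots> = (\<Sum>b\<in>F. (r b)\<^sup>2)"
      using F(1) by (intro sum.cong refl) (simp add: sum.delta power2_eq_square if_distrib cong: if_cong)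
    finally show ?thesis .
  qed
  have 2: "inner x (\<Sum>b\<in>F. r b *\<^sub>R c b) = (\<Sum>b\<in>F. r b * inner x (c b))"
    by (simp add: inner_sum_right)
  have 3: "inner (\<Sum>b\<in>F. r b *\<^sub>R c b) x = (\<Sum>b\<in>F. r b * inner x (c b))"
    using 2 by (metis inner_commute)
  have 4: "(\<Sum>b\<in>F. (r b - inner x (c b))\<^sup>2)
     = (\<Sum>b\<in>F. (r b)\<^sup>2) - 2 * (\<Sum>b\<in>F. r b * inner x (c b)) + (\<Sum>b\<in>F. (inner x (c b))\<^sup>2)"
    by (simp add: power2_diff sum.distrib sum_subtractf sum_distrib_left algebra_simps)
  show ?thesis
    unfolding power2_norm_eq_inner inner_diff_left inner_diff_right 1 2 3 4 by simp
qed

lemma Bessel_ineq: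
  fixes c :: "'b \<Rightarrow> 'a::real_inner"
  assumes on: "\<And>b b'. b \<in> B \<Longrightarrow> b' \<in> B \<Longrightarrow> inner (c b) (c b') = (if b = b' then 1 else 0)"
    and F: "finite F" "F \<subseteq> B"
  shows "(\<Sum>b\<in>F. (inner x (c b))\<^sup>2) \<le> (norm x)\<^sup>2"
  using orthonormal_family_defect[OF on F, of x "\<lambda>b. inner x (c b)"]
  by (simp) (smt (verit) zero_le_power2)

text \<open>The family need not be complete, as \<open>x\<close> lies in its closed span. A finite
  combination close to \<open>x\<close> bounds the Bessel defect of every finite set that contains
  its indices.\<close>

lemma Parseval_has_sum_square:
  fixes c :: "'b \<Rightarrow> 'a::real_inner"
  assumes on: "\<And>b b'. b \<in> B \<Longrightarrow> b' \<in> B \<Longrightarrow> inner (c b) (c b') = (if b = b' then 1 else 0)"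
    and x: "x \<in> closure (span (c ` B))"
  shows "((\<lambda>b. (inner x (c b))\<^sup>2) has_sum (norm x)\<^sup>2) B"
  unfolding has_sum_def tendsto_iff eventually_finite_subsets_at_top
proof (intro allI impI)
  fix e :: real assume e: "0 < e"
  obtain p where p: "p \<in> span (c ` B)" "dist p x < sqrt e"
    using x e unfolding closure_approachable by (meson real_sqrt_gt_zero)
  obtain T r where T: "finite T" "T \<subseteq> c ` B" "p = (\<Sum>a\<in>T. r a *\<^sub>R a)"
    using p(1) unfolding span_explicit by blast
  have inj: "inj_on c B"
    by (rule inj_onI) (metis on zero_neq_one)
  obtain F where F: "F \<subseteq> B" "finite F" "T = c ` F" using T(1,2) by (meson finite_subset_image)
  have pF: "p = (\<Sum>b\<in>F. r (c b) *\<^sub>R c b)"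
    unfolding T(3) F(3) by (subst sum.reindex) (use inj F(1) in \<open>auto intro: inj_on_subset\<close>)
  show "\<exists>X. finite X \<and> X \<subseteq> B \<and> (\<forall>Y. finite Y \<and> X \<subseteq> Y \<and> Y \<subseteq> B \<longrightarrow>
      dist (sum (\<lambda>b. (inner x (c b))\<^sup>2) Y) ((norm x)\<^sup>2) < e)"
  proof (intro exI conjI allI impI)
    fix Y assume Y: "finite Y \<and> F \<subseteq> Y \<and> Y \<subseteq> B"
    \<comment> \<open>Padded with zeros, so that \<open>p\<close> becomes a combination over the
      larger set \<open>Y\<close>.\<close>
    define r' where "r' b = (if b \<in> F then r (c b) else 0)" for b
    have "p = (\<Sum>b\<in>Y. r' b *\<^sub>R c b)"
      unfolding pF r'_def using Y by (intro sum.mono_neutral_cong_left) auto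
    moreover have "(norm (x - (\<Sum>b\<in>Y. r' b *\<^sub>R c b)))\<^sup>2
           = (norm x)\<^sup>2 - (\<Sum>b\<in>Y. (inner x (c b))\<^sup>2) + (\<Sum>b\<in>Y. (r' b - inner x (c b))\<^sup>2)"
      using Y by (intro orthonormal_family_defect[of B] on) auto
    ultimately have "(norm (x - p))\<^sup>2 \<ge> (norm x)\<^sup>2 - (\<Sum>b\<in>Y. (inner x (c b))\<^sup>2)"
      by (simp add: sum_nonneg)
    moreover have "(norm (x - p))\<^sup>2 < e"
      using p(2) e by (simp add: dist_norm norm_minus_commute) (metis norm_ge_zero real_sqrt_less_iff real_sqrt_unique)
    moreover have "(\<Sum>b\<in>Y. (inner x (c b))\<^sup>2) \<le> (norm x)\<^sup>2" by (rule Bessel_ineq[OF on]) (use Y in auto)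
    ultimately show "dist (sum (\<lambda>b. (inner x (c b))\<^sup>2) Y) ((norm x)\<^sup>2) < e"
      by (simp add: dist_real_def)
  qed (use F in auto)
qed

lemma has_sum_Diff2:
  fixes f g :: "'b \<Rightarrow> 'a::real_normed_vector"
  assumes "(f has_sum a) A" "(g has_sum b) A"
  shows "((\<lambda>x. f x - g x) has_sum (a - b)) A"
  using has_sum_add[OF assms(1), of "\<lambda>x. - g x" "- b"] assms(2) by (simp add: has_sum_uminus)

text \<open>Polarisation of the quadratic version.\<close>

lemma Parseval_has_sum:
  fixes c :: "'b \<Rightarrow> 'a::real_inner"
  assumes on: "\<And>b b'. b \<in> B \<Longrightarrow> b' \<in> B \<Longrightarrow> inner (c b) (c b') = (if b = b' then 1 else 0)"
    and x: "x \<in> closure (span (c ` B))" and y: "y \<in> closure (span (c ` B))"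
  shows "((\<lambda>b. inner x (c b) * inner y (c b)) has_sum inner x y) B"
proof -
  have sub: "subspace (closure (span (c ` B)))" by (intro subspace_closure subspace_span)
  have p: "x + y \<in> closure (span (c ` B))" and m: "x - y \<in> closure (span (c ` B))"
    using sub x y by (auto intro: subspace_add subspace_diff)
  have "((\<lambda>b. (1/4) * ((inner (x + y) (c b))\<^sup>2 - (inner (x - y) (c b))\<^sup>2))
        has_sum (1/4) * ((norm (x + y))\<^sup>2 - (norm (x - y))\<^sup>2)) B"
    by (intro has_sum_cmult_right has_sum_Diff2 Parseval_has_sum_square on p m)
  moreover have "(1/4) * ((inner (x + y) (c b))\<^sup>2 - (inner (x - y) (c b))\<^sup>2) = inner x (c b) * inner y (c b)" for b
    by (simp add: inner_simps power2_eq_square algebra_simps)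
  moreover have "(1/4) * ((norm (x + y))\<^sup>2 - (norm (x - y))\<^sup>2) = inner x y"
    by (simp add: power2_norm_eq_inner inner_simps inner_commute)
  ultimately show ?thesis by simp
qed

text \<open>By Bessel, a vector of a countable dense set has only countably many nonzero Fourier
  coefficients. Every member of the family is closer than 1 to some such vector, which therefore has
  a nonzero coefficient there.\<close>

lemma orthonormal_family_countable:
  fixes c :: "'b \<Rightarrow> 'a::{real_inner, second_countable_topology}"
  assumes on: "\<And>b b'. b \<in> B \<Longrightarrow> b' \<in> B \<Longrightarrow> inner (c b) (c b') = (if b = b' then 1 else 0)"
  shows "countable B"
proof -
  obtain Dn :: "'a set" where Dn: "countable Dn" "\<And>X. open X \<Longrightarrow> X \<noteq> {} \<Longrightarrow> \<exists>d\<in>Dn. d \<in> X"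
    using countable_dense_setE by blast
  have sum: "(\<lambda>b. (inner x (c b))\<^sup>2) summable_on B" for x
    by (rule nonneg_bdd_above_summable_on)
       (auto intro!: bdd_aboveI[of _ "(norm x)\<^sup>2"] Bessel_ineq[OF on])
  have "countable {b\<in>B. (inner x (c b))\<^sup>2 \<noteq> 0}" for x by (rule summable_countable_real[OF sum])
  then have "countable (\<Union>x\<in>Dn. {b\<in>B. (inner x (c b))\<^sup>2 \<noteq> 0})" using Dn(1) by blast
  moreover have "B \<subseteq> (\<Union>x\<in>Dn. {b\<in>B. (inner x (c b))\<^sup>2 \<noteq> 0})"
  proof
    fix b assume b: "b \<in> B"
    obtain x where x: "x \<in> Dn" "x \<in> ball (c b) 1" using Dn(2)[of "ball (c b) 1"] by auto
    have nb: "norm (c b) = 1" using on[OF b b] by (simp add: norm_eq_sqrt_inner)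
    have "inner x (c b) = 1 - inner (c b - x) (c b)" using on[OF b b] by (simp add: inner_diff_left)
    moreover have "\<bar>inner (c b - x) (c b)\<bar> < 1"
      using Cauchy_Schwarz_ineq2[of "c b - x" "c b"] x(2) nb by (simp add: dist_norm)
    ultimately have "inner x (c b) \<noteq> 0" by linarith
    then show "b \<in> (\<Union>x\<in>Dn. {b\<in>B. (inner x (c b))\<^sup>2 \<noteq> 0})" using x(1) b by auto
  qed
  ultimately show ?thesis by (rule countable_subset[rotated])
qed

section \<open>Square roots of positive operators\<close>

text \<open>The Taylor coefficients at 0 of the square root of \<open>1 - x\<close>.\<close>

definition sqrt_coeff :: "nat \<Rightarrow> real" where
  "sqrt_coeff k = (-1) ^ k * ((1/2) gchoose k)"

lemma sqrt_coeff_0: "sqrt_coeff 0 = 1" by (simp add: sqrt_coeff_def)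

lemma sqrt_coeff_Suc: "sqrt_coeff (Suc k) = sqrt_coeff k * (real k - 1/2) / (real k + 1)"
proof -
  have "((1/2::real) gchoose (Suc k)) = ((1/2) gchoose k) * (1/2 - real k) / (real k + 1)"
    using gbinomial_mult_1[of "1/2::real" k] by (simp add: field_simps)
  then show ?thesis by (simp add: sqrt_coeff_def) (simp add: field_simps)
qed

lemma sqrt_coeff_neg: "sqrt_coeff (Suc k) \<le> 0"
proof (induction k)
  case 0 show ?case by (simp add: sqrt_coeff_Suc sqrt_coeff_0)
next
  case (Suc k)
  show ?case unfolding sqrt_coeff_Suc[of "Suc k"]
    by (rule divide_nonpos_pos, rule mult_nonpos_nonneg) (use Suc in auto)
qed

text \<open>Together with \<open>sqrt_coeff_neg\<close> the closed form shows that the partial sums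
  stay nonnegative. As all coefficients after the first are nonpositive, their absolute values then
  sum to at most 1.\<close>

lemma sqrt_coeff_sum: "(\<Sum>i\<le>k. sqrt_coeff i) = - (2 * real k + 2) * sqrt_coeff (Suc k)"
proof (induction k)
  case 0 show ?case by (simp add: sqrt_coeff_Suc sqrt_coeff_0)
next
  case (Suc k)
  show ?case by (simp add: Suc sqrt_coeff_Suc[of "Suc k"] field_simps)
qed

lemma sqrt_coeff_abs_sum: "(\<Sum>i<k. \<bar>sqrt_coeff (Suc i)\<bar>) \<le> 1"
proof -
  have "(\<Sum>i<k. \<bar>sqrt_coeff (Suc i)\<bar>) = (\<Sum>i<k. - sqrt_coeff (Suc i))"
    using sqrt_coeff_neg by (intro sum.cong) auto
  also have "\<dots> = 1 - (\<Sum>i\<le>k. sqrt_coeff i)"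
    by (subst sum.atMost_shift) (simp add: sqrt_coeff_0 sum_negf)
  also have "\<dots> \<le> 1" unfolding sqrt_coeff_sum using sqrt_coeff_neg[of k]
    by (smt (verit) mult_nonpos_nonpos of_nat_0_le_iff)
  finally show ?thesis .
qed

lemma sqrt_coeff_summable: "summable (\<lambda>k. \<bar>sqrt_coeff k\<bar>)"
proof -
  have "summable (\<lambda>k. \<bar>sqrt_coeff (Suc k)\<bar>)"
    by (rule summableI_nonneg_bounded[where x=1]) (use sqrt_coeff_abs_sum in auto)
  then show ?thesis by (rule summable_Suc_iff[THEN iffD1])
qed

text \<open>The bound 1, and not mere convergence, is what makes the operator series
  positive.\<close>

lemma sqrt_coeff_suminf: "(\<Sum>k. \<bar>sqrt_coeff (Suc k)\<bar>) \<le> 1"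
  using summable_Suc_iff[of "\<lambda>k. \<bar>sqrt_coeff k\<bar>"] sqrt_coeff_summable
  by (intro suminf_le_const sqrt_coeff_abs_sum) simp

text \<open>The series squares to \<open>1 - x\<close>: this is Vandermonde's identity for
  \<open>1/2 + 1/2 = 1\<close>.\<close>

lemma sqrt_coeff_convolution:
  "(\<Sum>i\<le>k. sqrt_coeff i * sqrt_coeff (k - i)) = (if k = 0 then 1 else if k = 1 then -1 else 0)"
proof -
  have "(\<Sum>i\<le>k. sqrt_coeff i * sqrt_coeff (k - i))
      = (\<Sum>i\<le>k. (-1)^k * (((1/2) gchoose i) * ((1/2) gchoose (k - i))))"
    unfolding sqrt_coeff_def
    by (intro sum.cong refl) (simp add: algebra_simps flip: power_add)
  also have "\<dots> = (-1)^k * ((1::real) gchoose k)"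
    using gbinomial_Vandermonde[of "1/2::real" "1/2" k]
    by (simp add: atLeast0AtMost flip: sum_distrib_left)
  also have "(1::real) gchoose k = real (1 choose k)" by (metis binomial_gbinomial of_nat_1)
  also have "(-1)^k * real (1 choose k) = (if k = 0 then 1 else if k = 1 then -1 else 0)"
    by (cases k) (auto simp: binomial_eq_0)
  finally show ?thesis .
qed

text \<open>A Cauchy product, meant for \<open>m k = inner (blinfun_pow B k x) y\<close>. It allows
  the square of an operator series to be computed weakly, with real double series only.\<close>

lemma suminf_shift_convolution:
  fixes a m :: "nat \<Rightarrow> real"
  assumes a: "summable (\<lambda>k. \<bar>a k\<bar>)" and m: "\<And>k. \<bar>m k\<bar> \<le> C"
  shows "(\<Sum>k. a k * (\<Sum>l. a l * m (k + l))) = (\<Sum>n. (\<Sum>i\<le>n. a i * a (n - i)) * m n)"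
proof -
  define f where "f = (\<lambda>(k, l). a k * a l * m (k + l))"
  have C: "0 \<le> C" using m[of 0] by linarith
  have aon: "(\<lambda>k. \<bar>a k\<bar>) summable_on UNIV" using norm_summable_imp_summable_on[of "\<lambda>k. \<bar>a k\<bar>"] a by simp
  have "(\<lambda>(k, l). \<bar>a k\<bar> * (\<bar>a l\<bar> * C)) summable_on (UNIV \<times> UNIV)"
    by (rule summable_on_SigmaI[where g = "\<lambda>k. \<bar>a k\<bar> * (infsum (\<lambda>l. \<bar>a l\<bar>) UNIV * C)"])
       (auto intro!: has_sum_cmult_right has_sum_cmult_left has_sum_infsum aon summable_on_cmult_left mult_nonneg_nonneg C)
  moreover have "norm (f p) \<le> norm ((\<lambda>(k, l). \<bar>a k\<bar> * (\<bar>a l\<bar> * C)) p)" for p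
  proof -
    obtain k l where p: "p = (k, l)" by force
    have "norm (f p) = \<bar>a k\<bar> * (\<bar>a l\<bar> * \<bar>m (k + l)\<bar>)" by (simp add: f_def p abs_mult)
    also have "\<dots> \<le> \<bar>a k\<bar> * (\<bar>a l\<bar> * C)" by (intro mult_left_mono m) auto
    finally show ?thesis using C by (simp add: p abs_mult)
  qed
  ultimately have fabs: "(\<lambda>p. norm (f p)) summable_on (UNIV \<times> UNIV)"
  proof -
    assume 1: "(\<lambda>(k, l). \<bar>a k\<bar> * (\<bar>a l\<bar> * C)) summable_on UNIV \<times> UNIV"
      and 2: "\<And>p. norm (f p) \<le> norm ((\<lambda>(k, l). \<bar>a k\<bar> * (\<bar>a l\<bar> * C)) p)"
    have "(\<lambda>p. norm ((\<lambda>(k, l). \<bar>a k\<bar> * (\<bar>a l\<bar> * C)) p)) = (\<lambda>(k, l). \<bar>a k\<bar> * (\<bar>a l\<bar> * C))"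
      using C by (auto simp: fun_eq_iff abs_mult)
    with 1 have "(\<lambda>p. norm ((\<lambda>(k, l). \<bar>a k\<bar> * (\<bar>a l\<bar> * C)) p)) summable_on UNIV \<times> UNIV" by simp
    from Infinite_Sum.abs_summable_on_comparison_test[OF this, of f] 2 show ?thesis by simp
  qed
  have fs: "f summable_on (UNIV \<times> UNIV)" using fabs by (rule abs_summable_summable)
  have sumto: "summable (\<lambda>l. \<bar>a l * m (k + l)\<bar>)" for k
    by (rule summable_comparison_test'[of "\<lambda>l. \<bar>a l\<bar> * C" 0])
       (use a m in \<open>auto intro!: summable_mult2 mult_left_mono simp: abs_mult\<close>)
  have inner_has: "((\<lambda>l. f (k, l)) has_sum (a k * (\<Sum>l. a l * m (k + l)))) UNIV" for k
  proof -
    have "((\<lambda>l. a l * m (k + l)) has_sum (\<Sum>l. a l * m (k + l))) UNIV"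
      by (rule norm_summable_imp_has_sum) (use sumto[of k] in \<open>auto intro: summable_rabs_cancel summable_sums\<close>)
    from has_sum_cmult_right[OF this, of "a k"] show ?thesis by (simp add: f_def mult.assoc)
  qed
  have tot1: "((\<lambda>k. a k * (\<Sum>l. a l * m (k + l))) has_sum infsum f (UNIV \<times> UNIV)) UNIV"
    by (rule has_sum_SigmaD[OF has_sum_infsum[OF fs]]) (use inner_has in auto)
  \<comment> \<open>Pairs \<open>(k, l)\<close> are grouped by their sum \<open>n\<close>, and
    \<open>i\<close> is the first component.\<close>
  have bij: "bij_betw (\<lambda>(n, i). (i, n - i)) (Sigma UNIV (\<lambda>n::nat. {..n})) (UNIV \<times> UNIV)"
    by (rule bij_betw_byWitness[where f' = "\<lambda>(k, l). (k + l, k)"]) auto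
  have "((\<lambda>p. f ((\<lambda>(n, i). (i, n - i)) p)) has_sum infsum f (UNIV \<times> UNIV)) (Sigma UNIV (\<lambda>n::nat. {..n}))"
    using has_sum_reindex_bij_betw[OF bij, of f] has_sum_infsum[OF fs] by simp
  then have tot2: "((\<lambda>n. \<Sum>i\<le>n. a i * a (n - i) * m n) has_sum infsum f (UNIV \<times> UNIV)) UNIV"
    by (rule has_sum_SigmaD) (auto simp: f_def intro!: has_sum_finiteI)
  show ?thesis
    using has_sum_imp_sums[OF tot1] has_sum_imp_sums[OF tot2]
    by (simp add: sums_iff sum_distrib_right)
qed

section \<open>Positive operators and their square roots\<close>

lemma positive_op_Cauchy_Schwarz:
  fixes P :: "'a::real_inner \<Rightarrow>\<^sub>L 'a"
  assumes P: "positive_op P"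
  shows "(inner (P x) y)\<^sup>2 \<le> inner (P x) x * inner (P y) y"
proof -
  have sym: "inner (P x) y = inner x (P y)" for x y using P by (auto simp: positive_op_def)
  have pos: "0 \<le> inner (P x) x" for x using P by (auto simp: positive_op_def)
  have q: "0 \<le> inner (P x) x + 2 * t * inner (P x) y + t\<^sup>2 * inner (P y) y" for t
  proof -
    have "0 \<le> inner (P (x + t *\<^sub>R y)) (x + t *\<^sub>R y)" by (rule pos)
    also have "\<dots> = inner (P x) x + 2 * t * inner (P x) y + t\<^sup>2 * inner (P y) y"
      using sym[of y x]
      by (simp add: blinfun.bilinear_simps inner_simps inner_commute power2_eq_square algebra_simps)
    finally show ?thesis .
  qed
  show ?thesis
  proof (cases "inner (P y) y = 0")
    case True
    have "inner (P x) y = 0"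
    proof (rule ccontr)
      assume n: "inner (P x) y \<noteq> 0"
      \<comment> \<open>When \<open>inner (P y) y = 0\<close> the polynomial in \<open>q\<close> is
        affine in \<open>t\<close>, and this \<open>t\<close> gives it the value -1.\<close>
      have "inner (P x) x + 2 * (- (inner (P x) x + 1) / (2 * inner (P x) y)) * inner (P x) y = -1"
        using n by (simp add: field_simps)
      with q[of "- (inner (P x) x + 1) / (2 * inner (P x) y)"] True show False by simp
    qed
    then show ?thesis using pos by simp
  next
    case False
    then have p: "inner (P y) y > 0" using pos[of y] by linarith
    have "inner (P x) x + 2 * (- inner (P x) y / inner (P y) y) * inner (P x) y
        + (- inner (P x) y / inner (P y) y)\<^sup>2 * inner (P y) y
       = inner (P x) x - (inner (P x) y)\<^sup>2 / inner (P y) y"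
      using p by (simp add: field_simps power2_eq_square)
    with q[of "- inner (P x) y / inner (P y) y"]
    have "(inner (P x) y)\<^sup>2 / inner (P y) y \<le> inner (P x) x" by linarith
    with p show ?thesis by (simp add: pos_divide_le_eq)
  qed
qed

lemma positive_op_eq_0:
  assumes P: "positive_op P" and "inner (blinfun_apply P x) x = 0"
  shows "blinfun_apply P x = 0"
  using positive_op_Cauchy_Schwarz[OF P, of x "P x"] assms(2) by simp

text \<open>Cauchy-Schwarz for the form of \<open>P\<close>, taken at \<open>x\<close> and
  \<open>P x\<close>, turns the bound on the form into one on the norm.\<close>

lemma positive_op_norm_le:
  assumes P: "positive_op P" and le: "\<And>x. inner (blinfun_apply P x) x \<le> (norm x)\<^sup>2"
  shows "norm (blinfun_apply P x) \<le> norm x"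
proof -
  have "((norm (P x))\<^sup>2)\<^sup>2 \<le> inner (P x) x * inner (P (P x)) (P x)"
    using positive_op_Cauchy_Schwarz[OF P, of x "P x"] by (simp add: power2_norm_eq_inner)
  also have "\<dots> \<le> (norm x)\<^sup>2 * (norm (P x))\<^sup>2"
  proof (intro mult_mono le)
    show "0 \<le> inner (P (P x)) (P x)" using P unfolding positive_op_def by blast
  qed simp
  finally have *: "(norm (P x))\<^sup>2 * (norm (P x))\<^sup>2 \<le> (norm x)\<^sup>2 * (norm (P x))\<^sup>2"
    by (simp add: power2_eq_square)
  show ?thesis
  proof (cases "P x = 0")
    case False
    then have "0 < (norm (P x))\<^sup>2" by simp
    with * have "(norm (P x))\<^sup>2 \<le> (norm x)\<^sup>2" by (rule mult_right_le_imp_le)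
    then show ?thesis by (rule power2_le_imp_le) simp
  qed simp
qed

primrec blinfun_pow :: "('a::real_normed_vector \<Rightarrow>\<^sub>L 'a) \<Rightarrow> nat \<Rightarrow> 'a \<Rightarrow>\<^sub>L 'a" where
  "blinfun_pow B 0 = id_blinfun"
| "blinfun_pow B (Suc k) = B o\<^sub>L blinfun_pow B k"

lemma blinfun_pow_add: "blinfun_pow B k (blinfun_pow B l x) = blinfun_pow B (k + l) x"
  by (induction k) auto

lemma blinfun_pow_selfadjoint:
  assumes "\<And>x y. inner (blinfun_apply B x) y = inner x (blinfun_apply B y)"
  shows "inner (blinfun_pow B k x) y = inner x (blinfun_pow B k y)"
proof (induction k arbitrary: x y)
  case (Suc k)
  have "blinfun_pow B k (B y) = B (blinfun_pow B k y)"
    using blinfun_pow_add[of B k 1 y] blinfun_pow_add[of B 1 k y] by (simp add: add.commute)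
  then show ?case using Suc assms by simp
qed simp

text \<open>\<open>T\<close> is the binomial series for the root of \<open>1 - B\<close>. As a limit
  of polynomials in \<open>B\<close> it commutes with whatever commutes with \<open>B\<close>; this
  last conclusion is what later makes the root unique.\<close>

lemma positive_contraction_sqrt:
  fixes B :: "'a::{real_inner, banach} \<Rightarrow>\<^sub>L 'a"
  assumes B: "positive_op B" and le: "\<And>x. norm (B x) \<le> norm x"
  obtains T where "positive_op T" "T o\<^sub>L T = id_blinfun - B"
    "\<And>Z x. (\<And>x. blinfun_apply Z (blinfun_apply B x) = blinfun_apply B (blinfun_apply Z x)) \<Longrightarrow>
       blinfun_apply Z (blinfun_apply T x) = blinfun_apply T (blinfun_apply Z x)"
proof -
  have sym: "inner (B x) y = inner x (B y)" for x y using B by (auto simp: positive_op_def)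
  have pw_le: "norm (blinfun_pow B k x) \<le> norm x" for k x
    by (induction k) (auto intro: order_trans[OF le])
  have pw_norm: "norm (blinfun_pow B k) \<le> 1" for k
    by (rule norm_blinfun_bound) (use pw_le in auto)
  define T where "T = (\<Sum>k. sqrt_coeff k *\<^sub>R blinfun_pow B k)"
  have sT: "summable (\<lambda>k. sqrt_coeff k *\<^sub>R blinfun_pow B k)"
    by (rule summable_comparison_test'[OF sqrt_coeff_summable, of 0])
       (use pw_norm in \<open>auto intro: mult_left_le\<close>)
  have Tx: "(\<lambda>k. sqrt_coeff k *\<^sub>R blinfun_pow B k x) sums T x" for x
    using bounded_linear.sums[OF blinfun.bounded_linear_left summable_sums[OF sT], of x]
    by (simp add: T_def blinfun.scaleR_left)
  have Ti: "(\<lambda>k. sqrt_coeff k * inner (blinfun_pow B k x) y) sums inner (T x) y" for x y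
    using bounded_linear.sums[OF bounded_linear_inner_left[of y] Tx[of x]] by simp
  have Tsym: "inner (T x) y = inner x (T y)" for x y
  proof -
    have "(\<lambda>k. sqrt_coeff k * inner (blinfun_pow B k x) y) = (\<lambda>k. sqrt_coeff k * inner (blinfun_pow B k y) x)"
      using blinfun_pow_selfadjoint[OF sym, of _ x y] by (simp add: inner_commute)
    with Ti[of x y] Ti[of y x] have "inner (T x) y = inner (T y) x" by (metis sums_unique2)
    then show ?thesis by (simp add: inner_commute)
  qed
  have bd: "\<bar>inner (blinfun_pow B k x) y\<bar> \<le> norm x * norm y" for k x y
    by (rule order_trans[OF Cauchy_Schwarz_ineq2]) (simp add: mult_right_mono pw_le)
  have Tpos: "0 \<le> inner (T x) x" for x
  proof -
    \<comment> \<open>The series without its constant term. Its modulus is at most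
      \<open>(norm x)\<^sup>2\<close>, which is exactly what the constant term contributes.\<close>
    define u where "u k = sqrt_coeff (Suc k) * inner (blinfun_pow B (Suc k) x) x" for k
    have u: "u sums (inner (T x) x - inner x x)"
      using Ti[of x x] sums_Suc_iff[of "\<lambda>k. sqrt_coeff k * inner (blinfun_pow B k x) x"]
      unfolding u_def by (simp add: sqrt_coeff_0 sums_Suc_iff)
    have sa: "summable (\<lambda>k. \<bar>sqrt_coeff (Suc k)\<bar>)"
      using sqrt_coeff_summable summable_Suc_iff[of "\<lambda>k. \<bar>sqrt_coeff k\<bar>"] by simp
    have ul: "- (\<bar>sqrt_coeff (Suc k)\<bar> * (norm x)\<^sup>2) \<le> u k" for k
    proof -
      have "\<bar>u k\<bar> \<le> \<bar>sqrt_coeff (Suc k)\<bar> * (norm x)\<^sup>2"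
        unfolding u_def abs_mult using bd[of "Suc k" x x]
        by (intro mult_left_mono) (auto simp: power2_eq_square)
      then show ?thesis by linarith
    qed
    have "(\<lambda>k. - (\<bar>sqrt_coeff (Suc k)\<bar> * (norm x)\<^sup>2)) sums (- ((\<Sum>k. \<bar>sqrt_coeff (Suc k)\<bar>) * (norm x)\<^sup>2))"
      by (intro sums_minus sums_mult2 summable_sums sa)
    from sums_le[OF ul this u] have "- ((\<Sum>k. \<bar>sqrt_coeff (Suc k)\<bar>) * (norm x)\<^sup>2) \<le> inner (T x) x - inner x x" .
    moreover have "(\<Sum>k. \<bar>sqrt_coeff (Suc k)\<bar>) * (norm x)\<^sup>2 \<le> 1 * (norm x)\<^sup>2"
      by (intro mult_right_mono sqrt_coeff_suminf) auto
    ultimately show ?thesis by (simp add: power2_norm_eq_inner)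
  qed
  have TT: "T (T x) = x - B x" for x
  proof -
    have "inner (T (T x)) y = inner (x - B x) y" for y
    proof -
      define m where "m k = inner (blinfun_pow B k x) y" for k
      have "inner (blinfun_pow B k (T x)) y = (\<Sum>l. sqrt_coeff l * m (k + l))" for k
      proof -
        have "(\<lambda>l. sqrt_coeff l * inner (blinfun_pow B l x) (blinfun_pow B k y)) sums inner (T x) (blinfun_pow B k y)"
          by (rule Ti)
        moreover have "inner (blinfun_pow B l x) (blinfun_pow B k y) = m (k + l)" for l
          using blinfun_pow_selfadjoint[OF sym, of k "blinfun_pow B l x" y] by (simp add: m_def blinfun_pow_add)
        ultimately show ?thesis using blinfun_pow_selfadjoint[OF sym, of k "T x" y] by (simp add: sums_iff)
      qed
      then have "inner (T (T x)) y = (\<Sum>k. sqrt_coeff k * (\<Sum>l. sqrt_coeff l * m (k + l)))"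
        using Ti[of "T x" y] by (simp add: sums_iff)
      also have "\<dots> = (\<Sum>n. (\<Sum>i\<le>n. sqrt_coeff i * sqrt_coeff (n - i)) * m n)"
        by (rule suminf_shift_convolution[OF sqrt_coeff_summable, of m "norm x * norm y"])
           (use bd in \<open>auto simp: m_def\<close>)
      also have "\<dots> = (\<Sum>n\<in>{0,1}. (\<Sum>i\<le>n. sqrt_coeff i * sqrt_coeff (n - i)) * m n)"
        by (rule suminf_finite) (auto simp: sqrt_coeff_convolution)
      also have "\<dots> = m 0 - m 1" unfolding sqrt_coeff_convolution by simp
      also have "\<dots> = inner (x - B x) y" by (simp add: m_def inner_diff_left)
      finally show ?thesis .
    qed
    then show ?thesis by (rule vector_eq_rdot[THEN iffD1, OF allI])
  qed
  have comm: "Z (T x) = T (Z x)" if Z: "\<And>x. Z (B x) = B (Z x)" for Z :: "'a \<Rightarrow>\<^sub>L 'a" and x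
  proof -
    have "Z (blinfun_pow B k x) = blinfun_pow B k (Z x)" for k by (induction k) (simp_all add: Z)
    then have "(\<lambda>k. Z (sqrt_coeff k *\<^sub>R blinfun_pow B k x)) = (\<lambda>k. sqrt_coeff k *\<^sub>R blinfun_pow B k (Z x))"
      by (simp add: blinfun.scaleR_right)
    with bounded_linear.sums[OF blinfun.bounded_linear_right[of Z] Tx[of x]] Tx[of "Z x"]
    show ?thesis by (metis sums_unique2)
  qed
  show ?thesis
  proof (rule that[of T])
    show "positive_op T" using Tsym Tpos by (auto simp: positive_op_def)
    show "T o\<^sub>L T = id_blinfun - B" by (rule blinfun_eqI) (simp add: TT blinfun.diff_left)
  qed (rule comm)
qed

text \<open>Rescaling: for \<open>c = norm Q + 1\<close> the operator \<open>B = 1 - Q / c\<close>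
  is a positive contraction, and the root of \<open>1 - B\<close> is multiplied by
  \<open>sqrt c\<close>. The summand 1 keeps \<open>c\<close> positive when
  \<open>Q = 0\<close>.\<close>

lemma positive_op_sqrt_exists:
  fixes Q :: "'a::{real_inner, banach} \<Rightarrow>\<^sub>L 'a"
  assumes Q: "positive_op Q"
  obtains R where "positive_op R" "R o\<^sub>L R = Q"
    "\<And>Z x. (\<And>x. blinfun_apply Z (blinfun_apply Q x) = blinfun_apply Q (blinfun_apply Z x)) \<Longrightarrow>
       blinfun_apply Z (blinfun_apply R x) = blinfun_apply R (blinfun_apply Z x)"
proof -
  define c where "c = norm Q + 1"
  have c: "c > 0" by (simp add: c_def add_nonneg_pos)
  define B where "B = id_blinfun - (1/c) *\<^sub>R Q"
  have Bx: "B x = x - (1/c) *\<^sub>R Q x" for x by (simp add: B_def blinfun.bilinear_simps)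
  have Qle: "inner (Q x) x \<le> c * (norm x)\<^sup>2" for x
  proof -
    have "inner (Q x) x \<le> norm (Q x) * norm x" by (rule norm_cauchy_schwarz)
    also have "\<dots> \<le> (norm Q * norm x) * norm x" by (intro mult_right_mono norm_blinfun) auto
    also have "\<dots> \<le> c * (norm x)\<^sup>2" by (simp add: c_def power2_eq_square algebra_simps)
    finally show ?thesis .
  qed
  have B: "positive_op B"
    unfolding positive_op_def
  proof (intro conjI allI)
    fix x y
    show "inner (B x) y = inner x (B y)" using Q by (simp add: Bx positive_op_def inner_simps)
    have "inner (Q x) x / c \<le> (norm x)\<^sup>2" using Qle[of x] c by (simp add: divide_le_eq mult.commute)
    then show "0 \<le> inner (B x) x" by (simp add: Bx inner_simps power2_norm_eq_inner)
  qed
  have Bn: "norm (B x) \<le> norm x" for x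
  proof (rule positive_op_norm_le[OF B])
    fix x
    have "0 \<le> inner (Q x) x" using Q by (auto simp: positive_op_def)
    then show "inner (B x) x \<le> (norm x)\<^sup>2" using c by (simp add: Bx inner_simps power2_norm_eq_inner)
  qed
  obtain T where T: "positive_op T" "T o\<^sub>L T = id_blinfun - B"
    "\<And>Z x. (\<And>x. blinfun_apply Z (blinfun_apply B x) = blinfun_apply B (blinfun_apply Z x)) \<Longrightarrow>
       blinfun_apply Z (blinfun_apply T x) = blinfun_apply T (blinfun_apply Z x)"
    using positive_contraction_sqrt[OF B Bn] by blast
  show ?thesis
  proof (rule that[of "sqrt c *\<^sub>R T"])
    show "positive_op (sqrt c *\<^sub>R T)" using T(1) c by (auto simp: positive_op_def blinfun.bilinear_simps)
    show "sqrt c *\<^sub>R T o\<^sub>L sqrt c *\<^sub>R T = Q"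
    proof (rule blinfun_eqI)
      fix x
      have "T (T x) = (1/c) *\<^sub>R Q x"
        using arg_cong[OF T(2), of "\<lambda>S. blinfun_apply S x"] by (simp add: blinfun.diff_left Bx)
      then show "(sqrt c *\<^sub>R T o\<^sub>L sqrt c *\<^sub>R T) x = Q x" using c by (simp add: blinfun.bilinear_simps)
    qed
    show "Z ((sqrt c *\<^sub>R T) x) = (sqrt c *\<^sub>R T) (Z x)" if "\<And>x. Z (Q x) = Q (Z x)" for Z :: "'a \<Rightarrow>\<^sub>L 'a" and x
      using T(3)[of Z x] that by (simp add: Bx blinfun.bilinear_simps)
  qed
qed

text \<open>\<open>T\<close> commutes with its square \<open>Q\<close>, hence with \<open>R\<close>,
  so \<open>T + R\<close> annihilates every value of \<open>T - R\<close>. Positivity of both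
  summands makes \<open>T\<close> and \<open>R\<close> vanish there separately, and self-adjointness
  of \<open>T - R\<close> finishes the argument.\<close>

lemma positive_op_sqrt_unique:
  fixes R T :: "'a::{real_inner, banach} \<Rightarrow>\<^sub>L 'a"
  assumes R: "positive_op R" "R o\<^sub>L R = Q"
    and comm: "\<And>Z x. (\<And>x. blinfun_apply Z (blinfun_apply Q x) = blinfun_apply Q (blinfun_apply Z x)) \<Longrightarrow>
       blinfun_apply Z (blinfun_apply R x) = blinfun_apply R (blinfun_apply Z x)"
    and T: "positive_op T" "T o\<^sub>L T = Q"
  shows "T = R"
proof (rule blinfun_eqI)
  fix x
  have RR: "R (R x) = Q x" and TT: "T (T x) = Q x" for x
    using R(2) T(2) by (metis blinfun_apply_blinfun_compose)+
  have TR: "T (R x) = R (T x)" for x by (rule comm) (simp flip: TT)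
  define d where "d = T x - R x"
  have "T d + R d = 0" by (simp add: d_def blinfun.bilinear_simps RR TT TR)
  then have "inner (T d) d + inner (R d) d = 0" by (metis inner_add_left inner_zero_left)
  moreover have "0 \<le> inner (T d) d" "0 \<le> inner (R d) d" using R(1) T(1) by (auto simp: positive_op_def)
  ultimately have "T d = 0" "R d = 0"
    using positive_op_eq_0[OF T(1), of d] positive_op_eq_0[OF R(1), of d] by auto
  moreover have "inner d d = inner x (T d - R d)"
    using R(1) T(1) by (simp add: d_def positive_op_def inner_simps blinfun.bilinear_simps)
  ultimately show "T x = R x" by (simp add: d_def)
qed

lemma op_sqrt:
  fixes Q :: "'a::{real_inner, banach} \<Rightarrow>\<^sub>L 'a"
  assumes "positive_op Q"
  shows "positive_op (op_sqrt Q)" "op_sqrt Q o\<^sub>L op_sqrt Q = Q"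
proof -
  obtain R where R: "positive_op R" "R o\<^sub>L R = Q"
    "\<And>Z x. (\<And>x. blinfun_apply Z (blinfun_apply Q x) = blinfun_apply Q (blinfun_apply Z x)) \<Longrightarrow>
       blinfun_apply Z (blinfun_apply R x) = blinfun_apply R (blinfun_apply Z x)"
    using positive_op_sqrt_exists[OF assms] by blast
  have "op_sqrt Q = R" unfolding op_sqrt_def
  proof (rule the_equality)
    show "T = R" if "positive_op T \<and> T o\<^sub>L T = Q" for T
      using that by (intro positive_op_sqrt_unique[OF R]) auto
  qed (use R in blast)
  with R show "positive_op (op_sqrt Q)" "op_sqrt Q o\<^sub>L op_sqrt Q = Q" by auto
qed

lemma has_sum_finite_sum:
  fixes f :: "'i \<Rightarrow> 'b \<Rightarrow> 'a::topological_comm_monoid_add"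
  assumes "finite I" "\<And>i. i \<in> I \<Longrightarrow> (f i has_sum s i) A"
  shows "((\<lambda>x. \<Sum>i\<in>I. f i x) has_sum (\<Sum>i\<in>I. s i)) A"
  using assms by (induction I rule: finite_induct) (auto intro!: has_sum_add has_sum_0)

lemma dense_approx:
  fixes x :: "'a::metric_space"
  assumes "\<And>X. open X \<Longrightarrow> X \<noteq> {} \<Longrightarrow> \<exists>d\<in>Dn. d \<in> X" "0 < (\<epsilon>::real)"
  obtains d where "d \<in> Dn" "dist d x < \<epsilon>"
  using assms(1)[of "ball x \<epsilon>"] assms(2) by (auto simp: dist_commute)

section \<open>Hilbert-Schmidt operators on the range of the root of the covariance\<close>

definition finite_rank_op :: "('u::real_inner \<times> 'h::real_vector) list \<Rightarrow> 'u \<Rightarrow> 'h" where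
  "finite_rank_op L v = (\<Sum>(u, x)\<leftarrow>L. inner u v *\<^sub>R x)"

text \<open>One fixed sequence of finite-rank operators, dense in \<open>L20 Q\<close>. It starts
  with the zero operator, so the best of its first entries never has an error above the norm of the
  operator approximated; this supplies the majorant for dominated convergence.\<close>

definition dense_ops :: "('u::real_inner \<Rightarrow>\<^sub>L 'u) \<Rightarrow> nat \<Rightarrow> ('u \<times> 'h::real_normed_vector) list" where
  "dense_ops Q = (SOME D. D 0 = [] \<and>
     (\<forall>T\<in>L20 Q. \<forall>\<epsilon>>0. \<exists>k. L20_dist Q T (finite_rank_op (D k)) < \<epsilon>))"

locale covariance =
  fixes Q :: "'u::{real_inner, banach, second_countable_topology} \<Rightarrow>\<^sub>L 'u"
  assumes Q_pos: "positive_op Q"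
begin

definition "R = op_sqrt Q"
definition "pin = pseudo_inverse R"
definition "B = U0_basis Q"
text \<open>The orthogonal complement of the kernel of \<open>R\<close>. There \<open>R\<close> is
  injective with inverse \<open>pin\<close>, and all computations in \<open>U0 Q\<close> are carried
  out there.\<close>

definition "K = closure (range (blinfun_apply R))"

section \<open>The range of the root, its pseudo-inverse and its orthonormal basis\<close>

lemma R_sym: "inner (R x) y = inner x (R y)"
  using op_sqrt[OF Q_pos] by (auto simp: positive_op_def R_def)

lemma R_R: "R (R x) = Q x"
  using op_sqrt(2)[OF Q_pos] by (metis R_def blinfun_apply_blinfun_compose)

lemma R_inner: "inner (R u) (R v) = inner (Q u) v"
  by (metis R_R R_sym)

lemma U0_eq: "U0 Q = range (blinfun_apply R)" by (simp add: U0_def R_def)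

lemma U0_subspace: "subspace (U0 Q)"
  unfolding U0_eq by (intro subspace_UNIV linear_subspace_image bounded_linear.linear blinfun.bounded_linear_right)

lemma U0_inner_eq: "U0_inner Q x y = inner (pin x) (pin y)"
  by (simp add: U0_inner_def pin_def R_def)

lemma K_subspace: "subspace K"
  unfolding K_def U0_eq[symmetric] by (intro subspace_closure U0_subspace)

lemma K_closed: "closed K" by (simp add: K_def)

lemma R_in_K: "R u \<in> K" unfolding K_def by (rule subsetD[OF closure_subset]) simp

lemma K_ker: assumes "k \<in> K" "R z = 0" shows "inner k z = 0"
proof -
  have "closed {k. inner k z = 0}" by (intro closed_Collect_eq continuous_intros)
  moreover have "range (blinfun_apply R) \<subseteq> {k. inner k z = 0}" using R_sym assms(2) by auto
  ultimately have "K \<subseteq> {k. inner k z = 0}" unfolding K_def by (rule closure_minimal[rotated])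
  with assms(1) show ?thesis by auto
qed

lemma pin_R: assumes "c \<in> K" shows "pin (R c) = c"
  unfolding pin_def pseudo_inverse_def
proof (rule the_equality)
  fix y assume y: "R y = R c \<and> (\<forall>z. R z = 0 \<longrightarrow> inner y z = 0)"
  then have "R (y - c) = 0" by (simp add: blinfun.diff_right)
  then have "inner y (y - c) = 0" "inner c (y - c) = 0" using y K_ker[OF assms] by blast+
  then have "inner (y - c) (y - c) = 0" by (simp add: inner_diff_left)
  then show "y = c" by simp
qed (use K_ker[OF assms] in auto)

text \<open>Project any preimage onto \<open>K\<close>: what is split off is orthogonal to the range
  of \<open>R\<close>, hence killed by the symmetric operator \<open>R\<close>.\<close>

lemma U0_preimage: assumes "x \<in> U0 Q" obtains c where "c \<in> K" "x = R c"
proof -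
  obtain z where z: "x = R z" using assms U0_eq by auto
  obtain p where p: "p \<in> K" "\<And>k. k \<in> K \<Longrightarrow> inner (z - p) k = 0"
    using closed_subspace_projection[OF K_subspace K_closed] by blast
  have "inner (R (z - p)) w = 0" for w using p(2)[OF R_in_K[of w]] R_sym by simp
  then have "R (z - p) = 0" by (metis inner_eq_zero_iff)
  then have "x = R p" using z by (simp add: blinfun.diff_right)
  with p(1) that show ?thesis by blast
qed

lemma R_pin: "x \<in> U0 Q \<Longrightarrow> R (pin x) = x" and pin_in_K: "x \<in> U0 Q \<Longrightarrow> pin x \<in> K"
  by (metis U0_preimage pin_R)+

lemma pin_scaleR: "x \<in> U0 Q \<Longrightarrow> pin (c *\<^sub>R x) = c *\<^sub>R pin x"
  by (metis K_subspace R_pin blinfun.scaleR_right pin_R pin_in_K subspace_scale)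

lemma inner_U0: "v \<in> U0 Q \<Longrightarrow> inner u v = inner (R u) (pin v)"
  by (metis R_pin R_sym)

text \<open>The basis is picked by \<open>SOME\<close>, so existence has to be shown: Zorn's lemma
  yields a maximal orthonormal system.\<close>

lemma U0_basis: "U0_orthonormal_basis Q B"
proof -
  let ?A = "{B. B \<subseteq> U0 Q \<and> (\<forall>b\<in>B. \<forall>c\<in>B. inner (pin b) (pin c) = (if b = c then 1 else 0))}"
  have "\<exists>M\<in>?A. \<forall>X\<in>?A. M \<subseteq> X \<longrightarrow> X = M"
  proof (rule subset_Zorn_nonempty)
    show "?A \<noteq> {}" by (auto intro!: exI[of _ "{}"])
    fix C assume C: "C \<noteq> {}" "subset.chain ?A C"
    have tot: "\<forall>X\<in>C. \<forall>Y\<in>C. X \<subseteq> Y \<or> Y \<subseteq> X" and sub: "C \<subseteq> ?A"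
      using C(2) unfolding subset_chain_def by (rule conjunct2, rule conjunct1)
    have two: "\<exists>X\<in>C. b \<in> X \<and> c \<in> X" if bc: "b \<in> \<Union>C" "c \<in> \<Union>C" for b c
    proof -
      obtain X Y where XY: "X \<in> C" "Y \<in> C" "b \<in> X" "c \<in> Y" using bc by blast
      then have "X \<subseteq> Y \<or> Y \<subseteq> X" using tot by blast
      with XY show ?thesis by blast
    qed
    have CA: "X \<in> ?A" if "X \<in> C" for X using sub that by (rule subsetD)
    have "inner (pin b) (pin c) = (if b = c then 1 else 0)" if bc: "b \<in> \<Union>C" "c \<in> \<Union>C" for b c
    proof -
      obtain X where X: "X \<in> C" "b \<in> X" "c \<in> X" using two[OF bc] by blast
      from CA[OF X(1)] X(2,3) show ?thesis by simp
    qed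
    moreover have "\<Union>C \<subseteq> U0 Q"
    proof (rule Union_least)
      fix X assume "X \<in> C" then show "X \<subseteq> U0 Q" using CA[of X] by simp
    qed
    ultimately show "\<Union>C \<in> ?A" by simp
  qed
  then obtain N where NA: "N \<in> ?A" and mx0: "\<forall>X\<in>?A. N \<subseteq> X \<longrightarrow> X = N" by (rule bexE)
  have mx: "X = N" if "X \<in> ?A" "N \<subseteq> X" for X using mx0[rule_format, OF that] .
  have N: "N \<subseteq> U0 Q" "\<And>b c. b \<in> N \<Longrightarrow> c \<in> N \<Longrightarrow> inner (pin b) (pin c) = (if b = c then 1 else 0)"
    using NA by simp_all
  have "x = 0" if x: "x \<in> U0 Q" "\<And>b. b \<in> N \<Longrightarrow> inner (pin x) (pin b) = 0" for x
  proof (rule ccontr)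
    assume x0: "x \<noteq> 0"
    then have p0: "pin x \<noteq> 0" using R_pin[OF x(1)] by auto
    \<comment> \<open>Normalised in the norm of \<open>U0 Q\<close>, so that it would enlarge the
      maximal system \<open>N\<close>.\<close>
    define y where "y = (1 / norm (pin x)) *\<^sub>R x"
    have yU: "y \<in> U0 Q" unfolding y_def using x(1) U0_subspace by (simp add: subspace_scale)
    have py: "pin y = (1 / norm (pin x)) *\<^sub>R pin x" unfolding y_def by (rule pin_scaleR[OF x(1)])
    have 1: "inner (pin y) (pin y) = 1" using p0 by (simp add: py power2_norm_eq_inner[symmetric] power2_eq_square)
    have 2: "inner (pin y) (pin b) = 0" "inner (pin b) (pin y) = 0" if "b \<in> N" for b
      using x(2)[OF that] by (simp_all add: py inner_commute)
    have yN: "y \<notin> N" using 1 2(1)[of y] by auto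
    have "inner (pin b) (pin c) = (if b = c then 1 else 0)" if "b \<in> insert y N" "c \<in> insert y N" for b c
      using that N(2)[of b c] 1 2 yN by (cases "b = y"; cases "c = y") auto
    then have "insert y N \<in> ?A" using N(1) yU by simp
    then show False using mx[of "insert y N"] yN by auto
  qed
  with N have "U0_orthonormal_basis Q N" by (auto simp: U0_orthonormal_basis_def U0_inner_eq)
  then show ?thesis unfolding B_def U0_basis_def by (rule someI)
qed

lemma B_U0: "b \<in> B \<Longrightarrow> b \<in> U0 Q"
  using U0_basis by (auto simp: U0_orthonormal_basis_def)

lemma pin_orthonormal: "b \<in> B \<Longrightarrow> c \<in> B \<Longrightarrow> inner (pin b) (pin c) = (if b = c then 1 else 0)"
  using U0_basis by (auto simp: U0_orthonormal_basis_def U0_inner_eq)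

lemma B_countable: "countable B"
  by (rule orthonormal_family_countable[of B pin]) (rule pin_orthonormal)

text \<open>Completeness of \<open>B\<close>, moved from \<open>U0 Q\<close> to \<open>K\<close>: a
  vector of \<open>K\<close> orthogonal to all \<open>pin b\<close> is sent to 0 by
  \<open>R\<close>, and \<open>R\<close> is injective on \<open>K\<close>.\<close>

lemma K_eq: "K = closure (span (pin ` B))"
proof
  have "span (pin ` B) \<subseteq> K" using pin_in_K B_U0 by (intro span_minimal K_subspace) auto
  then show sub: "closure (span (pin ` B)) \<subseteq> K" by (intro closure_minimal K_closed)
  show "K \<subseteq> closure (span (pin ` B))"
  proof
    fix k assume k: "k \<in> K"
    obtain p where p: "p \<in> closure (span (pin ` B))"
      "\<And>y. y \<in> closure (span (pin ` B)) \<Longrightarrow> inner (k - p) y = 0"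
      using closed_subspace_projection[OF subspace_closure[OF subspace_span] closed_closure] by metis
    have kp: "k - p \<in> K" using k p(1) sub K_subspace by (auto intro: subspace_diff)
    have U: "R (k - p) \<in> U0 Q" by (simp add: U0_eq)
    have "U0_inner Q (R (k - p)) b = 0" if "b \<in> B" for b
      unfolding U0_inner_eq pin_R[OF kp]
      by (rule p(2)) (use that closure_subset[of "span (pin ` B)"] in \<open>auto intro: span_base\<close>)
    then have "R (k - p) = 0" using U0_basis U by (auto simp: U0_orthonormal_basis_def)
    then have "inner (k - p) (k - p) = 0" using K_ker[OF kp] by simp
    then show "k \<in> closure (span (pin ` B))" using p(1) by simp
  qed
qed

lemma K_Parseval: "k \<in> K \<Longrightarrow> l \<in> K \<Longrightarrow> ((\<lambda>b. inner k (pin b) * inner l (pin b)) has_sum inner k l) B"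
  by (rule Parseval_has_sum[of B pin]) (auto simp: pin_orthonormal K_eq)

text \<open>The link between the two sides of the Ito isometry: the sum over the basis of
  \<open>U0 Q\<close> gives \<open>inner (Q u) v\<close>, which is also the covariance per unit time
  of the noise in the directions \<open>u\<close> and \<open>v\<close>.\<close>

lemma Q_Parseval: "((\<lambda>b. inner u b * inner v b) has_sum inner (Q u) v) B"
  using K_Parseval[OF R_in_K R_in_K, of u v]
  unfolding R_inner by (rule has_sum_cong[THEN iffD1, rotated]) (simp add: inner_U0[OF B_U0])

section \<open>The Hilbert-Schmidt norm and its triangle inequality\<close>

lemma L20_iff: "T \<in> L20 Q \<longleftrightarrow>
     (\<forall>x\<in>U0 Q. \<forall>y\<in>U0 Q. T (x + y) = T x + T y) \<and>
     (\<forall>c. \<forall>x\<in>U0 Q. T (c *\<^sub>R x) = c *\<^sub>R T x) \<and>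
     (\<exists>K. \<forall>x\<in>U0 Q. norm (T x) \<le> K * norm (pin x)) \<and>
     (\<lambda>b. (norm (T b))\<^sup>2) summable_on B"
  by (simp add: L20_def U0_inner_eq B_def norm_eq_sqrt_inner)

lemma L20_summable: "T \<in> L20 Q \<Longrightarrow> (\<lambda>b. (norm (T b))\<^sup>2) summable_on B"
  by (simp add: L20_iff)

lemma square_summable_add:
  assumes "(\<lambda>b. (norm (T b))\<^sup>2) summable_on B" "(\<lambda>b. (norm (T' b))\<^sup>2) summable_on B"
  shows "(\<lambda>b. (norm (T b + T' b :: 'h::real_normed_vector))\<^sup>2) summable_on B"
proof (rule summable_on_comparison_test)
  show "(\<lambda>b. 2 * (norm (T b))\<^sup>2 + 2 * (norm (T' b))\<^sup>2) summable_on B"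
    by (intro summable_on_add summable_on_cmult_right assms)
  fix b
  have "(norm (T b + T' b))\<^sup>2 \<le> (norm (T b) + norm (T' b))\<^sup>2" by (intro power_mono norm_triangle_ineq) auto
  also have "\<dots> \<le> 2 * (norm (T b))\<^sup>2 + 2 * (norm (T' b))\<^sup>2" using sum_squares_bound[of "norm (T b)" "norm (T' b)"] by (simp add: power2_sum)
  finally show "(norm (T b + T' b))\<^sup>2 \<le> 2 * (norm (T b))\<^sup>2 + 2 * (norm (T' b))\<^sup>2" .
qed simp

lemma L20_add:
  assumes "T \<in> L20 Q" "T' \<in> L20 Q" shows "(\<lambda>v. T v + T' v :: 'h::real_normed_vector) \<in> L20 Q"
proof -
  obtain C C' where C: "\<forall>x\<in>U0 Q. norm (T x) \<le> C * norm (pin x)" "\<forall>x\<in>U0 Q. norm (T' x) \<le> C' * norm (pin x)"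
    using assms by (auto simp: L20_iff)
  have "\<forall>x\<in>U0 Q. norm (T x + T' x) \<le> (C + C') * norm (pin x)"
    using C by (auto intro!: norm_triangle_le simp: distrib_right add_mono)
  then have "\<exists>K. \<forall>x\<in>U0 Q. norm (T x + T' x) \<le> K * norm (pin x)" by blast
  then show ?thesis using assms square_summable_add[of T T']
    by (simp add: L20_iff algebra_simps)
qed

lemma L20_bounded_linear:
  fixes G :: "'h::real_normed_vector \<Rightarrow> 'k::real_normed_vector"
  assumes "T \<in> L20 Q" "bounded_linear G" shows "(\<lambda>v. G (T v)) \<in> L20 Q"
proof -
  interpret G: bounded_linear G by fact
  obtain c where c: "0 < c" "\<And>x. norm (G x) \<le> norm x * c" using G.pos_bounded by blast
  obtain C where C: "\<forall>x\<in>U0 Q. norm (T x) \<le> C * norm (pin x)" using assms by (auto simp: L20_iff)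
  have "norm (G (T x)) \<le> (C * c) * norm (pin x)" if "x \<in> U0 Q" for x
  proof -
    have "norm (G (T x)) \<le> norm (T x) * c" by (rule c)
    also have "\<dots> \<le> (C * norm (pin x)) * c" using C that c(1) by (intro mult_right_mono) auto
    finally show ?thesis by (simp add: algebra_simps)
  qed
  moreover have "(\<lambda>b. (norm (G (T b)))\<^sup>2) summable_on B"
  proof (rule summable_on_comparison_test)
    show "(\<lambda>b. (norm (T b))\<^sup>2 * c\<^sup>2) summable_on B" by (intro summable_on_cmult_left L20_summable assms)
    fix b
    have "(norm (G (T b)))\<^sup>2 \<le> (norm (T b) * c)\<^sup>2" by (intro power_mono c) auto
    then show "(norm (G (T b)))\<^sup>2 \<le> (norm (T b))\<^sup>2 * c\<^sup>2" by (simp add: power_mult_distrib)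
  qed simp
  ultimately show ?thesis using assms(1)
    by (auto simp: L20_iff G.add G.scaleR)
qed

lemma L20_diff:
  assumes "T \<in> L20 Q" "T' \<in> L20 Q" shows "(\<lambda>v. T v - T' v :: 'h::real_normed_vector) \<in> L20 Q"
  using L20_add[OF assms(1) L20_bounded_linear[OF assms(2), of uminus]]
  by (simp add: bounded_linear_minus bounded_linear_ident)

lemma L20_zero: "(\<lambda>v. 0 :: 'h::real_normed_vector) \<in> L20 Q"
  by (auto simp: L20_iff intro!: exI[of _ 0])

lemma K_vector_has_sum:
  assumes "k \<in> K"
  shows "((\<lambda>b. (norm (inner k (pin b) *\<^sub>R x))\<^sup>2) has_sum (norm k * norm x)\<^sup>2) B"
  using has_sum_cmult_left[OF K_Parseval[OF assms assms], of "(norm x)\<^sup>2"]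
  by (simp add: power_mult_distrib power2_eq_square power2_norm_eq_inner[symmetric] algebra_simps)

lemma L20_rank_one: "(\<lambda>v. inner u v *\<^sub>R x) \<in> L20 Q"
proof -
  have "norm (inner u v *\<^sub>R x) \<le> (norm (R u) * norm x) * norm (pin v)" if "v \<in> U0 Q" for v
    using Cauchy_Schwarz_ineq2[of "R u" "pin v"] by (simp add: inner_U0[OF that] mult_right_mono algebra_simps mult_left_mono)
  moreover have "(\<lambda>b. (norm (inner u b *\<^sub>R x))\<^sup>2) summable_on B"
    using K_vector_has_sum[OF R_in_K[of u], of x]
    by (auto simp: summable_on_def inner_U0[OF B_U0] cong: has_sum_cong)
  ultimately show ?thesis by (auto simp: L20_iff inner_add_right scaleR_left_distrib simp del: norm_scaleR)
qed

lemma L20_norm_eq: "L20_norm Q T = sqrt (infsum (\<lambda>b. (norm (T b))\<^sup>2) B)"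
  by (simp add: L20_norm_def B_def)

lemma L20_norm_nonneg: "0 \<le> L20_norm Q T"
  unfolding L20_norm_eq by (intro real_sqrt_ge_zero infsum_nonneg) auto

lemma L20_norm_power2: "(L20_norm Q T)\<^sup>2 = infsum (\<lambda>b. (norm (T b))\<^sup>2) B"
  unfolding L20_norm_eq by (intro real_sqrt_pow2 infsum_nonneg) auto

lemma L20_norm_cong: "(\<And>b. b \<in> B \<Longrightarrow> norm (T b) = norm (T' b)) \<Longrightarrow> L20_norm Q T = L20_norm Q T'"
  unfolding L20_norm_eq by (metis (mono_tags, lifting) infsum_cong)

lemma L20_norm_zero: "(\<And>b. b \<in> B \<Longrightarrow> T b = 0) \<Longrightarrow> L20_norm Q T = 0"
  unfolding L20_norm_eq by (simp add: infsum_0)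

lemma finite_sum_le_L20_norm:
  assumes "(\<lambda>b. (norm (T b))\<^sup>2) summable_on B" "finite F" "F \<subseteq> B"
  shows "(\<Sum>b\<in>F. (norm (T b))\<^sup>2) \<le> (L20_norm Q T)\<^sup>2"
  unfolding L20_norm_power2 by (rule finite_sum_le_infsum) (use assms in auto)

lemma norm_le_L20_norm: assumes "T \<in> L20 Q" "b \<in> B" shows "norm (T b) \<le> L20_norm Q T"
proof (rule power2_le_imp_le)
  show "(norm (T b))\<^sup>2 \<le> (L20_norm Q T)\<^sup>2"
    using finite_sum_le_L20_norm[of T "{b}"] assms by (simp add: L20_summable)
qed (rule L20_norm_nonneg)

text \<open>Minkowski's inequality on finite sets of basis vectors. Only square summability over
  \<open>B\<close> is assumed, so that it covers maps whose membership in \<open>L20 Q\<close> has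
  not been established.\<close>

lemma L20_triangle_summable:
  fixes T T' :: "'u \<Rightarrow> 'h::real_normed_vector"
  assumes T: "(\<lambda>b. (norm (T b))\<^sup>2) summable_on B" and T': "(\<lambda>b. (norm (T' b))\<^sup>2) summable_on B"
  shows "L20_norm Q (\<lambda>v. T v + T' v) \<le> L20_norm Q T + L20_norm Q T'"
proof (rule power2_le_imp_le)
  show "(L20_norm Q (\<lambda>v. T v + T' v))\<^sup>2 \<le> (L20_norm Q T + L20_norm Q T')\<^sup>2"
    unfolding L20_norm_power2[of "\<lambda>v. T v + T' v"]
  proof (rule infsum_le_finite_sums[OF square_summable_add[OF T T']])
    fix F assume F: "finite F" "F \<subseteq> B"
    have "sqrt (\<Sum>b\<in>F. (norm (T b + T' b))\<^sup>2) \<le> sqrt (\<Sum>b\<in>F. (norm (T b) + norm (T' b))\<^sup>2)"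
      by (intro real_sqrt_le_mono sum_mono power_mono norm_triangle_ineq) auto
    also have "\<dots> \<le> sqrt (\<Sum>b\<in>F. (norm (T b))\<^sup>2) + sqrt (\<Sum>b\<in>F. (norm (T' b))\<^sup>2)"
      using L2_set_triangle_ineq[of "\<lambda>b. norm (T b)" "\<lambda>b. norm (T' b)" F] by (simp add: L2_set_def)
    also have "\<dots> \<le> L20_norm Q T + L20_norm Q T'"
      by (intro add_mono real_le_lsqrt L20_norm_nonneg finite_sum_le_L20_norm T T' F)
    finally have "sqrt (\<Sum>b\<in>F. (norm (T b + T' b))\<^sup>2) \<le> L20_norm Q T + L20_norm Q T'" .
    then show "(\<Sum>b\<in>F. (norm (T b + T' b))\<^sup>2) \<le> (L20_norm Q T + L20_norm Q T')\<^sup>2"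
      by (rule sqrt_le_D)
  qed
qed (simp add: L20_norm_nonneg)

lemma L20_dist_triangle:
  fixes T1 T2 T3 :: "'u \<Rightarrow> 'h::real_normed_vector"
  assumes "T1 \<in> L20 Q" "T2 \<in> L20 Q" "T3 \<in> L20 Q"
  shows "L20_dist Q T1 T3 \<le> L20_dist Q T1 T2 + L20_dist Q T2 T3"
  using L20_triangle_summable[OF L20_summable[OF L20_diff[OF assms(1,2)]] L20_summable[OF L20_diff[OF assms(2,3)]]]
  by simp

lemma L20_dist_commute: "L20_dist Q T1 T2 = L20_dist Q T2 (T1 :: 'u \<Rightarrow> 'h::real_normed_vector)"
  by (rule L20_norm_cong) (rule norm_minus_commute)

lemma L20_norm_triangle_diff:
  fixes T1 T2 :: "'u \<Rightarrow> 'h::real_normed_vector"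
  assumes "T1 \<in> L20 Q" "T2 \<in> L20 Q"
  shows "L20_norm Q T1 \<le> L20_norm Q T2 + L20_dist Q T1 T2"
  using L20_dist_triangle[OF assms L20_zero] by simp

lemma L20_norm_bounded_linear:
  fixes G :: "'h::real_normed_vector \<Rightarrow> 'k::real_normed_vector"
  assumes T: "T \<in> L20 Q" and G: "bounded_linear G" and c: "0 \<le> c" "\<And>x. norm (G x) \<le> c * norm x"
  shows "L20_norm Q (\<lambda>v. G (T v)) \<le> c * L20_norm Q T"
proof (rule power2_le_imp_le)
  have "infsum (\<lambda>b. (norm (G (T b)))\<^sup>2) B \<le> infsum (\<lambda>b. c\<^sup>2 * (norm (T b))\<^sup>2) B"
  proof (rule infsum_mono)
    show "(norm (G (T b)))\<^sup>2 \<le> c\<^sup>2 * (norm (T b))\<^sup>2" for b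
      using power_mono[OF c(2)[of "T b"], of 2] by (simp add: power_mult_distrib)
  qed (intro L20_summable L20_bounded_linear[OF T G] summable_on_cmult_right T)+
  also have "\<dots> = c\<^sup>2 * infsum (\<lambda>b. (norm (T b))\<^sup>2) B"
    by (rule infsum_cmult_right) (intro L20_summable T)
  finally show "(L20_norm Q (\<lambda>v. G (T v)))\<^sup>2 \<le> (c * L20_norm Q T)\<^sup>2"
    by (simp add: power_mult_distrib L20_norm_power2)
qed (simp add: c L20_norm_nonneg)

lemma finite_rank_op_L20: "finite_rank_op L \<in> L20 Q"
proof (induction L)
  case Nil show ?case using L20_zero by (simp add: finite_rank_op_def[abs_def])
next
  case (Cons a L)
  obtain u x where a: "a = (u, x)" by force
  show ?case using L20_add[OF L20_rank_one[of u x] Cons] by (simp add: finite_rank_op_def[abs_def] a)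
qed

text \<open>The Gram expansion of a finite-rank operator; the second moment of the corresponding
  combination of Wiener increments expands into terms of the same shape.\<close>

lemma bilinear_sum_L20:
  fixes x :: "nat \<Rightarrow> 'h::real_inner"
  shows "((\<lambda>b. (norm (\<Sum>i<n. (r i * inner (u i) b) *\<^sub>R x i))\<^sup>2) has_sum
     (\<Sum>i<n. \<Sum>j<n. r i * r j * inner (Q (u i)) (u j) * inner (x i) (x j))) B"
proof -
  have "((\<lambda>b. \<Sum>i<n. \<Sum>j<n. (r i * r j * inner (x i) (x j)) * (inner (u i) b * inner (u j) b)) has_sum
     (\<Sum>i<n. \<Sum>j<n. (r i * r j * inner (x i) (x j)) * inner (Q (u i)) (u j))) B"
    by (intro has_sum_finite_sum has_sum_cmult_right Q_Parseval) auto
  moreover have "(norm (\<Sum>i<n. (r i * inner (u i) b) *\<^sub>R x i))\<^sup>2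
     = (\<Sum>i<n. \<Sum>j<n. (r i * r j * inner (x i) (x j)) * (inner (u i) b * inner (u j) b))" for b
    unfolding power2_norm_eq_inner inner_sum_left inner_sum_right
    by (intro sum.cong refl) (simp add: inner_commute)
  ultimately show ?thesis by (simp add: algebra_simps)
qed

text \<open>Restricting \<open>T\<close> to finitely many basis vectors leaves a sum of rank-one
  operators given by vectors of \<open>K\<close>. Those are approximated by \<open>R u\<close> with
  \<open>u\<close> in the dense set, since the range of \<open>R\<close> is dense in
  \<open>K\<close> and \<open>R\<close> is continuous.\<close>

lemma L20_approx:
  fixes T :: "'u \<Rightarrow> 'h::real_normed_vector"
  assumes T: "T \<in> L20 Q" and e: "0 < e"
    and DU: "\<And>X :: 'u set. open X \<Longrightarrow> X \<noteq> {} \<Longrightarrow> \<exists>d\<in>DU. d \<in> X"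
    and DX: "\<And>X :: 'h set. open X \<Longrightarrow> X \<noteq> {} \<Longrightarrow> \<exists>d\<in>DX. d \<in> X"
  obtains L where "L \<in> lists (DU \<times> DX)" "L20_dist Q T (finite_rank_op L) < e"
proof -
  have one: "\<exists>u\<in>DU. \<exists>x'\<in>DX. (\<lambda>b. (norm (inner k (pin b) *\<^sub>R x - inner u b *\<^sub>R x'))\<^sup>2) summable_on B \<and>
      L20_norm Q (\<lambda>b. inner k (pin b) *\<^sub>R x - inner u b *\<^sub>R x') < d"
    if k: "k \<in> K" and d: "0 < d" for k d and x :: 'h
  proof -
    \<comment> \<open>\<open>d1\<close> here and \<open>d2\<close> below are such that each of the
      two errors stays under \<open>d / 2\<close>; the summand 1 in the denominators covers
      vanishing norms.\<close>
    define d1 where "d1 = d / (2 * (norm x + 1))"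
    have nx: "norm x + 1 > 0" by (simp add: add_nonneg_pos)
    have d1: "d1 > 0" using d nx by (simp add: d1_def)
    obtain y where y: "dist (R y) k < d1 / 2"
      using k d1 unfolding K_def closure_approachable by (metis half_gt_zero rangeE)
    have "isCont (blinfun_apply R) y" by (intro linear_continuous_at blinfun.bounded_linear_right)
    then obtain s where s: "s > 0" "\<And>z. dist z y < s \<Longrightarrow> dist (R z) (R y) < d1 / 2"
      using d1 unfolding continuous_at_eps_delta dist_norm by (metis half_gt_zero)
    obtain u where u: "u \<in> DU" "dist u y < s" using dense_approx[OF DU s(1)] by blast
    have ku: "norm (k - R u) < d1" using s(2)[OF u(2)] y by (metis dist_commute dist_norm dist_triangle_half_l)
    define d2 where "d2 = d / (2 * (norm (R u) + 1))"
    have nR: "norm (R u) + 1 > 0" by (simp add: add_nonneg_pos)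
    have d2: "d2 > 0" using d nR by (simp add: d2_def)
    obtain x' where x': "x' \<in> DX" "dist x' x < d2" using dense_approx[OF DX d2] by blast
    have kK: "k - R u \<in> K" using k R_in_K K_subspace by (auto intro: subspace_diff)
    let ?T1 = "\<lambda>b. inner (k - R u) (pin b) *\<^sub>R x" and ?T2 = "\<lambda>b. inner (R u) (pin b) *\<^sub>R (x - x')"
    have eq: "inner k (pin b) *\<^sub>R x - inner u b *\<^sub>R x' = ?T1 b + ?T2 b" if "b \<in> B" for b
      by (simp add: inner_U0[OF B_U0[OF that]] inner_diff_left algebra_simps)
    have s1: "(\<lambda>b. (norm (?T1 b))\<^sup>2) summable_on B" "(\<lambda>b. (norm (?T2 b))\<^sup>2) summable_on B"
      using K_vector_has_sum[OF kK, of x] K_vector_has_sum[OF R_in_K[of u], of "x - x'"] by (auto simp: summable_on_def)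
    have n1: "L20_norm Q ?T1 = norm (k - R u) * norm x" "L20_norm Q ?T2 = norm (R u) * norm (x - x')"
      unfolding L20_norm_eq using infsumI[OF K_vector_has_sum[OF kK, of x]] infsumI[OF K_vector_has_sum[OF R_in_K[of u], of "x - x'"]]
      by (simp_all del: norm_scaleR)
    have "L20_norm Q (\<lambda>b. inner k (pin b) *\<^sub>R x - inner u b *\<^sub>R x') = L20_norm Q (\<lambda>b. ?T1 b + ?T2 b)"
      using eq by (intro L20_norm_cong) simp
    also have "\<dots> \<le> norm (k - R u) * norm x + norm (R u) * norm (x - x')"
      using L20_triangle_summable[OF s1] by (simp add: n1)
    also have "\<dots> < d"
    proof -
      have "norm (k - R u) * norm x \<le> d1 * norm x" using ku by (intro mult_right_mono) auto
      also have "\<dots> < d / 2" using d nx unfolding d1_def by (simp add: field_simps)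
      finally have 1: "norm (k - R u) * norm x < d / 2" .
      have "norm (R u) * norm (x - x') \<le> norm (R u) * d2"
        using x'(2) by (intro mult_left_mono) (auto simp: dist_norm norm_minus_commute)
      also have "\<dots> < d / 2" using d nR unfolding d2_def by (simp add: field_simps)
      finally show ?thesis using 1 by simp
    qed
    finally have "L20_norm Q (\<lambda>b. inner k (pin b) *\<^sub>R x - inner u b *\<^sub>R x') < d" .
    moreover have "(\<lambda>b. (norm (inner k (pin b) *\<^sub>R x - inner u b *\<^sub>R x'))\<^sup>2) summable_on B"
      using square_summable_add[OF s1] eq by (simp cong: summable_on_cong)
    ultimately show ?thesis using u(1) x'(1) by blast
  qed
  have fin: "\<exists>L\<in>lists (DU \<times> DX).
      (\<lambda>b. (norm ((\<Sum>c\<in>F. inner (pin c) (pin b) *\<^sub>R T c) - finite_rank_op L b))\<^sup>2) summable_on B \<and>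
      L20_norm Q (\<lambda>b. (\<Sum>c\<in>F. inner (pin c) (pin b) *\<^sub>R T c) - finite_rank_op L b) < d"
    if "finite F" "F \<subseteq> B" "0 < d" for F d
    using that
  proof (induction F arbitrary: d rule: finite_induct)
    case empty
    then show ?case by (intro bexI[of _ "[]"]) (auto simp: finite_rank_op_def L20_norm_zero)
  next
    case (insert c F)
    have "\<exists>u\<in>DU. \<exists>x'\<in>DX. (\<lambda>b. (norm (inner (pin c) (pin b) *\<^sub>R T c - inner u b *\<^sub>R x'))\<^sup>2) summable_on B \<and>
      L20_norm Q (\<lambda>b. inner (pin c) (pin b) *\<^sub>R T c - inner u b *\<^sub>R x') < d / 2"
      by (rule one) (use insert.prems in \<open>auto intro: pin_in_K B_U0\<close>)
    then obtain u x' where ux: "u \<in> DU" "x' \<in> DX"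
      "(\<lambda>b. (norm (inner (pin c) (pin b) *\<^sub>R T c - inner u b *\<^sub>R x'))\<^sup>2) summable_on B"
      "L20_norm Q (\<lambda>b. inner (pin c) (pin b) *\<^sub>R T c - inner u b *\<^sub>R x') < d / 2" by blast
    obtain L where L: "L \<in> lists (DU \<times> DX)"
      "(\<lambda>b. (norm ((\<Sum>c\<in>F. inner (pin c) (pin b) *\<^sub>R T c) - finite_rank_op L b))\<^sup>2) summable_on B"
      "L20_norm Q (\<lambda>b. (\<Sum>c\<in>F. inner (pin c) (pin b) *\<^sub>R T c) - finite_rank_op L b) < d / 2"
      using insert.IH[of "d/2"] insert.prems by auto
    have eq: "(\<Sum>c\<in>insert c F. inner (pin c) (pin b) *\<^sub>R T c) - finite_rank_op ((u, x') # L) b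
       = (inner (pin c) (pin b) *\<^sub>R T c - inner u b *\<^sub>R x') + ((\<Sum>c\<in>F. inner (pin c) (pin b) *\<^sub>R T c) - finite_rank_op L b)" for b
      using insert.hyps by (simp add: finite_rank_op_def)
    have "L20_norm Q (\<lambda>b. (\<Sum>c\<in>insert c F. inner (pin c) (pin b) *\<^sub>R T c) - finite_rank_op ((u, x') # L) b) < d"
      unfolding eq using L20_triangle_summable[OF ux(3) L(2)] ux(4) L(3) by linarith
    moreover have "(\<lambda>b. (norm ((\<Sum>c\<in>insert c F. inner (pin c) (pin b) *\<^sub>R T c) - finite_rank_op ((u, x') # L) b))\<^sup>2) summable_on B"
      unfolding eq by (rule square_summable_add[OF ux(3) L(2)])
    ultimately show ?case using ux(1,2) L(1) by (intro bexI[of _ "(u, x') # L"]) auto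
  qed
  have "((\<lambda>b. (norm (T b))\<^sup>2) has_sum infsum (\<lambda>b. (norm (T b))\<^sup>2) B) B"
    by (intro has_sum_infsum L20_summable T)
  from has_sum_finite_approximation[OF this, of "(e/3)\<^sup>2"] e
  obtain F where F: "finite F" "F \<subseteq> B"
    "dist (\<Sum>b\<in>F. (norm (T b))\<^sup>2) (infsum (\<lambda>b. (norm (T b))\<^sup>2) B) \<le> (e/3)\<^sup>2" by auto
  \<comment> \<open>This agrees with \<open>T\<close> on the basis vectors in \<open>F\<close> and
    vanishes on the others.\<close>
  define TF where "TF b = (\<Sum>c\<in>F. inner (pin c) (pin b) *\<^sub>R T c)" for b
  have TF: "T b - TF b = (if b \<in> F then 0 else T b)" if "b \<in> B" for b
  proof -
    have "TF b = (\<Sum>c\<in>F. if c = b then T c else 0)"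
      unfolding TF_def using pin_orthonormal that F(2) by (intro sum.cong) auto
    then show ?thesis using F(1) by simp
  qed
  have hs: "((\<lambda>b. (norm (T b - TF b))\<^sup>2) has_sum (infsum (\<lambda>b. (norm (T b))\<^sup>2) B - (\<Sum>b\<in>F. (norm (T b))\<^sup>2))) B"
  proof -
    have "((\<lambda>b. (norm (T b))\<^sup>2 - (if b \<in> F then (norm (T b))\<^sup>2 else 0)) has_sum
        (infsum (\<lambda>b. (norm (T b))\<^sup>2) B - (\<Sum>b\<in>F. (norm (T b))\<^sup>2))) B"
      by (intro has_sum_Diff2 has_sum_infsum L20_summable T has_sum_finite_neutralI[OF F(1,2)]) auto
    then show ?thesis by (rule has_sum_cong[THEN iffD1, rotated]) (simp add: TF)
  qed
  have N1: "L20_norm Q (\<lambda>b. T b - TF b) \<le> e / 3"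
    unfolding L20_norm_eq infsumI[OF hs] using F(3) e by (intro real_le_lsqrt) (auto simp: dist_real_def)
  obtain L where L: "L \<in> lists (DU \<times> DX)"
      "(\<lambda>b. (norm (TF b - finite_rank_op L b))\<^sup>2) summable_on B"
      "L20_norm Q (\<lambda>b. TF b - finite_rank_op L b) < e / 3"
    using fin[OF F(1,2), of "e/3"] e unfolding TF_def by auto
  have "(\<lambda>b. (norm (T b - TF b))\<^sup>2) summable_on B" using hs by (auto simp: summable_on_def)
  from L20_triangle_summable[OF this L(2)] N1 L(3) e
  have "L20_dist Q T (finite_rank_op L) < e" by simp
  with L(1) that show ?thesis by blast
qed

lemma dense_ops:
  shows dense_ops_0: "dense_ops Q 0 = ([] :: ('u \<times> 'h::{real_normed_vector, second_countable_topology}) list)"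
    and dense_ops_dense: "\<And>T :: 'u \<Rightarrow> 'h. \<And>e. T \<in> L20 Q \<Longrightarrow> 0 < e \<Longrightarrow> \<exists>k. L20_dist Q T (finite_rank_op (dense_ops Q k)) < e"
proof -
  obtain DU :: "'u set" where DU: "countable DU" "\<And>X. open X \<Longrightarrow> X \<noteq> {} \<Longrightarrow> \<exists>d\<in>DU. d \<in> X"
    using countable_dense_setE by blast
  obtain DX :: "'h set" where DX: "countable DX" "\<And>X. open X \<Longrightarrow> X \<noteq> {} \<Longrightarrow> \<exists>d\<in>DX. d \<in> X"
    using countable_dense_setE by blast
  have cl: "countable (lists (DU \<times> DX))" using DU(1) DX(1) by simp
  have ne: "lists (DU \<times> DX) \<noteq> {}" by (metis empty_iff lists.Nil)
  define D :: "nat \<Rightarrow> ('u \<times> 'h) list" where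
    "D k = (case k of 0 \<Rightarrow> [] | Suc k \<Rightarrow> from_nat_into (lists (DU \<times> DX)) k)" for k
  have "D 0 = [] \<and> (\<forall>T\<in>L20 Q. \<forall>\<epsilon>>0. \<exists>k. L20_dist Q T (finite_rank_op (D k)) < \<epsilon>)"
  proof (intro conjI ballI allI impI)
    fix T :: "'u \<Rightarrow> 'h" and e :: real assume T: "T \<in> L20 Q" "0 < e"
    obtain L where L: "L \<in> lists (DU \<times> DX)" "L20_dist Q T (finite_rank_op L) < e"
      using L20_approx[OF T DU(2) DX(2)] by blast
    obtain k where "from_nat_into (lists (DU \<times> DX)) k = L" using from_nat_into_surj[OF cl L(1)] by blast
    then show "\<exists>k. L20_dist Q T (finite_rank_op (D k)) < e" using L(2) by (intro exI[of _ "Suc k"]) (simp add: D_def)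
  qed (simp add: D_def)
  from someI[where P="\<lambda>D. D 0 = [] \<and> (\<forall>T\<in>L20 Q. \<forall>\<epsilon>>0. \<exists>k. L20_dist Q T (finite_rank_op (D k)) < \<epsilon>)", OF this, folded dense_ops_def]
  show "dense_ops Q 0 = ([] :: ('u \<times> 'h) list)"
    and "\<And>T :: 'u \<Rightarrow> 'h. \<And>e. T \<in> L20 Q \<Longrightarrow> 0 < e \<Longrightarrow> \<exists>k. L20_dist Q T (finite_rank_op (dense_ops Q k)) < e"
    by blast+
qed

end

section \<open>The stochastic integral\<close>

text \<open>Young's inequality with a free weight. Letting \<open>\<epsilon>\<close> tend to 0
  restores the constant 1 in front of the first term, which the usual factor 2 would lose.\<close>

lemma power2_norm_sum_le:
  fixes x y :: "'a::real_normed_vector"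
  assumes "0 < \<epsilon>"
  shows "(norm (x + y))\<^sup>2 \<le> (1 + \<epsilon>) * (norm x)\<^sup>2 + (1 + 1 / \<epsilon>) * (norm y)\<^sup>2"
proof -
  have "(norm (x + y))\<^sup>2 \<le> (norm x + norm y)\<^sup>2" by (intro power_mono norm_triangle_ineq) auto
  also have "\<dots> = (norm x)\<^sup>2 + (norm y)\<^sup>2 + 2 * norm x * norm y" by (simp add: power2_sum)
  also have "2 * norm x * norm y \<le> \<epsilon> * (norm x)\<^sup>2 + (1 / \<epsilon>) * (norm y)\<^sup>2"
  proof -
    have "0 \<le> (\<epsilon> * norm x - norm y)\<^sup>2 / \<epsilon>" using assms by simp
    also have "\<dots> = \<epsilon> * (norm x)\<^sup>2 + (1 / \<epsilon>) * (norm y)\<^sup>2 - 2 * norm x * norm y"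
      using assms by (simp add: power2_diff power_mult_distrib diff_divide_distrib add_divide_distrib) (simp add: power2_eq_square)
    finally show ?thesis by simp
  qed
  finally show ?thesis by (simp add: algebra_simps)
qed

lemma power2_real_sum_le:
  assumes "0 < \<epsilon>" "0 \<le> x" "0 \<le> y"
  shows "(x + y)\<^sup>2 \<le> (1 + \<epsilon>) * x\<^sup>2 + (1 + 1 / \<epsilon>) * (y::real)\<^sup>2"
  using power2_norm_sum_le[OF assms(1), of x y] by simp

lemma nn_integral_le_combination:
  fixes f g h :: "'a \<Rightarrow> ennreal"
  assumes "\<And>x. x \<in> space N \<Longrightarrow> f x \<le> c * g x + d * h x"
    and [measurable]: "g \<in> borel_measurable N" "h \<in> borel_measurable N"
  shows "(\<integral>\<^sup>+x. f x \<partial>N) \<le> c * (\<integral>\<^sup>+x. g x \<partial>N) + d * (\<integral>\<^sup>+x. h x \<partial>N)"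
proof -
  have "(\<integral>\<^sup>+x. f x \<partial>N) \<le> (\<integral>\<^sup>+x. c * g x + d * h x \<partial>N)" by (intro nn_integral_mono assms)
  also have "\<dots> = c * (\<integral>\<^sup>+x. g x \<partial>N) + d * (\<integral>\<^sup>+x. h x \<partial>N)"
    by (subst nn_integral_add) (auto simp: nn_integral_cmult)
  finally show ?thesis .
qed

lemma nn_integral_norm_sum_le2:
  fixes X Y :: "'a \<Rightarrow> 'h::{real_normed_vector, second_countable_topology}"
  assumes [measurable]: "X \<in> borel_measurable N" "Y \<in> borel_measurable N"
    and Z: "\<And>x. x \<in> space N \<Longrightarrow> norm (Z x) \<le> norm (X x) + norm (Y x)"
  shows "(\<integral>\<^sup>+x. ennreal ((norm (Z x))\<^sup>2) \<partial>N)
     \<le> 2 * (\<integral>\<^sup>+x. ennreal ((norm (X x))\<^sup>2) \<partial>N) + 2 * (\<integral>\<^sup>+x. ennreal ((norm (Y x))\<^sup>2) \<partial>N)"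
proof (rule nn_integral_le_combination)
  fix x assume "x \<in> space N"
  then have "(norm (Z x))\<^sup>2 \<le> (norm (X x) + norm (Y x))\<^sup>2" by (intro power_mono Z) auto
  also have "\<dots> \<le> 2 * (norm (X x))\<^sup>2 + 2 * (norm (Y x))\<^sup>2"
    using sum_squares_bound[of "norm (X x)" "norm (Y x)"] by (simp add: power2_sum)
  finally have "ennreal ((norm (Z x))\<^sup>2) \<le> ennreal (2 * (norm (X x))\<^sup>2 + 2 * (norm (Y x))\<^sup>2)" by (rule ennreal_leI)
  then show "ennreal ((norm (Z x))\<^sup>2) \<le> 2 * ennreal ((norm (X x))\<^sup>2) + 2 * ennreal ((norm (Y x))\<^sup>2)"
    by (simp add: ennreal_plus ennreal_mult)
qed auto

lemma integral_double_sum: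
  fixes f :: "nat \<Rightarrow> nat \<Rightarrow> 'a \<Rightarrow> real"
  assumes "\<And>i j. i < n \<Longrightarrow> j < n \<Longrightarrow> integrable N (f i j)"
  shows "(\<integral>p. (\<Sum>i<n. \<Sum>j<n. f i j p * q i j) \<partial>N) = (\<Sum>i<n. \<Sum>j<n. (\<integral>p. f i j p \<partial>N) * q i j)"
proof -
  have "(\<integral>p. (\<Sum>i<n. \<Sum>j<n. f i j p * q i j) \<partial>N) = (\<Sum>i<n. \<integral>p. (\<Sum>j<n. f i j p * q i j) \<partial>N)"
    by (intro Bochner_Integration.integral_sum Bochner_Integration.integrable_sum integrable_mult_left assms) auto
  also have "\<dots> = (\<Sum>i<n. \<Sum>j<n. \<integral>p. f i j p * q i j \<partial>N)"
    by (intro sum.cong refl Bochner_Integration.integral_sum integrable_mult_left assms) auto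
  finally show ?thesis by simp
qed

lemma square_prod_integrable:
  fixes X Y :: "'a \<Rightarrow> real"
  assumes [measurable]: "X \<in> borel_measurable N" "Y \<in> borel_measurable N"
    and "integrable N (\<lambda>\<omega>. (X \<omega>)\<^sup>2)" "integrable N (\<lambda>\<omega>. (Y \<omega>)\<^sup>2)"
  shows "integrable N (\<lambda>\<omega>. X \<omega> * Y \<omega>)"
proof (rule Bochner_Integration.integrable_bound)
  show "integrable N (\<lambda>\<omega>. (X \<omega>)\<^sup>2 + (Y \<omega>)\<^sup>2)" using assms by simp
  show "AE \<omega> in N. norm (X \<omega> * Y \<omega>) \<le> norm ((X \<omega>)\<^sup>2 + (Y \<omega>)\<^sup>2)"
  proof (rule AE_I2)
    fix \<omega>
    have "2 * \<bar>X \<omega>\<bar> * \<bar>Y \<omega>\<bar> \<le> (X \<omega>)\<^sup>2 + (Y \<omega>)\<^sup>2" using sum_squares_bound[of "\<bar>X \<omega>\<bar>" "\<bar>Y \<omega>\<bar>"] by simp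
    moreover have "0 \<le> \<bar>X \<omega>\<bar> * \<bar>Y \<omega>\<bar>" by simp
    ultimately have "\<bar>X \<omega>\<bar> * \<bar>Y \<omega>\<bar> \<le> (X \<omega>)\<^sup>2 + (Y \<omega>)\<^sup>2" by linarith
    then show "norm (X \<omega> * Y \<omega>) \<le> norm ((X \<omega>)\<^sup>2 + (Y \<omega>)\<^sup>2)" by (simp add: abs_mult)
  qed
qed simp

lemma bounded_mult_integrable:
  fixes X Y :: "'a \<Rightarrow> real"
  assumes [measurable]: "X \<in> borel_measurable N" "integrable N Y"
    and "\<And>\<omega>. \<omega> \<in> space N \<Longrightarrow> \<bar>X \<omega>\<bar> \<le> C"
  shows "integrable N (\<lambda>\<omega>. X \<omega> * Y \<omega>)"
proof (rule Bochner_Integration.integrable_bound)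
  show "integrable N (\<lambda>\<omega>. C * Y \<omega>)" using assms by simp
  show "AE \<omega> in N. norm (X \<omega> * Y \<omega>) \<le> norm (C * Y \<omega>)"
    using assms(3) by (intro AE_I2) (simp add: abs_mult, meson abs_ge_self abs_ge_zero mult_right_mono order_trans)
qed (use assms in measurable)

lemma square_integrable_mono_le:
  fixes X :: "'a \<Rightarrow> 'h::{real_normed_vector, second_countable_topology}"
  assumes "X \<in> borel_measurable N" "(\<integral>\<^sup>+x. ennreal ((norm (X x))\<^sup>2) \<partial>N) < \<infinity>"
  shows "square_integrable N X"
  unfolding square_integrable_def using assms by (auto intro!: integrableI_nonneg)

lemma square_integrable_nn:
  "square_integrable N X \<Longrightarrow> (\<integral>\<^sup>+x. ennreal ((norm (X x))\<^sup>2) \<partial>N) = ennreal (\<integral>x. (norm (X x))\<^sup>2 \<partial>N)"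
  unfolding square_integrable_def by (intro nn_integral_eq_integral) auto

locale wiener_space = covariance Q + prob_space M
  for Q :: "'u::{real_inner, banach, second_countable_topology} \<Rightarrow>\<^sub>L 'u" and M :: "'w measure" +
  fixes F :: "real \<Rightarrow> 'w measure" and W :: "real \<Rightarrow> 'u \<Rightarrow> 'w \<Rightarrow> real"
  assumes usual: "usual_filtration M F" and wiener: "two_sided_wiener M F Q W"
begin

section \<open>The filtration and the increments of the Wiener process\<close>

lemma F_sub: "subalgebra M (F t)"
  using usual unfolding usual_filtration_def by blast

lemma F_space: "space (F t) = space M"
  using F_sub by (simp add: subalgebra_def)

lemma F_mono: "s \<le> t \<Longrightarrow> sets (F s) \<subseteq> sets (F t)"
proof -
  have "filtration (space M) F" using usual unfolding usual_filtration_def by (rule conjunct1)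
  then show "s \<le> t \<Longrightarrow> sets (F s) \<subseteq> sets (F t)" by (rule filtration.sets_F_mono)
qed

lemma F_null: "N \<in> null_sets M \<Longrightarrow> N \<in> sets (F t)"
  using usual unfolding usual_filtration_def by blast

lemma measurable_F_M: "X \<in> measurable (F t) N \<Longrightarrow> X \<in> measurable M N"
  by (rule measurable_from_subalg[OF F_sub])

lemma measurable_F_mono: "X \<in> measurable (F s) N \<Longrightarrow> s \<le> t \<Longrightarrow> X \<in> measurable (F t) N"
  using F_mono[of s t] by (auto simp: measurable_def F_space)

definition dW :: "real \<Rightarrow> real \<Rightarrow> 'u \<Rightarrow> 'w \<Rightarrow> real" where
  "dW s t u \<omega> = W t u \<omega> - W s u \<omega>"

lemma W_meas[measurable]: "W t u \<in> borel_measurable M"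
  using wiener by (auto simp: two_sided_wiener_def)

lemma dW_meas[measurable]: "dW s t u \<in> borel_measurable M"
  unfolding dW_def[abs_def] by measurable

lemma dW_measF: "s \<le> t \<Longrightarrow> dW s t u \<in> borel_measurable (F t)"
  using wiener by (cases "s = t") (auto simp: two_sided_wiener_def dW_def[abs_def])

lemma dW_same: "dW s s u = (\<lambda>\<omega>. 0)" by (simp add: dW_def[abs_def])

lemma dW_split: "dW s t u \<omega> = dW s r u \<omega> + dW r t u \<omega>" by (simp add: dW_def)

lemma dW_gaussian: assumes "s \<le> t"
  shows "integrable M (\<lambda>\<omega>. (dW s t u \<omega>)\<^sup>2)" "integrable M (dW s t u)"
    "(\<integral>\<omega>. dW s t u \<omega> \<partial>M) = 0" "(\<integral>\<omega>. (dW s t u \<omega>)\<^sup>2 \<partial>M) = (t - s) * inner (Q u) u"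
proof -
  let ?v = "(t - s) * inner (Q u) u"
  have v0: "0 \<le> ?v" using assms Q_pos by (auto simp: positive_op_def)
  have "integrable M (\<lambda>\<omega>. (dW s t u \<omega>)\<^sup>2) \<and> (\<integral>\<omega>. dW s t u \<omega> \<partial>M) = 0 \<and> (\<integral>\<omega>. (dW s t u \<omega>)\<^sup>2 \<partial>M) = ?v"
  \<comment> \<open>A vanishing variance is a separate case of \<open>centered_gaussian\<close>,
    since the increment then has no density.\<close>
  proof (cases "?v = 0")
    case True
    have ae: "AE \<omega> in M. dW s t u \<omega> = 0"
    proof (cases "s = t")
      case False
      then have "centered_gaussian M (dW s t u) ?v"
        using assms wiener by (auto simp: two_sided_wiener_def dW_def[abs_def])
      then show ?thesis by (simp add: centered_gaussian_def True)
    qed (simp add: dW_def)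
    then have ae2: "AE \<omega> in M. (dW s t u \<omega>)\<^sup>2 = 0" by eventually_elim simp
    have "integrable M (\<lambda>\<omega>. (dW s t u \<omega>)\<^sup>2)"
      by (subst integrable_cong_AE[OF _ _ ae2]) auto
    moreover have "(\<integral>\<omega>. dW s t u \<omega> \<partial>M) = 0" using integral_cong_AE[OF _ _ ae] by simp
    moreover have "(\<integral>\<omega>. (dW s t u \<omega>)\<^sup>2 \<partial>M) = 0" using integral_cong_AE[OF _ _ ae2] by simp
    ultimately show ?thesis using True by simp
  next
    case False
    then have st: "s < t" using assms by auto
    have "0 < ?v" using False v0 by (rule le_neq_trans[OF _ not_sym, rotated])
    then have \<sigma>: "0 < sqrt ?v" by (rule real_sqrt_gt_zero)
    have D: "distributed M lborel (dW s t u) (normal_density 0 (sqrt ?v))"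
      using wiener st False unfolding two_sided_wiener_def centered_gaussian_def dW_def[abs_def] by simp
    have e: "(\<integral>\<omega>. dW s t u \<omega> \<partial>M) = 0" by (rule normal_distributed_expectation[OF \<sigma> D])
    have v: "(\<integral>\<omega>. (dW s t u \<omega>)\<^sup>2 \<partial>M) = ?v" using normal_distributed_variance[OF \<sigma> D] e v0 by simp
    have "integrable M (\<lambda>\<omega>. (dW s t u \<omega>)\<^sup>2)"
      using distributed_integrable[OF D, of "\<lambda>x. x\<^sup>2"] integrable_normal_moment[OF \<sigma>, of 0 2] by simp
    with e v show ?thesis by simp
  qed
  note conj = this
  show "(\<integral>\<omega>. dW s t u \<omega> \<partial>M) = 0" by (rule conj[THEN conjunct2, THEN conjunct1])
  show "(\<integral>\<omega>. (dW s t u \<omega>)\<^sup>2 \<partial>M) = ?v" by (rule conj[THEN conjunct2, THEN conjunct2])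
  show "integrable M (\<lambda>\<omega>. (dW s t u \<omega>)\<^sup>2)" by (rule conj[THEN conjunct1])
  then show "integrable M (dW s t u)" by (rule square_integrable_imp_integrable[OF dW_meas])
qed

lemma dW_indep:
  assumes "s < t" "X \<in> borel_measurable (F s)"
  shows "indep_var borel X borel (dW s t u)"
  unfolding indep_var_eq
proof (intro conjI)
  show X: "X \<in> borel_measurable M" by (rule measurable_F_M[OF assms(2)])
  have ind: "indep_set (sets (F s)) (sets (vimage_algebra (space M) (dW s t u) borel))"
    using wiener assms(1) unfolding two_sided_wiener_def dW_def[abs_def] by blast
  have "sigma_sets (space M) {X -` A \<inter> space M |A. A \<in> sets borel} \<subseteq> sets (F s)"
    unfolding F_space[of s, symmetric] by (rule sets.sigma_sets_subset) (use assms(2) in \<open>auto intro: measurable_sets\<close>)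
  then show "indep_set (sigma_sets (space M) {X -` A \<inter> space M |A. A \<in> sets borel})
     (sigma_sets (space M) {dW s t u -` A \<inter> space M |A. A \<in> sets borel})"
    using ind unfolding indep_set_def
    by (elim indep_sets_mono_sets) (auto split: bool.split simp: sets_vimage_algebra)
qed (rule dW_meas)

lemma dW_orth:
  assumes "s \<le> t" "X \<in> borel_measurable (F s)" "integrable M X"
  shows "integrable M (\<lambda>\<omega>. X \<omega> * dW s t u \<omega>)" "(\<integral>\<omega>. X \<omega> * dW s t u \<omega> \<partial>M) = 0"
proof -
  have "integrable M (\<lambda>\<omega>. X \<omega> * dW s t u \<omega>) \<and> (\<integral>\<omega>. X \<omega> * dW s t u \<omega> \<partial>M) = 0"
  proof (cases "s = t")
    case False
    with assms have "s < t" by simp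
    note I = dW_indep[OF this assms(2), of u]
    show ?thesis using indep_var_integrable[OF I assms(3) dW_gaussian(2)[OF assms(1)]]
        indep_var_lebesgue_integral[OF I assms(3) dW_gaussian(2)[OF assms(1)]] dW_gaussian(3)[OF assms(1)] by simp
  qed (simp add: dW_same)
  then show "integrable M (\<lambda>\<omega>. X \<omega> * dW s t u \<omega>)" "(\<integral>\<omega>. X \<omega> * dW s t u \<omega> \<partial>M) = 0" by auto
qed

lemma dW_square:
  assumes "s \<le> t" "X \<in> borel_measurable (F s)" "integrable M X"
  shows "integrable M (\<lambda>\<omega>. X \<omega> * (dW s t u \<omega>)\<^sup>2)"
    "(\<integral>\<omega>. X \<omega> * (dW s t u \<omega>)\<^sup>2 \<partial>M) = (\<integral>\<omega>. X \<omega> \<partial>M) * ((t - s) * inner (Q u) u)"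
proof -
  have "integrable M (\<lambda>\<omega>. X \<omega> * (dW s t u \<omega>)\<^sup>2) \<and>
    (\<integral>\<omega>. X \<omega> * (dW s t u \<omega>)\<^sup>2 \<partial>M) = (\<integral>\<omega>. X \<omega> \<partial>M) * ((t - s) * inner (Q u) u)"
  proof (cases "s = t")
    case False
    with assms have "s < t" by simp
    then have "indep_var borel (id \<circ> X) borel ((\<lambda>x. x\<^sup>2) \<circ> dW s t u)"
      by (intro indep_var_compose[OF dW_indep[OF _ assms(2)]]) auto
    then have I: "indep_var borel X borel (\<lambda>\<omega>. (dW s t u \<omega>)\<^sup>2)" by (simp add: comp_def)
    show ?thesis using indep_var_integrable[OF I assms(3) dW_gaussian(1)[OF assms(1)]]
        indep_var_lebesgue_integral[OF I assms(3) dW_gaussian(1)[OF assms(1)]] dW_gaussian(4)[OF assms(1)] by simp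
  qed (simp add: dW_same)
  then show "integrable M (\<lambda>\<omega>. X \<omega> * (dW s t u \<omega>)\<^sup>2)"
    "(\<integral>\<omega>. X \<omega> * (dW s t u \<omega>)\<^sup>2 \<partial>M) = (\<integral>\<omega>. X \<omega> \<partial>M) * ((t - s) * inner (Q u) u)" by auto
qed

lemma dW_add: "AE \<omega> in M. dW s t (u + v) \<omega> = dW s t u \<omega> + dW s t v \<omega>"
proof -
  have "AE \<omega> in M. W r (1 *\<^sub>R u + 1 *\<^sub>R v) \<omega> = 1 * W r u \<omega> + 1 * W r v \<omega>" for r
    using wiener unfolding two_sided_wiener_def by blast
  then have "AE \<omega> in M. W r (u + v) \<omega> = W r u \<omega> + W r v \<omega>" for r by simp
  from this[of s] this[of t] show ?thesis by eventually_elim (simp add: dW_def)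
qed

text \<open>Polarisation of \<open>dW_square\<close>. The increment is additive in its direction
  only almost surely, so the identity is inserted under the integral.\<close>

lemma dW_product:
  assumes "s \<le> t" "X \<in> borel_measurable (F s)" "integrable M X"
  shows "integrable M (\<lambda>\<omega>. X \<omega> * (dW s t u \<omega> * dW s t v \<omega>))"
    "(\<integral>\<omega>. X \<omega> * (dW s t u \<omega> * dW s t v \<omega>) \<partial>M) = (\<integral>\<omega>. X \<omega> \<partial>M) * ((t - s) * inner (Q u) v)"
proof -
  have [measurable]: "X \<in> borel_measurable M" by (rule measurable_F_M[OF assms(2)])
  let ?f = "\<lambda>\<omega>. (1/2) * (X \<omega> * (dW s t (u + v) \<omega>)\<^sup>2 - X \<omega> * (dW s t u \<omega>)\<^sup>2 - X \<omega> * (dW s t v \<omega>)\<^sup>2)"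
  have ae: "AE \<omega> in M. X \<omega> * (dW s t u \<omega> * dW s t v \<omega>) = ?f \<omega>"
    using dW_add[of s t u v] by eventually_elim (simp add: power2_sum algebra_simps)
  note d = dW_square[OF assms]
  have i: "integrable M ?f" using d(1) by simp
  show "integrable M (\<lambda>\<omega>. X \<omega> * (dW s t u \<omega> * dW s t v \<omega>))"
    by (subst integrable_cong_AE[OF _ _ ae]) (use i in auto)
  have "(\<integral>\<omega>. X \<omega> * (dW s t u \<omega> * dW s t v \<omega>) \<partial>M) = (\<integral>\<omega>. ?f \<omega> \<partial>M)"
    by (rule integral_cong_AE[OF _ _ ae]) auto
  also have "\<dots> = (1/2) * ((\<integral>\<omega>. X \<omega> \<partial>M) * ((t - s) * inner (Q (u+v)) (u+v)) - (\<integral>\<omega>. X \<omega> \<partial>M) * ((t - s) * inner (Q u) u)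
      - (\<integral>\<omega>. X \<omega> \<partial>M) * ((t - s) * inner (Q v) v))"
    using d by simp
  also have "\<dots> = (\<integral>\<omega>. X \<omega> \<partial>M) * ((t - s) * inner (Q u) v)"
  proof -
    have "inner (Q v) u = inner (Q u) v" using Q_pos by (metis inner_commute positive_op_def)
    then show ?thesis by (simp add: blinfun.add_right inner_add_left inner_add_right algebra_simps)
  qed
  finally show "(\<integral>\<omega>. X \<omega> * (dW s t u \<omega> * dW s t v \<omega>) \<partial>M) = (\<integral>\<omega>. X \<omega> \<partial>M) * ((t - s) * inner (Q u) v)" .
qed

lemma dW_prod_integrable:
  assumes "s \<le> t" "s' \<le> t'" "X \<in> borel_measurable M" "\<And>\<omega>. \<omega> \<in> space M \<Longrightarrow> \<bar>X \<omega>\<bar> \<le> C"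
  shows "integrable M (\<lambda>\<omega>. X \<omega> * (dW s t u \<omega> * dW s' t' v \<omega>))"
  by (intro bounded_mult_integrable[OF assms(3) square_prod_integrable assms(4)] dW_gaussian assms) auto

text \<open>The covariance of two terms of simple integrals: splitting at the end points of the intervals
  leaves only the common part, since increments are orthogonal to the past.\<close>

lemma simple_terms_covariance_ordered:
  assumes o: "\<alpha>1 \<le> \<beta>1" "\<alpha>2 \<le> \<beta>2" "\<alpha>1 \<le> \<alpha>2"
    and m: "\<psi>1 \<in> borel_measurable (F \<alpha>1)" "\<psi>2 \<in> borel_measurable (F \<alpha>2)"
    and b: "\<And>\<omega>. \<omega> \<in> space M \<Longrightarrow> \<bar>\<psi>1 \<omega>\<bar> \<le> C1" "\<And>\<omega>. \<omega> \<in> space M \<Longrightarrow> \<bar>\<psi>2 \<omega>\<bar> \<le> C2"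
  shows "(\<integral>\<omega>. (\<psi>1 \<omega> * dW \<alpha>1 \<beta>1 u1 \<omega>) * (\<psi>2 \<omega> * dW \<alpha>2 \<beta>2 u2 \<omega>) \<partial>M)
    = (\<integral>\<omega>. \<psi>1 \<omega> * \<psi>2 \<omega> \<partial>M) * (max 0 (min \<beta>1 \<beta>2 - max \<alpha>1 \<alpha>2) * inner (Q u1) u2)"
proof -
  define X where "X \<omega> = \<psi>1 \<omega> * \<psi>2 \<omega>" for \<omega>
  have [measurable]: "\<psi>1 \<in> borel_measurable (F \<alpha>2)" by (rule measurable_F_mono[OF m(1) o(3)])
  have [measurable]: "\<psi>2 \<in> borel_measurable (F \<alpha>2)" by (rule m)
  have X2: "X \<in> borel_measurable (F \<alpha>2)" unfolding X_def by measurable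
  have XM[measurable]: "X \<in> borel_measurable M" by (rule measurable_F_M[OF X2])
  have Xb: "\<bar>X \<omega>\<bar> \<le> C1 * C2" if "\<omega> \<in> space M" for \<omega>
    unfolding X_def abs_mult using b[OF that] by (intro mult_mono) auto
  have Xi: "integrable M X" by (rule integrable_const_bound[of _ "C1 * C2"]) (use Xb in auto)
  have Xd: "integrable M (\<lambda>\<omega>. X \<omega> * dW s t u \<omega>)" if "s \<le> t" for s t u
    by (intro bounded_mult_integrable[OF XM dW_gaussian(2)[OF that] Xb])
  show ?thesis
  proof (cases "\<beta>1 \<le> \<alpha>2")
    case True
    have m': "(\<lambda>\<omega>. X \<omega> * dW \<alpha>1 \<beta>1 u1 \<omega>) \<in> borel_measurable (F \<alpha>2)"
      using measurable_F_mono[OF dW_measF[OF o(1)] True, of u1] X2 by measurable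
    have "(\<integral>\<omega>. (X \<omega> * dW \<alpha>1 \<beta>1 u1 \<omega>) * dW \<alpha>2 \<beta>2 u2 \<omega> \<partial>M) = 0"
      by (rule dW_orth[OF o(2) m' Xd[OF o(1)]])
    moreover have "max 0 (min \<beta>1 \<beta>2 - max \<alpha>1 \<alpha>2) = 0" using True o by auto
    ultimately show ?thesis by (simp add: X_def algebra_simps)
  next
    case False
    define \<gamma> where "\<gamma> = min \<beta>1 \<beta>2"
    have g: "\<alpha>2 \<le> \<gamma>" "\<gamma> \<le> \<beta>1" "\<gamma> \<le> \<beta>2" using False o by (auto simp: \<gamma>_def)
    have Xg: "X \<in> borel_measurable (F \<gamma>)" by (rule measurable_F_mono[OF X2 g(1)])
    \<comment> \<open>\<open>\<gamma>\<close> is one of the two right end points, so one of these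
      increments runs over an empty interval.\<close>
    have z6: "dW \<gamma> \<beta>1 u1 \<omega> * dW \<gamma> \<beta>2 u2 \<omega> = 0" for \<omega>
      by (cases "\<beta>1 \<le> \<beta>2") (simp_all add: \<gamma>_def dW_def)
    have m1: "(\<lambda>\<omega>. X \<omega> * dW \<alpha>1 \<alpha>2 u1 \<omega>) \<in> borel_measurable (F \<alpha>2)"
      using dW_measF[OF o(3), of u1] X2 by measurable
    have m1g: "(\<lambda>\<omega>. X \<omega> * dW \<alpha>1 \<alpha>2 u1 \<omega>) \<in> borel_measurable (F \<gamma>)"
      by (rule measurable_F_mono[OF m1 g(1)])
    have mg: "(\<lambda>\<omega>. X \<omega> * dW \<alpha>2 \<gamma> u \<omega>) \<in> borel_measurable (F \<gamma>)" for u
      using dW_measF[OF g(1), of u] Xg by measurable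
    note I1 = dW_orth[OF g(1) m1 Xd[OF o(3)], of u2]
    note I2 = dW_orth[OF g(3) m1g Xd[OF o(3)], of u2]
    note I3 = dW_product[OF g(1) X2 Xi, of u1 u2]
    note I4 = dW_orth[OF g(3) mg Xd[OF g(1)], of u1 u2]
    note I5 = dW_orth[OF g(2) mg Xd[OF g(1)], of u2 u1]
    have "(\<psi>1 \<omega> * dW \<alpha>1 \<beta>1 u1 \<omega>) * (\<psi>2 \<omega> * dW \<alpha>2 \<beta>2 u2 \<omega>)
       = X \<omega> * dW \<alpha>1 \<alpha>2 u1 \<omega> * dW \<alpha>2 \<gamma> u2 \<omega> + X \<omega> * dW \<alpha>1 \<alpha>2 u1 \<omega> * dW \<gamma> \<beta>2 u2 \<omega>
       + X \<omega> * (dW \<alpha>2 \<gamma> u1 \<omega> * dW \<alpha>2 \<gamma> u2 \<omega>)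
       + X \<omega> * dW \<alpha>2 \<gamma> u1 \<omega> * dW \<gamma> \<beta>2 u2 \<omega> + X \<omega> * dW \<alpha>2 \<gamma> u2 \<omega> * dW \<gamma> \<beta>1 u1 \<omega>" for \<omega>
    proof -
      have "(\<psi>1 \<omega> * dW \<alpha>1 \<beta>1 u1 \<omega>) * (\<psi>2 \<omega> * dW \<alpha>2 \<beta>2 u2 \<omega>)
        = X \<omega> * ((dW \<alpha>1 \<alpha>2 u1 \<omega> + dW \<alpha>2 \<gamma> u1 \<omega> + dW \<gamma> \<beta>1 u1 \<omega>) * (dW \<alpha>2 \<gamma> u2 \<omega> + dW \<gamma> \<beta>2 u2 \<omega>))"
        by (simp add: X_def dW_def)
      then show ?thesis using z6[of \<omega>] by (simp add: algebra_simps)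
    qed
    then have "(\<integral>\<omega>. (\<psi>1 \<omega> * dW \<alpha>1 \<beta>1 u1 \<omega>) * (\<psi>2 \<omega> * dW \<alpha>2 \<beta>2 u2 \<omega>) \<partial>M)
       = (\<integral>\<omega>. X \<omega> \<partial>M) * ((\<gamma> - \<alpha>2) * inner (Q u1) u2)"
      using I1 I2 I3 I4 I5 by simp
    moreover have "max 0 (min \<beta>1 \<beta>2 - max \<alpha>1 \<alpha>2) = \<gamma> - \<alpha>2" using g o by (auto simp: \<gamma>_def)
    ultimately show ?thesis by (simp add: X_def)
  qed
qed

lemma simple_terms_covariance:
  assumes o: "\<alpha>1 \<le> \<beta>1" "\<alpha>2 \<le> \<beta>2"
    and m: "\<psi>1 \<in> borel_measurable (F \<alpha>1)" "\<psi>2 \<in> borel_measurable (F \<alpha>2)"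
    and b: "\<And>\<omega>. \<omega> \<in> space M \<Longrightarrow> \<bar>\<psi>1 \<omega>\<bar> \<le> C1" "\<And>\<omega>. \<omega> \<in> space M \<Longrightarrow> \<bar>\<psi>2 \<omega>\<bar> \<le> C2"
  shows "integrable M (\<lambda>\<omega>. (\<psi>1 \<omega> * dW \<alpha>1 \<beta>1 u1 \<omega>) * (\<psi>2 \<omega> * dW \<alpha>2 \<beta>2 u2 \<omega>))"
    "(\<integral>\<omega>. (\<psi>1 \<omega> * dW \<alpha>1 \<beta>1 u1 \<omega>) * (\<psi>2 \<omega> * dW \<alpha>2 \<beta>2 u2 \<omega>) \<partial>M)
    = (\<integral>\<omega>. \<psi>1 \<omega> * \<psi>2 \<omega> \<partial>M) * (max 0 (min \<beta>1 \<beta>2 - max \<alpha>1 \<alpha>2) * inner (Q u1) u2)"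
proof -
  have [measurable]: "\<psi>1 \<in> borel_measurable M" "\<psi>2 \<in> borel_measurable M" using m measurable_F_M by blast+
  have Xb: "\<bar>\<psi>1 \<omega> * \<psi>2 \<omega>\<bar> \<le> C1 * C2" if "\<omega> \<in> space M" for \<omega>
    unfolding abs_mult using b[OF that] by (intro mult_mono) auto
  show "integrable M (\<lambda>\<omega>. (\<psi>1 \<omega> * dW \<alpha>1 \<beta>1 u1 \<omega>) * (\<psi>2 \<omega> * dW \<alpha>2 \<beta>2 u2 \<omega>))"
    using dW_prod_integrable[OF o, where X = "\<lambda>\<omega>. \<psi>1 \<omega> * \<psi>2 \<omega>" and C = "C1 * C2" and u = u1 and v = u2] Xb
    by (simp add: algebra_simps)
  show "(\<integral>\<omega>. (\<psi>1 \<omega> * dW \<alpha>1 \<beta>1 u1 \<omega>) * (\<psi>2 \<omega> * dW \<alpha>2 \<beta>2 u2 \<omega>) \<partial>M)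
    = (\<integral>\<omega>. \<psi>1 \<omega> * \<psi>2 \<omega> \<partial>M) * (max 0 (min \<beta>1 \<beta>2 - max \<alpha>1 \<alpha>2) * inner (Q u1) u2)"
  proof (cases "\<alpha>1 \<le> \<alpha>2")
    case True then show ?thesis by (rule simple_terms_covariance_ordered[OF o _ m b])
  next
    case False
    then have "\<alpha>2 \<le> \<alpha>1" by simp
    have "(\<integral>\<omega>. (\<psi>2 \<omega> * dW \<alpha>2 \<beta>2 u2 \<omega>) * (\<psi>1 \<omega> * dW \<alpha>1 \<beta>1 u1 \<omega>) \<partial>M)
      = (\<integral>\<omega>. \<psi>2 \<omega> * \<psi>1 \<omega> \<partial>M) * (max 0 (min \<beta>2 \<beta>1 - max \<alpha>2 \<alpha>1) * inner (Q u2) u1)"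
      by (rule simple_terms_covariance_ordered[OF o(2,1) \<open>\<alpha>2 \<le> \<alpha>1\<close> m(2,1) b(2,1)])
    moreover have "inner (Q u2) u1 = inner (Q u1) u2" using Q_pos by (metis inner_commute positive_op_def)
    ultimately show ?thesis by (simp add: mult.commute min.commute max.commute)
  qed
qed


section \<open>Simple integrands and the Ito isometry for them\<close>

abbreviation st_l :: "(real \<times> real \<times> ('w \<Rightarrow> real) \<times> 'u \<times> 'h) \<Rightarrow> real" where "st_l p \<equiv> fst p"
abbreviation st_r :: "(real \<times> real \<times> ('w \<Rightarrow> real) \<times> 'u \<times> 'h) \<Rightarrow> real" where "st_r p \<equiv> fst (snd p)"
abbreviation st_psi :: "(real \<times> real \<times> ('w \<Rightarrow> real) \<times> 'u \<times> 'h) \<Rightarrow> 'w \<Rightarrow> real" where "st_psi p \<equiv> fst (snd (snd p))"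
abbreviation st_u :: "(real \<times> real \<times> ('w \<Rightarrow> real) \<times> 'u \<times> 'h) \<Rightarrow> 'u" where "st_u p \<equiv> fst (snd (snd (snd p)))"
abbreviation st_x :: "(real \<times> real \<times> ('w \<Rightarrow> real) \<times> 'u \<times> 'h) \<Rightarrow> 'h" where "st_x p \<equiv> snd (snd (snd (snd p)))"

lemma simple_integral_nth:
  "simple_integral W E \<omega> =
     (\<Sum>i<length E. (st_psi (E!i) \<omega> * dW (st_l (E!i)) (st_r (E!i)) (st_u (E!i)) \<omega>) *\<^sub>R st_x (E!i))"
  unfolding simple_integral_def by (simp add: sum_list_sum_nth case_prod_unfold dW_def atLeast0LessThan)

lemma simple_process_nth:
  "simple_process E s \<omega> v =
     (\<Sum>i<length E. ((indicator {st_l (E!i)<..st_r (E!i)} s * st_psi (E!i) \<omega>) * inner (st_u (E!i)) v) *\<^sub>R st_x (E!i))"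
  unfolding simple_process_def by (simp add: sum_list_sum_nth case_prod_unfold atLeast0LessThan)

lemma simple_integrand_nth:
  assumes "simple_integrand M F a b E" "i < length E"
  shows "a \<le> st_l (E!i)" "st_l (E!i) \<le> st_r (E!i)" "st_r (E!i) \<le> b"
    "st_psi (E!i) \<in> borel_measurable (F (st_l (E!i)))"
    "\<exists>K. \<forall>\<omega>\<in>space M. \<bar>st_psi (E!i) \<omega>\<bar> \<le> K"
  using assms nth_mem[OF assms(2)] by (auto simp: simple_integrand_def case_prod_unfold)

lemma simple_process_L20: "simple_process E s \<omega> \<in> L20 Q"
proof -
  have "simple_process E s \<omega> = finite_rank_op (map (\<lambda>(\<alpha>, \<beta>, \<psi>, u, x). (u, (indicator {\<alpha><..\<beta>} s * \<psi> \<omega>) *\<^sub>R x)) E)"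
    by (rule ext) (simp add: simple_process_def finite_rank_op_def comp_def case_prod_unfold mult.commute)
  then show ?thesis using finite_rank_op_L20 by metis
qed

lemma simple_integral_append: "simple_integral W (E @ E') \<omega> = simple_integral W E \<omega> + simple_integral W E' \<omega>"
  by (simp add: simple_integral_def)

lemma simple_process_append: "simple_process (E @ E') s \<omega> v = simple_process E s \<omega> v + simple_process E' s \<omega> v"
  by (simp add: simple_process_def)

lemma simple_integrand_append:
  "simple_integrand M F a b (E @ E') \<longleftrightarrow> simple_integrand M F a b E \<and> simple_integrand M F a b E'"
  by (simp add: simple_integrand_def ball_Un)

text \<open>Applied to \<open>uminus\<close>, and combined with list append, this writes a
  difference of simple integrands as a single one.\<close>

definition simple_map :: "('h \<Rightarrow> 'k) \<Rightarrow> ('w, 'u, 'h) simple \<Rightarrow> ('w, 'u, 'k) simple" where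
  "simple_map G = map (\<lambda>(\<alpha>, \<beta>, \<psi>, u, x). (\<alpha>, \<beta>, \<psi>, u, G x))"

lemma simple_integrand_map: "simple_integrand M F a b (simple_map G E) \<longleftrightarrow> simple_integrand M F a b E"
  by (auto simp: simple_integrand_def simple_map_def case_prod_unfold)

lemma simple_process_map:
  assumes "linear G" shows "simple_process (simple_map G E) s \<omega> v = G (simple_process E s \<omega> v)"
proof -
  interpret linear G by fact
  show ?thesis by (induction E) (auto simp: simple_process_def simple_map_def zero add scaleR)
qed

lemma simple_integral_map:
  assumes "linear G" shows "simple_integral W (simple_map G E) \<omega> = G (simple_integral W E \<omega>)"
proof -
  interpret linear G by fact
  show ?thesis by (induction E) (auto simp: simple_integral_def simple_map_def zero add scaleR)
qed

lemma simple_integrand_mono: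
  "simple_integrand M F a b E \<Longrightarrow> a' \<le> a \<Longrightarrow> b \<le> b' \<Longrightarrow> simple_integrand M F a' b' E"
  by (fastforce simp: simple_integrand_def)

lemma simple_process_outside:
  fixes E :: "('w, 'u, 'h::real_vector) simple"
  assumes "simple_integrand M F a b E" "s \<notin> {a<..b}"
  shows "simple_process E s \<omega> v = 0"
  unfolding simple_process_nth
proof (rule sum.neutral, rule ballI)
  fix i assume "i \<in> {..<length E}"
  then have "s \<notin> {st_l (E!i)<..st_r (E!i)}" using simple_integrand_nth[OF assms(1), of i] assms(2) by auto
  then show "((indicator {st_l (E!i)<..st_r (E!i)} s * st_psi (E!i) \<omega>) * inner (st_u (E!i)) v) *\<^sub>R st_x (E!i) = 0" by simp
qed

definition interval :: "real \<Rightarrow> real \<Rightarrow> real measure" where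
  "interval a b = restrict_space lborel {a<..b}"

lemma interval_space: "space (interval a b) = {a<..b}" by (simp add: interval_def space_restrict_space)

lemma interval_finite: "finite_measure (interval a b)"
  by (rule finite_measureI, cases "a \<le> b") (simp_all add: interval_def emeasure_restrict_space space_restrict_space)

lemma interval_pair: "pair_sigma_finite (interval a b) M"
  using interval_finite finite_measure_axioms
  by (intro pair_sigma_finite.intro finite_measure.axioms(1)) auto

lemma interval_pair_finite: "finite_measure (interval a b \<Otimes>\<^sub>M M)"
  by (intro finite_measure_pair_measure interval_finite finite_measure_axioms)

lemma interval_measurable: "f \<in> borel_measurable borel \<Longrightarrow> f \<in> borel_measurable (interval a b)"
  unfolding interval_def by (intro measurable_restrict_space1) simp

lemma st_measurable_pair:
  assumes "simple_integrand M F a b E" "i < length E"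
  shows "(\<lambda>p. indicator {st_l (E!i)<..st_r (E!i)} (fst p) * st_psi (E!i) (snd p) :: real) \<in> borel_measurable (interval a b \<Otimes>\<^sub>M M)"
proof -
  have [measurable]: "st_psi (E!i) \<in> borel_measurable M"
    by (rule measurable_F_M[OF simple_integrand_nth(4)[OF assms]])
  have [measurable]: "(\<lambda>s. indicator {st_l (E!i)<..st_r (E!i)} s :: real) \<in> borel_measurable (interval a b)"
    by (rule interval_measurable) measurable
  show ?thesis by measurable
qed

lemma simple_process_measurable:
  fixes E :: "('w, 'u, 'h::{real_normed_vector, second_countable_topology}) simple"
  assumes "simple_integrand M F a b E"
  shows "(\<lambda>(s, \<omega>). simple_process E s \<omega> v) \<in> borel_measurable (interval a b \<Otimes>\<^sub>M M)"
  unfolding simple_process_nth case_prod_unfold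
  by (intro borel_measurable_sum borel_measurable_scaleR borel_measurable_times st_measurable_pair[OF assms]) auto

lemma simple_integral_measurable:
  fixes E :: "('w, 'u, 'h::{real_normed_vector, second_countable_topology}) simple"
  assumes "simple_integrand M F a b E"
  shows "simple_integral W E \<in> borel_measurable M"
  unfolding simple_integral_nth[abs_def]
  using measurable_F_M[OF simple_integrand_nth(4)[OF assms]]
  by (intro borel_measurable_sum borel_measurable_scaleR borel_measurable_times) auto

text \<open>The time integral that matches the overlap length in
  \<open>simple_terms_covariance\<close>.\<close>

lemma overlap_integral:
  assumes "a \<le> l" "r \<le> b" "l \<le> r" "a \<le> l'" "r' \<le> b" "l' \<le> r'"
  shows "(\<integral>s. (indicator {l<..r} s * indicator {l'<..r'} s :: real) \<partial>interval a b) = max 0 (min r r' - max l l')"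
proof -
  have "(\<integral>s. (indicator {l<..r} s * indicator {l'<..r'} s :: real) \<partial>interval a b)
      = (\<integral>s. indicator {a<..b} s *\<^sub>R (indicator {l<..r} s * indicator {l'<..r'} s) \<partial>lborel)"
    unfolding interval_def by (rule integral_restrict_space) simp
  also have "(\<lambda>s. indicator {a<..b} s *\<^sub>R (indicator {l<..r} s * indicator {l'<..r'} s))
      = (indicator {max l l'<..min r r'} :: real \<Rightarrow> real)"
    using assms by (auto simp: fun_eq_iff indicator_def)
  also have "(\<integral>s. indicator {max l l'<..min r r'} s \<partial>lborel) = measure lborel {max l l'<..min r r'}" by simp
  also have "\<dots> = max 0 (min r r' - max l l')"
    by (cases "max l l' \<le> min r r'") auto
  finally show ?thesis .
qed

text \<open>Both sides expand into a double sum over pairs of terms. For each pair both give the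
  product of the mean of the two coefficients, the length of the overlap of the intervals, and the
  inner products taken with \<open>Q\<close> and between the vectors.\<close>

lemma Ito_isometry_simple:
  fixes E :: "('w, 'u, 'h::{real_inner, second_countable_topology}) simple"
  assumes E: "simple_integrand M F a b E"
  shows "(\<integral>\<^sup>+ p. ennreal ((L20_norm Q (simple_process E (fst p) (snd p)))\<^sup>2) \<partial>(interval a b \<Otimes>\<^sub>M M))
      = (\<integral>\<^sup>+ \<omega>. ennreal ((norm (simple_integral W E \<omega>))\<^sup>2) \<partial>M)"
    and "square_integrable M (simple_integral W E)"
proof -
  let ?n = "length E"
  define q where "q i j = inner (Q (st_u (E!i))) (st_u (E!j)) * inner (st_x (E!i)) (st_x (E!j))" for i j
  define k where "k i p = (indicator {st_l (E!i)<..st_r (E!i)} (fst p) * st_psi (E!i) (snd p) :: real)" for i and p :: "real \<times> 'w"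
  define I where "I i \<omega> = st_psi (E!i) \<omega> * dW (st_l (E!i)) (st_r (E!i)) (st_u (E!i)) \<omega>" for i \<omega>
  note En = simple_integrand_nth[OF E]
  have km[measurable]: "k i \<in> borel_measurable (interval a b \<Otimes>\<^sub>M M)" if "i < ?n" for i
    unfolding k_def[abs_def] by (rule st_measurable_pair[OF E that])
  obtain C where C: "\<And>i \<omega>. i < ?n \<Longrightarrow> \<omega> \<in> space M \<Longrightarrow> \<bar>st_psi (E!i) \<omega>\<bar> \<le> C i" using En(5) by metis
  have C0: "0 \<le> C i" if "i < ?n" for i using C[OF that] not_empty by (meson abs_ge_zero all_not_in_conv order_trans)
  have kb: "\<bar>k i p\<bar> \<le> C i" if "i < ?n" "p \<in> space (interval a b \<Otimes>\<^sub>M M)" for i p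
    using C[OF that(1), of "snd p"] C0[OF that(1)] that(2)
    by (auto simp: k_def space_pair_measure indicator_def abs_mult)
  have kk: "integrable (interval a b \<Otimes>\<^sub>M M) (\<lambda>p. k i p * k j p)" if "i < ?n" "j < ?n" for i j
  proof (rule finite_measure.integrable_const_bound[OF interval_pair_finite])
    show "AE p in interval a b \<Otimes>\<^sub>M M. norm (k i p * k j p) \<le> C i * C j"
      using kb that by (intro AE_I2) (auto simp: abs_mult intro!: mult_mono C0)
  qed (use that in measurable)
  have norm_eq: "(L20_norm Q (simple_process E (fst p) (snd p)))\<^sup>2 = (\<Sum>i<?n. \<Sum>j<?n. (k i p * k j p) * q i j)" for p
    unfolding L20_norm_power2 simple_process_nth
    using infsumI[OF bilinear_sum_L20[where n = ?n and r="\<lambda>i. k i p" and u = "\<lambda>i. st_u (E!i)" and x = "\<lambda>i. st_x (E!i)"]]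
    by (simp add: k_def q_def mult.assoc)
  have cov: "integrable M (\<lambda>\<omega>. I i \<omega> * I j \<omega>)"
    "(\<integral>\<omega>. I i \<omega> * I j \<omega> \<partial>M) = (\<integral>\<omega>. st_psi (E!i) \<omega> * st_psi (E!j) \<omega> \<partial>M) *
      (max 0 (min (st_r (E!i)) (st_r (E!j)) - max (st_l (E!i)) (st_l (E!j))) * inner (Q (st_u (E!i))) (st_u (E!j)))"
    if "i < ?n" "j < ?n" for i j
    unfolding I_def
    using simple_terms_covariance[OF En(2)[OF that(1)] En(2)[OF that(2)] En(4)[OF that(1)] En(4)[OF that(2)] C[OF that(1)] C[OF that(2)]]
    by auto
  have kint: "(\<integral>p. k i p * k j p \<partial>(interval a b \<Otimes>\<^sub>M M)) = (\<integral>\<omega>. st_psi (E!i) \<omega> * st_psi (E!j) \<omega> \<partial>M) *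
      max 0 (min (st_r (E!i)) (st_r (E!j)) - max (st_l (E!i)) (st_l (E!j)))" if ij: "i < ?n" "j < ?n" for i j
  proof -
    interpret P: pair_sigma_finite "interval a b" M by (rule interval_pair)
    have "(\<integral>p. k i p * k j p \<partial>(interval a b \<Otimes>\<^sub>M M)) = (\<integral>s. (\<integral>\<omega>. k i (s, \<omega>) * k j (s, \<omega>) \<partial>M) \<partial>interval a b)"
      by (rule P.integral_fst'[symmetric, OF kk[OF ij]])
    also have "\<dots> = (\<integral>s. (indicator {st_l (E!i)<..st_r (E!i)} s * indicator {st_l (E!j)<..st_r (E!j)} s) *
        (\<integral>\<omega>. st_psi (E!i) \<omega> * st_psi (E!j) \<omega> \<partial>M) \<partial>interval a b)"
      by (intro Bochner_Integration.integral_cong refl)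
         (simp add: k_def mult.assoc mult.left_commute[of "st_psi _ _"] flip: integral_mult_right_zero)
    also have "\<dots> = max 0 (min (st_r (E!i)) (st_r (E!j)) - max (st_l (E!i)) (st_l (E!j))) *
        (\<integral>\<omega>. st_psi (E!i) \<omega> * st_psi (E!j) \<omega> \<partial>M)"
      using overlap_integral[OF En(1)[OF ij(1)] En(3)[OF ij(1)] En(2)[OF ij(1)] En(1)[OF ij(2)] En(3)[OF ij(2)] En(2)[OF ij(2)]]
      by simp
    finally show ?thesis by simp
  qed
  have sq_eq: "(norm (simple_integral W E \<omega>))\<^sup>2 = (\<Sum>i<?n. \<Sum>j<?n. (I i \<omega> * I j \<omega>) * inner (st_x (E!i)) (st_x (E!j)))" for \<omega>
    unfolding power2_norm_eq_inner simple_integral_nth inner_sum_left inner_sum_right I_def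
    by (intro sum.cong refl) (simp add: inner_commute)
  have si: "integrable M (\<lambda>\<omega>. (norm (simple_integral W E \<omega>))\<^sup>2)"
    unfolding sq_eq by (intro Bochner_Integration.integrable_sum integrable_mult_left cov(1)) auto
  then show "square_integrable M (simple_integral W E)"
    using simple_integral_measurable[OF E] by (simp add: square_integrable_def)
  have ni: "integrable (interval a b \<Otimes>\<^sub>M M) (\<lambda>p. (L20_norm Q (simple_process E (fst p) (snd p)))\<^sup>2)"
    unfolding norm_eq by (intro Bochner_Integration.integrable_sum integrable_mult_left kk) auto
  have "(\<integral>p. (L20_norm Q (simple_process E (fst p) (snd p)))\<^sup>2 \<partial>(interval a b \<Otimes>\<^sub>M M))
     = (\<Sum>i<?n. \<Sum>j<?n. (\<integral>p. k i p * k j p \<partial>(interval a b \<Otimes>\<^sub>M M)) * q i j)"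
    unfolding norm_eq by (rule integral_double_sum) (rule kk)
  also have "\<dots> = (\<Sum>i<?n. \<Sum>j<?n. (\<integral>\<omega>. I i \<omega> * I j \<omega> \<partial>M) * inner (st_x (E!i)) (st_x (E!j)))"
    by (intro sum.cong refl) (simp add: kint cov q_def algebra_simps)
  also have "\<dots> = (\<integral>\<omega>. (norm (simple_integral W E \<omega>))\<^sup>2 \<partial>M)"
    unfolding sq_eq by (rule integral_double_sum[symmetric]) (rule cov(1))
  finally show "(\<integral>\<^sup>+ p. ennreal ((L20_norm Q (simple_process E (fst p) (snd p)))\<^sup>2) \<partial>(interval a b \<Otimes>\<^sub>M M))
      = (\<integral>\<^sup>+ \<omega>. ennreal ((norm (simple_integral W E \<omega>))\<^sup>2) \<partial>M)"
    using nn_integral_eq_integral[OF ni] nn_integral_eq_integral[OF si] by simp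
qed


section \<open>Integrals as limits of simple integrals\<close>

lemma infsum_measurable_countable:
  fixes f :: "'b \<Rightarrow> 'a \<Rightarrow> real"
  assumes A: "countable A" and f: "\<And>b. b \<in> A \<Longrightarrow> f b \<in> borel_measurable N"
    and s: "\<And>x. x \<in> space N \<Longrightarrow> (\<lambda>b. f b x) summable_on A"
  shows "(\<lambda>x. infsum (\<lambda>b. f b x) A) \<in> borel_measurable N"
proof (cases "finite A")
  case True
  then show ?thesis using f by simp
next
  case False
  have bij: "bij_betw (from_nat_into A) UNIV A" by (rule bij_betw_from_nat_into[OF A False])
  have "infsum (\<lambda>b. f b x) A = (\<Sum>k. f (from_nat_into A k) x)" if "x \<in> space N" for x
  proof -
    have "((\<lambda>k. f (from_nat_into A k) x) has_sum infsum (\<lambda>b. f b x) A) UNIV"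
      using has_sum_reindex_bij_betw[OF bij, of "\<lambda>b. f b x"] has_sum_infsum[OF s[OF that]] by simp
    then show ?thesis by (metis has_sum_imp_sums sums_unique)
  qed
  moreover have "(\<lambda>x. \<Sum>k. f (from_nat_into A k) x) \<in> borel_measurable N"
    using f from_nat_into[of A] False by (intro borel_measurable_suminf) auto
  ultimately show ?thesis by (subst measurable_cong) auto
qed

lemma L20_norm_measurable:
  fixes T :: "'a \<Rightarrow> 'u \<Rightarrow> 'h::{real_normed_vector, second_countable_topology}"
  assumes "\<And>x. x \<in> space N \<Longrightarrow> T x \<in> L20 Q" and "\<And>b. b \<in> B \<Longrightarrow> (\<lambda>x. T x b) \<in> borel_measurable N"
  shows "(\<lambda>x. L20_norm Q (T x)) \<in> borel_measurable N"
proof -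
  have [measurable]: "(\<lambda>x. infsum (\<lambda>b. (norm (T x b))\<^sup>2) B) \<in> borel_measurable N"
    by (intro infsum_measurable_countable[OF B_countable] L20_summable assms
      borel_measurable_power measurable_compose[OF assms(2) borel_measurable_norm])
  show ?thesis unfolding L20_norm_eq by measurable
qed

lemma square_int_le: "square_integrable M X \<Longrightarrow> (\<integral>\<^sup>+x. ennreal ((norm (X x))\<^sup>2) \<partial>M) < \<infinity>"
  by (simp add: square_integrable_nn)

lemma has_ito_integralD:
  fixes Z :: "'w \<Rightarrow> 'h::{real_inner, second_countable_topology}"
  assumes "has_ito_integral M F Q W a b \<Phi> Z"
  obtains E where "\<And>m. simple_integrand M F a b (E m)"
    "\<And>m. (\<lambda>p. L20_dist Q (\<Phi> (fst p) (snd p)) (simple_process (E m) (fst p) (snd p))) \<in> borel_measurable (interval a b \<Otimes>\<^sub>M M)"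
    "(\<lambda>m. \<integral>\<^sup>+p. ennreal ((L20_dist Q (\<Phi> (fst p) (snd p)) (simple_process (E m) (fst p) (snd p)))\<^sup>2) \<partial>(interval a b \<Otimes>\<^sub>M M)) \<longlonglongrightarrow> 0"
    "(\<lambda>m. \<integral>\<^sup>+\<omega>. ennreal ((norm (Z \<omega> - simple_integral W (E m) \<omega>))\<^sup>2) \<partial>M) \<longlonglongrightarrow> 0"
    "Z \<in> borel_measurable M" "\<And>s \<omega>. s \<in> {a<..b} \<Longrightarrow> \<omega> \<in> space M \<Longrightarrow> \<Phi> s \<omega> \<in> L20 Q"
  using assms unfolding has_ito_integral_def interval_def[symmetric] case_prod_unfold by blast

lemma has_ito_integralI:
  fixes Z :: "'w \<Rightarrow> 'h::{real_inner, second_countable_topology}"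
  assumes "\<And>m. simple_integrand M F a b (E m)"
    "\<And>m. (\<lambda>p. L20_dist Q (\<Phi> (fst p) (snd p)) (simple_process (E m) (fst p) (snd p))) \<in> borel_measurable (interval a b \<Otimes>\<^sub>M M)"
    "(\<lambda>m. \<integral>\<^sup>+p. ennreal ((L20_dist Q (\<Phi> (fst p) (snd p)) (simple_process (E m) (fst p) (snd p)))\<^sup>2) \<partial>(interval a b \<Otimes>\<^sub>M M)) \<longlonglongrightarrow> 0"
    "(\<lambda>m. \<integral>\<^sup>+\<omega>. ennreal ((norm (Z \<omega> - simple_integral W (E m) \<omega>))\<^sup>2) \<partial>M) \<longlonglongrightarrow> 0"
    "Z \<in> borel_measurable M" "\<And>s \<omega>. s \<in> {a<..b} \<Longrightarrow> \<omega> \<in> space M \<Longrightarrow> \<Phi> s \<omega> \<in> L20 Q"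
  shows "has_ito_integral M F Q W a b \<Phi> Z"
  unfolding has_ito_integral_def interval_def[symmetric] case_prod_unfold using assms by blast

lemma has_ito_simple:
  fixes E :: "('w, 'u, 'h::{real_inner, second_countable_topology}) simple"
  assumes "simple_integrand M F a b E"
  shows "has_ito_integral M F Q W a b (simple_process E) (simple_integral W E)"
  by (rule has_ito_integralI[where E = "\<lambda>_. E"])
     (use assms in \<open>auto simp: L20_norm_zero simple_process_L20 simple_integral_measurable\<close>)

text \<open>\<open>E1\<close> followed by the negative of \<open>E2\<close> is again a simple
  integrand, so the isometry applies to it.\<close>

lemma Ito_diff_simple:
  fixes E1 E2 :: "('w, 'u, 'h::{real_inner, second_countable_topology}) simple"
  assumes E: "simple_integrand M F a b E1" "simple_integrand M F a b E2"
  shows "(\<integral>\<^sup>+ \<omega>. ennreal ((norm (simple_integral W E1 \<omega> - simple_integral W E2 \<omega>))\<^sup>2) \<partial>M)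
     = (\<integral>\<^sup>+ p. ennreal ((L20_dist Q (simple_process E1 (fst p) (snd p)) (simple_process E2 (fst p) (snd p)))\<^sup>2) \<partial>(interval a b \<Otimes>\<^sub>M M))"
proof -
  have l: "linear (uminus :: 'h \<Rightarrow> 'h)" by (simp add: module_hom_uminus linear_iff)
  have "simple_integrand M F a b (E1 @ simple_map uminus E2)"
    using E by (simp add: simple_integrand_append simple_integrand_map)
  from Ito_isometry_simple(1)[OF this] show ?thesis
    by (simp add: simple_integral_append simple_integral_map[OF l] simple_process_append[abs_def] simple_process_map[OF l])
qed

text \<open>Only an upper bound of the distance of the integrands is assumed, since nothing is
  required of the integrands themselves as far as measurability is concerned.\<close>

lemma Ito_diff_le:
  fixes Z1 Z2 :: "'w \<Rightarrow> 'h::{real_inner, second_countable_topology}"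
  assumes 1: "has_ito_integral M F Q W a b \<Phi>1 Z1" and 2: "has_ito_integral M F Q W a b \<Phi>2 Z2"
    and G[measurable]: "G \<in> borel_measurable (interval a b \<Otimes>\<^sub>M M)"
    and le: "\<And>s \<omega>. s \<in> {a<..b} \<Longrightarrow> \<omega> \<in> space M \<Longrightarrow> ennreal ((L20_dist Q (\<Phi>1 s \<omega>) (\<Phi>2 s \<omega>))\<^sup>2) \<le> G (s, \<omega>)"
  shows "(\<integral>\<^sup>+\<omega>. ennreal ((norm (Z1 \<omega> - Z2 \<omega>))\<^sup>2) \<partial>M) \<le> (\<integral>\<^sup>+p. G p \<partial>(interval a b \<Otimes>\<^sub>M M))"
proof -
  let ?P = "interval a b \<Otimes>\<^sub>M M"
  let ?g = "\<integral>\<^sup>+p. G p \<partial>?P" and ?z = "\<integral>\<^sup>+\<omega>. ennreal ((norm (Z1 \<omega> - Z2 \<omega>))\<^sup>2) \<partial>M"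
  obtain E1 where E1: "\<And>m. simple_integrand M F a b (E1 m)"
    "\<And>m. (\<lambda>p. L20_dist Q (\<Phi>1 (fst p) (snd p)) (simple_process (E1 m) (fst p) (snd p))) \<in> borel_measurable ?P"
    "(\<lambda>m. \<integral>\<^sup>+p. ennreal ((L20_dist Q (\<Phi>1 (fst p) (snd p)) (simple_process (E1 m) (fst p) (snd p)))\<^sup>2) \<partial>?P) \<longlonglongrightarrow> 0"
    "(\<lambda>m. \<integral>\<^sup>+\<omega>. ennreal ((norm (Z1 \<omega> - simple_integral W (E1 m) \<omega>))\<^sup>2) \<partial>M) \<longlonglongrightarrow> 0"
    "Z1 \<in> borel_measurable M" "\<And>s \<omega>. s \<in> {a<..b} \<Longrightarrow> \<omega> \<in> space M \<Longrightarrow> \<Phi>1 s \<omega> \<in> L20 Q"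
    by (rule has_ito_integralD[OF 1]) blast
  obtain E2 where E2: "\<And>m. simple_integrand M F a b (E2 m)"
    "\<And>m. (\<lambda>p. L20_dist Q (\<Phi>2 (fst p) (snd p)) (simple_process (E2 m) (fst p) (snd p))) \<in> borel_measurable ?P"
    "(\<lambda>m. \<integral>\<^sup>+p. ennreal ((L20_dist Q (\<Phi>2 (fst p) (snd p)) (simple_process (E2 m) (fst p) (snd p)))\<^sup>2) \<partial>?P) \<longlonglongrightarrow> 0"
    "(\<lambda>m. \<integral>\<^sup>+\<omega>. ennreal ((norm (Z2 \<omega> - simple_integral W (E2 m) \<omega>))\<^sup>2) \<partial>M) \<longlonglongrightarrow> 0"
    "Z2 \<in> borel_measurable M" "\<And>s \<omega>. s \<in> {a<..b} \<Longrightarrow> \<omega> \<in> space M \<Longrightarrow> \<Phi>2 s \<omega> \<in> L20 Q"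
    by (rule has_ito_integralD[OF 2]) blast
  note [measurable] = E1(2,5) E2(2,5) simple_integral_measurable[OF E1(1)] simple_integral_measurable[OF E2(1)]
  \<comment> \<open>The weighted triangle inequality is used once for the integrals and once for the
    integrands. Each use costs a factor \<open>1 + \<epsilon>\<close>, while the approximation
    errors, which carry the large factor \<open>c\<close>, vanish as \<open>m\<close> grows.\<close>
  have eps: "?z \<le> ennreal (1 + \<epsilon>) * (ennreal (1 + \<epsilon>) * ?g)" if \<epsilon>: "0 < \<epsilon>" for \<epsilon>
  proof -
    define c where "c = 2 * (1 + 1 / \<epsilon>)"
    have c: "0 \<le> c" using \<epsilon> by (simp add: c_def)
    define d1 d2 where "d1 m = (\<integral>\<^sup>+p. ennreal ((L20_dist Q (\<Phi>1 (fst p) (snd p)) (simple_process (E1 m) (fst p) (snd p)))\<^sup>2) \<partial>?P)"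
      and "d2 m = (\<integral>\<^sup>+p. ennreal ((L20_dist Q (\<Phi>2 (fst p) (snd p)) (simple_process (E2 m) (fst p) (snd p)))\<^sup>2) \<partial>?P)" for m
    define r1 r2 where "r1 m = (\<integral>\<^sup>+\<omega>. ennreal ((norm (Z1 \<omega> - simple_integral W (E1 m) \<omega>))\<^sup>2) \<partial>M)"
      and "r2 m = (\<integral>\<^sup>+\<omega>. ennreal ((norm (Z2 \<omega> - simple_integral W (E2 m) \<omega>))\<^sup>2) \<partial>M)" for m
    have wt: "(x + (y1 + y2))\<^sup>2 \<le> (1 + \<epsilon>) * x\<^sup>2 + c * (y1\<^sup>2 + y2\<^sup>2)" if "0 \<le> x" "0 \<le> y1" "0 \<le> y2" for x y1 y2 :: real
    proof -
      have "(x + (y1 + y2))\<^sup>2 \<le> (1 + \<epsilon>) * x\<^sup>2 + (1 + 1 / \<epsilon>) * (y1 + y2)\<^sup>2"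
        by (rule power2_real_sum_le[OF \<epsilon>]) (use that in auto)
      also have "(1 + 1 / \<epsilon>) * (y1 + y2)\<^sup>2 \<le> (1 + 1 / \<epsilon>) * (2 * (y1\<^sup>2 + y2\<^sup>2))"
        using \<epsilon> sum_squares_bound[of y1 y2] by (intro mult_left_mono) (auto simp: power2_sum)
      finally show ?thesis by (simp add: c_def algebra_simps)
    qed
    have wte: "ennreal t \<le> ennreal (1 + \<epsilon>) * ennreal (x\<^sup>2) + ennreal c * (ennreal (y1\<^sup>2) + ennreal (y2\<^sup>2))"
      if "t \<le> (x + (y1 + y2))\<^sup>2" "0 \<le> x" "0 \<le> y1" "0 \<le> y2" for t x y1 y2 :: real
    proof -
      have "ennreal t \<le> ennreal ((1 + \<epsilon>) * x\<^sup>2 + c * (y1\<^sup>2 + y2\<^sup>2))"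
        using wt[OF that(2-4)] that(1) by (intro ennreal_leI) linarith
      also have "\<dots> = ennreal (1 + \<epsilon>) * ennreal (x\<^sup>2) + ennreal c * (ennreal (y1\<^sup>2) + ennreal (y2\<^sup>2))"
        using \<epsilon> c by (simp add: ennreal_plus ennreal_mult del: ennreal_plus[symmetric])
      finally show ?thesis .
    qed
    have "?z \<le> ennreal (1 + \<epsilon>) * (ennreal (1 + \<epsilon>) * ?g + ennreal c * (d1 m + d2 m)) + ennreal c * (r1 m + r2 m)" for m
    proof -
      have "?z \<le> ennreal (1 + \<epsilon>) * (\<integral>\<^sup>+\<omega>. ennreal ((norm (simple_integral W (E1 m) \<omega> - simple_integral W (E2 m) \<omega>))\<^sup>2) \<partial>M)
          + ennreal c * (\<integral>\<^sup>+\<omega>. ennreal ((norm (Z1 \<omega> - simple_integral W (E1 m) \<omega>))\<^sup>2) + ennreal ((norm (Z2 \<omega> - simple_integral W (E2 m) \<omega>))\<^sup>2) \<partial>M)"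
      proof (rule nn_integral_le_combination)
        fix \<omega>
        have "norm (Z1 \<omega> - Z2 \<omega>) \<le> norm (simple_integral W (E1 m) \<omega> - simple_integral W (E2 m) \<omega>)
          + (norm (Z1 \<omega> - simple_integral W (E1 m) \<omega>) + norm (Z2 \<omega> - simple_integral W (E2 m) \<omega>))" by norm
        then show "ennreal ((norm (Z1 \<omega> - Z2 \<omega>))\<^sup>2) \<le> ennreal (1 + \<epsilon>) * ennreal ((norm (simple_integral W (E1 m) \<omega> - simple_integral W (E2 m) \<omega>))\<^sup>2)
          + ennreal c * (ennreal ((norm (Z1 \<omega> - simple_integral W (E1 m) \<omega>))\<^sup>2) + ennreal ((norm (Z2 \<omega> - simple_integral W (E2 m) \<omega>))\<^sup>2))"
          by (intro wte power_mono) auto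
      qed measurable
      also have "(\<integral>\<^sup>+\<omega>. ennreal ((norm (Z1 \<omega> - simple_integral W (E1 m) \<omega>))\<^sup>2) + ennreal ((norm (Z2 \<omega> - simple_integral W (E2 m) \<omega>))\<^sup>2) \<partial>M) = r1 m + r2 m"
        unfolding r1_def r2_def by (rule nn_integral_add) measurable
      also have "(\<integral>\<^sup>+\<omega>. ennreal ((norm (simple_integral W (E1 m) \<omega> - simple_integral W (E2 m) \<omega>))\<^sup>2) \<partial>M)
         \<le> ennreal (1 + \<epsilon>) * ?g + ennreal c * (d1 m + d2 m)"
      proof -
        have "(\<integral>\<^sup>+\<omega>. ennreal ((norm (simple_integral W (E1 m) \<omega> - simple_integral W (E2 m) \<omega>))\<^sup>2) \<partial>M)
          \<le> ennreal (1 + \<epsilon>) * ?g + ennreal c * (\<integral>\<^sup>+p. ennreal ((L20_dist Q (\<Phi>1 (fst p) (snd p)) (simple_process (E1 m) (fst p) (snd p)))\<^sup>2)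
             + ennreal ((L20_dist Q (\<Phi>2 (fst p) (snd p)) (simple_process (E2 m) (fst p) (snd p)))\<^sup>2) \<partial>?P)"
          unfolding Ito_diff_simple[OF E1(1) E2(1)]
        proof (rule nn_integral_le_combination)
          fix p assume "p \<in> space ?P"
          then have p: "fst p \<in> {a<..b}" "snd p \<in> space M" by (auto simp: space_pair_measure interval_space)
          let ?a = "\<Phi>1 (fst p) (snd p)" and ?b = "\<Phi>2 (fst p) (snd p)"
          let ?e = "simple_process (E1 m) (fst p) (snd p)" and ?f = "simple_process (E2 m) (fst p) (snd p)"
          note L = E1(6)[OF p] E2(6)[OF p] simple_process_L20[of "E1 m" "fst p" "snd p"] simple_process_L20[of "E2 m" "fst p" "snd p"]
          have "L20_dist Q ?e ?f \<le> L20_dist Q ?a ?b + (L20_dist Q ?a ?e + L20_dist Q ?b ?f)"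
            using L20_dist_triangle[OF L(3,1,4)] L20_dist_triangle[OF L(1,2,4)] L20_dist_commute[of ?e ?a] by linarith
          then have "ennreal ((L20_dist Q ?e ?f)\<^sup>2) \<le> ennreal (1 + \<epsilon>) * ennreal ((L20_dist Q ?a ?b)\<^sup>2)
             + ennreal c * (ennreal ((L20_dist Q ?a ?e)\<^sup>2) + ennreal ((L20_dist Q ?b ?f)\<^sup>2))"
            by (intro wte power_mono) (auto simp: L20_norm_nonneg)
          also have "\<dots> \<le> ennreal (1 + \<epsilon>) * G p + ennreal c * (ennreal ((L20_dist Q ?a ?e)\<^sup>2) + ennreal ((L20_dist Q ?b ?f)\<^sup>2))"
            using le[OF p] by (intro add_right_mono mult_left_mono) auto
          finally show "ennreal ((L20_dist Q ?e ?f)\<^sup>2) \<le> \<dots>" .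
        qed measurable
        also have "(\<integral>\<^sup>+p. ennreal ((L20_dist Q (\<Phi>1 (fst p) (snd p)) (simple_process (E1 m) (fst p) (snd p)))\<^sup>2)
             + ennreal ((L20_dist Q (\<Phi>2 (fst p) (snd p)) (simple_process (E2 m) (fst p) (snd p)))\<^sup>2) \<partial>?P) = d1 m + d2 m"
          unfolding d1_def d2_def by (rule nn_integral_add) measurable
        finally show ?thesis .
      qed
      finally show ?thesis by (simp add: add_mono mult_left_mono)
    qed
    moreover have "(\<lambda>m. ennreal (1 + \<epsilon>) * (ennreal (1 + \<epsilon>) * ?g + ennreal c * (d1 m + d2 m)) + ennreal c * (r1 m + r2 m))
      \<longlonglongrightarrow> ennreal (1 + \<epsilon>) * (ennreal (1 + \<epsilon>) * ?g + ennreal c * (0 + 0)) + ennreal c * (0 + 0)"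
      using E1(3,4) E2(3,4) unfolding d1_def d2_def r1_def r2_def
      by (intro tendsto_add ennreal_tendsto_cmult tendsto_const) auto
    ultimately show ?thesis by (intro LIMSEQ_le_const[of "\<lambda>m. ennreal (1 + \<epsilon>) * (ennreal (1 + \<epsilon>) * ?g + ennreal c * (d1 m + d2 m)) + ennreal c * (r1 m + r2 m)"]) auto
  qed
  \<comment> \<open>Now \<open>\<epsilon>\<close> tends to 0. For an infinite right-hand side the
    claim is trivial, and for a finite one the product in \<open>ennreal\<close> is
    continuous.\<close>
  have "(\<lambda>i. ennreal (1 + inverse (real (Suc i))) * (ennreal (1 + inverse (real (Suc i))) * ?g)) \<longlonglongrightarrow> ennreal (1 + 0) * (ennreal (1 + 0) * ?g)"
    if "?g < \<infinity>"
  proof -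
    have e: "(\<lambda>i. ennreal (1 + inverse (real (Suc i)))) \<longlonglongrightarrow> ennreal (1 + 0)"
      by (intro tendsto_ennrealI tendsto_add tendsto_const LIMSEQ_inverse_real_of_nat)
    have "(\<lambda>i. (ennreal (1 + inverse (real (Suc i))) * ennreal (1 + inverse (real (Suc i)))) * ?g) \<longlonglongrightarrow> (ennreal (1 + 0) * ennreal (1 + 0)) * ?g"
      using e that by (intro tendsto_mult_ennreal tendsto_const) auto
    then show ?thesis by (simp add: mult.assoc)
  qed
  then show ?thesis
    using eps[of "inverse (real (Suc _))"] by (cases "?g < \<infinity>") (auto intro!: LIMSEQ_le_const simp: less_top[symmetric])
qed


section \<open>Uniqueness, orthogonality and calculus rules of the integral\<close>

lemma pair_interval_nn:
  assumes [measurable]: "f \<in> borel_measurable (interval a b \<Otimes>\<^sub>M M)"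
  shows "(\<integral>\<^sup>+p. f p \<partial>(interval a b \<Otimes>\<^sub>M M)) = (\<integral>\<^sup>+s. (\<integral>\<^sup>+\<omega>. f (s, \<omega>) \<partial>M) * indicator {a<..b} s \<partial>lborel)"
    and "(\<lambda>s. (\<integral>\<^sup>+\<omega>. f (s, \<omega>) \<partial>M) * indicator {a<..b} s) \<in> borel_measurable lborel"
proof -
  have m: "(\<lambda>s. \<integral>\<^sup>+\<omega>. f (s, \<omega>) \<partial>M) \<in> borel_measurable (interval a b)" by measurable
  have "(\<integral>\<^sup>+p. f p \<partial>(interval a b \<Otimes>\<^sub>M M)) = (\<integral>\<^sup>+s. \<integral>\<^sup>+\<omega>. f (s, \<omega>) \<partial>M \<partial>interval a b)"
    by (rule nn_integral_fst[symmetric]) measurable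
  also have "\<dots> = (\<integral>\<^sup>+s. (\<integral>\<^sup>+\<omega>. f (s, \<omega>) \<partial>M) * indicator {a<..b} s \<partial>lborel)"
    unfolding interval_def by (rule nn_integral_restrict_space) simp
  finally show "(\<integral>\<^sup>+p. f p \<partial>(interval a b \<Otimes>\<^sub>M M)) = (\<integral>\<^sup>+s. (\<integral>\<^sup>+\<omega>. f (s, \<omega>) \<partial>M) * indicator {a<..b} s \<partial>lborel)" .
  show "(\<lambda>s. (\<integral>\<^sup>+\<omega>. f (s, \<omega>) \<partial>M) * indicator {a<..b} s) \<in> borel_measurable lborel"
    using m unfolding interval_def by (subst (asm) borel_measurable_restrict_space_iff_ennreal) auto
qed

lemma pair_interval_const:
  assumes [measurable]: "f \<in> borel_measurable M" and ab: "a \<le> b"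
  shows "(\<integral>\<^sup>+p. f (snd p) \<partial>(interval a b \<Otimes>\<^sub>M M)) = ennreal (b - a) * (\<integral>\<^sup>+\<omega>. f \<omega> \<partial>M)"
proof -
  have "(\<integral>\<^sup>+p. f (snd p) \<partial>(interval a b \<Otimes>\<^sub>M M)) = (\<integral>\<^sup>+s. (\<integral>\<^sup>+\<omega>. f \<omega> \<partial>M) * indicator {a<..b} s \<partial>lborel)"
    by (subst pair_interval_nn) auto
  also have "\<dots> = (\<integral>\<^sup>+\<omega>. f \<omega> \<partial>M) * emeasure lborel {a<..b}" by (subst nn_integral_cmult_indicator) auto
  finally show ?thesis using ab by (simp add: mult.commute)
qed

lemma pair_interval_sub:
  assumes "f \<in> measurable (interval a c \<Otimes>\<^sub>M M) N" "a \<le> a'" "b' \<le> c"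
  shows "f \<in> measurable (interval a' b' \<Otimes>\<^sub>M M) N"
proof -
  have "(\<lambda>s. s) \<in> measurable (interval a' b') (interval a c)"
    unfolding interval_def using assms(2,3)
    by (intro measurable_restrict_space2) (auto simp: space_restrict_space intro: measurable_restrict_space1)
  then have [measurable]: "fst \<in> measurable (interval a' b' \<Otimes>\<^sub>M M) (interval a c)"
    using measurable_compose[OF measurable_fst] by blast
  have "(\<lambda>p. (fst p, snd p)) \<in> measurable (interval a' b' \<Otimes>\<^sub>M M) (interval a c \<Otimes>\<^sub>M M)" by measurable
  from measurable_compose[OF this assms(1)] show ?thesis by simp
qed

lemma pair_interval_split:
  assumes f: "f \<in> borel_measurable (interval a c \<Otimes>\<^sub>M M)" and o: "a \<le> b" "b \<le> c"
  shows "(\<integral>\<^sup>+p. f p \<partial>(interval a c \<Otimes>\<^sub>M M)) = (\<integral>\<^sup>+p. f p \<partial>(interval a b \<Otimes>\<^sub>M M)) + (\<integral>\<^sup>+p. f p \<partial>(interval b c \<Otimes>\<^sub>M M))"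
proof -
  have f1: "f \<in> borel_measurable (interval a b \<Otimes>\<^sub>M M)" by (rule pair_interval_sub[OF f]) (use o in auto)
  have f2: "f \<in> borel_measurable (interval b c \<Otimes>\<^sub>M M)" by (rule pair_interval_sub[OF f]) (use o in auto)
  have i: "(indicator {a<..c} s :: ennreal) = indicator {a<..b} s + indicator {b<..c} s" for s
    using o by (auto simp: indicator_def)
  show ?thesis
    unfolding pair_interval_nn(1)[OF f] pair_interval_nn(1)[OF f1] pair_interval_nn(1)[OF f2] i distrib_left
    by (rule nn_integral_add) (use pair_interval_nn(2)[OF f1] pair_interval_nn(2)[OF f2] in auto)
qed

lemma Ito_unique_AE:
  fixes Z1 Z2 :: "'w \<Rightarrow> 'h::{real_inner, second_countable_topology}"
  assumes 1: "has_ito_integral M F Q W a b \<Phi>1 Z1" and 2: "has_ito_integral M F Q W a b \<Phi>2 Z2"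
    and ae: "AE \<omega> in M. \<forall>s\<in>{a<..b}. \<forall>v\<in>B. \<Phi>1 s \<omega> v = \<Phi>2 s \<omega> v"
  shows "AE \<omega> in M. Z1 \<omega> = Z2 \<omega>"
proof -
  obtain N where N: "N \<in> null_sets M" "{\<omega>\<in>space M. \<not> (\<forall>s\<in>{a<..b}. \<forall>v\<in>B. \<Phi>1 s \<omega> v = \<Phi>2 s \<omega> v)} \<subseteq> N"
    using ae by (auto elim!: AE_E intro!: null_setsI)
  have Ns[measurable]: "N \<in> sets M" using N(1) by auto
  \<comment> \<open>Infinite on the exceptional null set, where nothing is known about the
    integrands, and 0 elsewhere; its integral is still 0.\<close>
  let ?G = "\<lambda>p. \<infinity> * indicator N (snd p) :: ennreal"
  have "(\<integral>\<^sup>+\<omega>. ennreal ((norm (Z1 \<omega> - Z2 \<omega>))\<^sup>2) \<partial>M) \<le> (\<integral>\<^sup>+p. ?G p \<partial>(interval a b \<Otimes>\<^sub>M M))"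
  proof (rule Ito_diff_le[OF 1 2])
    fix s \<omega> assume s: "s \<in> {a<..b}" "\<omega> \<in> space M"
    show "ennreal ((L20_dist Q (\<Phi>1 s \<omega>) (\<Phi>2 s \<omega>))\<^sup>2) \<le> ?G (s, \<omega>)"
    proof (cases "\<omega> \<in> N")
      case False
      then have "\<Phi>1 s \<omega> v = \<Phi>2 s \<omega> v" if "v \<in> B" for v using N(2) s that by blast
      then have "L20_dist Q (\<Phi>1 s \<omega>) (\<Phi>2 s \<omega>) = 0" by (intro L20_norm_zero) simp
      then show ?thesis by simp
    qed simp
  qed measurable
  also have "\<dots> = 0"
    by (subst pair_interval_nn) (use N(1) in \<open>auto simp: nn_integral_cmult_indicator\<close>)
  finally have "(\<integral>\<^sup>+\<omega>. ennreal ((norm (Z1 \<omega> - Z2 \<omega>))\<^sup>2) \<partial>M) = 0" by simp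
  moreover have [measurable]: "Z1 \<in> borel_measurable M" "Z2 \<in> borel_measurable M"
    using 1 2 by (auto simp: has_ito_integral_def)
  ultimately have "AE \<omega> in M. ennreal ((norm (Z1 \<omega> - Z2 \<omega>))\<^sup>2) = 0" by (subst (asm) nn_integral_0_iff_AE) auto
  then show ?thesis by eventually_elim simp
qed

lemma has_ito_measurable: "has_ito_integral M F Q W a b \<Phi> Z \<Longrightarrow> Z \<in> borel_measurable M"
  by (simp add: has_ito_integral_def)

lemma Ito_square_integrable:
  fixes Z :: "'w \<Rightarrow> 'h::{real_inner, second_countable_topology}"
  assumes Z: "has_ito_integral M F Q W a b \<Phi> Z"
  shows "square_integrable M Z"
proof -
  obtain E where E: "\<And>m. simple_integrand M F a b (E m)"
    "(\<lambda>m. \<integral>\<^sup>+\<omega>. ennreal ((norm (Z \<omega> - simple_integral W (E m) \<omega>))\<^sup>2) \<partial>M) \<longlonglongrightarrow> 0"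
    by (rule has_ito_integralD[OF Z]) blast
  have [measurable]: "Z \<in> borel_measurable M" by (rule has_ito_measurable[OF Z])
  have "eventually (\<lambda>m. (\<integral>\<^sup>+\<omega>. ennreal ((norm (Z \<omega> - simple_integral W (E m) \<omega>))\<^sup>2) \<partial>M) < 1) sequentially"
    using E(2) by (rule order_tendstoD) simp
  then obtain m where m: "(\<integral>\<^sup>+\<omega>. ennreal ((norm (Z \<omega> - simple_integral W (E m) \<omega>))\<^sup>2) \<partial>M) < 1"
    by (auto simp: eventually_sequentially)
  note [measurable] = simple_integral_measurable[OF E(1)]
  have "(\<integral>\<^sup>+\<omega>. ennreal ((norm (Z \<omega>))\<^sup>2) \<partial>M)
    \<le> 2 * (\<integral>\<^sup>+\<omega>. ennreal ((norm (Z \<omega> - simple_integral W (E m) \<omega>))\<^sup>2) \<partial>M) + 2 * (\<integral>\<^sup>+\<omega>. ennreal ((norm (simple_integral W (E m) \<omega>))\<^sup>2) \<partial>M)"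
  proof (rule nn_integral_norm_sum_le2)
    show "norm (Z \<omega>) \<le> norm (Z \<omega> - simple_integral W (E m) \<omega>) + norm (simple_integral W (E m) \<omega>)" for \<omega>
      using norm_triangle_sub[of "Z \<omega>" "simple_integral W (E m) \<omega>"] by simp
  qed measurable
  also have "\<dots> < \<infinity>"
    using m square_int_le[OF Ito_isometry_simple(2)[OF E(1)[of m]]]
    by (auto simp: ennreal_add_eq_top ennreal_mult_eq_top_iff less_top[symmetric])
  finally show ?thesis by (intro square_integrable_mono_le) auto
qed

lemma inner_integrable:
  fixes V Z :: "'w \<Rightarrow> 'h::{real_inner, second_countable_topology}"
  assumes "square_integrable M V" "square_integrable M Z"
  shows "integrable M (\<lambda>\<omega>. inner (V \<omega>) (Z \<omega>))"
proof (rule Bochner_Integration.integrable_bound)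
  have [measurable]: "V \<in> borel_measurable M" "Z \<in> borel_measurable M" using assms by (auto simp: square_integrable_def)
  show "integrable M (\<lambda>\<omega>. norm (V \<omega>) * norm (Z \<omega>))"
    by (rule square_prod_integrable) (use assms in \<open>auto simp: square_integrable_def\<close>)
  show "AE \<omega> in M. norm (inner (V \<omega>) (Z \<omega>)) \<le> norm (norm (V \<omega>) * norm (Z \<omega>))"
    by (intro AE_I2) (simp add: Cauchy_Schwarz_ineq2)
  show "(\<lambda>\<omega>. inner (V \<omega>) (Z \<omega>)) \<in> borel_measurable M" by measurable
qed

text \<open>Both \<open>V\<close> and the coefficient of a term are known at the left end of its
  interval, so each increment is centred and independent of them.\<close>

lemma simple_integral_orth:
  fixes E :: "('w, 'u, 'h::{real_inner, second_countable_topology}) simple"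
  assumes E: "simple_integrand M F a b E" and V: "V \<in> borel_measurable (F a)" "square_integrable M V"
  shows "(\<integral>\<omega>. inner (V \<omega>) (simple_integral W E \<omega>) \<partial>M) = 0"
proof -
  have t: "integrable M (\<lambda>\<omega>. (inner (V \<omega>) (st_x (E!i)) * st_psi (E!i) \<omega>) * dW (st_l (E!i)) (st_r (E!i)) (st_u (E!i)) \<omega>) \<and>
     (\<integral>\<omega>. (inner (V \<omega>) (st_x (E!i)) * st_psi (E!i) \<omega>) * dW (st_l (E!i)) (st_r (E!i)) (st_u (E!i)) \<omega> \<partial>M) = 0"
    if i: "i < length E" for i
  proof -
    note En = simple_integrand_nth[OF E i]
    have [measurable]: "V \<in> borel_measurable (F (st_l (E!i)))" by (rule measurable_F_mono[OF V(1) En(1)])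
    have [measurable]: "st_psi (E!i) \<in> borel_measurable (F (st_l (E!i)))" by (rule En(4))
    have m: "(\<lambda>\<omega>. inner (V \<omega>) (st_x (E!i)) * st_psi (E!i) \<omega>) \<in> borel_measurable (F (st_l (E!i)))" by measurable
    obtain C where C: "\<forall>\<omega>\<in>space M. \<bar>st_psi (E!i) \<omega>\<bar> \<le> C" using En(5) by blast
    have "square_integrable M (\<lambda>\<omega>. st_x (E!i))" by (simp add: square_integrable_def)
    from bounded_mult_integrable[OF measurable_F_M[OF En(4)] inner_integrable[OF V(2) this], of C] C
    have "integrable M (\<lambda>\<omega>. inner (V \<omega>) (st_x (E!i)) * st_psi (E!i) \<omega>)" by (simp add: mult.commute)
    from dW_orth[OF En(2) m this] show ?thesis by blast
  qed
  have "(\<integral>\<omega>. inner (V \<omega>) (simple_integral W E \<omega>) \<partial>M) = (\<integral>\<omega>. (\<Sum>i<length E.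
      (inner (V \<omega>) (st_x (E!i)) * st_psi (E!i) \<omega>) * dW (st_l (E!i)) (st_r (E!i)) (st_u (E!i)) \<omega>) \<partial>M)"
    unfolding simple_integral_nth inner_sum_right by (simp add: algebra_simps)
  also have "\<dots> = (\<Sum>i<length E. (\<integral>\<omega>. (inner (V \<omega>) (st_x (E!i)) * st_psi (E!i) \<omega>) * dW (st_l (E!i)) (st_r (E!i)) (st_u (E!i)) \<omega> \<partial>M))"
    by (rule Bochner_Integration.integral_sum) (use t in auto)
  also have "\<dots> = 0" using t by (intro sum.neutral) auto
  finally show ?thesis .
qed

lemma square_integrable_diff:
  fixes X Y :: "'w \<Rightarrow> 'h::{real_normed_vector, second_countable_topology}"
  assumes "square_integrable M X" "square_integrable M Y"
  shows "square_integrable M (\<lambda>\<omega>. X \<omega> - Y \<omega>)"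
proof (rule square_integrable_mono_le)
  have [measurable]: "X \<in> borel_measurable M" "Y \<in> borel_measurable M" using assms by (auto simp: square_integrable_def)
  show "(\<lambda>\<omega>. X \<omega> - Y \<omega>) \<in> borel_measurable M" by measurable
  have "(\<integral>\<^sup>+\<omega>. ennreal ((norm (X \<omega> - Y \<omega>))\<^sup>2) \<partial>M) \<le> 2 * (\<integral>\<^sup>+\<omega>. ennreal ((norm (X \<omega>))\<^sup>2) \<partial>M) + 2 * (\<integral>\<^sup>+\<omega>. ennreal ((norm (Y \<omega>))\<^sup>2) \<partial>M)"
    by (rule nn_integral_norm_sum_le2) (auto intro: norm_triangle_ineq4)
  also have "\<dots> < \<infinity>" using square_int_le[OF assms(1)] square_int_le[OF assms(2)]
    by (auto simp: ennreal_add_eq_top ennreal_mult_eq_top_iff less_top[symmetric])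
  finally show "(\<integral>\<^sup>+\<omega>. ennreal ((norm (X \<omega> - Y \<omega>))\<^sup>2) \<partial>M) < \<infinity>" .
qed

text \<open>Passage to the limit from simple integrals. The error is bounded by a weighted Young
  inequality with parameter \<open>\<delta>\<close>; first the approximation error tends to 0, then
  \<open>\<delta>\<close>.\<close>

lemma Ito_orth:
  fixes Z :: "'w \<Rightarrow> 'h::{real_inner, second_countable_topology}"
  assumes Z: "has_ito_integral M F Q W a b \<Phi> Z" and V: "V \<in> borel_measurable (F a)" "square_integrable M V"
  shows "(\<integral>\<omega>. inner (V \<omega>) (Z \<omega>) \<partial>M) = 0"
proof -
  obtain E where E: "\<And>m. simple_integrand M F a b (E m)"
    "(\<lambda>m. \<integral>\<^sup>+\<omega>. ennreal ((norm (Z \<omega> - simple_integral W (E m) \<omega>))\<^sup>2) \<partial>M) \<longlonglongrightarrow> 0"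
    by (rule has_ito_integralD[OF Z]) blast
  note sq = Ito_square_integrable[OF Z] Ito_isometry_simple(2)[OF E(1)]
  define r where "r m = (\<integral>\<omega>. (norm (Z \<omega> - simple_integral W (E m) \<omega>))\<^sup>2 \<partial>M)" for m
  define v where "v = (\<integral>\<omega>. (norm (V \<omega>))\<^sup>2 \<partial>M)"
  define c where "c = (\<integral>\<omega>. inner (V \<omega>) (Z \<omega>) \<partial>M)"
  have sqd: "square_integrable M (\<lambda>\<omega>. Z \<omega> - simple_integral W (E m) \<omega>)" for m
    by (intro square_integrable_diff sq)
  have r: "r \<longlonglongrightarrow> 0"
  proof -
    have "(\<lambda>m. ennreal (r m)) \<longlonglongrightarrow> ennreal 0" using E(2) unfolding r_def square_integrable_nn[OF sqd, symmetric] by simp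
    then show ?thesis by (subst (asm) tendsto_ennreal_iff) (auto simp: r_def)
  qed
  have cb: "\<bar>c\<bar> \<le> \<delta> * v + r m / \<delta>" if \<delta>: "0 < \<delta>" for \<delta> m
  proof -
    have "c = (\<integral>\<omega>. inner (V \<omega>) (Z \<omega>) \<partial>M) - (\<integral>\<omega>. inner (V \<omega>) (simple_integral W (E m) \<omega>) \<partial>M)"
      using simple_integral_orth[OF E(1) V] by (simp add: c_def)
    also have "\<dots> = (\<integral>\<omega>. inner (V \<omega>) (Z \<omega>) - inner (V \<omega>) (simple_integral W (E m) \<omega>) \<partial>M)"
      by (rule Bochner_Integration.integral_diff[symmetric]; rule inner_integrable; fact V sq)
    also have "\<dots> = (\<integral>\<omega>. inner (V \<omega>) (Z \<omega> - simple_integral W (E m) \<omega>) \<partial>M)" by (simp add: inner_diff_right)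
    finally have "\<bar>c\<bar> \<le> (\<integral>\<omega>. \<bar>inner (V \<omega>) (Z \<omega> - simple_integral W (E m) \<omega>)\<bar> \<partial>M)"
      using integral_abs_bound by metis
    also have "\<dots> \<le> (\<integral>\<omega>. \<delta> * (norm (V \<omega>))\<^sup>2 + (norm (Z \<omega> - simple_integral W (E m) \<omega>))\<^sup>2 / \<delta> \<partial>M)"
    proof (rule integral_mono)
      show "integrable M (\<lambda>\<omega>. \<bar>inner (V \<omega>) (Z \<omega> - simple_integral W (E m) \<omega>)\<bar>)"
        by (intro integrable_abs inner_integrable V sqd)
      show "integrable M (\<lambda>\<omega>. \<delta> * (norm (V \<omega>))\<^sup>2 + (norm (Z \<omega> - simple_integral W (E m) \<omega>))\<^sup>2 / \<delta>)"
        using V(2) sqd[of m] by (auto simp: square_integrable_def)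
      fix \<omega>
      let ?x = "norm (V \<omega>)" and ?y = "norm (Z \<omega> - simple_integral W (E m) \<omega>)"
      have "0 \<le> (\<delta> * ?x - ?y)\<^sup>2 / \<delta>" using \<delta> by simp
      also have "\<dots> = \<delta> * ?x\<^sup>2 + ?y\<^sup>2 / \<delta> - 2 * (?x * ?y)" using \<delta> by (simp add: power2_eq_square field_simps)
      finally have "?x * ?y \<le> \<delta> * ?x\<^sup>2 + ?y\<^sup>2 / \<delta>" by (smt (verit) mult_nonneg_nonneg norm_ge_zero)
      then show "\<bar>inner (V \<omega>) (Z \<omega> - simple_integral W (E m) \<omega>)\<bar> \<le> \<delta> * ?x\<^sup>2 + ?y\<^sup>2 / \<delta>"
        using Cauchy_Schwarz_ineq2 order_trans by blast
    qed
    also have "\<dots> = \<delta> * v + r m / \<delta>"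
      unfolding v_def r_def using V(2) sqd[of m] by (subst Bochner_Integration.integral_add) (auto simp: square_integrable_def)
    finally show ?thesis .
  qed
  have cv: "\<bar>c\<bar> \<le> \<delta> * v" if \<delta>: "0 < \<delta>" for \<delta>
  proof -
    have "(\<lambda>m. \<delta> * v + r m / \<delta>) \<longlonglongrightarrow> \<delta> * v + 0 / \<delta>" by (intro tendsto_intros r) (use \<delta> in auto)
    then show ?thesis using cb[OF \<delta>] by (intro LIMSEQ_le_const[of "\<lambda>m. \<delta> * v + r m / \<delta>"]) auto
  qed
  have v0: "0 \<le> v" by (simp add: v_def)
  have "\<bar>c\<bar> \<le> 0 + e" if "0 < e" for e
  proof -
    have "\<bar>c\<bar> \<le> e / (v + 1) * v" using cv[of "e / (v + 1)"] that v0 by simp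
    also have "\<dots> \<le> e" using that v0 by (simp add: divide_le_eq)
    finally show ?thesis by simp
  qed
  then have "\<bar>c\<bar> \<le> 0" by (rule field_le_epsilon)
  then show ?thesis by (simp add: c_def)
qed

text \<open>Tested on the countable basis only. For integrands with values in \<open>L20 Q\<close>
  this makes their distances to simple processes measurable, which is the measurability that
  \<open>has_ito_integral\<close> asks for.\<close>

definition weakly_measurable :: "real \<Rightarrow> real \<Rightarrow> (real \<Rightarrow> 'w \<Rightarrow> 'u \<Rightarrow> 'h::real_normed_vector) \<Rightarrow> bool" where
  "weakly_measurable a b \<Phi> \<longleftrightarrow> (\<forall>v\<in>B. (\<lambda>p. \<Phi> (fst p) (snd p) v) \<in> borel_measurable (interval a b \<Otimes>\<^sub>M M))"

lemma dist_simple_measurable: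
  fixes E :: "('w, 'u, 'h::{real_inner, second_countable_topology}) simple"
  assumes "weakly_measurable a b \<Phi>" "\<And>s \<omega>. s \<in> {a<..b} \<Longrightarrow> \<omega> \<in> space M \<Longrightarrow> \<Phi> s \<omega> \<in> L20 Q"
    and E: "simple_integrand M F a b E"
  shows "(\<lambda>p. L20_dist Q (\<Phi> (fst p) (snd p)) (simple_process E (fst p) (snd p))) \<in> borel_measurable (interval a b \<Otimes>\<^sub>M M)"
proof (rule L20_norm_measurable)
  show "(\<lambda>p. \<Phi> (fst p) (snd p) v - simple_process E (fst p) (snd p) v) \<in> borel_measurable (interval a b \<Otimes>\<^sub>M M)" if "v \<in> B" for v
    using assms(1) that simple_process_measurable[OF E, of v] unfolding weakly_measurable_def case_prod_unfold
    by (intro borel_measurable_diff) auto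
  show "(\<lambda>v. \<Phi> (fst p) (snd p) v - simple_process E (fst p) (snd p) v) \<in> L20 Q" if "p \<in> space (interval a b \<Otimes>\<^sub>M M)" for p
    using that by (intro L20_diff assms(2) simple_process_L20) (auto simp: space_pair_measure interval_space)
qed

text \<open>The approximants are mapped term by term; boundedness of \<open>G\<close> controls both
  errors, and \<open>weakly_measurable\<close> provides measurability of the new distances.\<close>

lemma has_ito_map:
  fixes Z :: "'w \<Rightarrow> 'h::{real_inner, second_countable_topology}" and G :: "'h \<Rightarrow> 'k::{real_inner, second_countable_topology}"
  assumes Z: "has_ito_integral M F Q W a b \<Phi> Z" and G: "bounded_linear G" and wm: "weakly_measurable a b \<Phi>"
  shows "has_ito_integral M F Q W a b (\<lambda>s \<omega> v. G (\<Phi> s \<omega> v)) (\<lambda>\<omega>. G (Z \<omega>))"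
proof -
  obtain E where E: "\<And>m. simple_integrand M F a b (E m)"
    "\<And>m. (\<lambda>p. L20_dist Q (\<Phi> (fst p) (snd p)) (simple_process (E m) (fst p) (snd p))) \<in> borel_measurable (interval a b \<Otimes>\<^sub>M M)"
    "(\<lambda>m. \<integral>\<^sup>+p. ennreal ((L20_dist Q (\<Phi> (fst p) (snd p)) (simple_process (E m) (fst p) (snd p)))\<^sup>2) \<partial>(interval a b \<Otimes>\<^sub>M M)) \<longlonglongrightarrow> 0"
    "(\<lambda>m. \<integral>\<^sup>+\<omega>. ennreal ((norm (Z \<omega> - simple_integral W (E m) \<omega>))\<^sup>2) \<partial>M) \<longlonglongrightarrow> 0"
    "Z \<in> borel_measurable M" "\<And>s \<omega>. s \<in> {a<..b} \<Longrightarrow> \<omega> \<in> space M \<Longrightarrow> \<Phi> s \<omega> \<in> L20 Q"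
    by (rule has_ito_integralD[OF Z]) blast
  obtain c where c: "0 < c" "\<And>x. norm (G x) \<le> norm x * c" using bounded_linear.pos_bounded[OF G] by blast
  have l: "linear G" by (rule bounded_linear.linear[OF G])
  have Gm: "G \<in> borel_measurable borel" by (intro borel_measurable_continuous_onI linear_continuous_on G)
  note [measurable] = E(2,5) simple_integral_measurable[OF E(1)]
  have sq: "ennreal t \<le> ennreal (c\<^sup>2) * ennreal (x\<^sup>2)" if "t \<le> (c * x)\<^sup>2" for t x
    using that c(1) by (simp add: power_mult_distrib ennreal_mult[symmetric] ennreal_leI)
  have lim0: "(\<lambda>m. ennreal (c\<^sup>2) * y m) \<longlonglongrightarrow> 0" if "y \<longlonglongrightarrow> 0" for y :: "nat \<Rightarrow> ennreal"
    using ennreal_tendsto_cmult[OF _ that, of "ennreal (c\<^sup>2)"] by simp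
  show ?thesis
  proof (rule has_ito_integralI[where E = "\<lambda>m. simple_map G (E m)"])
    show s: "simple_integrand M F a b (simple_map G (E m))" for m by (simp add: simple_integrand_map E(1))
    show L: "(\<lambda>v. G (\<Phi> s \<omega> v)) \<in> L20 Q" if "s \<in> {a<..b}" "\<omega> \<in> space M" for s \<omega>
      by (rule L20_bounded_linear[OF E(6)[OF that] G])
    show "(\<lambda>\<omega>. G (Z \<omega>)) \<in> borel_measurable M" by (rule measurable_compose[OF E(5) Gm])
    show "(\<lambda>p. L20_dist Q (\<lambda>v. G (\<Phi> (fst p) (snd p) v)) (simple_process (simple_map G (E m)) (fst p) (snd p)))
        \<in> borel_measurable (interval a b \<Otimes>\<^sub>M M)" for m
    proof (rule dist_simple_measurable[OF _ L s])
      show "weakly_measurable a b (\<lambda>s \<omega> v. G (\<Phi> s \<omega> v))"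
        using wm unfolding weakly_measurable_def by (auto intro: measurable_compose[OF _ Gm])
    qed
    have "(\<integral>\<^sup>+p. ennreal ((L20_dist Q (\<lambda>v. G (\<Phi> (fst p) (snd p) v)) (simple_process (simple_map G (E m)) (fst p) (snd p)))\<^sup>2) \<partial>(interval a b \<Otimes>\<^sub>M M))
      \<le> ennreal (c\<^sup>2) * (\<integral>\<^sup>+p. ennreal ((L20_dist Q (\<Phi> (fst p) (snd p)) (simple_process (E m) (fst p) (snd p)))\<^sup>2) \<partial>(interval a b \<Otimes>\<^sub>M M))" for m
    proof (subst nn_integral_cmult[symmetric])
      show "(\<integral>\<^sup>+p. ennreal ((L20_dist Q (\<lambda>v. G (\<Phi> (fst p) (snd p) v)) (simple_process (simple_map G (E m)) (fst p) (snd p)))\<^sup>2) \<partial>(interval a b \<Otimes>\<^sub>M M))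
        \<le> (\<integral>\<^sup>+p. ennreal (c\<^sup>2) * ennreal ((L20_dist Q (\<Phi> (fst p) (snd p)) (simple_process (E m) (fst p) (snd p)))\<^sup>2) \<partial>(interval a b \<Otimes>\<^sub>M M))"
      proof (intro nn_integral_mono sq power_mono L20_norm_nonneg)
        fix p assume "p \<in> space (interval a b \<Otimes>\<^sub>M M)"
        then have p: "fst p \<in> {a<..b}" "snd p \<in> space M" by (auto simp: space_pair_measure interval_space)
        have "L20_norm Q (\<lambda>v. G (\<Phi> (fst p) (snd p) v - simple_process (E m) (fst p) (snd p) v)) \<le> c * L20_dist Q (\<Phi> (fst p) (snd p)) (simple_process (E m) (fst p) (snd p))"
          by (rule L20_norm_bounded_linear[OF L20_diff[OF E(6)[OF p] simple_process_L20] G]) (use c in \<open>auto simp: mult.commute\<close>)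
        then show "L20_dist Q (\<lambda>v. G (\<Phi> (fst p) (snd p) v)) (simple_process (simple_map G (E m)) (fst p) (snd p)) \<le> c * L20_dist Q (\<Phi> (fst p) (snd p)) (simple_process (E m) (fst p) (snd p))"
          by (simp add: simple_process_map[OF l] linear_diff[OF l])
      qed
    qed measurable
    then show "(\<lambda>m. \<integral>\<^sup>+p. ennreal ((L20_dist Q (\<lambda>v. G (\<Phi> (fst p) (snd p) v)) (simple_process (simple_map G (E m)) (fst p) (snd p)))\<^sup>2) \<partial>(interval a b \<Otimes>\<^sub>M M)) \<longlonglongrightarrow> 0"
      by (intro tendsto_sandwich[OF _ _ tendsto_const lim0[OF E(3)]]) auto
    have "(\<integral>\<^sup>+\<omega>. ennreal ((norm (G (Z \<omega>) - simple_integral W (simple_map G (E m)) \<omega>))\<^sup>2) \<partial>M)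
      \<le> ennreal (c\<^sup>2) * (\<integral>\<^sup>+\<omega>. ennreal ((norm (Z \<omega> - simple_integral W (E m) \<omega>))\<^sup>2) \<partial>M)" for m
    proof (subst nn_integral_cmult[symmetric])
      show "(\<integral>\<^sup>+\<omega>. ennreal ((norm (G (Z \<omega>) - simple_integral W (simple_map G (E m)) \<omega>))\<^sup>2) \<partial>M)
        \<le> (\<integral>\<^sup>+\<omega>. ennreal (c\<^sup>2) * ennreal ((norm (Z \<omega> - simple_integral W (E m) \<omega>))\<^sup>2) \<partial>M)"
        unfolding simple_integral_map[OF l] linear_diff[OF l, symmetric]
        by (intro nn_integral_mono sq power_mono) (use c in \<open>auto simp: mult.commute\<close>)
    qed measurable
    then show "(\<lambda>m. \<integral>\<^sup>+\<omega>. ennreal ((norm (G (Z \<omega>) - simple_integral W (simple_map G (E m)) \<omega>))\<^sup>2) \<partial>M) \<longlonglongrightarrow> 0"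
      by (intro tendsto_sandwich[OF _ _ tendsto_const lim0[OF E(4)]]) auto
  qed
qed

text \<open>The approximating lists are concatenated. Each process vanishes outside its own
  half-open interval, so the energies over the two halves simply add.\<close>

lemma has_ito_concat:
  fixes Z1 Z2 :: "'w \<Rightarrow> 'h::{real_inner, second_countable_topology}"
  assumes Z1: "has_ito_integral M F Q W a b \<Phi> Z1" and Z2: "has_ito_integral M F Q W b c \<Phi> Z2"
    and wm: "weakly_measurable a c \<Phi>" and o: "a \<le> b" "b \<le> c"
  shows "has_ito_integral M F Q W a c \<Phi> (\<lambda>\<omega>. Z1 \<omega> + Z2 \<omega>)"
proof -
  obtain E1 where E1: "\<And>m. simple_integrand M F a b (E1 m)"
    "(\<lambda>m. \<integral>\<^sup>+p. ennreal ((L20_dist Q (\<Phi> (fst p) (snd p)) (simple_process (E1 m) (fst p) (snd p)))\<^sup>2) \<partial>(interval a b \<Otimes>\<^sub>M M)) \<longlonglongrightarrow> 0"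
    "(\<lambda>m. \<integral>\<^sup>+\<omega>. ennreal ((norm (Z1 \<omega> - simple_integral W (E1 m) \<omega>))\<^sup>2) \<partial>M) \<longlonglongrightarrow> 0"
    "Z1 \<in> borel_measurable M" "\<And>s \<omega>. s \<in> {a<..b} \<Longrightarrow> \<omega> \<in> space M \<Longrightarrow> \<Phi> s \<omega> \<in> L20 Q"
    by (rule has_ito_integralD[OF Z1]) blast
  obtain E2 where E2: "\<And>m. simple_integrand M F b c (E2 m)"
    "(\<lambda>m. \<integral>\<^sup>+p. ennreal ((L20_dist Q (\<Phi> (fst p) (snd p)) (simple_process (E2 m) (fst p) (snd p)))\<^sup>2) \<partial>(interval b c \<Otimes>\<^sub>M M)) \<longlonglongrightarrow> 0"
    "(\<lambda>m. \<integral>\<^sup>+\<omega>. ennreal ((norm (Z2 \<omega> - simple_integral W (E2 m) \<omega>))\<^sup>2) \<partial>M) \<longlonglongrightarrow> 0"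
    "Z2 \<in> borel_measurable M" "\<And>s \<omega>. s \<in> {b<..c} \<Longrightarrow> \<omega> \<in> space M \<Longrightarrow> \<Phi> s \<omega> \<in> L20 Q"
    by (rule has_ito_integralD[OF Z2]) blast
  note [measurable] = E1(4) E2(4) simple_integral_measurable[OF E1(1)] simple_integral_measurable[OF E2(1)]
  show ?thesis
  proof (rule has_ito_integralI[where E = "\<lambda>m. E1 m @ E2 m"])
    show s: "simple_integrand M F a c (E1 m @ E2 m)" for m
      using simple_integrand_mono[OF E1(1)] simple_integrand_mono[OF E2(1)] o by (simp add: simple_integrand_append)
    show L: "\<Phi> s \<omega> \<in> L20 Q" if "s \<in> {a<..c}" "\<omega> \<in> space M" for s \<omega>
      using E1(5)[OF _ that(2), of s] E2(5)[OF _ that(2), of s] that(1) by (cases "s \<le> b") auto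
    show m: "(\<lambda>p. L20_dist Q (\<Phi> (fst p) (snd p)) (simple_process (E1 m @ E2 m) (fst p) (snd p))) \<in> borel_measurable (interval a c \<Otimes>\<^sub>M M)" for m
      by (rule dist_simple_measurable[OF wm L s])
    show "(\<lambda>\<omega>. Z1 \<omega> + Z2 \<omega>) \<in> borel_measurable M" by measurable
    have e1: "simple_process (E1 m @ E2 m) (fst p) (snd p) = simple_process (E1 m) (fst p) (snd p)" if "p \<in> space (interval a b \<Otimes>\<^sub>M M)" for m p
      using that simple_process_outside[OF E2(1), of "fst p"] by (auto simp: fun_eq_iff simple_process_append space_pair_measure interval_space)
    have e2: "simple_process (E1 m @ E2 m) (fst p) (snd p) = simple_process (E2 m) (fst p) (snd p)" if "p \<in> space (interval b c \<Otimes>\<^sub>M M)" for m p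
      using that simple_process_outside[OF E1(1), of "fst p"] by (auto simp: fun_eq_iff simple_process_append space_pair_measure interval_space)
    have "(\<integral>\<^sup>+p. ennreal ((L20_dist Q (\<Phi> (fst p) (snd p)) (simple_process (E1 m @ E2 m) (fst p) (snd p)))\<^sup>2) \<partial>(interval a c \<Otimes>\<^sub>M M))
      = (\<integral>\<^sup>+p. ennreal ((L20_dist Q (\<Phi> (fst p) (snd p)) (simple_process (E1 m) (fst p) (snd p)))\<^sup>2) \<partial>(interval a b \<Otimes>\<^sub>M M))
      + (\<integral>\<^sup>+p. ennreal ((L20_dist Q (\<Phi> (fst p) (snd p)) (simple_process (E2 m) (fst p) (snd p)))\<^sup>2) \<partial>(interval b c \<Otimes>\<^sub>M M))" for m
      using m[of m] o e1 e2 by (subst pair_interval_split[of _ a c b]) (auto intro!: arg_cong2[of _ _ _ _ "(+)"] nn_integral_cong)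
    then show "(\<lambda>m. \<integral>\<^sup>+p. ennreal ((L20_dist Q (\<Phi> (fst p) (snd p)) (simple_process (E1 m @ E2 m) (fst p) (snd p)))\<^sup>2) \<partial>(interval a c \<Otimes>\<^sub>M M)) \<longlonglongrightarrow> 0"
      using tendsto_add[OF E1(2) E2(2)] by simp
    have le: "(\<integral>\<^sup>+\<omega>. ennreal ((norm (Z1 \<omega> + Z2 \<omega> - simple_integral W (E1 m @ E2 m) \<omega>))\<^sup>2) \<partial>M)
      \<le> 2 * (\<integral>\<^sup>+\<omega>. ennreal ((norm (Z1 \<omega> - simple_integral W (E1 m) \<omega>))\<^sup>2) \<partial>M) + 2 * (\<integral>\<^sup>+\<omega>. ennreal ((norm (Z2 \<omega> - simple_integral W (E2 m) \<omega>))\<^sup>2) \<partial>M)" for m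
      by (rule nn_integral_norm_sum_le2) (auto simp: simple_integral_append norm_diff_triangle_ineq)
    have "(\<lambda>m. 2 * (\<integral>\<^sup>+\<omega>. ennreal ((norm (Z1 \<omega> - simple_integral W (E1 m) \<omega>))\<^sup>2) \<partial>M) + 2 * (\<integral>\<^sup>+\<omega>. ennreal ((norm (Z2 \<omega> - simple_integral W (E2 m) \<omega>))\<^sup>2) \<partial>M)) \<longlonglongrightarrow> 2 * 0 + 2 * 0"
      by (intro tendsto_add ennreal_tendsto_cmult E1(3) E2(3)) auto
    then have lim: "(\<lambda>m. 2 * (\<integral>\<^sup>+\<omega>. ennreal ((norm (Z1 \<omega> - simple_integral W (E1 m) \<omega>))\<^sup>2) \<partial>M) + 2 * (\<integral>\<^sup>+\<omega>. ennreal ((norm (Z2 \<omega> - simple_integral W (E2 m) \<omega>))\<^sup>2) \<partial>M)) \<longlonglongrightarrow> 0"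
      by simp
    show "(\<lambda>m. \<integral>\<^sup>+\<omega>. ennreal ((norm (Z1 \<omega> + Z2 \<omega> - simple_integral W (E1 m @ E2 m) \<omega>))\<^sup>2) \<partial>M) \<longlonglongrightarrow> 0"
      by (rule tendsto_sandwich[OF _ _ tendsto_const lim]) (auto intro: always_eventually le)
  qed
qed

text \<open>The integrand of the continuous scheme jumps at the right end of every step, whereas
  integrals live on intervals closed on the right. The end point is a null set in time.\<close>

lemma has_ito_change_endpoint:
  fixes Z :: "'w \<Rightarrow> 'h::{real_inner, second_countable_topology}"
  assumes Z: "has_ito_integral M F Q W a b \<Phi> Z" and wm: "weakly_measurable a b \<Phi>'"
    and L': "\<And>s \<omega>. s \<in> {a<..b} \<Longrightarrow> \<omega> \<in> space M \<Longrightarrow> \<Phi>' s \<omega> \<in> L20 Q"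
    and eq: "\<And>s \<omega>. s \<in> {a<..<b} \<Longrightarrow> \<omega> \<in> space M \<Longrightarrow> \<Phi>' s \<omega> = \<Phi> s \<omega>"
  shows "has_ito_integral M F Q W a b \<Phi>' Z"
proof -
  obtain E where E: "\<And>m. simple_integrand M F a b (E m)"
    "\<And>m. (\<lambda>p. L20_dist Q (\<Phi> (fst p) (snd p)) (simple_process (E m) (fst p) (snd p))) \<in> borel_measurable (interval a b \<Otimes>\<^sub>M M)"
    "(\<lambda>m. \<integral>\<^sup>+p. ennreal ((L20_dist Q (\<Phi> (fst p) (snd p)) (simple_process (E m) (fst p) (snd p)))\<^sup>2) \<partial>(interval a b \<Otimes>\<^sub>M M)) \<longlonglongrightarrow> 0"
    "(\<lambda>m. \<integral>\<^sup>+\<omega>. ennreal ((norm (Z \<omega> - simple_integral W (E m) \<omega>))\<^sup>2) \<partial>M) \<longlonglongrightarrow> 0"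
    "Z \<in> borel_measurable M" "\<And>s \<omega>. s \<in> {a<..b} \<Longrightarrow> \<omega> \<in> space M \<Longrightarrow> \<Phi> s \<omega> \<in> L20 Q"
    by (rule has_ito_integralD[OF Z]) blast
  show ?thesis
  proof (rule has_ito_integralI[of a b E, OF E(1) _ _ E(4,5) L'])
    show m: "(\<lambda>p. L20_dist Q (\<Phi>' (fst p) (snd p)) (simple_process (E m) (fst p) (snd p))) \<in> borel_measurable (interval a b \<Otimes>\<^sub>M M)" for m
      by (rule dist_simple_measurable[OF wm L' E(1)])
    have "(\<integral>\<^sup>+p. ennreal ((L20_dist Q (\<Phi>' (fst p) (snd p)) (simple_process (E m) (fst p) (snd p)))\<^sup>2) \<partial>(interval a b \<Otimes>\<^sub>M M))
       = (\<integral>\<^sup>+p. ennreal ((L20_dist Q (\<Phi> (fst p) (snd p)) (simple_process (E m) (fst p) (snd p)))\<^sup>2) \<partial>(interval a b \<Otimes>\<^sub>M M))" for m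
    proof -
      note [measurable] = m[of m] E(2)[of m]
      have "AE s in lborel. s \<noteq> b" by (rule AE_lborel_singleton)
      then have "AE s in lborel. (\<integral>\<^sup>+\<omega>. ennreal ((L20_dist Q (\<Phi>' s \<omega>) (simple_process (E m) s \<omega>))\<^sup>2) \<partial>M) * indicator {a<..b} s
         = (\<integral>\<^sup>+\<omega>. ennreal ((L20_dist Q (\<Phi> s \<omega>) (simple_process (E m) s \<omega>))\<^sup>2) \<partial>M) * indicator {a<..b} s"
      proof eventually_elim
        case (elim s)
        then show ?case using eq[of s] by (cases "s \<in> {a<..b}") (auto intro!: nn_integral_cong)
      qed
      from nn_integral_cong_AE[OF this] show ?thesis
        by (subst (1 2) pair_interval_nn(1)) (auto)
    qed
    then show "(\<lambda>m. \<integral>\<^sup>+p. ennreal ((L20_dist Q (\<Phi>' (fst p) (snd p)) (simple_process (E m) (fst p) (snd p)))\<^sup>2) \<partial>(interval a b \<Otimes>\<^sub>M M)) \<longlonglongrightarrow> 0"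
      using E(3) by simp
  qed
qed

lemma has_ito_trivial:
  fixes \<Phi> :: "real \<Rightarrow> 'w \<Rightarrow> 'u \<Rightarrow> 'h::{real_inner, second_countable_topology}"
  shows "has_ito_integral M F Q W a a \<Phi> (\<lambda>_. 0)"
proof (rule has_ito_integralI[where E = "\<lambda>_. []"])
  have sp: "space (interval a a \<Otimes>\<^sub>M M) = {}" by (simp add: space_pair_measure interval_space)
  show "(\<lambda>p. L20_dist Q (\<Phi> (fst p) (snd p)) (simple_process [] (fst p) (snd p))) \<in> borel_measurable (interval a a \<Otimes>\<^sub>M M)"
    by (simp add: measurable_def sp)
  show "(\<lambda>m. \<integral>\<^sup>+p. ennreal ((L20_dist Q (\<Phi> (fst p) (snd p)) (simple_process [] (fst p) (snd p)))\<^sup>2) \<partial>(interval a a \<Otimes>\<^sub>M M)) \<longlonglongrightarrow> 0"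
    by (subst nn_integral_cong[where v = "\<lambda>_. 0"]) (auto simp: sp)
qed (auto simp: simple_integrand_def simple_integral_def)

end

section \<open>Integrals of integrands that are constant in time\<close>

text \<open>Fatou's lemma in the form used for completeness arguments, where the bound holds only
  from some index on.\<close>

lemma nn_integral_Fatou_bound:
  fixes f :: "nat \<Rightarrow> 'a \<Rightarrow> ennreal"
  assumes [measurable]: "\<And>j. f j \<in> borel_measurable N"
    and lim: "AE x in N. (\<lambda>j. f j x) \<longlonglongrightarrow> g x"
    and le: "eventually (\<lambda>j. (\<integral>\<^sup>+x. f j x \<partial>N) \<le> C) sequentially"
  shows "(\<integral>\<^sup>+x. g x \<partial>N) \<le> C"
proof -
  have "AE x in N. g x = liminf (\<lambda>j. f j x)"
    using lim by eventually_elim (simp add: lim_imp_Liminf)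
  then have "(\<integral>\<^sup>+x. g x \<partial>N) = (\<integral>\<^sup>+x. liminf (\<lambda>j. f j x) \<partial>N)" by (rule nn_integral_cong_AE)
  also have "\<dots> \<le> liminf (\<lambda>j. \<integral>\<^sup>+x. f j x \<partial>N)" by (rule nn_integral_liminf) measurable
  also have "\<dots> \<le> limsup (\<lambda>j. \<integral>\<^sup>+x. f j x \<partial>N)" by (rule Liminf_le_Limsup) simp
  also have "\<dots> \<le> C" using le by (rule Limsup_bounded)
  finally show ?thesis .
qed

text \<open>The dyadic points of the interval are dense. Approaching \<open>r\<close> by rounding
  down keeps the approximating points inside \<open>{a..b}\<close>.\<close>

lemma continuous_bounded_on_dyadics:
  fixes \<phi> :: "real \<Rightarrow> 'h::real_normed_vector"
  assumes c: "continuous_on {a..b} \<phi>" and ab: "a \<le> b"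
    and le: "\<And>k p. k \<le> 2 ^ p \<Longrightarrow> norm (\<phi> (a + (b - a) * (real k / 2 ^ p))) \<le> C"
    and r: "r \<in> {a..b}"
  shows "norm (\<phi> r) \<le> C"
proof (cases "a = b")
  case True
  then show ?thesis using le[of 0 0] r by simp
next
  case False
  then have ab: "a < b" using ab by simp
  define x where "x = (r - a) / (b - a)"
  have x: "0 \<le> x" "x \<le> 1" "r = a + (b - a) * x" using r ab by (auto simp: x_def)
  define k where "k p = nat \<lfloor>x * 2 ^ p\<rfloor>" for p :: nat
  have kr: "real (k p) = of_int \<lfloor>x * 2 ^ p\<rfloor>" for p using x by (simp add: k_def)
  have kle: "real (k p) \<le> x * 2 ^ p" "x * 2 ^ p < real (k p) + 1" for p unfolding kr by linarith+
  have k1: "k p \<le> 2 ^ p" for p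
  proof -
    have "real (k p) \<le> 1 * 2 ^ p" using kle(1)[of p] x(2) by (meson mult_right_mono order_trans zero_le_numeral zero_le_power)
    then show ?thesis by (metis mult_1 of_nat_le_iff of_nat_numeral of_nat_power)
  qed
  define q where "q p = a + (b - a) * (real (k p) / 2 ^ p)" for p
  have "(\<lambda>p. real (k p) / 2 ^ p) \<longlonglongrightarrow> x"
  proof (rule tendsto_sandwich)
    show "\<forall>\<^sub>F p in sequentially. x - (1/2) ^ p \<le> real (k p) / 2 ^ p"
    proof (intro always_eventually allI)
      fix p
      have "x - (1/2) ^ p = (x * 2 ^ p - 1) / 2 ^ p" by (simp add: diff_divide_distrib power_one_over inverse_eq_divide)
      also have "\<dots> \<le> real (k p) / 2 ^ p" using kle(2)[of p] by (intro divide_right_mono) auto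
      finally show "x - (1/2) ^ p \<le> real (k p) / 2 ^ p" .
    qed
    show "\<forall>\<^sub>F p in sequentially. real (k p) / 2 ^ p \<le> x"
      using kle(1) by (intro always_eventually allI) (auto simp: field_simps)
    have "(\<lambda>p. x - (1/2) ^ p) \<longlonglongrightarrow> x - 0" by (intro tendsto_intros LIMSEQ_realpow_zero) auto
    then show "(\<lambda>p. x - (1/2) ^ p) \<longlonglongrightarrow> x" by simp
  qed simp
  then have q: "q \<longlonglongrightarrow> r" unfolding q_def x(3) by (intro tendsto_intros)
  have qab: "q p \<in> {a..b}" for p
  proof -
    have "0 \<le> real (k p) / 2 ^ p" "real (k p) / 2 ^ p \<le> 1"
      using k1[of p] by (auto simp: divide_le_eq_1)
    then show ?thesis using ab mult_left_le[of "real (k p) / 2 ^ p" "b - a"] by (auto simp: q_def)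
  qed
  have "(\<lambda>p. \<phi> (q p)) \<longlonglongrightarrow> \<phi> r"
    using c q r qab unfolding continuous_on_sequentially comp_def by blast
  then have "(\<lambda>p. norm (\<phi> (q p))) \<longlonglongrightarrow> norm (\<phi> r)" by (rule tendsto_norm)
  then show ?thesis using le[OF k1] by (intro LIMSEQ_le_const2) (auto simp: q_def)
qed

context wiener_space
begin

section \<open>Time-constant simple integrands as martingales, and the maximal inequality\<close>

definition block :: "real \<Rightarrow> real \<Rightarrow> (('w \<Rightarrow> real) \<times> 'u \<times> 'h) list \<Rightarrow> ('w, 'u, 'h) simple" where
  "block a r L = map (\<lambda>(\<psi>, u, x). (a, r, \<psi>, u, x)) L"

definition coefficients :: "real \<Rightarrow> (('w \<Rightarrow> real) \<times> 'u \<times> 'h) list \<Rightarrow> bool" where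
  "coefficients a L \<longleftrightarrow> (\<forall>(\<psi>, u, x)\<in>set L. \<psi> \<in> borel_measurable (F a) \<and> (\<exists>K. \<forall>\<omega>\<in>space M. \<bar>\<psi> \<omega>\<bar> \<le> K))"

text \<open>For admissible coefficients and fixed \<open>L\<close> this is a martingale in
  \<open>r\<close>: the coefficients are known at time \<open>a\<close>, and only the increments
  vary.\<close>

definition block_int :: "real \<Rightarrow> real \<Rightarrow> (('w \<Rightarrow> real) \<times> 'u \<times> 'h::real_vector) list \<Rightarrow> 'w \<Rightarrow> 'h" where
  "block_int a r L = simple_integral W (block a r L)"

lemma block_int_eq: "block_int a r L \<omega> = (\<Sum>(\<psi>, u, x)\<leftarrow>L. (\<psi> \<omega> * dW a r u \<omega>) *\<^sub>R x)"
  unfolding block_int_def block_def simple_integral_def by (simp add: comp_def case_prod_unfold dW_def)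

lemma coefficients_mono: "coefficients a L \<Longrightarrow> a \<le> a' \<Longrightarrow> coefficients a' L"
  unfolding coefficients_def using measurable_F_mono by blast

lemma block_simple: "coefficients a L \<Longrightarrow> a \<le> r \<Longrightarrow> r \<le> b \<Longrightarrow> simple_integrand M F a b (block a r L)"
  unfolding simple_integrand_def block_def coefficients_def by auto

lemma block_int_split: "block_int a b L \<omega> = block_int a r L \<omega> + block_int r b L \<omega>"
  unfolding block_int_eq
  by (induction L) (auto simp: dW_split[of a b _ \<omega> r] algebra_simps)

lemma block_int_measF:
  fixes L :: "(('w \<Rightarrow> real) \<times> 'u \<times> 'h::{real_normed_vector, second_countable_topology}) list"
  assumes "coefficients a L" "a \<le> r" shows "block_int a r L \<in> borel_measurable (F r)"
  using assms(1)
proof (induction L)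
  case Nil then show ?case by (simp add: block_int_eq[abs_def])
next
  case (Cons p L)
  obtain \<psi> u x where p: "p = (\<psi>, u, x)" by (cases p)
  have [measurable]: "\<psi> \<in> borel_measurable (F r)" "block_int a r L \<in> borel_measurable (F r)" "dW a r u \<in> borel_measurable (F r)"
    using Cons measurable_F_mono[OF _ assms(2)] dW_measF[OF assms(2)] by (auto simp: coefficients_def p)
  have "block_int a r (p # L) = (\<lambda>\<omega>. (\<psi> \<omega> * dW a r u \<omega>) *\<^sub>R x + block_int a r L \<omega>)"
    by (rule ext) (simp add: block_int_eq p)
  then show ?case by simp
qed

lemma block_int_sq:
  fixes L :: "(('w \<Rightarrow> real) \<times> 'u \<times> 'h::{real_inner, second_countable_topology}) list"
  shows "coefficients a L \<Longrightarrow> a \<le> r \<Longrightarrow> square_integrable M (block_int a r L)"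
  unfolding block_int_def by (rule Ito_isometry_simple(2)[OF block_simple]) auto

lemma block_int_continuous:
  fixes L :: "(('w \<Rightarrow> real) \<times> 'u \<times> 'h::real_normed_vector) list"
  shows "AE \<omega> in M. continuous_on UNIV (\<lambda>r. block_int a r L \<omega>)"
proof (induction L)
  case Nil show ?case by (simp add: block_int_eq)
next
  case (Cons p L)
  obtain \<psi> u x where p: "p = (\<psi>, u, x)" by (cases p)
  have "AE \<omega> in M. continuous_on UNIV (\<lambda>t. W t u \<omega>)" using wiener unfolding two_sided_wiener_def by blast
  with Cons show ?case
    by eventually_elim (auto simp: block_int_eq p dW_def intro!: continuous_intros)
qed

text \<open>The squared norm of a martingale is a submartingale, here tested on events of
  \<open>F r\<close>. The cross term vanishes because the later increment is orthogonal to the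
  earlier value cut off to \<open>A\<close>.\<close>

lemma submartingale_block_int:
  fixes L :: "(('w \<Rightarrow> real) \<times> 'u \<times> 'h::{real_inner, second_countable_topology}) list"
  assumes L: "coefficients a L" and o: "a \<le> r" "r \<le> b" and A: "A \<in> sets (F r)"
  shows "(\<integral>\<omega>. indicator A \<omega> * (norm (block_int a r L \<omega>))\<^sup>2 \<partial>M) \<le> (\<integral>\<omega>. indicator A \<omega> * (norm (block_int a b L \<omega>))\<^sup>2 \<partial>M)"
proof -
  have AM[measurable]: "A \<in> sets M" using A F_sub[of r] by (auto simp: subalgebra_def)
  define V where "V \<omega> = indicator A \<omega> *\<^sub>R block_int a r L \<omega>" for \<omega>
  have ar: "square_integrable M (block_int a r L)" and ab: "square_integrable M (block_int a b L)"
    and rb: "square_integrable M (block_int r b L)"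
    using o by (auto intro!: block_int_sq L coefficients_mono[OF L])
  have [measurable]: "block_int a r L \<in> borel_measurable (F r)" by (rule block_int_measF[OF L o(1)])
  have "V \<in> borel_measurable (F r)" unfolding V_def using A by measurable
  have iA: "integrable M (\<lambda>\<omega>. indicator A \<omega> * (norm (X \<omega>))\<^sup>2)" if "square_integrable M X" for X :: "'w \<Rightarrow> 'h"
    by (rule bounded_mult_integrable[where C = 1]) (use that in \<open>auto simp: square_integrable_def indicator_def\<close>)
  have Vs: "square_integrable M V"
  proof (rule square_integrable_mono_le)
    show "V \<in> borel_measurable M" by (rule measurable_F_M[OF \<open>V \<in> borel_measurable (F r)\<close>])
    have "(\<integral>\<^sup>+\<omega>. ennreal ((norm (V \<omega>))\<^sup>2) \<partial>M) \<le> (\<integral>\<^sup>+\<omega>. ennreal ((norm (block_int a r L \<omega>))\<^sup>2) \<partial>M)"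
      by (intro nn_integral_mono) (auto simp: V_def indicator_def)
    also have "\<dots> < \<infinity>" by (rule square_int_le[OF ar])
    finally show "(\<integral>\<^sup>+\<omega>. ennreal ((norm (V \<omega>))\<^sup>2) \<partial>M) < \<infinity>" .
  qed
  have z: "(\<integral>\<omega>. inner (V \<omega>) (block_int r b L \<omega>) \<partial>M) = 0"
    unfolding block_int_def[of r b]
    by (rule simple_integral_orth[OF block_simple[OF coefficients_mono[OF L o(1)] o(2) order_refl] \<open>V \<in> borel_measurable (F r)\<close> Vs])
  have "(\<integral>\<omega>. indicator A \<omega> * (norm (block_int a r L \<omega>))\<^sup>2 \<partial>M)
      = (\<integral>\<omega>. indicator A \<omega> * (norm (block_int a r L \<omega>))\<^sup>2 + 2 * inner (V \<omega>) (block_int r b L \<omega>) \<partial>M)"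
    using z inner_integrable[OF Vs rb] iA[OF ar] by simp
  also have "\<dots> \<le> (\<integral>\<omega>. indicator A \<omega> * (norm (block_int a b L \<omega>))\<^sup>2 \<partial>M)"
  proof (rule integral_mono)
    show "integrable M (\<lambda>\<omega>. indicator A \<omega> * (norm (block_int a r L \<omega>))\<^sup>2 + 2 * inner (V \<omega>) (block_int r b L \<omega>))"
      using inner_integrable[OF Vs rb] iA[OF ar] by simp
    show "integrable M (\<lambda>\<omega>. indicator A \<omega> * (norm (block_int a b L \<omega>))\<^sup>2)" by (rule iA[OF ab])
    fix \<omega>
    have "(norm (block_int a b L \<omega>))\<^sup>2 = (norm (block_int a r L \<omega>))\<^sup>2 + 2 * inner (block_int a r L \<omega>) (block_int r b L \<omega>) + (norm (block_int r b L \<omega>))\<^sup>2"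
      unfolding block_int_split[of a b L \<omega> r] power2_norm_eq_inner by (simp add: inner_simps inner_commute)
    then show "indicator A \<omega> * (norm (block_int a r L \<omega>))\<^sup>2 + 2 * inner (V \<omega>) (block_int r b L \<omega>)
        \<le> indicator A \<omega> * (norm (block_int a b L \<omega>))\<^sup>2"
      by (simp add: V_def indicator_def)
  qed
  finally show ?thesis .
qed

text \<open>Doob's argument: the event is split by the first index at which the level
  \<open>c\<close> is exceeded. Each piece is known at that time, so the submartingale inequality
  applies to it.\<close>

lemma maximal_inequality_finite:
  fixes r :: "nat \<Rightarrow> real" and L :: "(('w \<Rightarrow> real) \<times> 'u \<times> 'h::{real_inner, second_countable_topology}) list"
  assumes L: "coefficients a L" and r: "\<And>i. a \<le> r i" "\<And>i. r i \<le> b" "mono r" and c: "0 < c"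
  shows "c\<^sup>2 * prob {\<omega>\<in>space M. \<exists>i\<le>J. c < norm (block_int a (r i) L \<omega>)} \<le> (\<integral>\<omega>. (norm (block_int a b L \<omega>))\<^sup>2 \<partial>M)"
proof -
  define A where "A i = {\<omega>\<in>space M. c < norm (block_int a (r i) L \<omega>) \<and> (\<forall>j<i. \<not> c < norm (block_int a (r j) L \<omega>))}" for i
  have m: "block_int a (r j) L \<in> borel_measurable (F (r i))" if "j \<le> i" for i j
    by (rule measurable_F_mono[OF block_int_measF[OF L r(1)] monoD[OF r(3) that]])
  have AF: "A i \<in> sets (F (r i))" for i
  proof -
    have 1: "{\<omega>\<in>space (F (r i)). c < norm (block_int a (r j) L \<omega>)} \<in> sets (F (r i))" if "j \<le> i" for j
    proof -
      note [measurable] = m[OF that]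
      show ?thesis by measurable
    qed
    have "A i = {\<omega>\<in>space (F (r i)). c < norm (block_int a (r i) L \<omega>)} - (\<Union>j\<in>{..<i}. {\<omega>\<in>space (F (r i)). c < norm (block_int a (r j) L \<omega>)})"
      unfolding A_def F_space by blast
    also have "\<dots> \<in> sets (F (r i))"
      by (intro sets.Diff sets.finite_UN 1) auto
    finally show ?thesis .
  qed
  then have AM[measurable]: "A i \<in> sets M" for i using F_sub[of "r i"] by (auto simp: subalgebra_def)
  have disj: "disjoint_family_on A {..J}"
    unfolding disjoint_family_on_def
  proof (intro ballI impI)
    fix i j :: nat assume "i \<noteq> j"
    then consider "i < j" | "j < i" by linarith
    then show "A i \<inter> A j = {}"
    proof cases
      case 1 show ?thesis using 1 unfolding A_def by blast
    next
      case 2 show ?thesis using 2 unfolding A_def by blast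
    qed
  qed
  have un: "{\<omega>\<in>space M. \<exists>i\<le>J. c < norm (block_int a (r i) L \<omega>)} = (\<Union>i\<in>{..J}. A i)"
  proof (intro set_eqI iffI)
    fix \<omega> assume "\<omega> \<in> {\<omega>\<in>space M. \<exists>i\<le>J. c < norm (block_int a (r i) L \<omega>)}"
    then obtain i where i: "\<omega> \<in> space M" "i \<le> J" "c < norm (block_int a (r i) L \<omega>)" by blast
    define k where "k = (LEAST i. c < norm (block_int a (r i) L \<omega>))"
    have "c < norm (block_int a (r k) L \<omega>)" "k \<le> i" unfolding k_def using i(3) by (auto intro: LeastI Least_le)
    moreover have "\<not> c < norm (block_int a (r j) L \<omega>)" if "j < k" for j using that not_less_Least unfolding k_def by blast
    ultimately show "\<omega> \<in> (\<Union>i\<in>{..J}. A i)" using i by (auto simp: A_def intro!: bexI[of _ k])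
  qed (auto simp: A_def)
  have sq: "square_integrable M (block_int a t L)" if "a \<le> t" for t by (rule block_int_sq[OF L that])
  have iA: "integrable M (\<lambda>\<omega>. indicator (A i) \<omega> * (norm (block_int a t L \<omega>))\<^sup>2)" if "a \<le> t" for t i
    by (rule bounded_mult_integrable[where C = 1]) (use sq[OF that] in \<open>auto simp: square_integrable_def indicator_def\<close>)
  have ab: "a \<le> b" using r(1,2)[of 0] by linarith
  have one: "c\<^sup>2 * prob (A i) \<le> (\<integral>\<omega>. indicator (A i) \<omega> * (norm (block_int a b L \<omega>))\<^sup>2 \<partial>M)" for i
  proof -
    have "c\<^sup>2 * prob (A i) = (\<integral>\<omega>. indicator (A i) \<omega> * c\<^sup>2 \<partial>M)" by (simp add: mult.commute)
    also have "\<dots> \<le> (\<integral>\<omega>. indicator (A i) \<omega> * (norm (block_int a (r i) L \<omega>))\<^sup>2 \<partial>M)"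
    proof (rule integral_mono)
      show "integrable M (\<lambda>\<omega>. indicator (A i) \<omega> * c\<^sup>2)" by (intro integrable_mult_left integrable_real_indicator) (auto simp: emeasure_eq_measure)
      show "indicator (A i) \<omega> * c\<^sup>2 \<le> indicator (A i) \<omega> * (norm (block_int a (r i) L \<omega>))\<^sup>2" for \<omega>
        using c by (auto simp: A_def indicator_def intro!: power_mono)
    qed (rule iA[OF r(1)])
    also have "\<dots> \<le> (\<integral>\<omega>. indicator (A i) \<omega> * (norm (block_int a b L \<omega>))\<^sup>2 \<partial>M)"
      by (rule submartingale_block_int[OF L r(1,2) AF])
    finally show ?thesis .
  qed
  have "c\<^sup>2 * prob (\<Union>i\<in>{..J}. A i) = (\<Sum>i\<le>J. c\<^sup>2 * prob (A i))"
    by (subst finite_measure_finite_Union) (use disj in \<open>auto simp: sum_distrib_left\<close>)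
  also have "\<dots> \<le> (\<Sum>i\<le>J. (\<integral>\<omega>. indicator (A i) \<omega> * (norm (block_int a b L \<omega>))\<^sup>2 \<partial>M))" by (rule sum_mono[OF one])
  also have "\<dots> = (\<integral>\<omega>. (\<Sum>i\<le>J. indicator (A i) \<omega> * (norm (block_int a b L \<omega>))\<^sup>2) \<partial>M)"
    by (rule Bochner_Integration.integral_sum[symmetric]) (rule iA[OF ab])
  also have "\<dots> \<le> (\<integral>\<omega>. (norm (block_int a b L \<omega>))\<^sup>2 \<partial>M)"
  proof (rule integral_mono)
    show "integrable M (\<lambda>\<omega>. (\<Sum>i\<le>J. indicator (A i) \<omega> * (norm (block_int a b L \<omega>))\<^sup>2))"
      by (intro Bochner_Integration.integrable_sum iA[OF ab])
    show "integrable M (\<lambda>\<omega>. (norm (block_int a b L \<omega>))\<^sup>2)" using sq[OF ab] by (simp add: square_integrable_def)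
    fix \<omega>
    have "(\<Sum>i\<le>J. indicator (A i) \<omega>) = (indicator (\<Union>i\<in>{..J}. A i) \<omega> :: real)"
      by (rule indicator_UN_disjoint[symmetric]) (use disj in auto)
    then have "(\<Sum>i\<le>J. indicator (A i) \<omega>) \<le> (1::real)" by (simp add: indicator_def)
    then show "(\<Sum>i\<le>J. indicator (A i) \<omega> * (norm (block_int a b L \<omega>))\<^sup>2) \<le> (norm (block_int a b L \<omega>))\<^sup>2"
      unfolding sum_distrib_right[symmetric] by (intro mult_left_le_one_le) (auto simp: sum_nonneg)
  qed
  finally show ?thesis unfolding un .
qed

text \<open>The dyadic grids are nested, so their exceedance events increase to the event
  \<open>A\<close>; continuity of the paths extends the bound from dyadic times to all
  times.\<close>

lemma maximal_inequality:
  fixes L :: "(('w \<Rightarrow> real) \<times> 'u \<times> 'h::{real_inner, second_countable_topology}) list"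
  assumes L: "coefficients a L" and ab: "a \<le> b" and c: "0 < c"
  obtains A where "A \<in> sets M" "c\<^sup>2 * prob A \<le> (\<integral>\<omega>. (norm (block_int a b L \<omega>))\<^sup>2 \<partial>M)"
    "AE \<omega> in M. \<omega> \<notin> A \<longrightarrow> (\<forall>r\<in>{a..b}. norm (block_int a r L \<omega>) \<le> c)"
proof -
  \<comment> \<open>The minimum with \<open>2 ^ p\<close> makes \<open>q p\<close> monotone on all
    indices, as the finite inequality demands; after the last grid point it stays at
    \<open>b\<close>.\<close>
  define q where "q p k = a + (b - a) * (real (min k (2 ^ p)) / 2 ^ p)" for p k :: nat
  have q01: "0 \<le> real (min k (2 ^ p)) / 2 ^ p" "real (min k (2 ^ p)) / 2 ^ p \<le> 1" for p k :: nat
    by (auto simp: divide_le_eq_1)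
  have qab: "a \<le> q p k" "q p k \<le> b" for p k
    using q01[of k p] ab mult_left_le[of "real (min k (2 ^ p)) / 2 ^ p" "b - a"] by (auto simp: q_def)
  have qm: "mono (q p)" for p
    unfolding q_def mono_def using ab by (intro allI impI add_left_mono mult_left_mono divide_right_mono) auto
  define A where "A p = {\<omega>\<in>space M. \<exists>k\<le>2^p. c < norm (block_int a (q p k) L \<omega>)}" for p
  have Ab: "c\<^sup>2 * prob (A p) \<le> (\<integral>\<omega>. (norm (block_int a b L \<omega>))\<^sup>2 \<partial>M)" for p
    unfolding A_def by (rule maximal_inequality_finite[OF L qab qm c])
  have [measurable]: "block_int a t L \<in> borel_measurable M" if "a \<le> t" for t
    by (rule measurable_F_M[OF block_int_measF[OF L that]])
  have AM: "A p \<in> sets M" for p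
  proof -
    have 1: "{\<omega>\<in>space M. c < norm (block_int a (q p k) L \<omega>)} \<in> sets M" for k
      using qab(1)[of p k] by measurable
    have "A p = (\<Union>k\<in>{..2^p}. {\<omega>\<in>space M. c < norm (block_int a (q p k) L \<omega>)})"
      unfolding A_def by blast
    also have "\<dots> \<in> sets M" by (intro sets.finite_UN 1) auto
    finally show ?thesis .
  qed
  have inc: "incseq A"
  proof (rule incseq_SucI, rule subsetI)
    fix p \<omega> assume "\<omega> \<in> A p"
    then obtain k where k: "\<omega> \<in> space M" "k \<le> 2^p" "c < norm (block_int a (q p k) L \<omega>)" by (auto simp: A_def)
    \<comment> \<open>Nestedness: the point with index \<open>k\<close> has index
      \<open>2 * k\<close> in the next grid.\<close>
    have "q (Suc p) (2 * k) = q p k" using k(2) by (simp add: q_def min_def)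
    then show "\<omega> \<in> A (Suc p)" using k by (auto simp: A_def intro!: exI[of _ "2 * k"])
  qed
  have "(\<lambda>p. c\<^sup>2 * prob (A p)) \<longlonglongrightarrow> c\<^sup>2 * prob (\<Union>p. A p)"
    by (intro tendsto_mult_left finite_Lim_measure_incseq) (use AM inc in auto)
  then have "c\<^sup>2 * prob (\<Union>p. A p) \<le> (\<integral>\<omega>. (norm (block_int a b L \<omega>))\<^sup>2 \<partial>M)"
    using Ab by (intro LIMSEQ_le_const2) auto
  moreover have "AE \<omega> in M. \<omega> \<notin> (\<Union>p. A p) \<longrightarrow> (\<forall>r\<in>{a..b}. norm (block_int a r L \<omega>) \<le> c)"
    using block_int_continuous[of a L] AE_space
  proof eventually_elim
    case (elim \<omega>)
    show ?case
    proof (intro impI ballI)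
      fix r assume w: "\<omega> \<notin> (\<Union>p. A p)" and r: "r \<in> {a..b}"
      show "norm (block_int a r L \<omega>) \<le> c"
      proof (rule continuous_bounded_on_dyadics[OF continuous_on_subset[OF elim(1)] ab _ r])
        fix k p :: nat assume k: "k \<le> 2 ^ p"
        have "\<not> c < norm (block_int a (q p k) L \<omega>)" using w elim(2) k by (auto simp: A_def)
        then show "norm (block_int a (a + (b - a) * (real k / 2 ^ p)) L \<omega>) \<le> c" using k by (simp add: q_def min_def)
      qed simp
    qed
  qed
  ultimately show ?thesis using that[of "\<Union>p. A p"] AM by auto
qed

text \<open>The approximant of rank \<open>m\<close> is the nearest of the first \<open>m + 1\<close> operators of the enumeration.
  It depends on the operator alone, so it commutes with the Wiener shift even though nothing relates
  the shift to the filtration.\<close>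

definition nearest_op :: "nat \<Rightarrow> ('u \<Rightarrow> 'h::{real_normed_vector, second_countable_topology}) \<Rightarrow> nat" where
  "nearest_op m T = (LEAST k. k \<le> m \<and>
     (\<forall>j\<le>m. L20_dist Q T (finite_rank_op (dense_ops Q k)) \<le> L20_dist Q T (finite_rank_op (dense_ops Q j))))"

definition nearest_err :: "nat \<Rightarrow> ('u \<Rightarrow> 'h::{real_normed_vector, second_countable_topology}) \<Rightarrow> real" where
  "nearest_err m T = L20_dist Q T (finite_rank_op (dense_ops Q (nearest_op m T)))"

section \<open>Canonical approximants, chosen path by path\<close>

definition op_dW :: "real \<Rightarrow> real \<Rightarrow> ('u \<times> 'h::real_vector) list \<Rightarrow> 'w \<Rightarrow> 'h" where
  "op_dW a b l \<omega> = (\<Sum>(u, x)\<leftarrow>l. dW a b u \<omega> *\<^sub>R x)"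

text \<open>The random choice of an operator from the enumeration is encoded by indicator
  coefficients, which brings it into the form of a simple integrand.\<close>

definition approx_coeffs :: "('w \<Rightarrow> 'u \<Rightarrow> 'h::{real_normed_vector, second_countable_topology}) \<Rightarrow> nat \<Rightarrow> (('w \<Rightarrow> real) \<times> 'u \<times> 'h) list" where
  "approx_coeffs \<Gamma> m = concat (map (\<lambda>k. map (\<lambda>(u, x). (\<lambda>\<omega>. indicator {k} (nearest_op m (\<Gamma> \<omega>)), u, x)) (dense_ops Q k)) [0..<Suc m])"

lemma nearest_op:
  fixes T :: "'u \<Rightarrow> 'h::{real_normed_vector, second_countable_topology}"
  shows nearest_op_le: "nearest_op m T \<le> m"
    and nearest_err_le: "j \<le> m \<Longrightarrow> nearest_err m T \<le> L20_dist Q T (finite_rank_op (dense_ops Q j))"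
proof -
  let ?d = "\<lambda>k. L20_dist Q T (finite_rank_op (dense_ops Q k :: ('u \<times> 'h) list))"
  obtain k where "k \<in> {..m}" "\<forall>j\<in>{..m}. ?d k \<le> ?d j"
    using ex_min_if_finite[of "?d ` {..m}"] by (auto simp: not_less)
  then have "\<exists>k. k \<le> m \<and> (\<forall>j\<le>m. ?d k \<le> ?d j)" by auto
  from LeastI_ex[OF this] show "nearest_op m T \<le> m" "j \<le> m \<Longrightarrow> nearest_err m T \<le> ?d j"
    unfolding nearest_op_def nearest_err_def by auto
qed

lemma nearest_err_nonneg: "0 \<le> nearest_err m T" unfolding nearest_err_def by (rule L20_norm_nonneg)

lemma nearest_err_le_norm: "nearest_err m T \<le> L20_norm Q T"
  for T :: "'u \<Rightarrow> 'h::{real_normed_vector, second_countable_topology}"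
  using nearest_err_le[of 0 m T] by (simp add: dense_ops_0 finite_rank_op_def)

lemma nearest_err_tendsto:
  fixes T :: "'u \<Rightarrow> 'h::{real_normed_vector, second_countable_topology}"
  assumes "T \<in> L20 Q" shows "(\<lambda>m. nearest_err m T) \<longlonglongrightarrow> 0"
proof (rule LIMSEQ_I)
  fix e :: real assume "0 < e"
  then obtain k where k: "L20_dist Q T (finite_rank_op (dense_ops Q k)) < e" using dense_ops_dense[OF assms] by blast
  have "norm (nearest_err m T - 0) < e" if "m \<ge> k" for m
    using nearest_err_le[OF that, of T] k nearest_err_nonneg[of m T] by simp
  then show "\<exists>no. \<forall>m\<ge>no. norm (nearest_err m T - 0) < e" by blast
qed

text \<open>Only values on the basis enter. This matters because the noise coefficient is periodic
  on \<open>U0 Q\<close> only.\<close>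

lemma nearest_op_cong:
  fixes T T' :: "'u \<Rightarrow> 'h::{real_normed_vector, second_countable_topology}"
  assumes "\<And>v. v \<in> B \<Longrightarrow> T v = T' v" shows "nearest_op m T = nearest_op m T'"
proof -
  have "L20_dist Q T S = L20_dist Q T' S" for S by (rule L20_norm_cong) (simp add: assms)
  then show ?thesis by (simp add: nearest_op_def)
qed

lemma sum_list_indicator:
  fixes f :: "nat \<Rightarrow> 'a::comm_monoid_add"
  assumes "b \<le> m" shows "(\<Sum>k\<leftarrow>[0..<Suc m]. if b = k then f k else 0) = f b"
  using assms by (subst interv_sum_list_conv_sum_set_nat) (auto simp: sum.delta)

lemma approx_sum:
  fixes \<Gamma> :: "'w \<Rightarrow> 'u \<Rightarrow> 'h::{real_normed_vector, second_countable_topology}"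
  shows "(\<Sum>(\<psi>, u, x)\<leftarrow>approx_coeffs \<Gamma> m. (\<psi> \<omega> * \<phi> u) *\<^sub>R x) = (\<Sum>(u, x)\<leftarrow>dense_ops Q (nearest_op m (\<Gamma> \<omega>)). \<phi> u *\<^sub>R x)"
proof -
  let ?b = "nearest_op m (\<Gamma> \<omega>)"
  have 1: "(\<Sum>(\<psi>, u, x)\<leftarrow>map (\<lambda>(u, x). (\<lambda>\<omega>. indicator {k} (nearest_op m (\<Gamma> \<omega>)), u, x)) l. (\<psi> \<omega> * \<phi> u) *\<^sub>R x)
     = (if ?b = k then (\<Sum>(u, x)\<leftarrow>l. \<phi> u *\<^sub>R x) else 0)" for k and l :: "('u \<times> 'h) list"
    by (induction l) (auto simp: indicator_def)
  have "(\<Sum>(\<psi>, u, x)\<leftarrow>approx_coeffs \<Gamma> m. (\<psi> \<omega> * \<phi> u) *\<^sub>R x)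
    = (\<Sum>k\<leftarrow>[0..<Suc m]. \<Sum>(\<psi>, u, x)\<leftarrow>map (\<lambda>(u, x). (\<lambda>\<omega>. indicator {k} (nearest_op m (\<Gamma> \<omega>)), u, x)) (dense_ops Q k). (\<psi> \<omega> * \<phi> u) *\<^sub>R x)"
  proof -
    have "sum_list (map h (concat (map g ks))) = (\<Sum>k\<leftarrow>ks. sum_list (map h (g k)))"
      for h :: "('w \<Rightarrow> real) \<times> 'u \<times> 'h \<Rightarrow> 'h" and g :: "nat \<Rightarrow> (('w \<Rightarrow> real) \<times> 'u \<times> 'h) list" and ks
      by (induction ks) auto
    then show ?thesis unfolding approx_coeffs_def by blast
  qed
  also have "\<dots> = (\<Sum>(u, x)\<leftarrow>dense_ops Q ?b. \<phi> u *\<^sub>R x)"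
    unfolding 1 by (rule sum_list_indicator[OF nearest_op_le])
  finally show ?thesis .
qed

text \<open>Path by path, the integral of the approximant is the chosen operator applied to the
  increment. It is in this form that the shift can be inserted.\<close>

lemma approx_int: "block_int a b (approx_coeffs \<Gamma> m) \<omega> = op_dW a b (dense_ops Q (nearest_op m (\<Gamma> \<omega>))) \<omega>"
  unfolding block_int_eq op_dW_def by (rule approx_sum)

lemma approx_process:
  assumes "s \<in> {a<..b}"
  shows "simple_process (block a b (approx_coeffs \<Gamma> m)) s \<omega> = finite_rank_op (dense_ops Q (nearest_op m (\<Gamma> \<omega>)))"
proof
  fix v
  have "simple_process (block a b (approx_coeffs \<Gamma> m)) s \<omega> v = (\<Sum>(\<psi>, u, x)\<leftarrow>approx_coeffs \<Gamma> m. (\<psi> \<omega> * inner u v) *\<^sub>R x)"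
    using assms by (simp add: simple_process_def block_def comp_def case_prod_unfold)
  also have "\<dots> = finite_rank_op (dense_ops Q (nearest_op m (\<Gamma> \<omega>))) v" unfolding finite_rank_op_def by (rule approx_sum)
  finally show "simple_process (block a b (approx_coeffs \<Gamma> m)) s \<omega> v = finite_rank_op (dense_ops Q (nearest_op m (\<Gamma> \<omega>))) v" .
qed

definition random_op :: "real \<Rightarrow> ('w \<Rightarrow> 'u \<Rightarrow> 'h::{real_normed_vector, second_countable_topology}) \<Rightarrow> bool" where
  "random_op a \<Gamma> \<longleftrightarrow> (\<forall>\<omega>\<in>space M. \<Gamma> \<omega> \<in> L20 Q) \<and> (\<forall>v\<in>B. (\<lambda>\<omega>. \<Gamma> \<omega> v) \<in> borel_measurable (F a)) \<and>
     (\<integral>\<^sup>+\<omega>. ennreal ((L20_norm Q (\<Gamma> \<omega>))\<^sup>2) \<partial>M) < \<infinity>"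

lemma random_op_dist_measurable:
  assumes "random_op a \<Gamma>"
  shows "(\<lambda>\<omega>. L20_dist Q (\<Gamma> \<omega>) (finite_rank_op l)) \<in> borel_measurable (F a)"
  using assms unfolding random_op_def
  by (intro L20_norm_measurable) (auto simp: F_space intro!: L20_diff finite_rank_op_L20)

lemma nearest_op_measurable:
  assumes "random_op a \<Gamma>"
  shows "(\<lambda>\<omega>. nearest_op m (\<Gamma> \<omega>)) \<in> measurable (F a) (count_space UNIV)"
proof -
  note [measurable] = random_op_dist_measurable[OF assms]
  show ?thesis unfolding nearest_op_def by measurable
qed

lemma nearest_err_measurable:
  assumes "random_op a \<Gamma>"
  shows "(\<lambda>\<omega>. nearest_err m (\<Gamma> \<omega>)) \<in> borel_measurable (F a)"
  unfolding nearest_err_def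
  by (rule measurable_compose_countable[OF random_op_dist_measurable[OF assms] nearest_op_measurable[OF assms]])

lemma approx_coefficients:
  assumes "random_op a \<Gamma>" shows "coefficients a (approx_coeffs \<Gamma> m)"
proof -
  have "(\<lambda>\<omega>. indicator {k} (nearest_op m (\<Gamma> \<omega>)) :: real) \<in> borel_measurable (F a)" for k
    by (rule measurable_compose[OF nearest_op_measurable[OF assms]]) simp
  then show ?thesis
    unfolding coefficients_def approx_coeffs_def
    by (auto intro!: exI[of _ 1] simp: indicator_def)
qed

definition op_energy_err :: "('w \<Rightarrow> 'u \<Rightarrow> 'h::{real_normed_vector, second_countable_topology}) \<Rightarrow> nat \<Rightarrow> ennreal" where
  "op_energy_err \<Gamma> m = (\<integral>\<^sup>+\<omega>. ennreal ((nearest_err m (\<Gamma> \<omega>))\<^sup>2) \<partial>M)"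

text \<open>Dominated convergence; the norm of \<open>\<Gamma>\<close> is a majorant because the
  enumeration starts with the zero operator.\<close>

lemma op_energy_err_tendsto:
  assumes G: "random_op a \<Gamma>" shows "op_energy_err \<Gamma> \<longlonglongrightarrow> 0"
proof -
  have [measurable]: "(\<lambda>\<omega>. nearest_err m (\<Gamma> \<omega>)) \<in> borel_measurable M" for m
    by (rule measurable_F_M[OF nearest_err_measurable[OF G]])
  have [measurable]: "(\<lambda>\<omega>. L20_norm Q (\<Gamma> \<omega>)) \<in> borel_measurable M"
    using G unfolding random_op_def by (intro L20_norm_measurable) (auto intro: measurable_F_M)
  have "(\<lambda>m. \<integral>\<^sup>+\<omega>. ennreal ((nearest_err m (\<Gamma> \<omega>))\<^sup>2) \<partial>M) \<longlonglongrightarrow> (\<integral>\<^sup>+\<omega>. 0 \<partial>M)"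
  proof (rule nn_integral_dominated_convergence[where w = "\<lambda>\<omega>. ennreal ((L20_norm Q (\<Gamma> \<omega>))\<^sup>2)"])
    show "AE \<omega> in M. ennreal ((nearest_err m (\<Gamma> \<omega>))\<^sup>2) \<le> ennreal ((L20_norm Q (\<Gamma> \<omega>))\<^sup>2)" for m
      by (intro AE_I2 ennreal_leI power_mono nearest_err_le_norm nearest_err_nonneg)
    show "(\<integral>\<^sup>+\<omega>. ennreal ((L20_norm Q (\<Gamma> \<omega>))\<^sup>2) \<partial>M) < \<infinity>" using G by (simp add: random_op_def)
    show "AE \<omega> in M. (\<lambda>m. ennreal ((nearest_err m (\<Gamma> \<omega>))\<^sup>2)) \<longlonglongrightarrow> 0"
    proof (rule AE_I2)
      fix \<omega> assume "\<omega> \<in> space M"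
      then have "(\<lambda>m. nearest_err m (\<Gamma> \<omega>)) \<longlonglongrightarrow> 0" using G by (intro nearest_err_tendsto) (auto simp: random_op_def)
      then have "(\<lambda>m. ennreal ((nearest_err m (\<Gamma> \<omega>))\<^sup>2)) \<longlonglongrightarrow> ennreal (0\<^sup>2)" by (intro tendsto_ennrealI tendsto_power)
      then show "(\<lambda>m. ennreal ((nearest_err m (\<Gamma> \<omega>))\<^sup>2)) \<longlonglongrightarrow> 0" by simp
    qed
  qed measurable
  then show ?thesis by (simp add: op_energy_err_def[abs_def])
qed

lemma random_op_weakly_measurable:
  assumes "random_op a \<Gamma>" shows "weakly_measurable a' b (\<lambda>_. \<Gamma>)"
  unfolding weakly_measurable_def
proof
  fix v assume "v \<in> B"
  then have "(\<lambda>\<omega>. \<Gamma> \<omega> v) \<in> borel_measurable M" using assms by (auto simp: random_op_def intro: measurable_F_M)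
  then show "(\<lambda>p. \<Gamma> (snd p) v) \<in> borel_measurable (interval a' b \<Otimes>\<^sub>M M)" by (rule measurable_compose[OF measurable_snd])
qed

lemma approx_energy:
  fixes \<Gamma> :: "'w \<Rightarrow> 'u \<Rightarrow> 'h::{real_inner, second_countable_topology}"
  assumes G: "random_op a \<Gamma>" and ab: "a \<le> b"
  shows "(\<integral>\<^sup>+p. ennreal ((L20_dist Q (\<Gamma> (snd p)) (simple_process (block a b (approx_coeffs \<Gamma> m)) (fst p) (snd p)))\<^sup>2) \<partial>(interval a b \<Otimes>\<^sub>M M))
     = ennreal (b - a) * op_energy_err \<Gamma> m"
proof -
  have [measurable]: "(\<lambda>\<omega>. nearest_err m (\<Gamma> \<omega>)) \<in> borel_measurable M"
    by (rule measurable_F_M[OF nearest_err_measurable[OF G]])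
  have "(\<integral>\<^sup>+p. ennreal ((L20_dist Q (\<Gamma> (snd p)) (simple_process (block a b (approx_coeffs \<Gamma> m)) (fst p) (snd p)))\<^sup>2) \<partial>(interval a b \<Otimes>\<^sub>M M))
     = (\<integral>\<^sup>+p. ennreal ((nearest_err m (\<Gamma> (snd p)))\<^sup>2) \<partial>(interval a b \<Otimes>\<^sub>M M))"
    by (intro nn_integral_cong) (auto simp: approx_process nearest_err_def space_pair_measure interval_space)
  also have "\<dots> = ennreal (b - a) * op_energy_err \<Gamma> m"
    unfolding op_energy_err_def by (rule pair_interval_const[OF _ ab]) measurable
  finally show ?thesis .
qed

text \<open>Every version of the integral is the limit of the same explicit approximants, with an
  error bound independent of the approximating sequence hidden in
  \<open>has_ito_integral\<close>.\<close>

lemma const_integral_approx: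
  fixes \<Gamma> :: "'w \<Rightarrow> 'u \<Rightarrow> 'h::{real_inner, second_countable_topology}"
  assumes G: "random_op a \<Gamma>" and ab: "a \<le> b" and Z: "has_ito_integral M F Q W a b (\<lambda>_. \<Gamma>) Z"
  shows "(\<integral>\<^sup>+\<omega>. ennreal ((norm (Z \<omega> - block_int a b (approx_coeffs \<Gamma> m) \<omega>))\<^sup>2) \<partial>M) \<le> ennreal (b - a) * op_energy_err \<Gamma> m"
  unfolding block_int_def approx_energy[OF G ab, symmetric]
proof (rule Ito_diff_le[OF Z has_ito_simple])
  show s: "simple_integrand M F a b (block a b (approx_coeffs \<Gamma> m))"
    by (rule block_simple[OF approx_coefficients[OF G] ab order_refl])
  have "(\<lambda>p. L20_dist Q (\<Gamma> (snd p)) (simple_process (block a b (approx_coeffs \<Gamma> m)) (fst p) (snd p))) \<in> borel_measurable (interval a b \<Otimes>\<^sub>M M)"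
    using dist_simple_measurable[OF random_op_weakly_measurable[OF G] _ s] G by (simp add: random_op_def)
  then show "(\<lambda>p. ennreal ((L20_dist Q (\<Gamma> (snd p)) (simple_process (block a b (approx_coeffs \<Gamma> m)) (fst p) (snd p)))\<^sup>2)) \<in> borel_measurable (interval a b \<Otimes>\<^sub>M M)"
    by measurable
qed simp


text \<open>The null set that is removed lies in every \<open>F t\<close> by the usual conditions,
  so a process changed only outside \<open>\<Omega>0\<close> to a constant remains adapted.\<close>

lemma null_modification:
  assumes "AE \<omega> in M. P \<omega>"
  obtains \<Omega>0 where "\<Omega>0 \<in> sets M" "\<And>t. \<Omega>0 \<in> sets (F t)" "\<Omega>0 \<subseteq> space M" "\<And>\<omega>. \<omega> \<in> \<Omega>0 \<Longrightarrow> P \<omega>" "AE \<omega> in M. \<omega> \<in> \<Omega>0"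
proof -
  obtain N where N: "N \<in> null_sets M" "{\<omega>\<in>space M. \<not> P \<omega>} \<subseteq> N"
    using assms by (auto elim!: AE_E intro!: null_setsI)
  have "space M - N \<in> sets (F t)" for t
    using F_null[OF N(1), of t] F_space[of t] by (metis sets.compl_sets)
  moreover have "AE \<omega> in M. \<omega> \<in> space M - N" using AE_not_in[OF N(1)] AE_space by eventually_elim auto
  ultimately show ?thesis using N that[of "space M - N"] by (auto simp: null_setsD2)
qed

lemma measurable_F_AE:
  fixes X Y :: "'w \<Rightarrow> 'h::{real_normed_vector, second_countable_topology}"
  assumes X: "X \<in> borel_measurable (F t)" and Y: "Y \<in> borel_measurable M" and ae: "AE \<omega> in M. X \<omega> = Y \<omega>"
  shows "Y \<in> borel_measurable (F t)"
proof (rule measurableI)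
  fix A :: "'h set" assume A: "A \<in> sets borel"
  obtain \<Omega>0 where O: "\<Omega>0 \<in> sets M" "\<And>t. \<Omega>0 \<in> sets (F t)" "\<Omega>0 \<subseteq> space M" "\<And>\<omega>. \<omega> \<in> \<Omega>0 \<Longrightarrow> X \<omega> = Y \<omega>" "AE \<omega> in M. \<omega> \<in> \<Omega>0"
    using null_modification[OF ae] by blast
  have "Y -` A \<inter> space M \<in> sets M" using Y A by (rule measurable_sets)
  moreover have "{\<omega>\<in>space M. \<omega> \<notin> \<Omega>0} \<in> null_sets M"
    using O(1,5) by (subst AE_iff_null[symmetric]) auto
  ultimately have 1: "(Y -` A \<inter> space M) - \<Omega>0 \<in> null_sets M"
    using O(1) by (elim null_sets_subset) auto
  have 2: "(X -` A \<inter> space M) \<inter> \<Omega>0 \<in> sets (F t)"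
    using measurable_sets[OF X A] O(2) by (auto simp: F_space)
  have "Y -` A \<inter> space (F t) = ((X -` A \<inter> space M) \<inter> \<Omega>0) \<union> ((Y -` A \<inter> space M) - \<Omega>0)"
    using O(3,4) by (auto simp: F_space)
  then show "Y -` A \<inter> space (F t) \<in> sets (F t)" using 2 F_null[OF 1, of t] by auto
qed simp

text \<open>The approximants have continuous paths. Along a fast subsequence the maximal inequality
  and Borel-Cantelli make them converge uniformly on \<open>{a..b}\<close> almost surely, and the
  limit is a continuous version of the integral.\<close>

lemma const_integral_continuous:
  fixes \<Gamma> :: "'w \<Rightarrow> 'u \<Rightarrow> 'h::{real_inner, banach, second_countable_topology}"
  assumes G: "random_op a \<Gamma>" and ab: "a \<le> b"
  obtains Z where "\<And>r. r \<in> {a..b} \<Longrightarrow> has_ito_integral M F Q W a r (\<lambda>_. \<Gamma>) (Z r)"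
    "\<And>r. r \<in> {a..b} \<Longrightarrow> Z r \<in> borel_measurable (F r)"
    "\<And>\<omega>. \<omega> \<in> space M \<Longrightarrow> continuous_on {a..b} (\<lambda>r. Z r \<omega>)"
    "\<And>\<omega>. Z a \<omega> = 0"
proof -
  have "\<exists>m. op_energy_err \<Gamma> m \<le> ennreal ((1/16) ^ i)" for i
  proof -
    have "eventually (\<lambda>m. op_energy_err \<Gamma> m < ennreal ((1/16) ^ i)) sequentially"
      by (rule order_tendstoD(2)[OF op_energy_err_tendsto[OF G]]) simp
    then show ?thesis by (auto simp: eventually_sequentially intro: less_imp_le)
  qed
  \<comment> \<open>Energies of order \<open>(1/16) ^ i\<close> are compared with the level
    \<open>(1/2) ^ i\<close>, whose square is \<open>(1/4) ^ i\<close>; the exceedance probabilities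
    are then of order \<open>(1/4) ^ i\<close>, hence summable.\<close>
  then obtain \<mu> where \<mu>: "\<And>i. op_energy_err \<Gamma> (\<mu> i) \<le> ennreal ((1/16) ^ i)" by metis
  define N where "N i r = block_int a r (approx_coeffs \<Gamma> (\<mu> i))" for i r
  note co = approx_coefficients[OF G]
  have sdist: "L20_dist Q (finite_rank_op l) (finite_rank_op l') \<le> L20_dist Q T (finite_rank_op l) + L20_dist Q T (finite_rank_op l')"
    if "T \<in> L20 Q" for T and l l' :: "('u \<times> 'h) list"
    using L20_dist_triangle[OF finite_rank_op_L20[of l] that finite_rank_op_L20[of l']] L20_dist_commute[of T "finite_rank_op l"] by simp
  have Nm: "N i r \<in> borel_measurable (F r)" if "a \<le> r" for i r unfolding N_def by (rule block_int_measF[OF co that])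
  have NM: "N i r \<in> borel_measurable M" if "a \<le> r" for i r by (rule measurable_F_M[OF Nm[OF that]])
  have Ndiff: "(\<integral>\<^sup>+\<omega>. ennreal ((norm (N j r \<omega> - N i r \<omega>))\<^sup>2) \<partial>M) \<le> ennreal (r - a) * ennreal (4 * (1/16) ^ i)"
    if r: "a \<le> r" and ij: "i \<le> j" for i j r
  proof -
    have [measurable]: "(\<lambda>\<omega>. nearest_err m (\<Gamma> \<omega>)) \<in> borel_measurable M" for m
      by (rule measurable_F_M[OF nearest_err_measurable[OF G]])
    have "(\<integral>\<^sup>+\<omega>. ennreal ((norm (N j r \<omega> - N i r \<omega>))\<^sup>2) \<partial>M)
       = (\<integral>\<^sup>+p. ennreal ((L20_dist Q (simple_process (block a r (approx_coeffs \<Gamma> (\<mu> j))) (fst p) (snd p))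
            (simple_process (block a r (approx_coeffs \<Gamma> (\<mu> i))) (fst p) (snd p)))\<^sup>2) \<partial>(interval a r \<Otimes>\<^sub>M M))"
      unfolding N_def block_int_def by (intro Ito_diff_simple block_simple co r order_refl)
    also have "\<dots> \<le> (\<integral>\<^sup>+p. 2 * ennreal ((nearest_err (\<mu> j) (\<Gamma> (snd p)))\<^sup>2) + 2 * ennreal ((nearest_err (\<mu> i) (\<Gamma> (snd p)))\<^sup>2) \<partial>(interval a r \<Otimes>\<^sub>M M))"
    proof (rule nn_integral_mono)
      fix p assume "p \<in> space (interval a r \<Otimes>\<^sub>M M)"
      then have p: "fst p \<in> {a<..r}" "snd p \<in> space M" by (auto simp: space_pair_measure interval_space)
      let ?d = "L20_dist Q (simple_process (block a r (approx_coeffs \<Gamma> (\<mu> j))) (fst p) (snd p))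
            (simple_process (block a r (approx_coeffs \<Gamma> (\<mu> i))) (fst p) (snd p))"
      have "\<Gamma> (snd p) \<in> L20 Q" using G p by (simp add: random_op_def)
      then have "?d \<le> nearest_err (\<mu> j) (\<Gamma> (snd p)) + nearest_err (\<mu> i) (\<Gamma> (snd p))"
        unfolding approx_process[OF p(1)] nearest_err_def by (rule sdist)
      then have "?d\<^sup>2 \<le> (nearest_err (\<mu> j) (\<Gamma> (snd p)) + nearest_err (\<mu> i) (\<Gamma> (snd p)))\<^sup>2"
        by (intro power_mono L20_norm_nonneg)
      also have "\<dots> \<le> 2 * (nearest_err (\<mu> j) (\<Gamma> (snd p)))\<^sup>2 + 2 * (nearest_err (\<mu> i) (\<Gamma> (snd p)))\<^sup>2"
        using sum_squares_bound[of "nearest_err (\<mu> j) (\<Gamma> (snd p))" "nearest_err (\<mu> i) (\<Gamma> (snd p))"] by (simp add: power2_sum)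
      finally have "ennreal (?d\<^sup>2) \<le> ennreal (2 * (nearest_err (\<mu> j) (\<Gamma> (snd p)))\<^sup>2 + 2 * (nearest_err (\<mu> i) (\<Gamma> (snd p)))\<^sup>2)"
        by (rule ennreal_leI)
      then show "ennreal (?d\<^sup>2) \<le> 2 * ennreal ((nearest_err (\<mu> j) (\<Gamma> (snd p)))\<^sup>2) + 2 * ennreal ((nearest_err (\<mu> i) (\<Gamma> (snd p)))\<^sup>2)"
        by (simp add: ennreal_plus ennreal_mult)
    qed
    also have "\<dots> = ennreal (r - a) * (2 * op_energy_err \<Gamma> (\<mu> j) + 2 * op_energy_err \<Gamma> (\<mu> i))"
      unfolding op_energy_err_def
      by (subst pair_interval_const[OF _ r]) (auto simp: nn_integral_add nn_integral_cmult)
    also have "\<dots> \<le> ennreal (r - a) * ennreal (4 * (1/16) ^ i)"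
    proof (rule mult_left_mono)
      have "op_energy_err \<Gamma> (\<mu> j) \<le> ennreal ((1/16) ^ i)"
        using \<mu>[of j] ij by (elim order_trans) (auto intro!: ennreal_leI power_decreasing)
      then have "2 * op_energy_err \<Gamma> (\<mu> j) + 2 * op_energy_err \<Gamma> (\<mu> i) \<le> 2 * ennreal ((1/16) ^ i) + 2 * ennreal ((1/16) ^ i)"
        using \<mu>[of i] by (intro add_mono mult_left_mono) auto
      also have "\<dots> = ennreal (4 * (1/16) ^ i)" by (simp add: ennreal_mult distrib_right[symmetric])
      finally show "2 * op_energy_err \<Gamma> (\<mu> j) + 2 * op_energy_err \<Gamma> (\<mu> i) \<le> ennreal (4 * (1/16) ^ i)" .
    qed simp
    finally show ?thesis .
  qed
  have "\<exists>A. A \<in> sets M \<and> prob A \<le> 4 * (b - a) * (1/4) ^ i \<and>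
    (AE \<omega> in M. \<omega> \<notin> A \<longrightarrow> (\<forall>r\<in>{a..b}. norm (N (Suc i) r \<omega> - N i r \<omega>) \<le> (1/2) ^ i))" for i
  proof -
    \<comment> \<open>The difference of consecutive approximants, written as one block so that the
      maximal inequality applies to it.\<close>
    define L where "L = approx_coeffs \<Gamma> (\<mu> (Suc i)) @ map (\<lambda>(\<psi>, u, x). (\<psi>, u, - x)) (approx_coeffs \<Gamma> (\<mu> i))"
    have L: "coefficients a L" using co[of "\<mu> (Suc i)"] co[of "\<mu> i"] by (auto simp: coefficients_def L_def)
    have neg: "block_int a r (map (\<lambda>(\<psi>, u, x). (\<psi>, u, - x)) l) \<omega> = - block_int a r l \<omega>" for r \<omega> and l :: "(('w \<Rightarrow> real) \<times> 'u \<times> 'h) list"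
      by (induction l) (auto simp: block_int_eq)
    have Lr: "block_int a r L \<omega> = N (Suc i) r \<omega> - N i r \<omega>" for r \<omega>
      using neg[of r "approx_coeffs \<Gamma> (\<mu> i)" \<omega>] by (simp add: block_int_eq N_def L_def)
    obtain A where A: "A \<in> sets M" "((1/2) ^ i)\<^sup>2 * prob A \<le> (\<integral>\<omega>. (norm (block_int a b L \<omega>))\<^sup>2 \<partial>M)"
      "AE \<omega> in M. \<omega> \<notin> A \<longrightarrow> (\<forall>r\<in>{a..b}. norm (block_int a r L \<omega>) \<le> (1/2) ^ i)"
      using maximal_inequality[OF L ab, of "(1/2) ^ i"] by auto
    have "(\<integral>\<^sup>+\<omega>. ennreal ((norm (block_int a b L \<omega>))\<^sup>2) \<partial>M) \<le> ennreal (b - a) * ennreal (4 * (1/16) ^ i)"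
      unfolding Lr by (rule Ndiff[OF ab]) simp
    then have "ennreal (\<integral>\<omega>. (norm (block_int a b L \<omega>))\<^sup>2 \<partial>M) \<le> ennreal (b - a) * ennreal (4 * (1/16) ^ i)"
      using square_integrable_nn[OF block_int_sq[OF L ab]] by simp
    then have "(\<integral>\<omega>. (norm (block_int a b L \<omega>))\<^sup>2 \<partial>M) \<le> (b - a) * (4 * (1/16) ^ i)"
      using ab by (simp add: ennreal_mult[symmetric])
    with A(2) have "((1/2) ^ i)\<^sup>2 * prob A \<le> (b - a) * (4 * (1/16) ^ i)" by linarith
    moreover have "((1/2::real) ^ i)\<^sup>2 = (1/4) ^ i" by (simp add: power2_eq_square power_mult_distrib[symmetric])
    moreover have "(1/16::real) ^ i = (1/4) ^ i * (1/4) ^ i" by (simp add: power_mult_distrib[symmetric])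
    ultimately have "(1/4) ^ i * prob A \<le> (1/4) ^ i * (4 * (b - a) * (1/4) ^ i)" by (simp add: algebra_simps)
    then have "prob A \<le> 4 * (b - a) * (1/4) ^ i" by (simp add: mult_le_cancel_left_pos)
    with A Lr show ?thesis by auto
  qed
  then have "\<exists>A. \<forall>i. A i \<in> sets M \<and> prob (A i) \<le> 4 * (b - a) * (1/4) ^ i \<and>
    (AE \<omega> in M. \<omega> \<notin> A i \<longrightarrow> (\<forall>r\<in>{a..b}. norm (N (Suc i) r \<omega> - N i r \<omega>) \<le> (1/2) ^ i))"
    by (intro choice allI)
  then obtain A where AA: "\<forall>i. A i \<in> sets M \<and> prob (A i) \<le> 4 * (b - a) * (1/4) ^ i \<and>
    (AE \<omega> in M. \<omega> \<notin> A i \<longrightarrow> (\<forall>r\<in>{a..b}. norm (N (Suc i) r \<omega> - N i r \<omega>) \<le> (1/2) ^ i))" by (rule exE)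
  have A: "\<And>i. A i \<in> sets M" "\<And>i. prob (A i) \<le> 4 * (b - a) * (1/4) ^ i"
    "\<And>i. AE \<omega> in M. \<omega> \<notin> A i \<longrightarrow> (\<forall>r\<in>{a..b}. norm (N (Suc i) r \<omega> - N i r \<omega>) \<le> (1/2) ^ i)"
    by (rule AA[rule_format, THEN conjunct1], rule AA[rule_format, THEN conjunct2, THEN conjunct1],
        rule AA[rule_format, THEN conjunct2, THEN conjunct2])
  have "summable (\<lambda>i. prob (A i))"
    by (rule summable_comparison_test'[of "\<lambda>i. 4 * (b - a) * (1/4) ^ i" 0]) (use A(2) in auto)
  then have "AE \<omega> in M. eventually (\<lambda>i. \<omega> \<in> space M - A i) sequentially"
    by (intro borel_cantelli_AE1 A(1)) (auto simp: emeasure_eq_measure)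
  moreover have "AE \<omega> in M. \<forall>i. \<omega> \<notin> A i \<longrightarrow> (\<forall>r\<in>{a..b}. norm (N (Suc i) r \<omega> - N i r \<omega>) \<le> (1/2) ^ i)"
    using A(3) by (simp add: AE_all_countable)
  moreover have "AE \<omega> in M. \<forall>i. continuous_on UNIV (\<lambda>r. N i r \<omega>)"
    unfolding AE_all_countable N_def by (intro allI block_int_continuous)
  ultimately have "AE \<omega> in M. (\<forall>i. continuous_on {a..b} (\<lambda>r. N i r \<omega>)) \<and>
      (\<forall>\<^sub>F i in sequentially. \<forall>r\<in>{a..b}. norm (N (Suc i) r \<omega> - N i r \<omega>) \<le> (1/2) ^ i)"
  proof eventually_elim
    case (elim \<omega>)
    then have "\<forall>\<^sub>F i in sequentially. \<forall>r\<in>{a..b}. norm (N (Suc i) r \<omega> - N i r \<omega>) \<le> (1/2) ^ i"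
      by (auto elim!: eventually_mono)
    then show ?case using elim(3) by (auto intro: continuous_on_subset)
  qed
  then obtain \<Omega>0 where O: "\<And>t. \<Omega>0 \<in> sets (F t)" "\<Omega>0 \<subseteq> space M" "AE \<omega> in M. \<omega> \<in> \<Omega>0"
     "\<And>\<omega>. \<omega> \<in> \<Omega>0 \<Longrightarrow> (\<forall>i. continuous_on {a..b} (\<lambda>r. N i r \<omega>)) \<and>
      (\<forall>\<^sub>F i in sequentially. \<forall>r\<in>{a..b}. norm (N (Suc i) r \<omega> - N i r \<omega>) \<le> (1/2) ^ i)"
    by (rule null_modification) blast
  \<comment> \<open>The value 0 outside \<open>\<Omega>0\<close> makes every path continuous; since
    \<open>\<Omega>0\<close> lies in all \<open>F t\<close>, adaptedness is kept.\<close>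
  define Z where "Z r \<omega> = (if \<omega> \<in> \<Omega>0 then lim (\<lambda>i. N i r \<omega>) else 0)" for r \<omega>
  have uni: "uniform_limit {a..b} (\<lambda>i r. N i r \<omega>) (\<lambda>r. Z r \<omega>) sequentially" if w: "\<omega> \<in> \<Omega>0" for \<omega>
  proof -
    have "uniform_limit {a..b} (\<lambda>n r. \<Sum>i<n. N (Suc i) r \<omega> - N i r \<omega>) (\<lambda>r. \<Sum>i. N (Suc i) r \<omega> - N i r \<omega>) sequentially"
      by (rule Weierstrass_m_test_ev[where M = "\<lambda>i. (1/2) ^ i"]) (use O(4)[OF w] in auto)
    moreover have "(\<Sum>i<n. N (Suc i) r \<omega> - N i r \<omega>) = N n r \<omega> - N 0 r \<omega>" for n r by (rule sum_lessThan_telescope)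
    ultimately have "uniform_limit {a..b} (\<lambda>n r. N n r \<omega> - N 0 r \<omega>) (\<lambda>r. \<Sum>i. N (Suc i) r \<omega> - N i r \<omega>) sequentially" by simp
    then have u: "uniform_limit {a..b} (\<lambda>n r. N n r \<omega>) (\<lambda>r. (\<Sum>i. N (Suc i) r \<omega> - N i r \<omega>) + N 0 r \<omega>) sequentially"
      by (simp add: uniform_limit_iff dist_norm diff_diff_eq2 algebra_simps)
    have "Z r \<omega> = (\<Sum>i. N (Suc i) r \<omega> - N i r \<omega>) + N 0 r \<omega>" if "r \<in> {a..b}" for r
      using tendsto_uniform_limitI[OF u that] w by (simp add: Z_def limI)
    then show ?thesis using u by (simp add: uniform_limit_iff)
  qed
  have lim: "(\<lambda>i. N i r \<omega>) \<longlonglongrightarrow> Z r \<omega>" if "\<omega> \<in> \<Omega>0" "r \<in> {a..b}" for r \<omega>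
    by (rule tendsto_uniform_limitI[OF uni[OF that(1)] that(2)])
  have Zc: "continuous_on {a..b} (\<lambda>r. Z r \<omega>)" if "\<omega> \<in> space M" for \<omega>
  proof (cases "\<omega> \<in> \<Omega>0")
    case True
    then show ?thesis by (intro uniform_limit_theorem[OF _ uni[OF True]]) (use O(4) in auto)
  qed (simp add: Z_def)
  have Zm: "Z r \<in> borel_measurable (F r)" if "r \<in> {a..b}" for r
  proof -
    have [measurable]: "N i r \<in> borel_measurable (F r)" for i by (rule Nm) (use that in auto)
    have [measurable]: "\<Omega>0 \<in> sets (F r)" by (rule O(1))
    show ?thesis unfolding Z_def by measurable
  qed
  have Za: "Z a \<omega> = 0" for \<omega>
  proof -
    have "N i a \<omega> = 0" for i by (simp add: N_def block_int_eq dW_def case_prod_unfold comp_def)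
    then show ?thesis by (simp add: Z_def)
  qed
  have ito: "has_ito_integral M F Q W a r (\<lambda>_. \<Gamma>) (Z r)" if r: "r \<in> {a..b}" for r
  proof (rule has_ito_integralI[where E = "\<lambda>i. block a r (approx_coeffs \<Gamma> (\<mu> i))"])
    have ar: "a \<le> r" using r by simp
    show s: "simple_integrand M F a r (block a r (approx_coeffs \<Gamma> (\<mu> i)))" for i by (rule block_simple[OF co ar order_refl])
    show L: "\<Gamma> \<omega> \<in> L20 Q" if "\<omega> \<in> space M" for \<omega> using G that by (simp add: random_op_def)
    show "(\<lambda>p. L20_dist Q (\<Gamma> (snd p)) (simple_process (block a r (approx_coeffs \<Gamma> (\<mu> i))) (fst p) (snd p))) \<in> borel_measurable (interval a r \<Otimes>\<^sub>M M)" for i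
      by (rule dist_simple_measurable[OF random_op_weakly_measurable[OF G] L s])
    have e0: "(\<lambda>i. ennreal ((1/16) ^ i)) \<longlonglongrightarrow> 0"
    proof -
      have "(\<lambda>i. ennreal ((1/16) ^ i)) \<longlonglongrightarrow> ennreal 0" by (intro tendsto_ennrealI LIMSEQ_realpow_zero) auto
      then show ?thesis by simp
    qed
    have "(\<lambda>i. op_energy_err \<Gamma> (\<mu> i)) \<longlonglongrightarrow> 0"
      by (rule tendsto_sandwich[OF _ _ tendsto_const e0]) (auto intro: always_eventually \<mu>)
    then have "(\<lambda>i. ennreal (r - a) * op_energy_err \<Gamma> (\<mu> i)) \<longlonglongrightarrow> ennreal (r - a) * 0"
      by (intro ennreal_tendsto_cmult) auto
    then show "(\<lambda>i. \<integral>\<^sup>+p. ennreal ((L20_dist Q (\<Gamma> (snd p)) (simple_process (block a r (approx_coeffs \<Gamma> (\<mu> i))) (fst p) (snd p)))\<^sup>2) \<partial>(interval a r \<Otimes>\<^sub>M M)) \<longlonglongrightarrow> 0"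
      by (simp add: approx_energy[OF G ar])
    show ZM: "Z r \<in> borel_measurable M" by (rule measurable_F_M[OF Zm[OF r]])
    \<comment> \<open>By Fatou's lemma the later index in \<open>Ndiff\<close> may tend to infinity,
      so the pointwise limit is also the limit in mean square.\<close>
    have le: "(\<integral>\<^sup>+\<omega>. ennreal ((norm (Z r \<omega> - N i r \<omega>))\<^sup>2) \<partial>M) \<le> ennreal (r - a) * ennreal (4 * (1/16) ^ i)" for i
    proof (rule nn_integral_Fatou_bound[where f = "\<lambda>j \<omega>. ennreal ((norm (N j r \<omega> - N i r \<omega>))\<^sup>2)"])
      note [measurable] = NM[OF ar]
      show "(\<lambda>\<omega>. ennreal ((norm (N j r \<omega> - N i r \<omega>))\<^sup>2)) \<in> borel_measurable M" for j by measurable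
      show "AE \<omega> in M. (\<lambda>j. ennreal ((norm (N j r \<omega> - N i r \<omega>))\<^sup>2)) \<longlonglongrightarrow> ennreal ((norm (Z r \<omega> - N i r \<omega>))\<^sup>2)"
        using O(3)
      proof eventually_elim
        case (elim \<omega>)
        show ?case by (intro tendsto_ennrealI tendsto_power tendsto_norm tendsto_diff tendsto_const lim[OF elim r])
      qed
      show "\<forall>\<^sub>F j in sequentially. (\<integral>\<^sup>+\<omega>. ennreal ((norm (N j r \<omega> - N i r \<omega>))\<^sup>2) \<partial>M) \<le> ennreal (r - a) * ennreal (4 * (1/16) ^ i)"
        using Ndiff[OF ar] by (intro eventually_sequentiallyI[of i])
    qed
    have "(\<lambda>i. ennreal (r - a) * ennreal (4 * (1/16) ^ i)) \<longlonglongrightarrow> ennreal (r - a) * ennreal (4 * 0)"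
      by (intro ennreal_tendsto_cmult tendsto_ennrealI tendsto_mult_left LIMSEQ_realpow_zero) auto
    then have l0: "(\<lambda>i. ennreal (r - a) * ennreal (4 * (1/16) ^ i)) \<longlonglongrightarrow> 0" by simp
    show "(\<lambda>i. \<integral>\<^sup>+\<omega>. ennreal ((norm (Z r \<omega> - simple_integral W (block a r (approx_coeffs \<Gamma> (\<mu> i))) \<omega>))\<^sup>2) \<partial>M) \<longlonglongrightarrow> 0"
      unfolding block_int_def[symmetric] N_def[symmetric]
      by (rule tendsto_sandwich[OF _ _ tendsto_const l0]) (auto intro: always_eventually le)
  qed
  show ?thesis by (rule that[OF ito Zm Zc Za])
qed

end

section \<open>The semigroup on eigenvectors\<close>

text \<open>On \<open>x\<close> the semigroup is compared with the Euler products
  \<open>(1 - l * s) ^ k\<close>. The local error \<open>d s\<close> is of smaller order than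
  \<open>s\<close>, contractivity lets \<open>k\<close> local errors add up, and
  \<open>k * s = t\<close>; so the derivative at 0 is all that enters.\<close>

lemma semigroup_eigenvector:
  assumes S: "generates_contraction_semigroup D (\<lambda>x. - A x) S"
    and x: "x \<in> D" "A x = l *\<^sub>R x" and l: "0 \<le> l" and t: "0 \<le> t"
  shows "blinfun_apply (S t) x = exp (- l * t) *\<^sub>R x"
proof (cases "t = 0")
  case True
  then show ?thesis using S by (simp add: generates_contraction_semigroup_def)
next
  case False
  then have t: "0 < t" using t by simp
  have S0: "S 0 = id_blinfun" and Sadd: "\<And>s t. 0 \<le> s \<Longrightarrow> 0 \<le> t \<Longrightarrow> S (s + t) = S s o\<^sub>L S t"
    and Sn: "\<And>t. 0 \<le> t \<Longrightarrow> norm (S t) \<le> 1"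
    and gen: "((\<lambda>t. (blinfun_apply (S t) x - x) /\<^sub>R t) \<longlongrightarrow> - A x) (at_right 0)"
    using S x(1) unfolding generates_contraction_semigroup_def by blast+
  define d where "d s = S s x - (1 - l * s) *\<^sub>R x" for s
  \<comment> \<open>The condition \<open>l * s \<le> 1\<close> keeps the powers of
    \<open>1 - l * s\<close> in the unit interval, so earlier errors are not amplified.\<close>
  have key: "norm (S (real k * s) x - (1 - l * s) ^ k *\<^sub>R x) \<le> real k * norm (d s)"
    if s: "0 \<le> s" "l * s \<le> 1" for s k
  proof (induction k)
    case 0 then show ?case by (simp add: S0)
  next
    case (Suc k)
    have q: "\<bar>(1 - l * s) ^ k\<bar> \<le> 1" using s l by (simp add: power_abs power_le_one)
    have "S (real (Suc k) * s) x = S s (S (real k * s) x)"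
      using Sadd[of s "real k * s"] s by (simp add: distrib_right)
    then have "S (real (Suc k) * s) x - (1 - l * s) ^ Suc k *\<^sub>R x
       = S s (S (real k * s) x - (1 - l * s) ^ k *\<^sub>R x) + (1 - l * s) ^ k *\<^sub>R d s"
      by (simp add: d_def blinfun.diff_right blinfun.scaleR_right algebra_simps)
    also have "norm \<dots> \<le> norm (S (real k * s) x - (1 - l * s) ^ k *\<^sub>R x) + norm (d s)"
    proof (rule norm_triangle_le, rule add_mono)
      show "norm (S s (S (real k * s) x - (1 - l * s) ^ k *\<^sub>R x)) \<le> norm (S (real k * s) x - (1 - l * s) ^ k *\<^sub>R x)"
        using norm_blinfun[of "S s"] Sn[OF s(1)] by (meson mult_left_le_one_le norm_ge_zero order_trans)
      show "norm ((1 - l * s) ^ k *\<^sub>R d s) \<le> norm (d s)" using q by (simp add: mult_left_le_one_le)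
    qed
    also have "\<dots> \<le> real (Suc k) * norm (d s)" using Suc by (simp add: distrib_right)
    finally show ?case .
  qed
  have dlim: "((\<lambda>s. norm (d s) / s) \<longlongrightarrow> 0) (at_right 0)"
  proof -
    have "((\<lambda>s. norm ((S s x - x) /\<^sub>R s + A x)) \<longlongrightarrow> norm (- A x + A x)) (at_right 0)"
      by (intro tendsto_intros gen)
    then have z: "((\<lambda>s. norm ((S s x - x) /\<^sub>R s + A x)) \<longlongrightarrow> 0) (at_right 0)" by simp
    show ?thesis
    proof (rule Lim_transform_eventually[OF z])
      show "\<forall>\<^sub>F s in at_right 0. norm ((S s x - x) /\<^sub>R s + A x) = norm (d s) / s"
        unfolding eventually_at_filter
      proof (intro always_eventually allI impI)
        fix s :: real assume "s \<noteq> 0" "s \<in> {0<..}"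
        then have s: "0 < s" by simp
        have "(S s x - x) /\<^sub>R s + A x = (1/s) *\<^sub>R d s"
          using s by (simp add: d_def x(2) algebra_simps inverse_eq_divide)
        then show "norm ((S s x - x) /\<^sub>R s + A x) = norm (d s) / s" using s by simp
      qed
    qed
  qed
  define sq where "sq N = t / real (Suc N)" for N
  have sq0: "sq \<longlonglongrightarrow> 0"
  proof -
    have "(\<lambda>N. t * inverse (real (Suc N))) \<longlonglongrightarrow> t * 0" by (intro tendsto_intros LIMSEQ_inverse_real_of_nat)
    then show ?thesis by (simp add: sq_def[abs_def] divide_inverse)
  qed
  have sqp: "0 < sq N" for N using t by (simp add: sq_def)
  have fl: "filterlim sq (at_right 0) sequentially"
    unfolding filterlim_at using sq0 sqp less_imp_neq[OF sqp, symmetric] by auto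
  have e1: "(\<lambda>N. t * (norm (d (sq N)) / sq N)) \<longlonglongrightarrow> t * 0"
    by (intro tendsto_mult_left filterlim_compose[OF dlim fl])
  have ev: "\<forall>\<^sub>F N in sequentially. norm (S t x - (1 - l * sq N) ^ Suc N *\<^sub>R x) \<le> t * (norm (d (sq N)) / sq N)"
  proof -
    have "(\<lambda>N. l * sq N) \<longlonglongrightarrow> l * 0" by (intro tendsto_mult_left sq0)
    then have "\<forall>\<^sub>F N in sequentially. l * sq N < 1" by (rule order_tendstoD) simp
    then show ?thesis
    proof eventually_elim
      case (elim N)
      have "real (Suc N) * sq N = t" by (simp add: sq_def)
      moreover have "real (Suc N) * norm (d (sq N)) = t * (norm (d (sq N)) / sq N)" using t by (simp add: sq_def)
      ultimately show ?case using key[of "sq N" "Suc N"] sqp[of N] elim by simp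
    qed
  qed
  have "(\<lambda>N. norm (S t x - (1 - l * sq N) ^ Suc N *\<^sub>R x)) \<longlonglongrightarrow> 0"
    by (rule tendsto_sandwich[OF _ ev tendsto_const]) (use e1 in auto)
  moreover have "(\<lambda>N. norm (S t x - (1 - l * sq N) ^ Suc N *\<^sub>R x)) \<longlonglongrightarrow> norm (S t x - exp (- l * t) *\<^sub>R x)"
  proof (intro tendsto_intros)
    have "(\<lambda>N. (1 + (- l * t) / real (Suc N)) ^ Suc N) \<longlonglongrightarrow> exp (- l * t)"
      by (rule LIMSEQ_Suc[OF tendsto_exp_limit_sequentially])
    then show "(\<lambda>N. (1 - l * sq N) ^ Suc N) \<longlonglongrightarrow> exp (- l * t)" by (simp add: sq_def)
  qed
  ultimately have "norm (S t x - exp (- l * t) *\<^sub>R x) = 0" using LIMSEQ_unique by blast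
  then show ?thesis by simp
qed

section \<open>The one-step map and its contraction property\<close>

lemma L2_tendsto_unique:
  fixes X :: "nat \<Rightarrow> 'a \<Rightarrow> 'h::{real_normed_vector, second_countable_topology}"
  assumes [measurable]: "\<And>k. X k \<in> borel_measurable N" "Y \<in> borel_measurable N" "Z \<in> borel_measurable N"
    and Y: "(\<lambda>k. \<integral>\<^sup>+x. ennreal ((norm (X k x - Y x))\<^sup>2) \<partial>N) \<longlonglongrightarrow> 0"
    and Z: "(\<lambda>k. \<integral>\<^sup>+x. ennreal ((norm (X k x - Z x))\<^sup>2) \<partial>N) \<longlonglongrightarrow> 0"
  shows "AE x in N. Y x = Z x"
proof -
  have "(\<integral>\<^sup>+x. ennreal ((norm (Y x - Z x))\<^sup>2) \<partial>N)
    \<le> 2 * (\<integral>\<^sup>+x. ennreal ((norm (X k x - Y x))\<^sup>2) \<partial>N) + 2 * (\<integral>\<^sup>+x. ennreal ((norm (X k x - Z x))\<^sup>2) \<partial>N)" for k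
    by (rule nn_integral_norm_sum_le2) (measurable, norm)
  moreover have "(\<lambda>k. 2 * (\<integral>\<^sup>+x. ennreal ((norm (X k x - Y x))\<^sup>2) \<partial>N) + 2 * (\<integral>\<^sup>+x. ennreal ((norm (X k x - Z x))\<^sup>2) \<partial>N)) \<longlonglongrightarrow> 2 * 0 + 2 * 0"
    by (intro tendsto_add ennreal_tendsto_cmult Y Z) auto
  ultimately have "(\<integral>\<^sup>+x. ennreal ((norm (Y x - Z x))\<^sup>2) \<partial>N) \<le> 2 * 0 + 2 * 0"
    by (intro LIMSEQ_le_const) auto
  then have "(\<integral>\<^sup>+x. ennreal ((norm (Y x - Z x))\<^sup>2) \<partial>N) = 0" by simp
  then have "AE x in N. ennreal ((norm (Y x - Z x))\<^sup>2) = 0" by (subst (asm) nn_integral_0_iff_AE) auto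
  then show ?thesis by eventually_elim simp
qed

text \<open>The conditions on \<open>f\<close> and \<open>g\<close> are posed at all times, after
  periodic extension. \<open>h_small\<close> is the form in which the step size enters the one-step
  estimate: the quadratic drift term may consume half of the dissipation.\<close>

locale galerkin_scheme = wiener_space Q M F W
  for Q :: "'u::{real_inner, banach, second_countable_topology} \<Rightarrow>\<^sub>L 'u" and M :: "'w measure"
    and F :: "real \<Rightarrow> 'w measure" and W :: "real \<Rightarrow> 'u \<Rightarrow> 'w \<Rightarrow> real" +
  fixes S :: "real \<Rightarrow> 'h::{real_inner, banach, second_countable_topology} \<Rightarrow>\<^sub>L 'h"
    and e :: "nat \<Rightarrow> 'h" and lam :: "nat \<Rightarrow> real"
    and f :: "real \<Rightarrow> 'h \<Rightarrow> 'h" and g :: "real \<Rightarrow> 'h \<Rightarrow> 'u \<Rightarrow> 'h"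
    and n :: nat and h Cf Cg Cfg :: real
  assumes e_on: "\<And>i j. 1 \<le> i \<Longrightarrow> 1 \<le> j \<Longrightarrow> inner (e i) (e j) = (if i = j then 1 else 0)"
    and S_e: "\<And>i t. 1 \<le> i \<Longrightarrow> 0 \<le> t \<Longrightarrow> blinfun_apply (S t) (e i) = exp (- lam i * t) *\<^sub>R e i"
    and S_0: "S 0 = id_blinfun"
    and S_add: "\<And>s t. 0 \<le> s \<Longrightarrow> 0 \<le> t \<Longrightarrow> S (s + t) = S s o\<^sub>L S t"
    and S_norm: "\<And>t. 0 \<le> t \<Longrightarrow> norm (S t) \<le> 1"
    and g_L20: "\<And>t u. g t u \<in> L20 Q"
    and f_lip: "\<And>t u1 u2. norm (f t u1 - f t u2) \<le> Cf * norm (u1 - u2)"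
    and g_lip: "\<And>t u1 u2. L20_dist Q (g t u1) (g t u2) \<le> Cg * norm (u1 - u2)"
    and dissipative: "\<And>t u1 u2. 2 * inner (f t u1 - f t u2) (u1 - u2) + (L20_dist Q (g t u1) (g t u2))\<^sup>2
             \<le> - Cfg * (norm (u1 - u2))\<^sup>2"
    and C_pos: "0 \<le> Cf" "0 \<le> Cg" "0 < Cfg"
    and h_pos: "0 < h" and h_small: "Cf\<^sup>2 * h \<le> Cfg / 2"
begin

section \<open>The Galerkin projection and the projected coefficients\<close>

abbreviation "P \<equiv> galerkin_proj e n"
abbreviation "Hn \<equiv> galerkin_space e n"

lemma P_bounded_linear: "bounded_linear P"
  unfolding galerkin_proj_def[abs_def] by (intro bounded_linear_intros)

lemma P_linear: "linear P" by (rule bounded_linear.linear[OF P_bounded_linear])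

lemma P_in: "P x \<in> Hn"
  unfolding galerkin_proj_def galerkin_space_def by (intro span_sum span_scale span_base imageI) simp

lemma P_e: "i \<in> {1..n} \<Longrightarrow> P (e i) = e i"
proof -
  assume i: "i \<in> {1..n}"
  have "P (e i) = (\<Sum>j=1..n. if i = j then e j else 0)"
    unfolding galerkin_proj_def using e_on i by (intro sum.cong) auto
  then show ?thesis using i by simp
qed

lemma P_Hn: "x \<in> Hn \<Longrightarrow> P x = x"
  unfolding galerkin_space_def
proof (induction rule: span_induct_alt)
  case base show ?case by (simp add: linear_0[OF P_linear])
next
  case (step c x y)
  then show ?case using P_e by (auto simp: linear_add[OF P_linear] linear_scale[OF P_linear])
qed

lemma P_norm: "norm (P x) \<le> norm x"
proof -
  have on: "\<And>b b'. b \<in> {1..n} \<Longrightarrow> b' \<in> {1..n} \<Longrightarrow> inner (e b) (e b') = (if b = b' then 1 else 0)"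
    using e_on by auto
  have "(norm (0 - P x))\<^sup>2 = (norm (0::'h))\<^sup>2 - (\<Sum>b\<in>{1..n}. (inner 0 (e b))\<^sup>2) + (\<Sum>b\<in>{1..n}. (inner x (e b) - inner 0 (e b))\<^sup>2)"
    unfolding galerkin_proj_def by (rule orthonormal_family_defect[where B = "{1..n}" and c = e]) (use on in auto)
  then have "(norm (P x))\<^sup>2 = (\<Sum>b\<in>{1..n}. (inner x (e b))\<^sup>2)" by simp
  also have "\<dots> \<le> (norm x)\<^sup>2" by (rule Bessel_ineq[where B = "{1..n}"]) (use on in auto)
  finally show ?thesis by (rule power2_le_imp_le) simp
qed

lemma P_inner: assumes "y \<in> Hn" shows "inner (P x) y = inner x y"
proof -
  have "inner (P x) y = inner x (P y)"
    unfolding galerkin_proj_def by (simp add: inner_sum_left inner_sum_right inner_commute mult.commute)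
  then show ?thesis using P_Hn[OF assms] by simp
qed

lemma Hn_subspace: "subspace Hn" unfolding galerkin_space_def by (rule subspace_span)

lemma P_measurable[measurable]: "P \<in> borel_measurable borel"
  by (intro borel_measurable_continuous_onI linear_continuous_on P_bounded_linear)

lemma S_measurable[measurable]: "blinfun_apply (S t) \<in> borel_measurable borel"
  by (intro borel_measurable_continuous_onI linear_continuous_on blinfun.bounded_linear_right)

lemma S_contr: "0 \<le> t \<Longrightarrow> norm (S t x) \<le> norm x"
  using norm_blinfun[of "S t" x] S_norm[of t] by (meson mult_left_le_one_le norm_ge_zero order_trans)

text \<open>The explicit finite sum gives both the invariance of \<open>Hn\<close> and the
  continuity in time of the semigroup along continuous paths in \<open>Hn\<close>.\<close>

lemma S_Hn_eq: assumes "x \<in> Hn" "0 \<le> t"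
  shows "S t x = (\<Sum>i=1..n. (exp (- lam i * t) * inner x (e i)) *\<^sub>R e i)"
proof -
  have "S t x = S t (P x)" using P_Hn[OF assms(1)] by simp
  also have "\<dots> = (\<Sum>i=1..n. inner x (e i) *\<^sub>R S t (e i))"
    unfolding galerkin_proj_def by (simp add: blinfun.sum_right blinfun.scaleR_right)
  also have "\<dots> = (\<Sum>i=1..n. (exp (- lam i * t) * inner x (e i)) *\<^sub>R e i)"
    using S_e assms(2) by (intro sum.cong) (auto simp: mult.commute)
  finally show ?thesis .
qed

lemma S_in_Hn: "x \<in> Hn \<Longrightarrow> 0 \<le> t \<Longrightarrow> S t x \<in> Hn"
  unfolding S_Hn_eq unfolding galerkin_space_def by (intro span_sum span_scale span_base imageI) simp

definition fn :: "real \<Rightarrow> 'h \<Rightarrow> 'h" where "fn t y = P (f t y)"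
definition gn :: "real \<Rightarrow> 'h \<Rightarrow> 'u \<Rightarrow> 'h" where "gn t y v = P (g t y v)"

lemma fn_lip: "norm (fn t y - fn t y') \<le> Cf * norm (y - y')"
  unfolding fn_def linear_diff[OF P_linear, symmetric] by (rule order_trans[OF P_norm f_lip])

lemma gn_L20: "gn t y \<in> L20 Q"
  unfolding gn_def[abs_def] by (rule L20_bounded_linear[OF g_L20 P_bounded_linear])

lemma gn_dist: "L20_dist Q (gn t y) (gn t y') \<le> L20_dist Q (g t y) (g t y')"
proof -
  have "L20_norm Q (\<lambda>v. P (g t y v - g t y' v)) \<le> 1 * L20_dist Q (g t y) (g t y')"
    by (rule L20_norm_bounded_linear[OF L20_diff[OF g_L20 g_L20] P_bounded_linear]) (use P_norm in auto)
  then show ?thesis by (simp add: gn_def linear_diff[OF P_linear])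
qed

lemma gn_lip: "L20_dist Q (gn t y) (gn t y') \<le> Cg * norm (y - y')"
  by (rule order_trans[OF gn_dist g_lip])

text \<open>\<open>P\<close> is symmetric and fixes \<open>y - y'\<close>, so it disappears from the
  drift term; in the noise term it does not increase the norm.\<close>

lemma dissipative_n:
  assumes "y \<in> Hn" "y' \<in> Hn"
  shows "2 * inner (fn t y - fn t y') (y - y') + (L20_dist Q (gn t y) (gn t y'))\<^sup>2 \<le> - Cfg * (norm (y - y'))\<^sup>2"
proof -
  have "inner (fn t y - fn t y') (y - y') = inner (f t y - f t y') (y - y')"
    unfolding fn_def linear_diff[OF P_linear, symmetric] using assms Hn_subspace
    by (intro P_inner subspace_diff)
  moreover have "(L20_dist Q (gn t y) (gn t y'))\<^sup>2 \<le> (L20_dist Q (g t y) (g t y'))\<^sup>2"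
    by (intro power_mono gn_dist L20_norm_nonneg)
  ultimately show ?thesis using dissipative[of t y y'] by linarith
qed

lemma fn_measurable[measurable]: "fn t \<in> borel_measurable borel"
proof (intro borel_measurable_continuous_onI)
  have "Cf-lipschitz_on UNIV (fn t)" using fn_lip C_pos by (intro lipschitz_onI) (auto simp: dist_norm)
  then show "continuous_on UNIV (fn t)" by (rule lipschitz_on_continuous_on)
qed

lemma gn_measurable: assumes "v \<in> B" shows "(\<lambda>y. gn t y v) \<in> borel_measurable borel"
proof (intro borel_measurable_continuous_onI)
  have "norm (gn t y v - gn t y' v) \<le> Cg * norm (y - y')" for y y'
    using norm_le_L20_norm[OF L20_diff[OF gn_L20 gn_L20] assms] gn_lip order_trans by blast
  then have "Cg-lipschitz_on UNIV (\<lambda>y. gn t y v)" using C_pos by (intro lipschitz_onI) (auto simp: dist_norm)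
  then show "continuous_on UNIV (\<lambda>y. gn t y v)" by (rule lipschitz_on_continuous_on)
qed

lemma gn_random_op:
  assumes Y: "Y \<in> borel_measurable (F a)" "square_integrable M Y"
  shows "random_op a (\<lambda>\<omega>. gn t (Y \<omega>))"
  unfolding random_op_def
proof (intro conjI ballI)
  show "gn t (Y \<omega>) \<in> L20 Q" for \<omega> by (rule gn_L20)
  show "(\<lambda>\<omega>. gn t (Y \<omega>) v) \<in> borel_measurable (F a)" if "v \<in> B" for v
    by (rule measurable_compose[OF Y(1) gn_measurable[OF that]])
  let ?N = "L20_norm Q (gn t 0)"
  have [measurable]: "Y \<in> borel_measurable M" by (rule measurable_F_M[OF Y(1)])
  have "(\<integral>\<^sup>+\<omega>. ennreal ((L20_norm Q (gn t (Y \<omega>)))\<^sup>2) \<partial>M) \<le> ennreal (2 * ?N\<^sup>2) * (\<integral>\<^sup>+\<omega>. 1 \<partial>M) + ennreal (2 * Cg\<^sup>2) * (\<integral>\<^sup>+\<omega>. ennreal ((norm (Y \<omega>))\<^sup>2) \<partial>M)"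
  proof (rule nn_integral_le_combination)
    fix \<omega>
    have "L20_norm Q (gn t (Y \<omega>)) \<le> ?N + Cg * norm (Y \<omega>)"
      using L20_norm_triangle_diff[OF gn_L20[of t "Y \<omega>"] gn_L20[of t 0]] gn_lip[of t "Y \<omega>" 0] by simp
    then have "(L20_norm Q (gn t (Y \<omega>)))\<^sup>2 \<le> (?N + Cg * norm (Y \<omega>))\<^sup>2" by (intro power_mono L20_norm_nonneg)
    also have "\<dots> \<le> 2 * ?N\<^sup>2 * 1 + (2 * Cg\<^sup>2) * (norm (Y \<omega>))\<^sup>2"
      using sum_squares_bound[of ?N "Cg * norm (Y \<omega>)"] by (simp add: power2_sum power_mult_distrib)
    finally have "ennreal ((L20_norm Q (gn t (Y \<omega>)))\<^sup>2) \<le> ennreal (2 * ?N\<^sup>2 * 1 + (2 * Cg\<^sup>2) * (norm (Y \<omega>))\<^sup>2)" by (rule ennreal_leI)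
    also have "\<dots> = ennreal (2 * ?N\<^sup>2) * 1 + ennreal (2 * Cg\<^sup>2) * ennreal ((norm (Y \<omega>))\<^sup>2)"
      by (subst ennreal_plus) (auto simp: ennreal_mult)
    finally show "ennreal ((L20_norm Q (gn t (Y \<omega>)))\<^sup>2) \<le> ennreal (2 * ?N\<^sup>2) * 1 + ennreal (2 * Cg\<^sup>2) * ennreal ((norm (Y \<omega>))\<^sup>2)" .
  qed measurable
  also have "\<dots> < \<infinity>" using square_int_le[OF Y(2)] emeasure_space_1
    by (auto simp: ennreal_add_eq_top ennreal_mult_eq_top_iff less_top[symmetric])
  finally show "(\<integral>\<^sup>+\<omega>. ennreal ((L20_norm Q (gn t (Y \<omega>)))\<^sup>2) \<partial>M) < \<infinity>" .
qed

section \<open>One step of the scheme\<close>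

definition T :: "int \<Rightarrow> real" where "T j = of_int j * h"

lemma T_add: "T (j + k) = T j + of_int k * h" by (simp add: T_def algebra_simps)

lemma T_Suc: "T (j + 1) = T j + h" by (simp add: T_def algebra_simps)

definition adm :: "int \<Rightarrow> ('w \<Rightarrow> 'h) \<Rightarrow> bool" where
  "adm j Y \<longleftrightarrow> Y \<in> borel_measurable (F (T j)) \<and> square_integrable M Y \<and> (\<forall>\<omega>\<in>space M. Y \<omega> \<in> Hn)"

text \<open>For \<open>r = h\<close> this is a step of the scheme; smaller \<open>r\<close> gives
  the values of the continuous scheme between grid times. The projection in front of
  \<open>S r\<close> is absent because \<open>S r\<close> leaves \<open>Hn\<close>
  invariant.\<close>

definition step :: "int \<Rightarrow> real \<Rightarrow> ('w \<Rightarrow> 'h) \<Rightarrow> ('w \<Rightarrow> 'h) \<Rightarrow> bool" where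
  "step j r Y V \<longleftrightarrow> (\<exists>Z. has_ito_integral M F Q W (T j) (T j + r) (\<lambda>_ \<omega>. gn (T j) (Y \<omega>)) Z \<and>
     (AE \<omega> in M. V \<omega> = S r (Y \<omega> + r *\<^sub>R fn (T j) (Y \<omega>) + Z \<omega>)))"

lemma adm_M: "adm j Y \<Longrightarrow> Y \<in> borel_measurable M" unfolding adm_def using measurable_F_M by blast

lemma adm_cong_AE:
  assumes "adm j Y" "AE \<omega> in M. Y \<omega> = Y' \<omega>" "Y' \<in> borel_measurable M" "\<And>\<omega>. \<omega> \<in> space M \<Longrightarrow> Y' \<omega> \<in> Hn"
  shows "adm j Y'"
proof -
  have "square_integrable M Y"  using assms(1) by (simp add: adm_def)
  moreover have "AE \<omega> in M. (norm (Y \<omega>))\<^sup>2 = (norm (Y' \<omega>))\<^sup>2" using assms(2) by eventually_elim simp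
  ultimately have "square_integrable M Y'"
    unfolding square_integrable_def using assms(3) by (subst integrable_cong_AE[of _ _ "\<lambda>\<omega>. (norm (Y \<omega>))\<^sup>2"]) auto
  then show ?thesis using assms measurable_F_AE[of Y "T j" Y'] by (simp add: adm_def)
qed

text \<open>Before the semigroup acts, the new difference splits into a part \<open>X\<close> known
  at \<open>T j\<close> and the noise part \<open>dZ\<close>, orthogonal in mean square. The inner
  product of \<open>E\<close> and \<open>D\<close> occurs in both estimates with opposite signs, so
  only \<open>r\<^sup>2\<close> times the squared drift difference remains, and
  \<open>h_small\<close> pays for it with half of \<open>Cfg\<close>.\<close>

lemma step_contraction:
  assumes s: "step j r Y V" "step j r Y' V'" and a: "adm j Y" "adm j Y'" and r: "0 \<le> r" "r \<le> h"
  shows "(\<integral>\<^sup>+\<omega>. ennreal ((norm (V \<omega> - V' \<omega>))\<^sup>2) \<partial>M)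
    \<le> ennreal (max 0 (1 - r * Cfg / 2)) * (\<integral>\<^sup>+\<omega>. ennreal ((norm (Y \<omega> - Y' \<omega>))\<^sup>2) \<partial>M)"
proof -
  obtain Z where Z: "has_ito_integral M F Q W (T j) (T j + r) (\<lambda>_ \<omega>. gn (T j) (Y \<omega>)) Z"
    "AE \<omega> in M. V \<omega> = S r (Y \<omega> + r *\<^sub>R fn (T j) (Y \<omega>) + Z \<omega>)" using s(1) by (auto simp: step_def)
  obtain Z' where Z': "has_ito_integral M F Q W (T j) (T j + r) (\<lambda>_ \<omega>. gn (T j) (Y' \<omega>)) Z'"
    "AE \<omega> in M. V' \<omega> = S r (Y' \<omega> + r *\<^sub>R fn (T j) (Y' \<omega>) + Z' \<omega>)" using s(2) by (auto simp: step_def)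
  have [measurable]: "Y \<in> borel_measurable (F (T j))" "Y' \<in> borel_measurable (F (T j))" using a by (auto simp: adm_def)
  note [measurable] = adm_M[OF a(1)] adm_M[OF a(2)]
  have sqY: "square_integrable M Y" "square_integrable M Y'" using a by (auto simp: adm_def)
  note [measurable] = has_ito_measurable[OF Z(1)] has_ito_measurable[OF Z'(1)]
  note sqZ = Ito_square_integrable[OF Z(1)] Ito_square_integrable[OF Z'(1)]
  define D where "D \<omega> = Y \<omega> - Y' \<omega>" for \<omega>
  define E where "E \<omega> = fn (T j) (Y \<omega>) - fn (T j) (Y' \<omega>)" for \<omega>
  define X where "X \<omega> = D \<omega> + r *\<^sub>R E \<omega>" for \<omega>
  define dZ where "dZ \<omega> = Z \<omega> - Z' \<omega>" for \<omega>
  \<comment> \<open>The bound that dissipativity gives for the squared distance of the noise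
    coefficients. It is constant in time, so the comparison of integrals produces the factor
    \<open>r\<close>.\<close>
  define q where "q \<omega> = - Cfg * (norm (D \<omega>))\<^sup>2 - 2 * inner (E \<omega>) (D \<omega>)" for \<omega>
  have [measurable]: "D \<in> borel_measurable M" "E \<in> borel_measurable M" "X \<in> borel_measurable M" "dZ \<in> borel_measurable M"
    unfolding D_def E_def X_def dZ_def by measurable
  have XF: "X \<in> borel_measurable (F (T j))" unfolding X_def D_def E_def by measurable
  have sD: "square_integrable M D" unfolding D_def by (rule square_integrable_diff[OF sqY])
  have sZ: "square_integrable M dZ" unfolding dZ_def by (rule square_integrable_diff[OF sqZ])
  have Eb: "norm (E \<omega>) \<le> Cf * norm (D \<omega>)" for \<omega> unfolding E_def D_def by (rule fn_lip)
  have iD: "integrable M (\<lambda>\<omega>. (norm (D \<omega>))\<^sup>2)" using sD by (simp add: square_integrable_def)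
  have iE: "integrable M (\<lambda>\<omega>. (norm (E \<omega>))\<^sup>2)"
  proof (rule Bochner_Integration.integrable_bound)
    show "integrable M (\<lambda>\<omega>. Cf\<^sup>2 * (norm (D \<omega>))\<^sup>2)" using iD by simp
    show "AE \<omega> in M. norm ((norm (E \<omega>))\<^sup>2) \<le> norm (Cf\<^sup>2 * (norm (D \<omega>))\<^sup>2)"
      using power_mono[OF Eb norm_ge_zero, where n = 2] by (intro AE_I2) (simp add: power_mult_distrib)
  qed measurable
  have sE: "square_integrable M E" using iE by (simp add: square_integrable_def)
  have sX: "square_integrable M X"
  proof -
    have "square_integrable M (\<lambda>\<omega>. - r *\<^sub>R E \<omega>)" using iE by (simp add: square_integrable_def power_mult_distrib)
    from square_integrable_diff[OF sD this] show ?thesis by (simp add: X_def[abs_def])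
  qed
  have iED: "integrable M (\<lambda>\<omega>. inner (E \<omega>) (D \<omega>))" by (rule inner_integrable[OF sE sD])
  have iq: "integrable M q" unfolding q_def[abs_def] using iD iED by simp
  have qm[measurable]: "q \<in> borel_measurable M" unfolding q_def by measurable
  have dq: "(L20_dist Q (gn (T j) (Y \<omega>)) (gn (T j) (Y' \<omega>)))\<^sup>2 \<le> q \<omega>" if "\<omega> \<in> space M" for \<omega>
    using dissipative_n[of "Y \<omega>" "Y' \<omega>" "T j"] a that by (auto simp: adm_def q_def D_def E_def)
  have q0: "0 \<le> q \<omega>" if "\<omega> \<in> space M" for \<omega> using dq[OF that] zero_le_power2 order_trans by blast
  have "(\<integral>\<^sup>+\<omega>. ennreal ((norm (dZ \<omega>))\<^sup>2) \<partial>M) \<le> (\<integral>\<^sup>+p. ennreal (q (snd p)) \<partial>(interval (T j) (T j + r) \<Otimes>\<^sub>M M))"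
    unfolding dZ_def
  proof (rule Ito_diff_le[OF Z(1) Z'(1)])
    show "(\<lambda>p. ennreal (q (snd p))) \<in> borel_measurable (interval (T j) (T j + r) \<Otimes>\<^sub>M M)" by measurable
  qed (use dq in \<open>auto intro: ennreal_leI\<close>)
  also have "\<dots> = ennreal r * (\<integral>\<^sup>+\<omega>. ennreal (q \<omega>) \<partial>M)"
    using pair_interval_const[of "\<lambda>\<omega>. ennreal (q \<omega>)" "T j" "T j + r"] r by simp
  also have "(\<integral>\<^sup>+\<omega>. ennreal (q \<omega>) \<partial>M) = ennreal (\<integral>\<omega>. q \<omega> \<partial>M)"
    by (rule nn_integral_eq_integral[OF iq]) (use q0 in auto)
  finally have "ennreal (\<integral>\<omega>. (norm (dZ \<omega>))\<^sup>2 \<partial>M) \<le> ennreal (r * (\<integral>\<omega>. q \<omega> \<partial>M))"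
    using square_integrable_nn[OF sZ] r by (simp add: ennreal_mult')
  moreover have "0 \<le> (\<integral>\<omega>. q \<omega> \<partial>M)" by (rule integral_nonneg_AE) (use q0 in auto)
  ultimately have Zq: "(\<integral>\<omega>. (norm (dZ \<omega>))\<^sup>2 \<partial>M) \<le> r * (\<integral>\<omega>. q \<omega> \<partial>M)" using r by (subst (asm) ennreal_le_iff) auto
  have cross: "(\<integral>\<omega>. inner (X \<omega>) (dZ \<omega>) \<partial>M) = 0"
    unfolding dZ_def inner_diff_right
    using Ito_orth[OF Z(1) XF sX] Ito_orth[OF Z'(1) XF sX] inner_integrable[OF sX sqZ(1)] inner_integrable[OF sX sqZ(2)]
    by simp
  have iX: "integrable M (\<lambda>\<omega>. (norm (X \<omega>))\<^sup>2)" "integrable M (\<lambda>\<omega>. (norm (dZ \<omega>))\<^sup>2)" using sX sZ by (auto simp: square_integrable_def)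
  have "(\<integral>\<omega>. (norm (X \<omega> + dZ \<omega>))\<^sup>2 \<partial>M) = (\<integral>\<omega>. (norm (X \<omega>))\<^sup>2 + 2 * inner (X \<omega>) (dZ \<omega>) + (norm (dZ \<omega>))\<^sup>2 \<partial>M)"
    by (simp add: power2_norm_eq_inner inner_simps inner_commute algebra_simps)
  also have "\<dots> = (\<integral>\<omega>. (norm (X \<omega>))\<^sup>2 \<partial>M) + (\<integral>\<omega>. (norm (dZ \<omega>))\<^sup>2 \<partial>M)"
    using cross iX inner_integrable[OF sX sZ] by simp
  also have "\<dots> \<le> (\<integral>\<omega>. (norm (X \<omega>))\<^sup>2 \<partial>M) + r * (\<integral>\<omega>. q \<omega> \<partial>M)" using Zq by simp
  also have "\<dots> = (\<integral>\<omega>. (norm (X \<omega>))\<^sup>2 + r * q \<omega> \<partial>M)" using iX iq by simp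
  also have "\<dots> \<le> (\<integral>\<omega>. (1 - r * Cfg / 2) * (norm (D \<omega>))\<^sup>2 \<partial>M)"
  proof (rule integral_mono)
    show "integrable M (\<lambda>\<omega>. (norm (X \<omega>))\<^sup>2 + r * q \<omega>)" using iX iq by simp
    show "integrable M (\<lambda>\<omega>. (1 - r * Cfg / 2) * (norm (D \<omega>))\<^sup>2)" using iD by simp
    fix \<omega>
    have "(norm (X \<omega>))\<^sup>2 = (norm (D \<omega>))\<^sup>2 + 2 * r * inner (E \<omega>) (D \<omega>) + r\<^sup>2 * (norm (E \<omega>))\<^sup>2"
      unfolding X_def power2_norm_eq_inner by (simp add: inner_simps inner_commute power2_eq_square algebra_simps)
    \<comment> \<open>The terms with the inner product of \<open>E\<close> and \<open>D\<close>
      cancel here.\<close>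
    then have "(norm (X \<omega>))\<^sup>2 + r * q \<omega> = (1 - r * Cfg) * (norm (D \<omega>))\<^sup>2 + r\<^sup>2 * (norm (E \<omega>))\<^sup>2"
      by (simp add: q_def algebra_simps)
    also have "r\<^sup>2 * (norm (E \<omega>))\<^sup>2 \<le> r\<^sup>2 * (Cf\<^sup>2 * (norm (D \<omega>))\<^sup>2)"
      using power_mono[OF Eb norm_ge_zero, where n = 2] by (intro mult_left_mono) (auto simp: power_mult_distrib)
    also have "\<dots> \<le> (r * (Cfg / 2)) * (norm (D \<omega>))\<^sup>2"
    proof -
      have "r * Cf\<^sup>2 \<le> h * Cf\<^sup>2" using r by (intro mult_right_mono) auto
      then have "r * (r * Cf\<^sup>2) \<le> r * (Cfg / 2)" using h_small r by (intro mult_left_mono) (auto simp: mult.commute)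
      then have "(r * (r * Cf\<^sup>2)) * (norm (D \<omega>))\<^sup>2 \<le> (r * (Cfg / 2)) * (norm (D \<omega>))\<^sup>2" by (rule mult_right_mono) simp
      then show ?thesis by (simp add: power2_eq_square algebra_simps)
    qed
    finally show "(norm (X \<omega>))\<^sup>2 + r * q \<omega> \<le> (1 - r * Cfg / 2) * (norm (D \<omega>))\<^sup>2" by (simp add: algebra_simps)
  qed
  finally have main: "(\<integral>\<omega>. (norm (X \<omega> + dZ \<omega>))\<^sup>2 \<partial>M) \<le> (1 - r * Cfg / 2) * (\<integral>\<omega>. (norm (D \<omega>))\<^sup>2 \<partial>M)" by simp
  have iXZ: "integrable M (\<lambda>\<omega>. (norm (X \<omega> + dZ \<omega>))\<^sup>2)"
  proof -
    have "square_integrable M (\<lambda>\<omega>. - dZ \<omega>)" using sZ by (simp add: square_integrable_def)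
    from square_integrable_diff[OF sX this] show ?thesis by (simp add: square_integrable_def)
  qed
  have "(\<integral>\<^sup>+\<omega>. ennreal ((norm (V \<omega> - V' \<omega>))\<^sup>2) \<partial>M) \<le> (\<integral>\<^sup>+\<omega>. ennreal ((norm (X \<omega> + dZ \<omega>))\<^sup>2) \<partial>M)"
  proof (rule nn_integral_mono_AE)
    show "AE \<omega> in M. ennreal ((norm (V \<omega> - V' \<omega>))\<^sup>2) \<le> ennreal ((norm (X \<omega> + dZ \<omega>))\<^sup>2)"
      using Z(2) Z'(2)
    proof eventually_elim
      case (elim \<omega>)
      have "V \<omega> - V' \<omega> = S r (X \<omega> + dZ \<omega>)"
        unfolding elim blinfun.diff_right[symmetric] by (simp add: X_def D_def E_def dZ_def algebra_simps)
      then show ?case using S_contr[OF r(1), of "X \<omega> + dZ \<omega>"] by (auto intro!: ennreal_leI power_mono)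
    qed
  qed
  also have "\<dots> = ennreal (\<integral>\<omega>. (norm (X \<omega> + dZ \<omega>))\<^sup>2 \<partial>M)" by (rule nn_integral_eq_integral[OF iXZ]) simp
  also have "\<dots> \<le> ennreal ((1 - r * Cfg / 2) * (\<integral>\<omega>. (norm (D \<omega>))\<^sup>2 \<partial>M))" by (rule ennreal_leI[OF main])
  \<comment> \<open>The maximum spares a proof that the factor is nonnegative, as multiplicativity
    of \<open>ennreal\<close> demands.\<close>
  also have "\<dots> \<le> ennreal (max 0 (1 - r * Cfg / 2) * (\<integral>\<omega>. (norm (D \<omega>))\<^sup>2 \<partial>M))"
    by (intro ennreal_leI mult_right_mono) auto
  also have "\<dots> = ennreal (max 0 (1 - r * Cfg / 2)) * (\<integral>\<^sup>+\<omega>. ennreal ((norm (Y \<omega> - Y' \<omega>))\<^sup>2) \<partial>M)"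
    using square_integrable_nn[OF sD] by (simp add: ennreal_mult' D_def)
  finally show ?thesis .
qed

lemma step_unique:
  assumes s: "step j r Y V" "step j r Y' V'" and ae: "AE \<omega> in M. Y \<omega> = Y' \<omega>"
  shows "AE \<omega> in M. V \<omega> = V' \<omega>"
proof -
  obtain Z where Z: "has_ito_integral M F Q W (T j) (T j + r) (\<lambda>_ \<omega>. gn (T j) (Y \<omega>)) Z"
    "AE \<omega> in M. V \<omega> = S r (Y \<omega> + r *\<^sub>R fn (T j) (Y \<omega>) + Z \<omega>)" using s(1) by (auto simp: step_def)
  obtain Z' where Z': "has_ito_integral M F Q W (T j) (T j + r) (\<lambda>_ \<omega>. gn (T j) (Y' \<omega>)) Z'"
    "AE \<omega> in M. V' \<omega> = S r (Y' \<omega> + r *\<^sub>R fn (T j) (Y' \<omega>) + Z' \<omega>)" using s(2) by (auto simp: step_def)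
  have "AE \<omega> in M. Z \<omega> = Z' \<omega>"
    by (rule Ito_unique_AE[OF Z(1) Z'(1)]) (use ae in eventually_elim, simp)
  with Z(2) Z'(2) ae show ?thesis by eventually_elim simp
qed

lemma step_cong_result: "step j r Y V \<Longrightarrow> AE \<omega> in M. V \<omega> = V' \<omega> \<Longrightarrow> step j r Y V'"
  unfolding step_def
proof (elim exE conjE, intro exI conjI, assumption)
  fix Z assume "AE \<omega> in M. V \<omega> = V' \<omega>" "AE \<omega> in M. V \<omega> = S r (Y \<omega> + r *\<^sub>R fn (T j) (Y \<omega>) + Z \<omega>)"
  then show "AE \<omega> in M. V' \<omega> = S r (Y \<omega> + r *\<^sub>R fn (T j) (Y \<omega>) + Z \<omega>)" by eventually_elim simp
qed

text \<open>Continuity and values in \<open>Hn\<close> are demanded for every outcome, so that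
  gluing the steps later costs only the null sets on which neighbouring steps do not match.\<close>

definition step_path :: "int \<Rightarrow> ('w \<Rightarrow> 'h) \<Rightarrow> (real \<Rightarrow> 'w \<Rightarrow> 'h) \<Rightarrow> bool" where
  "step_path j Y V \<longleftrightarrow> (\<forall>r\<in>{0..h}. step j r Y (V r) \<and> V r \<in> borel_measurable (F (T j + r)) \<and>
       square_integrable M (V r) \<and> (\<forall>\<omega>\<in>space M. V r \<omega> \<in> Hn)) \<and>
     (\<forall>\<omega>\<in>space M. continuous_on {0..h} (\<lambda>r. V r \<omega>)) \<and> (\<forall>\<omega>. V 0 \<omega> = Y \<omega>)"

lemma step_pathD:
  assumes "step_path j Y V" "r \<in> {0..h}"
  shows "step j r Y (V r)" "V r \<in> borel_measurable (F (T j + r))" "square_integrable M (V r)"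
    "\<omega> \<in> space M \<Longrightarrow> V r \<omega> \<in> Hn"
  using assms unfolding step_path_def by blast+

lemma step_pathD2:
  assumes "step_path j Y V"
  shows "\<omega> \<in> space M \<Longrightarrow> continuous_on {0..h} (\<lambda>r. V r \<omega>)" "V 0 \<omega> = Y \<omega>"
  using assms unfolding step_path_def by blast+

lemma step_path_exists:
  assumes a: "adm j Y"
  shows "\<exists>V. step_path j Y V"
proof -
  have Y: "Y \<in> borel_measurable (F (T j))" "square_integrable M Y" "\<And>\<omega>. \<omega> \<in> space M \<Longrightarrow> Y \<omega> \<in> Hn"
    using a by (auto simp: adm_def)
  have ro: "random_op (T j) (\<lambda>\<omega>. gn (T j) (Y \<omega>))" by (rule gn_random_op[OF Y(1,2)])
  have "T j \<le> T j + h" using h_pos by simp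
  from const_integral_continuous[OF ro this]
  obtain Z0 where Z0: "\<And>r. r \<in> {T j..T j + h} \<Longrightarrow> has_ito_integral M F Q W (T j) r (\<lambda>_ \<omega>. gn (T j) (Y \<omega>)) (Z0 r)"
    "\<And>r. r \<in> {T j..T j + h} \<Longrightarrow> Z0 r \<in> borel_measurable (F r)"
    "\<And>\<omega>. \<omega> \<in> space M \<Longrightarrow> continuous_on {T j..T j + h} (\<lambda>r. Z0 r \<omega>)"
    "\<And>\<omega>. Z0 (T j) \<omega> = 0" by blast
  \<comment> \<open>Projecting the integral puts its values in \<open>Hn\<close> for every outcome,
    and leaves the integrand unchanged since \<open>P\<close> is idempotent.\<close>
  define Z where "Z r \<omega> = P (Z0 (T j + r) \<omega>)" for r \<omega>
  have Z: "has_ito_integral M F Q W (T j) (T j + r) (\<lambda>_ \<omega>. gn (T j) (Y \<omega>)) (Z r)" if "r \<in> {0..h}" for r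
  proof -
    have "(\<lambda>_ \<omega> v. P (gn (T j) (Y \<omega>) v)) = (\<lambda>(_::real) \<omega>. gn (T j) (Y \<omega>))"
      by (intro ext) (simp add: gn_def P_Hn[OF P_in])
    then show ?thesis
      using has_ito_map[OF Z0(1)[of "T j + r"] P_bounded_linear random_op_weakly_measurable[OF ro]] that by (simp add: Z_def[abs_def])
  qed
  define V where "V r \<omega> = S r (Y \<omega> + r *\<^sub>R fn (T j) (Y \<omega>) + Z r \<omega>)" for r \<omega>
  have inn: "Y \<omega> + r *\<^sub>R fn (T j) (Y \<omega>) + Z r \<omega> \<in> Hn" if "\<omega> \<in> space M" for \<omega> r
    unfolding Z_def fn_def using Y(3)[OF that] Hn_subspace P_in by (intro subspace_add subspace_scale)
  have Vm: "V r \<in> borel_measurable (F (T j + r))" if "r \<in> {0..h}" for r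
  proof -
    have [measurable]: "Y \<in> borel_measurable (F (T j + r))" by (rule measurable_F_mono[OF Y(1)]) (use that in auto)
    have [measurable]: "Z0 (T j + r) \<in> borel_measurable (F (T j + r))" by (rule Z0(2)) (use that in auto)
    show ?thesis unfolding V_def Z_def by measurable
  qed
  have st: "step j r Y (V r)" if "r \<in> {0..h}" for r
    unfolding step_def V_def using Z[OF that] by auto
  have "step_path j Y V"
    unfolding step_path_def
  proof (intro conjI ballI allI st Vm)
    show "V r \<omega> \<in> Hn" if "r \<in> {0..h}" "\<omega> \<in> space M" for r \<omega>
      unfolding V_def using inn that by (intro S_in_Hn) auto
    show "square_integrable M (V r)" if r: "r \<in> {0..h}" for r
    proof -
      have [measurable]: "Y \<in> borel_measurable M" by (rule adm_M[OF a])
      have iY: "integrable M (\<lambda>\<omega>. (norm (Y \<omega>))\<^sup>2)" using Y(2) by (simp add: square_integrable_def)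
      have s1: "square_integrable M (\<lambda>\<omega>. - r *\<^sub>R fn (T j) (Y \<omega>))"
        unfolding square_integrable_def
      proof (intro conjI)
        show "integrable M (\<lambda>\<omega>. (norm (- r *\<^sub>R fn (T j) (Y \<omega>)))\<^sup>2)"
        proof (rule Bochner_Integration.integrable_bound)
          let ?c = "norm (fn (T j) 0)"
          show "integrable M (\<lambda>\<omega>. r\<^sup>2 * (2 * ?c\<^sup>2 + 2 * Cf\<^sup>2 * (norm (Y \<omega>))\<^sup>2))" using iY by simp
          show "AE \<omega> in M. norm ((norm (- r *\<^sub>R fn (T j) (Y \<omega>)))\<^sup>2) \<le> norm (r\<^sup>2 * (2 * ?c\<^sup>2 + 2 * Cf\<^sup>2 * (norm (Y \<omega>))\<^sup>2))"
          proof (rule AE_I2)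
            fix \<omega>
            have "norm (fn (T j) (Y \<omega>)) \<le> ?c + Cf * norm (Y \<omega>)"
              using fn_lip[of "T j" "Y \<omega>" 0] norm_triangle_sub[of "fn (T j) (Y \<omega>)" "fn (T j) 0"] by simp
            then have "(norm (fn (T j) (Y \<omega>)))\<^sup>2 \<le> (?c + Cf * norm (Y \<omega>))\<^sup>2" by (intro power_mono) auto
            also have "\<dots> \<le> 2 * ?c\<^sup>2 + 2 * Cf\<^sup>2 * (norm (Y \<omega>))\<^sup>2"
              using sum_squares_bound[of ?c "Cf * norm (Y \<omega>)"] by (simp add: power2_sum power_mult_distrib)
            finally have "r\<^sup>2 * (norm (fn (T j) (Y \<omega>)))\<^sup>2 \<le> r\<^sup>2 * (2 * ?c\<^sup>2 + 2 * Cf\<^sup>2 * (norm (Y \<omega>))\<^sup>2)" by (intro mult_left_mono) auto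
            then show "norm ((norm (- r *\<^sub>R fn (T j) (Y \<omega>)))\<^sup>2) \<le> norm (r\<^sup>2 * (2 * ?c\<^sup>2 + 2 * Cf\<^sup>2 * (norm (Y \<omega>))\<^sup>2))"
              by (simp add: power_mult_distrib)
          qed
        qed measurable
      qed measurable
      have s2: "square_integrable M (\<lambda>\<omega>. - Z r \<omega>)" using Ito_square_integrable[OF Z[OF r]] by (simp add: square_integrable_def)
      have s3: "square_integrable M (\<lambda>\<omega>. Y \<omega> + r *\<^sub>R fn (T j) (Y \<omega>) + Z r \<omega>)"
        using square_integrable_diff[OF square_integrable_diff[OF Y(2) s1] s2] by simp
      have "(\<integral>\<^sup>+\<omega>. ennreal ((norm (V r \<omega>))\<^sup>2) \<partial>M) \<le> (\<integral>\<^sup>+\<omega>. ennreal ((norm (Y \<omega> + r *\<^sub>R fn (T j) (Y \<omega>) + Z r \<omega>))\<^sup>2) \<partial>M)"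
        unfolding V_def by (intro nn_integral_mono ennreal_leI power_mono S_contr) (use r in auto)
      also have "\<dots> < \<infinity>" by (rule square_int_le[OF s3])
      finally show ?thesis using measurable_F_M[OF Vm[OF r]] by (intro square_integrable_mono_le)
    qed
    show "continuous_on {0..h} (\<lambda>r. V r \<omega>)" if "\<omega> \<in> space M" for \<omega>
    proof -
      have P: "continuous_on A P" for A by (intro linear_continuous_on P_bounded_linear)
      have "continuous_on {0..h} (\<lambda>r. Z0 (T j + r) \<omega>)"
        by (rule continuous_on_compose2[OF Z0(3)[OF that]]) (auto intro!: continuous_intros)
      then have Zc: "continuous_on {0..h} (\<lambda>r. Z r \<omega>)" unfolding Z_def by (rule continuous_on_compose2[OF P]) auto
      \<comment> \<open>The finite sum of \<open>S_Hn_eq\<close> takes the place of joint continuity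
        of the semigroup.\<close>
      have "continuous_on {0..h} (\<lambda>r. \<Sum>i=1..n. (exp (- lam i * r) * inner (Y \<omega> + r *\<^sub>R fn (T j) (Y \<omega>) + Z r \<omega>) (e i)) *\<^sub>R e i)"
        by (intro continuous_intros Zc)
      then show ?thesis
        by (rule continuous_on_cong[THEN iffD1, rotated 2]) (auto simp: V_def S_Hn_eq[OF inn[OF that]])
    qed
    show "V 0 \<omega> = Y \<omega>" for \<omega> by (simp add: V_def S_0 Z_def Z0(4) linear_0[OF P_linear])
  qed
  then show ?thesis by (rule exI[of _ V])
qed


text \<open>\<open>J\<close> is \<open>{j0..}\<close> for a scheme started at the index
  \<open>j0\<close> and \<open>UNIV\<close> for the stationary solution, which has no starting
  time.\<close>

definition orbit :: "int set \<Rightarrow> (int \<Rightarrow> 'w \<Rightarrow> 'h) \<Rightarrow> bool" where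
  "orbit J Y \<longleftrightarrow> (\<forall>j\<in>J. j + 1 \<in> J \<and> adm j (Y j) \<and> step j h (Y j) (Y (j + 1)))"

lemma orbit_exists:
  assumes "adm j0 \<eta>"
  obtains Y where "Y j0 = \<eta>" "orbit {j0..} Y"
proof -
  have "\<exists>X. \<forall>i. (adm (j0 + int i) (X i) \<and> (i = 0 \<longrightarrow> X i = \<eta>)) \<and> step (j0 + int i) h (X i) (X (Suc i))"
  proof (rule dependent_nat_choice)
    show "\<exists>x. adm (j0 + int 0) x \<and> (0 = (0::nat) \<longrightarrow> x = \<eta>)" using assms by auto
    fix x i assume "adm (j0 + int i) x \<and> (i = 0 \<longrightarrow> x = \<eta>)"
    then have a: "adm (j0 + int i) x" by simp
    obtain V where V: "step_path (j0 + int i) x V" using step_path_exists[OF a] ..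
    have h: "h \<in> {0..h}" using h_pos by simp
    have eq: "j0 + int (Suc i) = (j0 + int i) + 1" by simp
    have "adm (j0 + int (Suc i)) (V h)" unfolding adm_def eq T_Suc using step_pathD[OF V h] by simp
    then show "\<exists>y. (adm (j0 + int (Suc i)) y \<and> (Suc i = 0 \<longrightarrow> y = \<eta>)) \<and> step (j0 + int i) h x y"
      using step_pathD(1)[OF V h] by auto
  qed
  then obtain X where X0: "\<forall>i. (adm (j0 + int i) (X i) \<and> (i = 0 \<longrightarrow> X i = \<eta>)) \<and> step (j0 + int i) h (X i) (X (Suc i))"
    by (rule exE)
  have X: "adm (j0 + int i) (X i)" "X 0 = \<eta>" "step (j0 + int i) h (X i) (X (Suc i))" for i
    using X0 by simp_all
  show ?thesis
  proof (rule that[of "\<lambda>j. X (nat (j - j0))"])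
    show "orbit {j0..} (\<lambda>j. X (nat (j - j0)))"
      unfolding orbit_def
    proof (intro ballI conjI)
      fix j assume j: "j \<in> {j0..}"
      then have e: "j0 + int (nat (j - j0)) = j" "nat (j + 1 - j0) = Suc (nat (j - j0))" by auto
      show "adm j (X (nat (j - j0)))" using X(1)[of "nat (j - j0)"] unfolding e .
      show "step j h (X (nat (j - j0))) (X (nat (j + 1 - j0)))" using X(3)[of "nat (j - j0)"] unfolding e .
    qed simp
  qed (simp add: X)
qed

definition \<rho> :: real where "\<rho> = max 0 (1 - h * Cfg / 2)"

lemma \<rho>: "0 \<le> \<rho>" "\<rho> < 1" using h_pos C_pos by (auto simp: \<rho>_def)

lemma orbit_contraction:
  assumes o: "orbit J Y" "orbit J Y'" and j: "j \<in> J"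
  shows "j + int k \<in> J \<and> (\<integral>\<^sup>+\<omega>. ennreal ((norm (Y (j + int k) \<omega> - Y' (j + int k) \<omega>))\<^sup>2) \<partial>M)
    \<le> ennreal (\<rho> ^ k) * (\<integral>\<^sup>+\<omega>. ennreal ((norm (Y j \<omega> - Y' j \<omega>))\<^sup>2) \<partial>M)"
proof (induction k)
  case 0 show ?case using j by simp
next
  case (Suc k)
  let ?i = "j + int k"
  have i: "?i \<in> J" using Suc by simp
  then have "step ?i h (Y ?i) (Y (?i + 1))" "step ?i h (Y' ?i) (Y' (?i + 1))" "adm ?i (Y ?i)" "adm ?i (Y' ?i)" "?i + 1 \<in> J"
    using o by (auto simp: orbit_def)
  note o' = this
  have "(\<integral>\<^sup>+\<omega>. ennreal ((norm (Y (?i + 1) \<omega> - Y' (?i + 1) \<omega>))\<^sup>2) \<partial>M) \<le> ennreal \<rho> * (\<integral>\<^sup>+\<omega>. ennreal ((norm (Y ?i \<omega> - Y' ?i \<omega>))\<^sup>2) \<partial>M)"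
    unfolding \<rho>_def by (rule step_contraction[OF o'(1-4)]) (use h_pos in auto)
  also have "\<dots> \<le> ennreal \<rho> * (ennreal (\<rho> ^ k) * (\<integral>\<^sup>+\<omega>. ennreal ((norm (Y j \<omega> - Y' j \<omega>))\<^sup>2) \<partial>M))"
    using Suc by (intro mult_left_mono) auto
  also have "\<dots> = ennreal (\<rho> ^ Suc k) * (\<integral>\<^sup>+\<omega>. ennreal ((norm (Y j \<omega> - Y' j \<omega>))\<^sup>2) \<partial>M)"
    using \<rho> by (simp add: ennreal_mult mult.assoc)
  finally show ?case using o'(5) by (simp add: algebra_simps)
qed

section \<open>Interpolation between grid times and the continuous scheme\<close>

lemma floor_T: assumes "r \<in> {0..<h}" shows "\<lfloor>(T j + r) / h\<rfloor> = j"
  using assms h_pos by (intro floor_unique) (auto simp: T_def field_simps)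

lemma T_floor: "T \<lfloor>t / h\<rfloor> \<le> t" "t < T \<lfloor>t / h\<rfloor> + h"
proof -
  have "of_int \<lfloor>t / h\<rfloor> \<le> t / h" "t / h < of_int \<lfloor>t / h\<rfloor> + 1" by linarith+
  note fl = this
  have "of_int \<lfloor>t / h\<rfloor> * h \<le> t / h * h" by (rule mult_right_mono[OF fl(1)]) (use h_pos in simp)
  then show "T \<lfloor>t / h\<rfloor> \<le> t" using h_pos by (simp add: T_def)
  have "t / h * h < (of_int \<lfloor>t / h\<rfloor> + 1) * h" by (rule mult_strict_right_mono[OF fl(2) h_pos])
  then show "t < T \<lfloor>t / h\<rfloor> + h" using h_pos by (simp add: T_def distrib_right)
qed

lemma continuous_on_grid:
  fixes \<phi> :: "real \<Rightarrow> 'h"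
  assumes c: "\<And>k. j \<le> k \<Longrightarrow> continuous_on {T k..T k + h} \<phi>"
  shows "continuous_on {T j..} \<phi>"
proof -
  have fin: "continuous_on {T j..T (j + int i)} \<phi>" for i
  proof (induction i)
    case (Suc i)
    have "continuous_on ({T j..T (j + int i)} \<union> {T (j + int i)..T (j + int i) + h}) \<phi>"
      by (rule continuous_on_closed_Un[OF _ _ Suc c]) auto
    moreover have "{T j..T (j + int (Suc i))} \<subseteq> {T j..T (j + int i)} \<union> {T (j + int i)..T (j + int i) + h}"
      using T_Suc[of "j + int i"] by (auto simp: algebra_simps)
    ultimately show ?case by (rule continuous_on_subset)
  qed simp
  show ?thesis unfolding continuous_on_eq_continuous_within
  proof
    fix t assume t: "t \<in> {T j..}"
    obtain i :: nat where "(t - T j) / h < real i" using reals_Archimedean2 by blast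
    then have i: "t < T (j + int i)" using h_pos by (simp add: T_add field_simps)
    have "at t within {T j..} = at t within {T j..T (j + int i)}"
      by (rule at_within_nhd[of t "{..<T (j + int i)}"]) (use i in auto)
    then show "continuous (at t within {T j..}) \<phi>"
      using fin[of i] t i unfolding continuous_on_eq_continuous_within by (simp add: continuous_within)
  qed
qed

text \<open>Continuous partial steps are glued along the grid. The end of each step matches the
  start of the next outside a null set, and countably many cells yield one null set.\<close>

lemma orbit_interpolation:
  assumes o: "orbit J Y"
  obtains X where "\<And>\<omega> t. X t \<omega> \<in> Hn" "\<And>t. X t \<in> borel_measurable M"
    "\<And>j r. j \<in> J \<Longrightarrow> r \<in> {0..h} \<Longrightarrow> step j r (Y j) (X (T j + r))"
    "\<And>j r. j \<in> J \<Longrightarrow> r \<in> {0..h} \<Longrightarrow> square_integrable M (X (T j + r))"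
    "\<And>j. j \<in> J \<Longrightarrow> AE \<omega> in M. X (T j) \<omega> = Y j \<omega>"
    "\<And>j \<omega>. j \<in> J \<Longrightarrow> \<omega> \<in> space M \<Longrightarrow> continuous_on {T j..T j + h} (\<lambda>t. X t \<omega>)"
proof -
  define good where "good j V \<longleftrightarrow> (\<forall>r\<in>{0..h}. step j r (Y j) (V r) \<and> V r \<in> borel_measurable M \<and> square_integrable M (V r) \<and>
      (\<forall>\<omega>\<in>space M. V r \<omega> \<in> Hn)) \<and> (\<forall>\<omega>\<in>space M. continuous_on {0..h} (\<lambda>r. V r \<omega>)) \<and> (\<forall>\<omega>. V 0 \<omega> = Y j \<omega>)" for j V
  have "\<exists>V. good j V" if "j \<in> J" for j
  proof -
    have "adm j (Y j)" using o that by (auto simp: orbit_def)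
    then obtain V where V: "step_path j (Y j) V" using step_path_exists by blast
    have "good j V" unfolding good_def
      using step_pathD[OF V] step_pathD2[OF V] measurable_F_M[OF step_pathD(2)[OF V]] by blast
    then show ?thesis by (rule exI[of _ V])
  qed
  then have "\<exists>V. \<forall>j\<in>J. good j (V j)" by (intro bchoice) auto
  then obtain V where V: "\<And>j. j \<in> J \<Longrightarrow> good j (V j)" by blast
  have "AE \<omega> in M. j \<in> J \<longrightarrow> V j h \<omega> = Y (j + 1) \<omega>" for j
  proof (cases "j \<in> J")
    case True
    then have "step j h (Y j) (V j h)" "step j h (Y j) (Y (j + 1))" using V[OF True] h_pos o by (auto simp: good_def orbit_def)
    from step_unique[OF this] show ?thesis by simp
  qed simp
  then have "AE \<omega> in M. \<forall>j. j \<in> J \<longrightarrow> V j h \<omega> = Y (j + 1) \<omega>" by (simp add: AE_all_countable)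
  then obtain \<Omega>0 where O: "\<Omega>0 \<in> sets M" "\<Omega>0 \<subseteq> space M" "\<And>\<omega> j. \<omega> \<in> \<Omega>0 \<Longrightarrow> j \<in> J \<Longrightarrow> V j h \<omega> = Y (j + 1) \<omega>" "AE \<omega> in M. \<omega> \<in> \<Omega>0"
    by (rule null_modification) blast
  \<comment> \<open>The value 0, which lies in \<open>Hn\<close>, is used on the null set and
    outside the time range; thus values in \<open>Hn\<close> and continuity on the cells of
    \<open>J\<close> hold for every outcome.\<close>
  define X where "X t \<omega> = (if \<omega> \<in> \<Omega>0 \<and> \<lfloor>t / h\<rfloor> \<in> J then V \<lfloor>t / h\<rfloor> (t - T \<lfloor>t / h\<rfloor>) \<omega> else 0)" for t \<omega>
  have XV: "X (T j + r) \<omega> = V j r \<omega>" if j: "j \<in> J" and r: "r \<in> {0..h}" and w: "\<omega> \<in> \<Omega>0" for j r \<omega>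
  proof (cases "r = h")
    case True
    \<comment> \<open>The right end of a cell is evaluated in the next cell, with residual time
      0.\<close>
    have j1: "j + 1 \<in> J" using o j by (auto simp: orbit_def)
    have "T j + r = T (j + 1) + 0" by (simp add: True T_Suc)
    moreover have "\<lfloor>(T (j + 1) + 0) / h\<rfloor> = j + 1" by (rule floor_T) (use h_pos in simp)
    ultimately have "X (T j + r) \<omega> = V (j + 1) 0 \<omega>" using w j1 by (simp add: X_def)
    also have "\<dots> = V j r \<omega>" using V[OF j1] O(3)[OF w j] by (simp add: good_def True)
    finally show ?thesis .
  next
    case False
    then have "\<lfloor>(T j + r) / h\<rfloor> = j" using r by (intro floor_T) auto
    then show ?thesis using w j by (simp add: X_def)
  qed
  have XVae: "AE \<omega> in M. V j r \<omega> = X (T j + r) \<omega>" if "j \<in> J" "r \<in> {0..h}" for j r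
    using O(4)
  proof eventually_elim
    case (elim \<omega>)
    show ?case by (rule XV[OF that elim, symmetric])
  qed
  have rr: "t - T \<lfloor>t / h\<rfloor> \<in> {0..h}" for t using T_floor[of t] by auto
  have Xm: "X t \<in> borel_measurable M" for t
  proof (cases "\<lfloor>t / h\<rfloor> \<in> J")
    case True
    then have [measurable]: "V \<lfloor>t / h\<rfloor> (t - T \<lfloor>t / h\<rfloor>) \<in> borel_measurable M" using V[OF True] rr by (auto simp: good_def)
    note [measurable] = O(1)
    show ?thesis using True unfolding X_def by measurable
  qed (simp add: X_def[abs_def])
  show ?thesis
  proof (rule that[of X])
    show "X t \<omega> \<in> Hn" for t \<omega>
      using V rr[of t] O(2) subspace_0[OF Hn_subspace] by (auto simp: X_def good_def)
    show "X t \<in> borel_measurable M" for t by (rule Xm)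
    show "step j r (Y j) (X (T j + r))" if "j \<in> J" "r \<in> {0..h}" for j r
      by (rule step_cong_result[OF _ XVae[OF that]]) (use V[OF that(1)] that(2) in \<open>auto simp: good_def\<close>)
    show "square_integrable M (X (T j + r))" if "j \<in> J" "r \<in> {0..h}" for j r
    proof -
      have "integrable M (\<lambda>\<omega>. (norm (V j r \<omega>))\<^sup>2)" and [measurable]: "V j r \<in> borel_measurable M"
        using V[OF that(1)] that(2) by (auto simp: good_def square_integrable_def)
      moreover have "AE \<omega> in M. (norm (V j r \<omega>))\<^sup>2 = (norm (X (T j + r) \<omega>))\<^sup>2" using XVae[OF that] by eventually_elim simp
      ultimately show ?thesis unfolding square_integrable_def using Xm
        by (subst integrable_cong_AE[of _ _ "\<lambda>\<omega>. (norm (V j r \<omega>))\<^sup>2"]) auto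
    qed
    show "AE \<omega> in M. X (T j) \<omega> = Y j \<omega>" if "j \<in> J" for j
      using O(4) by eventually_elim (use XV[of j 0] V[OF that] h_pos that in \<open>simp add: good_def\<close>)
    show "continuous_on {T j..T j + h} (\<lambda>t. X t \<omega>)" if j: "j \<in> J" and w: "\<omega> \<in> space M" for j \<omega>
    proof (cases "\<omega> \<in> \<Omega>0")
      case True
      have "continuous_on {0..h} (\<lambda>r. V j r \<omega>)" using V[OF j] w by (simp add: good_def)
      then have "continuous_on {T j..T j + h} (\<lambda>t. V j (t - T j) \<omega>)"
        by (rule continuous_on_compose2) (auto intro!: continuous_intros)
      then show ?thesis
        by (rule continuous_on_cong[THEN iffD1, rotated 2]) (use XV[OF j _ True, of "_ - T j"] in auto)
    qed (simp add: X_def)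
  qed
qed

text \<open>The value at the right end \<open>b\<close> is left free, because the integrand may jump
  there.\<close>

lemma set_integral_append_const:
  fixes \<phi> :: "real \<Rightarrow> 'h"
  assumes i: "set_integrable lborel {s..a} \<phi>" and o: "s \<le> a" "a \<le> b" and c: "\<And>r. r \<in> {a<..<b} \<Longrightarrow> \<phi> r = c"
  shows "set_integrable lborel {s..b} \<phi>" "(LINT r:{s..b}|lborel. \<phi> r) = (LINT r:{s..a}|lborel. \<phi> r) + (b - a) *\<^sub>R c"
proof -
  have "set_integrable lborel {s..b} \<phi> \<and> (LINT r:{s..b}|lborel. \<phi> r) = (LINT r:{s..a}|lborel. \<phi> r) + (b - a) *\<^sub>R c"
  proof (cases "a = b")
    case False
    then have ab: "a < b" using o by simp
    have eq: "indicator {s..b} r *\<^sub>R \<phi> r = indicator {s..a} r *\<^sub>R \<phi> r + (indicator {a<..<b} r *\<^sub>R c + indicator {b} r *\<^sub>R \<phi> b)" for r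
      using c[of r] o ab by (auto simp: indicator_def)
    have i1: "integrable lborel (\<lambda>r. indicator {s..a} r *\<^sub>R \<phi> r)" using i by (simp add: set_integrable_def)
    have i2: "integrable lborel (\<lambda>r. indicator {a<..<b} r *\<^sub>R c)" "integrable lborel (\<lambda>r. indicator {b} r *\<^sub>R \<phi> b)"
      using ab by (auto intro!: integrable_scaleR_left)
    have "(\<integral>r. indicator {a<..<b} r *\<^sub>R c \<partial>lborel) = (b - a) *\<^sub>R c" "(\<integral>r. indicator {b} r *\<^sub>R \<phi> b \<partial>lborel) = 0"
      using ab by (auto simp: integral_scaleR_left)
    then show ?thesis
      unfolding set_integrable_def set_lebesgue_integral_def eq using i1 i2 by simp
  qed (use i in simp)
  then show "set_integrable lborel {s..b} \<phi>" "(LINT r:{s..b}|lborel. \<phi> r) = (LINT r:{s..a}|lborel. \<phi> r) + (b - a) *\<^sub>R c"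
    by blast+
qed

text \<open>For a fixed final time \<open>t\<close>, induction over the steps turns
  \<open>S (t - (s + real i * h)) (Yd i \<omega>)\<close> into the mild formula with integrals up to
  the \<open>i\<close>-th grid time. A step of length \<open>r\<close> extends it since
  \<open>S\<close> over the remaining time composed with \<open>S r\<close> is \<open>S\<close> over
  the sum; the last, possibly incomplete step ends at \<open>t\<close>.\<close>

lemma orbit_continuous_scheme:
  assumes o: "orbit J Y" and j: "j \<in> J"
    and X: "\<And>i r. i \<in> J \<Longrightarrow> r \<in> {0..h} \<Longrightarrow> step i r (Y i) (X (T i + r))"
    and c: "AE \<omega> in M. continuous_on {T j..} (\<lambda>t. X t \<omega>)"
  shows "continuous_scheme M F Q W S e f g n h (T j) (Y j) X"
proof -
  define s where "s = T j"
  define Yd where "Yd i = Y (j + int i)" for i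
  have jJ: "j + int i \<in> J" for i   proof (induction i)
    case (Suc i)
    then have "(j + int i) + 1 \<in> J" using o by (auto simp: orbit_def)
    then show ?case by (simp add: algebra_simps)
  qed (use j in simp)
  have tT: "s + real i * h = T (j + int i)" for i by (simp add: s_def T_add)
  have Ya: "adm (j + int i) (Yd i)" for i using o jJ[of i] by (auto simp: orbit_def Yd_def)
  have Ys: "step (j + int i) h (Yd i) (Yd (Suc i))" for i
  proof -
    have "step (j + int i) h (Y (j + int i)) (Y (j + int i + 1))" using o jJ[of i] by (auto simp: orbit_def)
    then show ?thesis by (simp add: Yd_def algebra_simps)
  qed
  have YM[measurable]: "Yd i \<in> borel_measurable M" for i by (rule adm_M[OF Ya])
  have disc: "discrete_scheme M F Q W S e f g n h s (Y j) Yd"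
    unfolding discrete_scheme_def Let_def
  proof (intro conjI allI ballI)
    show "Yd 0 \<omega> = Y j \<omega>" for \<omega> by (simp add: Yd_def)
    show "Yd i \<in> borel_measurable (F (s + real i * h))" for i using Ya[of i] by (simp add: adm_def tT)
    fix i
    obtain Z where Z: "has_ito_integral M F Q W (T (j + int i)) (T (j + int i) + h) (\<lambda>_ \<omega>. gn (T (j + int i)) (Yd i \<omega>)) Z"
      "AE \<omega> in M. Yd (Suc i) \<omega> = S h (Yd i \<omega> + h *\<^sub>R fn (T (j + int i)) (Yd i \<omega>) + Z \<omega>)"
      using Ys[of i] by (auto simp: step_def)
    have T1: "T (j + int i) + h = s + real (Suc i) * h" by (simp add: s_def T_add algebra_simps)
    have g1: "gn (T (j + int i)) y = (\<lambda>v. P (g (T (j + int i)) y v))" for y by (simp add: gn_def[abs_def])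
    \<comment> \<open>The scheme has \<open>P\<close> in front, which changes nothing here because
      \<open>Yd (Suc i)\<close> already takes values in \<open>Hn\<close>.\<close>
    have "AE \<omega> in M. Yd (Suc i) \<omega> = P (S h (Yd i \<omega> + h *\<^sub>R P (f (T (j + int i)) (Yd i \<omega>)) + Z \<omega>))"
      using Z(2) AE_space
    proof eventually_elim
      case (elim \<omega>)
      have "Yd (Suc i) \<omega> \<in> Hn" using Ya[of "Suc i"] elim(2) by (auto simp: adm_def)
      then show ?case using elim(1) P_Hn by (simp add: fn_def)
    qed
    then show "\<exists>Z. has_ito_integral M F Q W (s + real i * h) (s + real (Suc i) * h) (\<lambda>r \<omega> v. P (g (s + real i * h) (Yd i \<omega>) v)) Z \<and>
       (AE \<omega> in M. Yd (Suc i) \<omega> = P (S h (Yd i \<omega> + h *\<^sub>R P (f (s + real i * h) (Yd i \<omega>)) + Z \<omega>)))"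
      using Z(1) unfolding tT[of i] T1[symmetric] g1 by blast
  qed
  define Lam where "Lam r = s + of_int \<lfloor>(r - s) / h\<rfloor> * h" for r
  define Yb where "Yb r = Yd (nat \<lfloor>(r - s) / h\<rfloor>)" for r
  define \<Phi> where "\<Phi> t r \<omega> v = S (t - Lam r) (gn (Lam r) (Yb r \<omega>) v)" for t r \<omega> v
  define \<phi> where "\<phi> t \<omega> r = S (t - Lam r) (fn (Lam r) (Yb r \<omega>))" for t \<omega> r
  have fl: "\<lfloor>(r - s) / h\<rfloor> = int i" if "s + real i * h \<le> r" "r < s + real i * h + h" for r i
    using that h_pos by (intro floor_unique) (auto simp: field_simps)
  have \<Phi>_const: "\<Phi> t r \<omega> = (\<lambda>v. S (t - T (j + int i)) (gn (T (j + int i)) (Yd i \<omega>) v))"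
    "\<phi> t \<omega> r = S (t - T (j + int i)) (fn (T (j + int i)) (Yd i \<omega>))"
    if "s + real i * h \<le> r" "r < s + real i * h + h" for t r \<omega> i
    using fl[OF that] tT[of i] by (auto simp: fun_eq_iff \<Phi>_def \<phi>_def Lam_def Yb_def)
  have wm: "weakly_measurable a b (\<Phi> t)" for a b t
    unfolding weakly_measurable_def
  proof
    fix v assume v: "v \<in> B"
    have idx: "(\<lambda>p. \<lfloor>(fst p - s) / h\<rfloor>) \<in> measurable (interval a b \<Otimes>\<^sub>M M) (count_space UNIV)"
    proof -
      have "(\<lambda>r. \<lfloor>(r - s) / h\<rfloor>) \<in> measurable (interval a b) (count_space UNIV)"
        unfolding interval_def by (intro measurable_restrict_space1) measurable
      then show ?thesis by measurable
    qed
    have "(\<lambda>p. S (t - (s + of_int i * h)) (gn (s + of_int i * h) (Yd (nat i) (snd p)) v)) \<in> borel_measurable (interval a b \<Otimes>\<^sub>M M)" for i :: int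
    proof -
      have [measurable]: "(\<lambda>\<omega>. gn (s + of_int i * h) (Yd (nat i) \<omega>) v) \<in> borel_measurable M"
        by (rule measurable_compose[OF YM gn_measurable[OF v]])
      show ?thesis by measurable
    qed
    from measurable_compose_countable[OF this idx]
    show "(\<lambda>p. \<Phi> t (fst p) (snd p) v) \<in> borel_measurable (interval a b \<Otimes>\<^sub>M M)" by (simp add: \<Phi>_def Lam_def Yb_def)
  qed
  have \<Phi>L: "\<Phi> t r \<omega> \<in> L20 Q" for t r \<omega>
    unfolding \<Phi>_def[abs_def] by (rule L20_bounded_linear[OF gn_L20 blinfun.bounded_linear_right])
  have piece: "\<exists>Z. has_ito_integral M F Q W s (s + real i * h + r) (\<Phi> t) Z \<and>
      (AE \<omega> in M. set_integrable lborel {s..s + real i * h + r} (\<phi> t \<omega>) \<and>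
         S (t - (s + real i * h + r)) (V \<omega>) = S (t - s) (Y j \<omega>) + (LINT q:{s..s + real i * h + r}|lborel. \<phi> t \<omega> q) + Z \<omega>)"
    if IH: "\<exists>Z. has_ito_integral M F Q W s (s + real i * h) (\<Phi> t) Z \<and>
      (AE \<omega> in M. set_integrable lborel {s..s + real i * h} (\<phi> t \<omega>) \<and>
         S (t - (s + real i * h)) (Yd i \<omega>) = S (t - s) (Y j \<omega>) + (LINT q:{s..s + real i * h}|lborel. \<phi> t \<omega> q) + Z \<omega>)"
      and r: "0 \<le> r" "r \<le> h" "s + real i * h + r \<le> t" and V: "step (j + int i) r (Yd i) V" for i t r V
  proof -
    let ?a = "s + real i * h"
    have sa: "s \<le> ?a" using h_pos by simp
    obtain Z1 where Z1: "has_ito_integral M F Q W s ?a (\<Phi> t) Z1"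
      "AE \<omega> in M. set_integrable lborel {s..?a} (\<phi> t \<omega>) \<and>
         S (t - ?a) (Yd i \<omega>) = S (t - s) (Y j \<omega>) + (LINT q:{s..?a}|lborel. \<phi> t \<omega> q) + Z1 \<omega>" using IH by blast
    obtain Z0 where Z0: "has_ito_integral M F Q W ?a (?a + r) (\<lambda>_ \<omega>. gn ?a (Yd i \<omega>)) Z0"
      "AE \<omega> in M. V \<omega> = S r (Yd i \<omega> + r *\<^sub>R fn ?a (Yd i \<omega>) + Z0 \<omega>)"
      using V unfolding tT[symmetric] step_def by blast
    have ro: "random_op ?a (\<lambda>\<omega>. gn ?a (Yd i \<omega>))"
      using Ya[of i] by (intro gn_random_op) (auto simp: adm_def tT)
    have "has_ito_integral M F Q W ?a (?a + r) (\<lambda>_ \<omega> v. S (t - ?a) (gn ?a (Yd i \<omega>) v)) (\<lambda>\<omega>. S (t - ?a) (Z0 \<omega>))"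
      by (rule has_ito_map[OF Z0(1) blinfun.bounded_linear_right random_op_weakly_measurable[OF ro]])
    \<comment> \<open>In the interior of the interval \<open>\<Phi> t\<close> is constant in time;
      at the right end of a full step it already belongs to the next one.\<close>
    then have "has_ito_integral M F Q W ?a (?a + r) (\<Phi> t) (\<lambda>\<omega>. S (t - ?a) (Z0 \<omega>))"
      by (rule has_ito_change_endpoint[OF _ wm \<Phi>L]) (use r in \<open>simp add: \<Phi>_const(1)[of i] tT\<close>)
    then have ito: "has_ito_integral M F Q W s (?a + r) (\<Phi> t) (\<lambda>\<omega>. Z1 \<omega> + S (t - ?a) (Z0 \<omega>))"
      by (rule has_ito_concat[OF Z1(1) _ wm sa]) (use r in simp)
    have "AE \<omega> in M. set_integrable lborel {s..?a + r} (\<phi> t \<omega>) \<and>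
         S (t - (?a + r)) (V \<omega>) = S (t - s) (Y j \<omega>) + (LINT q:{s..?a + r}|lborel. \<phi> t \<omega> q) + (Z1 \<omega> + S (t - ?a) (Z0 \<omega>))"
      using Z1(2) Z0(2)
    proof eventually_elim
      case (elim \<omega>)
      have cst: "\<phi> t \<omega> q = S (t - ?a) (fn ?a (Yd i \<omega>))" if "q \<in> {?a<..<?a + r}" for q
        using that r by (simp add: \<Phi>_const(2)[of i] tT)
      have aar: "?a \<le> ?a + r" using r by simp
      note I = set_integral_append_const[OF elim(1)[THEN conjunct1] sa aar cst]
      have "S (t - (?a + r)) (V \<omega>) = S (t - ?a) (Yd i \<omega> + r *\<^sub>R fn ?a (Yd i \<omega>) + Z0 \<omega>)"
      proof -
        have "t - ?a = (t - (?a + r)) + r" by simp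
        also have "S \<dots> = S (t - (?a + r)) o\<^sub>L S r" by (rule S_add) (use r in auto)
        finally have "S (t - ?a) = S (t - (?a + r)) o\<^sub>L S r" .
        then show ?thesis using elim(2) by simp
      qed
      also have "\<dots> = S (t - ?a) (Yd i \<omega>) + r *\<^sub>R S (t - ?a) (fn ?a (Yd i \<omega>)) + S (t - ?a) (Z0 \<omega>)"
        by (simp add: blinfun.add_right blinfun.scaleR_right)
      finally show ?case using I elim(1) by (simp add: algebra_simps)
    qed
    with ito show ?thesis by blast
  qed
  have grid: "\<exists>Z. has_ito_integral M F Q W s (s + real i * h) (\<Phi> t) Z \<and>
      (AE \<omega> in M. set_integrable lborel {s..s + real i * h} (\<phi> t \<omega>) \<and>
         S (t - (s + real i * h)) (Yd i \<omega>) = S (t - s) (Y j \<omega>) + (LINT q:{s..s + real i * h}|lborel. \<phi> t \<omega> q) + Z \<omega>)"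
    if "s + real i * h \<le> t" for i t
    using that
  proof (induction i)
    case 0
    have "set_integrable lborel {s..s} (\<phi> t \<omega>)" "(LINT q:{s..s}|lborel. \<phi> t \<omega> q) = 0" for \<omega>
    proof -
      have "(\<lambda>q. indicator {s..s} q *\<^sub>R \<phi> t \<omega> q) = (\<lambda>q. indicator {s} q *\<^sub>R \<phi> t \<omega> s)" by (auto simp: indicator_def)
      then show "set_integrable lborel {s..s} (\<phi> t \<omega>)" "(LINT q:{s..s}|lborel. \<phi> t \<omega> q) = 0"
        unfolding set_integrable_def set_lebesgue_integral_def by (auto simp: integral_scaleR_left intro!: integrable_scaleR_left)
    qed
    then show ?case using has_ito_trivial[of s "\<Phi> t"] by (auto simp: Yd_def intro!: exI[of _ "\<lambda>_. 0"])
  next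
    case (Suc i)
    have eq: "s + real (Suc i) * h = s + real i * h + h" by (simp add: algebra_simps)
    have "s + real i * h \<le> t" using Suc.prems h_pos unfolding eq by linarith
    from piece[OF Suc.IH[OF this] _ order_refl _ Ys] Suc.prems h_pos show ?case unfolding eq by simp
  qed
  have cont: "\<exists>Z. has_ito_integral M F Q W s t (\<Phi> t) Z \<and>
     (AE \<omega> in M. X t \<omega> = S (t - s) (Y j \<omega>) + (LINT r:{s..t}|lborel. \<phi> t \<omega> r) + Z \<omega>)" if t: "s \<le> t" for t
  proof -
    define i where "i = nat \<lfloor>(t - s) / h\<rfloor>"
    have i: "real i = of_int \<lfloor>(t - s) / h\<rfloor>" using t h_pos by (simp add: i_def)
    have "real i \<le> (t - s) / h" "(t - s) / h < real i + 1" unfolding i by linarith+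
    then have it: "s + real i * h \<le> t" "t < s + real i * h + h" using h_pos by (auto simp: field_simps)
    define r where "r = t - (s + real i * h)"
    have r: "0 \<le> r" "r \<le> h" "s + real i * h + r = t" using it by (auto simp: r_def)
    have "step (j + int i) r (Yd i) (X (T (j + int i) + r))" unfolding Yd_def using X[OF jJ] r by simp
    then have "step (j + int i) r (Yd i) (X t)" unfolding tT[symmetric] r(3) .
    from piece[OF grid[OF it(1)] r(1,2) _ this] show ?thesis unfolding r(3) by (auto simp: S_0)
  qed
  show ?thesis
    unfolding continuous_scheme_def Let_def
  proof (intro exI[of _ Yd] conjI allI impI)
    show "discrete_scheme M F Q W S e f g n h (T j) (Y j) Yd" using disc by (simp add: s_def)
    show "AE \<omega> in M. continuous_on {T j..} (\<lambda>t. X t \<omega>)" by (rule c)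
    fix t assume "T j \<le> t"
    then show "\<exists>Z. has_ito_integral M F Q W (T j) t
            (\<lambda>r \<omega> v. S (t - (T j + of_int \<lfloor>(r - T j) / h\<rfloor> * h)) (P (g (T j + of_int \<lfloor>(r - T j) / h\<rfloor> * h) (Yd (nat \<lfloor>(r - T j) / h\<rfloor>) \<omega>) v))) Z \<and>
         (AE \<omega> in M. X t \<omega> = S (t - T j) (Y j \<omega>) +
           (LINT r:{T j..t}|lborel. S (t - (T j + of_int \<lfloor>(r - T j) / h\<rfloor> * h)) (P (f (T j + of_int \<lfloor>(r - T j) / h\<rfloor> * h) (Yd (nat \<lfloor>(r - T j) / h\<rfloor>) \<omega>)))) + Z \<omega>)"
      using cont[of t] by (simp add: s_def \<Phi>_def[abs_def] \<phi>_def[abs_def] Lam_def Yb_def gn_def fn_def)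
  qed
qed

text \<open>The predicate leaves the process free on null sets. Uniqueness carries estimates from
  the constructed orbits over to every process that satisfies it.\<close>

lemma continuous_scheme_unique:
  assumes 1: "continuous_scheme M F Q W S e f g n h s \<eta>1 X1" and 2: "continuous_scheme M F Q W S e f g n h s \<eta>2 X2"
    and ae: "AE \<omega> in M. \<eta>1 \<omega> = \<eta>2 \<omega>" and t: "s \<le> t"
  shows "AE \<omega> in M. X1 t \<omega> = X2 t \<omega>"
proof -
  let ?L = "\<lambda>r. s + of_int \<lfloor>(r - s) / h\<rfloor> * h"
  let ?i = "\<lambda>r. nat \<lfloor>(r - s) / h\<rfloor>"
  obtain Y1 Z1 where Y1: "discrete_scheme M F Q W S e f g n h s \<eta>1 Y1"
    "has_ito_integral M F Q W s t (\<lambda>r \<omega> v. S (t - ?L r) (P (g (?L r) (Y1 (?i r) \<omega>) v))) Z1"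
    "AE \<omega> in M. X1 t \<omega> = S (t - s) (\<eta>1 \<omega>) + (LINT r:{s..t}|lborel. S (t - ?L r) (P (f (?L r) (Y1 (?i r) \<omega>)))) + Z1 \<omega>"
    using 1 t unfolding continuous_scheme_def Let_def by blast
  obtain Y2 Z2 where Y2: "discrete_scheme M F Q W S e f g n h s \<eta>2 Y2"
    "has_ito_integral M F Q W s t (\<lambda>r \<omega> v. S (t - ?L r) (P (g (?L r) (Y2 (?i r) \<omega>) v))) Z2"
    "AE \<omega> in M. X2 t \<omega> = S (t - s) (\<eta>2 \<omega>) + (LINT r:{s..t}|lborel. S (t - ?L r) (P (f (?L r) (Y2 (?i r) \<omega>)))) + Z2 \<omega>"
    using 2 t unfolding continuous_scheme_def Let_def by blast
  have "AE \<omega> in M. Y1 i \<omega> = Y2 i \<omega>" for i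
  proof (induction i)
    case 0
    have "\<forall>\<omega>\<in>space M. Y1 0 \<omega> = \<eta>1 \<omega>" "\<forall>\<omega>\<in>space M. Y2 0 \<omega> = \<eta>2 \<omega>"
      using Y1(1) Y2(1) unfolding discrete_scheme_def Let_def by blast+
    note Y0 = this
    show ?case using ae AE_space
    proof eventually_elim
      case (elim \<omega>)
      then show ?case using Y0 by simp
    qed
  next
    case (Suc i)
    let ?t = "s + real i * h"
    obtain U1 where U1: "has_ito_integral M F Q W ?t (s + real (Suc i) * h) (\<lambda>r \<omega> v. P (g ?t (Y1 i \<omega>) v)) U1"
      "AE \<omega> in M. Y1 (Suc i) \<omega> = P (S h (Y1 i \<omega> + h *\<^sub>R P (f ?t (Y1 i \<omega>)) + U1 \<omega>))"
      using Y1(1) unfolding discrete_scheme_def Let_def by blast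
    obtain U2 where U2: "has_ito_integral M F Q W ?t (s + real (Suc i) * h) (\<lambda>r \<omega> v. P (g ?t (Y2 i \<omega>) v)) U2"
      "AE \<omega> in M. Y2 (Suc i) \<omega> = P (S h (Y2 i \<omega> + h *\<^sub>R P (f ?t (Y2 i \<omega>)) + U2 \<omega>))"
      using Y2(1) unfolding discrete_scheme_def Let_def by blast
    have "AE \<omega> in M. U1 \<omega> = U2 \<omega>"
      by (rule Ito_unique_AE[OF U1(1) U2(1)]) (use Suc in eventually_elim, simp)
    with U1(2) U2(2) Suc show ?case by eventually_elim simp
  qed
  then have Y12: "AE \<omega> in M. \<forall>i. Y1 i \<omega> = Y2 i \<omega>" by (simp add: AE_all_countable)
  have "AE \<omega> in M. Z1 \<omega> = Z2 \<omega>"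
    by (rule Ito_unique_AE[OF Y1(2) Y2(2)]) (use Y12 in eventually_elim, simp)
  with Y1(3) Y2(3) Y12 ae show ?thesis by eventually_elim simp
qed

end

section \<open>The random periodic solution\<close>

text \<open>Cauchy-Schwarz with geometric weights, whose tail sum gives the factor in front.\<close>

lemma weighted_sum_square_le:
  fixes D :: "nat \<Rightarrow> 'h::real_normed_vector"
  assumes \<eta>: "0 < \<eta>" "\<eta> < 1"
  shows "(norm (\<Sum>i\<in>{k..<j}. D i))\<^sup>2 \<le> \<eta> ^ k / (1 - \<eta>) * (\<Sum>i\<in>{k..<j}. (norm (D i))\<^sup>2 / \<eta> ^ i)"
proof -
  have sq: "sqrt (\<eta> ^ i) > 0" "(sqrt (\<eta> ^ i))\<^sup>2 = \<eta> ^ i" for i using \<eta> by auto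
  have "norm (\<Sum>i\<in>{k..<j}. D i) \<le> (\<Sum>i\<in>{k..<j}. \<bar>sqrt (\<eta> ^ i)\<bar> * \<bar>norm (D i) / sqrt (\<eta> ^ i)\<bar>)"
    using sq \<eta> by (intro order_trans[OF norm_sum] sum_mono) auto
  also have "\<dots> \<le> L2_set (\<lambda>i. sqrt (\<eta> ^ i)) {k..<j} * L2_set (\<lambda>i. norm (D i) / sqrt (\<eta> ^ i)) {k..<j}"
    by (rule L2_set_mult_ineq)
  finally have "(norm (\<Sum>i\<in>{k..<j}. D i))\<^sup>2 \<le> (L2_set (\<lambda>i. sqrt (\<eta> ^ i)) {k..<j} * L2_set (\<lambda>i. norm (D i) / sqrt (\<eta> ^ i)) {k..<j})\<^sup>2"
    by (rule power_mono) simp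
  also have "\<dots> = (\<Sum>i\<in>{k..<j}. \<eta> ^ i) * (\<Sum>i\<in>{k..<j}. (norm (D i))\<^sup>2 / \<eta> ^ i)"
    using sq \<eta> by (simp add: power_mult_distrib L2_set_def sum_nonneg power_divide)
  also have "\<dots> \<le> \<eta> ^ k / (1 - \<eta>) * (\<Sum>i\<in>{k..<j}. (norm (D i))\<^sup>2 / \<eta> ^ i)"
  proof (rule mult_right_mono)
    have "(\<Sum>i\<in>{k..<j}. \<eta> ^ i) \<le> \<eta> ^ k / (1 - \<eta>)"
    proof (cases "k \<le> j")
      case True
      have "(1 - \<eta>) * (\<Sum>i\<in>{k..<j}. \<eta> ^ i) = \<eta> ^ k - \<eta> ^ j"
        using True
      proof (induction j rule: dec_induct)
        case (step i)
        have "(1 - \<eta>) * (\<Sum>i\<in>{k..<Suc i}. \<eta> ^ i) = (1 - \<eta>) * (\<Sum>i\<in>{k..<i}. \<eta> ^ i) + (1 - \<eta>) * \<eta> ^ i"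
          using step(1) by (simp add: distrib_left)
        also have "\<dots> = \<eta> ^ k - \<eta> ^ Suc i" unfolding step(3) by (simp add: left_diff_distrib)
        finally show ?case .
      qed simp
      also have "\<dots> \<le> \<eta> ^ k" using \<eta> by simp
      finally show ?thesis using \<eta> by (simp add: pos_le_divide_eq mult.commute)
    qed (use \<eta> in simp)
    then show "(\<Sum>i\<in>{k..<j}. \<eta> ^ i) \<le> \<eta> ^ k / (1 - \<eta>)" .
    show "0 \<le> (\<Sum>i\<in>{k..<j}. (norm (D i))\<^sup>2 / \<eta> ^ i)" using \<eta> by (intro sum_nonneg) auto
  qed
  finally show ?thesis .
qed

text \<open>The limit is realised pointwise, by \<open>lim\<close>, rather than as an abstract limit
  in mean square; in this way it inherits measurability with respect to the filtration.\<close>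

lemma L2_geometric_limit:
  fixes X :: "nat \<Rightarrow> 'a \<Rightarrow> 'h::{banach, second_countable_topology}"
  assumes X[measurable]: "\<And>k. X k \<in> borel_measurable N" and r: "0 \<le> r" "r < 1" and C: "0 \<le> C"
    and le: "\<And>k. (\<integral>\<^sup>+x. ennreal ((norm (X (Suc k) x - X k x))\<^sup>2) \<partial>N) \<le> ennreal (C * r ^ k)"
  shows "(\<lambda>k. \<integral>\<^sup>+x. ennreal ((norm (X k x - lim (\<lambda>k. X k x)))\<^sup>2) \<partial>N) \<longlonglongrightarrow> 0"
proof -
  \<comment> \<open>Any number strictly between \<open>r\<close> and 1 would do:
    \<open>r / \<eta> < 1\<close> makes \<open>G\<close> integrable, and \<open>\<eta> < 1\<close>
    makes the tails vanish.\<close>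
  define \<eta> where "\<eta> = (1 + r) / 2"
  have \<eta>: "0 < \<eta>" "\<eta> < 1" "r < \<eta>" using r by (auto simp: \<eta>_def)
  define D where "D i x = X (Suc i) x - X i x" for i x
  have Dm[measurable]: "D i \<in> borel_measurable N" for i unfolding D_def by measurable
  define G where "G x = (\<Sum>i. ennreal ((norm (D i x))\<^sup>2 / \<eta> ^ i))" for x
  have Gm[measurable]: "G \<in> borel_measurable N" unfolding G_def by measurable
  have "(\<integral>\<^sup>+x. G x \<partial>N) = (\<Sum>i. \<integral>\<^sup>+x. ennreal ((norm (D i x))\<^sup>2 / \<eta> ^ i) \<partial>N)"
    unfolding G_def by (rule nn_integral_suminf) measurable
  also have "\<dots> \<le> (\<Sum>i. ennreal (C * (r / \<eta>) ^ i))"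
  proof (intro suminf_le)
    fix i
    have "(\<integral>\<^sup>+x. ennreal ((norm (D i x))\<^sup>2 / \<eta> ^ i) \<partial>N) = (\<integral>\<^sup>+x. ennreal (1 / \<eta> ^ i) * ennreal ((norm (D i x))\<^sup>2) \<partial>N)"
      using \<eta> by (intro nn_integral_cong) (simp add: ennreal_mult[symmetric])
    also have "\<dots> = ennreal (1 / \<eta> ^ i) * (\<integral>\<^sup>+x. ennreal ((norm (D i x))\<^sup>2) \<partial>N)" by (rule nn_integral_cmult) measurable
    also have "\<dots> \<le> ennreal (1 / \<eta> ^ i) * ennreal (C * r ^ i)" unfolding D_def by (intro mult_left_mono le) simp
    also have "\<dots> = ennreal (C * (r / \<eta>) ^ i)" using \<eta> C r by (simp add: ennreal_mult[symmetric] power_divide)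
    finally show "(\<integral>\<^sup>+x. ennreal ((norm (D i x))\<^sup>2 / \<eta> ^ i) \<partial>N) \<le> ennreal (C * (r / \<eta>) ^ i)" .
  qed auto
  also have "\<dots> = ennreal (\<Sum>i. C * (r / \<eta>) ^ i)"
    by (rule suminf_ennreal2) (use C r \<eta> in \<open>auto intro!: summable_mult summable_geometric\<close>)
  finally have Gi: "(\<integral>\<^sup>+x. G x \<partial>N) < \<infinity>" by (auto simp: less_top[symmetric] top_unique)
  have fin: "AE x in N. G x \<noteq> \<infinity>" by (rule nn_integral_PInf_AE) (use Gi in auto)
  have bound: "(norm (X j x - X k x))\<^sup>2 \<le> \<eta> ^ k / (1 - \<eta>) * enn2real (G x)" if "G x \<noteq> \<infinity>" "k \<le> j" for x j k
  proof -
    have "X j x - X k x = (\<Sum>i\<in>{k..<j}. D i x)" unfolding D_def using that(2) by (rule sum_Suc_diff'[symmetric])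
    then have "(norm (X j x - X k x))\<^sup>2 \<le> \<eta> ^ k / (1 - \<eta>) * (\<Sum>i\<in>{k..<j}. (norm (D i x))\<^sup>2 / \<eta> ^ i)"
      using weighted_sum_square_le[OF \<eta>(1,2), of "\<lambda>i. D i x" k j] by simp
    also have "\<dots> \<le> \<eta> ^ k / (1 - \<eta>) * enn2real (G x)"
    proof (rule mult_left_mono)
      have "ennreal (\<Sum>i\<in>{k..<j}. (norm (D i x))\<^sup>2 / \<eta> ^ i) = (\<Sum>i\<in>{k..<j}. ennreal ((norm (D i x))\<^sup>2 / \<eta> ^ i))"
        using \<eta> by (intro sum_ennreal[symmetric]) auto
      also have "\<dots> \<le> G x" unfolding G_def by (rule sum_le_suminf) auto
      finally show "(\<Sum>i\<in>{k..<j}. (norm (D i x))\<^sup>2 / \<eta> ^ i) \<le> enn2real (G x)"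
        using that(1) \<eta> enn2real_mono[of "ennreal (\<Sum>i\<in>{k..<j}. (norm (D i x))\<^sup>2 / \<eta> ^ i)" "G x"]
        by (simp add: sum_nonneg less_top)
    qed (use \<eta> in auto)
    finally show ?thesis .
  qed
  have lim: "(norm (X k x - lim (\<lambda>k. X k x)))\<^sup>2 \<le> \<eta> ^ k / (1 - \<eta>) * enn2real (G x)" if G: "G x \<noteq> \<infinity>" for x k
  proof -
    have K0: "(\<lambda>k. \<eta> ^ k / (1 - \<eta>) * enn2real (G x)) \<longlonglongrightarrow> 0"
      using tendsto_mult_left_zero[OF tendsto_divide_zero[OF LIMSEQ_realpow_zero[of \<eta>]]] \<eta> by auto
    have "Cauchy (\<lambda>k. X k x)"
    proof (rule CauchyI')
      fix e :: real assume e: "0 < e"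
      have "eventually (\<lambda>k. \<eta> ^ k / (1 - \<eta>) * enn2real (G x) < e\<^sup>2) sequentially"
        using K0 by (rule order_tendstoD) (use e in simp)
      then obtain K where K: "\<And>k. K \<le> k \<Longrightarrow> \<eta> ^ k / (1 - \<eta>) * enn2real (G x) < e\<^sup>2" by (auto simp: eventually_sequentially)
      have "norm (X k x - X j x) < e" if "K \<le> k" "k < j" for k j
        using bound[OF G less_imp_le[OF that(2)]] K[OF that(1)] e
        by (intro power2_less_imp_less[of _ e]) (auto simp: norm_minus_commute)
      then show "\<exists>K. \<forall>k\<ge>K. \<forall>j>k. dist (X k x) (X j x) < e" by (auto simp: dist_norm)
    qed
    then have "(\<lambda>j. X j x) \<longlonglongrightarrow> lim (\<lambda>k. X k x)" by (simp add: Cauchy_convergent_iff convergent_LIMSEQ_iff)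
    then have "(\<lambda>j. (norm (X j x - X k x))\<^sup>2) \<longlonglongrightarrow> (norm (lim (\<lambda>k. X k x) - X k x))\<^sup>2" by (intro tendsto_intros)
    then have "(norm (lim (\<lambda>k. X k x) - X k x))\<^sup>2 \<le> \<eta> ^ k / (1 - \<eta>) * enn2real (G x)"
      by (rule LIMSEQ_le_const2) (use bound[OF G] in auto)
    then show ?thesis by (simp add: norm_minus_commute)
  qed
  have le2: "(\<integral>\<^sup>+x. ennreal ((norm (X k x - lim (\<lambda>k. X k x)))\<^sup>2) \<partial>N) \<le> ennreal (\<eta> ^ k / (1 - \<eta>)) * (\<integral>\<^sup>+x. G x \<partial>N)" for k
  proof -
    have "(\<integral>\<^sup>+x. ennreal ((norm (X k x - lim (\<lambda>k. X k x)))\<^sup>2) \<partial>N) \<le> (\<integral>\<^sup>+x. ennreal (\<eta> ^ k / (1 - \<eta>)) * G x \<partial>N)"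
    proof (rule nn_integral_mono_AE)
      show "AE x in N. ennreal ((norm (X k x - lim (\<lambda>k. X k x)))\<^sup>2) \<le> ennreal (\<eta> ^ k / (1 - \<eta>)) * G x"
        using fin
      proof eventually_elim
        case (elim x)
        have "ennreal ((norm (X k x - lim (\<lambda>k. X k x)))\<^sup>2) \<le> ennreal (\<eta> ^ k / (1 - \<eta>) * enn2real (G x))"
          by (rule ennreal_leI[OF lim[OF elim]])
        also have "\<dots> = ennreal (\<eta> ^ k / (1 - \<eta>)) * G x"
          using \<eta> elim by (subst ennreal_mult) (auto simp: less_top)
        finally show ?case .
      qed
    qed
    also have "\<dots> = ennreal (\<eta> ^ k / (1 - \<eta>)) * (\<integral>\<^sup>+x. G x \<partial>N)" by (rule nn_integral_cmult) measurable
    finally show ?thesis .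
  qed
  have "(\<lambda>k. ennreal (\<eta> ^ k / (1 - \<eta>)) * (\<integral>\<^sup>+x. G x \<partial>N)) \<longlonglongrightarrow> 0"
  proof -
    obtain c where c: "(\<integral>\<^sup>+x. G x \<partial>N) = ennreal c" "0 \<le> c" using Gi by (cases "\<integral>\<^sup>+x. G x \<partial>N") auto
    have "(\<lambda>k. ennreal (\<eta> ^ k / (1 - \<eta>) * c)) \<longlonglongrightarrow> ennreal 0"
      using tendsto_mult_left_zero[OF tendsto_divide_zero[OF LIMSEQ_realpow_zero[of \<eta>]]] \<eta> by (intro tendsto_ennrealI) auto
    moreover have "ennreal (\<eta> ^ k / (1 - \<eta>) * c) = ennreal (\<eta> ^ k / (1 - \<eta>)) * ennreal c" for k
      using \<eta> c by (intro ennreal_mult) auto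
    ultimately show ?thesis unfolding c(1) by simp
  qed
  from tendsto_sandwich[OF always_eventually always_eventually tendsto_const this] show ?thesis using le2 by simp
qed

text \<open>Sampling each path at the dyadic point below \<open>t\<close> yields jointly measurable
  processes that converge to it.\<close>

lemma continuous_paths_jointly_measurable:
  fixes y :: "real \<Rightarrow> 'a \<Rightarrow> 'h::{real_normed_vector, second_countable_topology}"
  assumes y[measurable]: "\<And>t. y t \<in> borel_measurable N" and c: "\<And>\<omega>. \<omega> \<in> space N \<Longrightarrow> continuous_on UNIV (\<lambda>t. y t \<omega>)"
  shows "(\<lambda>(t, \<omega>). y t \<omega>) \<in> borel_measurable (borel \<Otimes>\<^sub>M N)"
proof -
  define q :: "nat \<Rightarrow> real \<Rightarrow> real" where "q k t = of_int \<lfloor>t * 2 ^ k\<rfloor> / 2 ^ k" for k t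
  have q: "(\<lambda>k. q k t) \<longlonglongrightarrow> t" for t
  proof (rule tendsto_sandwich)
    have b: "t * 2 ^ k - 1 \<le> of_int \<lfloor>t * 2 ^ k\<rfloor>" "of_int \<lfloor>t * 2 ^ k\<rfloor> \<le> t * 2 ^ k" for k :: nat by linarith+
    show "\<forall>\<^sub>F k in sequentially. t - (1/2) ^ k \<le> q k t"
    proof (intro always_eventually allI)
      fix k
      have "t - (1/2) ^ k = (t * 2 ^ k - 1) / 2 ^ k" by (simp add: diff_divide_distrib power_one_over inverse_eq_divide)
      also have "\<dots> \<le> q k t" unfolding q_def using b(1) by (intro divide_right_mono) auto
      finally show "t - (1/2) ^ k \<le> q k t" .
    qed
    show "\<forall>\<^sub>F k in sequentially. q k t \<le> t"
      unfolding q_def using b(2) by (intro always_eventually allI) (simp add: pos_divide_le_eq)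
    have "(\<lambda>k. t - (1/2) ^ k) \<longlonglongrightarrow> t - 0" by (intro tendsto_intros LIMSEQ_realpow_zero) auto
    then show "(\<lambda>k. t - (1/2) ^ k) \<longlonglongrightarrow> t" by simp
  qed simp
  show ?thesis
  proof (rule borel_measurable_LIMSEQ_metric)
    fix k :: nat
    have "(\<lambda>p. y (of_int i / 2 ^ k) (snd p)) \<in> borel_measurable (borel \<Otimes>\<^sub>M N)" for i :: int by measurable
    moreover have "(\<lambda>p. \<lfloor>(fst p :: real) * 2 ^ k\<rfloor>) \<in> measurable (borel \<Otimes>\<^sub>M N) (count_space UNIV)" by measurable
    ultimately show "(\<lambda>p. y (q k (fst p)) (snd p)) \<in> borel_measurable (borel \<Otimes>\<^sub>M N)"
      unfolding q_def by (rule measurable_compose_countable)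
  next
    fix p :: "real \<times> 'a" assume "p \<in> space (borel \<Otimes>\<^sub>M N)"
    then have "isCont (\<lambda>t. y t (snd p)) (fst p)" using c[of "snd p"] by (auto simp: space_pair_measure continuous_on_eq_continuous_at)
    from isCont_tendsto_compose[OF this q]
    show "(\<lambda>k. y (q k (fst p)) (snd p)) \<longlonglongrightarrow> (\<lambda>(t, \<omega>). y t \<omega>) p" by (simp add: case_prod_unfold)
  qed
qed

lemma AE_continuous_eqI:
  fixes y z :: "real \<Rightarrow> 'a \<Rightarrow> 'h::real_normed_vector"
  assumes eq: "\<And>t. AE \<omega> in N. y t \<omega> = z t \<omega>" and c: "AE \<omega> in N. continuous_on UNIV (\<lambda>t. y t \<omega>)" "AE \<omega> in N. continuous_on UNIV (\<lambda>t. z t \<omega>)"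
  shows "AE \<omega> in N. \<forall>t. y t \<omega> = z t \<omega>"
proof -
  have "AE \<omega> in N. \<forall>t\<in>\<rat>. y t \<omega> = z t \<omega>" using eq countable_rat by (subst AE_ball_countable) auto
  with c show ?thesis
  proof eventually_elim
    case (elim \<omega>)
    have "closed {t. y t \<omega> = z t \<omega>}" using elim(1,2) by (rule closed_Collect_eq)
    then have "closure \<rat> \<subseteq> {t. y t \<omega> = z t \<omega>}" using elim(3) by (intro closure_minimal) auto
    then show ?case by (auto simp: Rats_closure_real)
  qed
qed

context galerkin_scheme
begin

section \<open>Contraction of the continuous scheme\<close>

lemma adm_const: "c \<in> Hn \<Longrightarrow> adm j (\<lambda>_. c)"
  by (simp add: adm_def square_integrable_def)

text \<open>Instead of changing the integrand inside the integral, a step from \<open>Y'\<close> is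
  constructed and then identified with \<open>V\<close> by uniqueness.\<close>

lemma step_cong_start:
  assumes s: "step j r Y V" and a: "adm j Y'" and ae: "AE \<omega> in M. Y \<omega> = Y' \<omega>" and r: "r \<in> {0..h}"
  shows "step j r Y' V"
proof -
  obtain V' where "step_path j Y' V'" using step_path_exists[OF a] by blast
  then have V': "step j r Y' (V' r)" using r by (rule step_pathD)
  have "AE \<omega> in M. V' r \<omega> = V \<omega>" by (rule step_unique[OF V' s]) (use ae in eventually_elim, simp)
  then show ?thesis by (rule step_cong_result[OF V'])
qed

lemma orbit_subset: "orbit {j0..} Y \<Longrightarrow> j0 \<le> j1 \<Longrightarrow> orbit {j1..} Y"
  by (auto simp: orbit_def)

lemma scheme_exists:
  assumes a: "adm j \<eta>"
  obtains Y X where "orbit {j..} Y" "Y j = \<eta>" "continuous_scheme M F Q W S e f g n h (T j) \<eta> X"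
    "\<And>i r. j \<le> i \<Longrightarrow> r \<in> {0..h} \<Longrightarrow> step i r (Y i) (X (T i + r))"
proof -
  obtain Y where Y: "Y j = \<eta>" "orbit {j..} Y" using orbit_exists[OF a] by blast
  obtain X where X: "\<And>\<omega> t. X t \<omega> \<in> Hn" "\<And>t. X t \<in> borel_measurable M"
    "\<And>i r. i \<in> {j..} \<Longrightarrow> r \<in> {0..h} \<Longrightarrow> step i r (Y i) (X (T i + r))"
    "\<And>i r. i \<in> {j..} \<Longrightarrow> r \<in> {0..h} \<Longrightarrow> square_integrable M (X (T i + r))"
    "\<And>i. i \<in> {j..} \<Longrightarrow> AE \<omega> in M. X (T i) \<omega> = Y i \<omega>"
    "\<And>i \<omega>. i \<in> {j..} \<Longrightarrow> \<omega> \<in> space M \<Longrightarrow> continuous_on {T i..T i + h} (\<lambda>t. X t \<omega>)"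
    by (rule orbit_interpolation[OF Y(2)]) blast
  have "continuous_on {T j..} (\<lambda>t. X t \<omega>)" if "\<omega> \<in> space M" for \<omega>
    by (rule continuous_on_grid) (use X(6) that in auto)
  then have "continuous_scheme M F Q W S e f g n h (T j) (Y j) X"
    by (intro orbit_continuous_scheme[OF Y(2)] X(3)) auto
  then show ?thesis using that[OF Y(2,1) _ X(3)] Y(1) by simp
qed

text \<open>The \<open>k\<close> full steps contribute \<open>\<rho> ^ k\<close>, and the last
  partial step a factor of at most 1. Arbitrary versions \<open>X1\<close> and \<open>X2\<close> are
  first replaced by constructed orbits.\<close>

lemma scheme_contraction:
  assumes 1: "continuous_scheme M F Q W S e f g n h (T j) \<eta>1 X1" and 2: "continuous_scheme M F Q W S e f g n h (T j) \<eta>2 X2"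
    and a: "adm j \<eta>1" "adm j \<eta>2" and t: "T (j + int k) \<le> t" "t \<le> T (j + int k) + h"
  shows "(\<integral>\<^sup>+\<omega>. ennreal ((norm (X1 t \<omega> - X2 t \<omega>))\<^sup>2) \<partial>M) \<le> ennreal (\<rho> ^ k) * (\<integral>\<^sup>+\<omega>. ennreal ((norm (\<eta>1 \<omega> - \<eta>2 \<omega>))\<^sup>2) \<partial>M)"
proof -
  define r where "r = t - T (j + int k)"
  have r: "r \<in> {0..h}" "t = T (j + int k) + r" using t by (auto simp: r_def)
  have jt: "T j \<le> t" using t(1) h_pos by (simp add: T_add) (meson add_increasing2 dual_order.trans le_add_same_cancel1 less_imp_le mult_nonneg_nonneg of_nat_0_le_iff)
  obtain Y1 V1 where V1: "orbit {j..} Y1" "Y1 j = \<eta>1" "continuous_scheme M F Q W S e f g n h (T j) \<eta>1 V1"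
    "\<And>i r. j \<le> i \<Longrightarrow> r \<in> {0..h} \<Longrightarrow> step i r (Y1 i) (V1 (T i + r))" using scheme_exists[OF a(1)] by blast
  obtain Y2 V2 where V2: "orbit {j..} Y2" "Y2 j = \<eta>2" "continuous_scheme M F Q W S e f g n h (T j) \<eta>2 V2"
    "\<And>i r. j \<le> i \<Longrightarrow> r \<in> {0..h} \<Longrightarrow> step i r (Y2 i) (V2 (T i + r))" using scheme_exists[OF a(2)] by blast
  have ae: "AE \<omega> in M. X1 t \<omega> = V1 t \<omega>" "AE \<omega> in M. X2 t \<omega> = V2 t \<omega>"
    using continuous_scheme_unique[OF 1 V1(3) _ jt] continuous_scheme_unique[OF 2 V2(3) _ jt] by auto
  have "(\<integral>\<^sup>+\<omega>. ennreal ((norm (X1 t \<omega> - X2 t \<omega>))\<^sup>2) \<partial>M) = (\<integral>\<^sup>+\<omega>. ennreal ((norm (V1 t \<omega> - V2 t \<omega>))\<^sup>2) \<partial>M)"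
    by (rule nn_integral_cong_AE) (use ae in eventually_elim, simp)
  also have "\<dots> \<le> ennreal (max 0 (1 - r * Cfg / 2)) * (\<integral>\<^sup>+\<omega>. ennreal ((norm (Y1 (j + int k) \<omega> - Y2 (j + int k) \<omega>))\<^sup>2) \<partial>M)"
    unfolding r(2)
  proof (rule step_contraction[OF V1(4) V2(4)])
    show "adm (j + int k) (Y1 (j + int k))" "adm (j + int k) (Y2 (j + int k))" using V1(1) V2(1) by (auto simp: orbit_def)
  qed (use r in auto)
  also have "\<dots> \<le> 1 * (\<integral>\<^sup>+\<omega>. ennreal ((norm (Y1 (j + int k) \<omega> - Y2 (j + int k) \<omega>))\<^sup>2) \<partial>M)"
    using r C_pos by (intro mult_right_mono) (auto simp: ennreal_le_1)
  also have "\<dots> \<le> ennreal (\<rho> ^ k) * (\<integral>\<^sup>+\<omega>. ennreal ((norm (\<eta>1 \<omega> - \<eta>2 \<omega>))\<^sup>2) \<partial>M)"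
    using orbit_contraction[OF V1(1) V2(1), of j k] V1(2) V2(2) by simp
  finally show ?thesis .
qed

end

text \<open>\<open>m\<close> is the number of steps in one period, so a shift by
  \<open>\<tau>\<close> moves grid indices by \<open>m\<close>.\<close>

locale galerkin_periodic = galerkin_scheme Q M F W S e lam f g n h Cf Cg Cfg
  for Q :: "'u::{real_inner, banach, second_countable_topology} \<Rightarrow>\<^sub>L 'u" and M :: "'w measure"
    and F :: "real \<Rightarrow> 'w measure" and W :: "real \<Rightarrow> 'u \<Rightarrow> 'w \<Rightarrow> real"
    and S :: "real \<Rightarrow> 'h::{real_inner, banach, second_countable_topology} \<Rightarrow>\<^sub>L 'h"
    and e :: "nat \<Rightarrow> 'h" and lam f g n h Cf Cg Cfg +
  fixes \<theta> :: "real \<Rightarrow> 'w \<Rightarrow> 'w" and \<tau> :: real and m :: nat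
  assumes shift: "ergodic_wiener_shift M W \<theta>"
    and f_periodic: "\<And>t u. f (t + \<tau>) u = f t u"
    and g_periodic: "\<And>t u v. v \<in> U0 Q \<Longrightarrow> g (t + \<tau>) u v = g t u v"
    and \<tau>: "\<tau> = real m * h" and m: "1 \<le> m"
begin

section \<open>Equivariance under the Wiener shift\<close>

lemma T_shift: "T (j + int m) = T j + \<tau>" by (simp add: T_add \<tau>)

lemma \<theta>_measurable[measurable]: "\<theta> \<tau> \<in> measurable M M" and \<theta>_distr: "distr M M (\<theta> \<tau>) = M"
  using conjunct1[OF shift[unfolded ergodic_wiener_shift_def]] by simp_all

lemma AE_\<theta>: "AE \<omega> in M. pr \<omega> \<Longrightarrow> AE \<omega> in M. pr (\<theta> \<tau> \<omega>)"
  by (rule AE_distrD[OF \<theta>_measurable]) (simp only: \<theta>_distr)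

lemma nn_integral_\<theta>: "p \<in> borel_measurable M \<Longrightarrow> (\<integral>\<^sup>+\<omega>. p (\<theta> \<tau> \<omega>) \<partial>M) = (\<integral>\<^sup>+\<omega>. p \<omega> \<partial>M)"
  using nn_integral_distr[OF \<theta>_measurable, of p] unfolding \<theta>_distr by simp

lemma dW_\<theta>: "AE \<omega> in M. dW a b u (\<theta> \<tau> \<omega>) = dW (a + \<tau>) (b + \<tau>) u \<omega>"
proof -
  have "AE \<omega> in M. W t u (\<theta> \<tau> \<omega>) = W (t + \<tau>) u \<omega> - W \<tau> u \<omega>" for t
    using shift unfolding ergodic_wiener_shift_def by blast
  from this[of a] this[of b] show ?thesis by eventually_elim (simp add: dW_def)
qed

lemma op_dW_\<theta>:
  fixes l :: "('u \<times> 'h) list"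
  shows "AE \<omega> in M. op_dW a b l (\<theta> \<tau> \<omega>) = op_dW (a + \<tau>) (b + \<tau>) l \<omega>"
proof (induction l)
  case (Cons p l)
  obtain u x where p: "p = (u, x)" by force
  from Cons dW_\<theta>[of a b u] show ?case by eventually_elim (simp add: op_dW_def p)
qed (simp add: op_dW_def)

text \<open>Almost surely the canonical approximants of \<open>\<Gamma>'\<close> are those of
  \<open>\<Gamma>\<close> composed with the shift. Both converge in mean square, the second because
  the shift preserves the measure, so the limits agree.\<close>

lemma const_integral_\<theta>:
  fixes \<Gamma> \<Gamma>' :: "'w \<Rightarrow> 'u \<Rightarrow> 'h"
  assumes G: "random_op a \<Gamma>" "random_op (a + \<tau>) \<Gamma>'" and ab: "a \<le> b"
    and ae: "AE \<omega> in M. \<forall>v\<in>B. \<Gamma>' \<omega> v = \<Gamma> (\<theta> \<tau> \<omega>) v"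
    and Z: "has_ito_integral M F Q W a b (\<lambda>_. \<Gamma>) Z" "has_ito_integral M F Q W (a + \<tau>) (b + \<tau>) (\<lambda>_. \<Gamma>') Z'"
  shows "AE \<omega> in M. Z' \<omega> = Z (\<theta> \<tau> \<omega>)"
proof -
  let ?I = "\<lambda>k. block_int a b (approx_coeffs \<Gamma> k)" and ?I' = "\<lambda>k. block_int (a + \<tau>) (b + \<tau>) (approx_coeffs \<Gamma>' k)"
  have [measurable]: "Z \<in> borel_measurable M" "Z' \<in> borel_measurable M" using Z by (auto intro: has_ito_measurable)
  have [measurable]: "?I k \<in> borel_measurable M" "?I' k \<in> borel_measurable M" for k
    using ab by (auto intro!: measurable_F_M[OF block_int_measF] approx_coefficients G)
  have "AE \<omega> in M. \<forall>k. op_dW a b (dense_ops Q k :: ('u \<times> 'h) list) (\<theta> \<tau> \<omega>) = op_dW (a + \<tau>) (b + \<tau>) (dense_ops Q k) \<omega>"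
    using op_dW_\<theta> by (subst AE_all_countable) blast
  with ae have I: "AE \<omega> in M. \<forall>k. ?I' k \<omega> = ?I k (\<theta> \<tau> \<omega>)"
  proof eventually_elim
    case (elim \<omega>)
    have "nearest_op k (\<Gamma>' \<omega>) = nearest_op k (\<Gamma> (\<theta> \<tau> \<omega>))" for k by (rule nearest_op_cong) (use elim in auto)
    then show ?case using elim(2) by (simp add: approx_int)
  qed
  have lim: "(\<lambda>k. ennreal (b - a) * op_energy_err \<Gamma> k) \<longlonglongrightarrow> 0" "(\<lambda>k. ennreal (b - a) * op_energy_err \<Gamma>' k) \<longlonglongrightarrow> 0"
    using ennreal_tendsto_cmult[OF _ op_energy_err_tendsto[OF G(1)], of "ennreal (b - a)"]
      ennreal_tendsto_cmult[OF _ op_energy_err_tendsto[OF G(2)], of "ennreal (b - a)"] by auto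
  show ?thesis
  proof (rule L2_tendsto_unique[of ?I'])
    have le1: "(\<integral>\<^sup>+\<omega>. ennreal ((norm (?I' k \<omega> - Z' \<omega>))\<^sup>2) \<partial>M) \<le> ennreal (b - a) * op_energy_err \<Gamma>' k" for k
      using const_integral_approx[OF G(2) _ Z(2), of k] ab by (simp add: norm_minus_commute)
    show "(\<lambda>k. \<integral>\<^sup>+\<omega>. ennreal ((norm (?I' k \<omega> - Z' \<omega>))\<^sup>2) \<partial>M) \<longlonglongrightarrow> 0"
      by (rule tendsto_sandwich[OF _ _ tendsto_const lim(2)]) (auto intro: always_eventually le1)
    have le2: "(\<integral>\<^sup>+\<omega>. ennreal ((norm (?I' k \<omega> - Z (\<theta> \<tau> \<omega>)))\<^sup>2) \<partial>M) \<le> ennreal (b - a) * op_energy_err \<Gamma> k" for k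
    proof -
      have "(\<integral>\<^sup>+\<omega>. ennreal ((norm (?I' k \<omega> - Z (\<theta> \<tau> \<omega>)))\<^sup>2) \<partial>M) = (\<integral>\<^sup>+\<omega>. ennreal ((norm (?I k (\<theta> \<tau> \<omega>) - Z (\<theta> \<tau> \<omega>)))\<^sup>2) \<partial>M)"
        by (rule nn_integral_cong_AE) (use I in eventually_elim, simp)
      also have "\<dots> = (\<integral>\<^sup>+\<omega>. ennreal ((norm (?I k \<omega> - Z \<omega>))\<^sup>2) \<partial>M)"
        by (rule nn_integral_\<theta>[of "\<lambda>\<omega>. ennreal ((norm (?I k \<omega> - Z \<omega>))\<^sup>2)"]) measurable
      also have "\<dots> \<le> ennreal (b - a) * op_energy_err \<Gamma> k"
        using const_integral_approx[OF G(1) ab Z(1), of k] by (simp add: norm_minus_commute)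
      finally show ?thesis .
    qed
    show "(\<lambda>k. \<integral>\<^sup>+\<omega>. ennreal ((norm (?I' k \<omega> - Z (\<theta> \<tau> \<omega>)))\<^sup>2) \<partial>M) \<longlonglongrightarrow> 0"
      by (rule tendsto_sandwich[OF _ _ tendsto_const lim(1)]) (auto intro: always_eventually le2)
  qed measurable
qed

text \<open>By periodicity of the coefficients, a step composed with the shift is a step one period
  later.\<close>

lemma step_\<theta>:
  assumes a: "adm j Y" "adm (j + int m) Y'" and ae: "AE \<omega> in M. Y' \<omega> = Y (\<theta> \<tau> \<omega>)"
    and s: "step j r Y V" "step (j + int m) r Y' V'" and r: "0 \<le> r"
  shows "AE \<omega> in M. V' \<omega> = V (\<theta> \<tau> \<omega>)"
proof -
  obtain Z where Z: "has_ito_integral M F Q W (T j) (T j + r) (\<lambda>_ \<omega>. gn (T j) (Y \<omega>)) Z"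
    "AE \<omega> in M. V \<omega> = S r (Y \<omega> + r *\<^sub>R fn (T j) (Y \<omega>) + Z \<omega>)" using s(1) by (auto simp: step_def)
  obtain Z' where Z': "has_ito_integral M F Q W (T j + \<tau>) (T j + \<tau> + r) (\<lambda>_ \<omega>. gn (T j + \<tau>) (Y' \<omega>)) Z'"
    "AE \<omega> in M. V' \<omega> = S r (Y' \<omega> + r *\<^sub>R fn (T j + \<tau>) (Y' \<omega>) + Z' \<omega>)" using s(2) by (auto simp: step_def T_shift)
  have fp: "fn (T j + \<tau>) y = fn (T j) y" for y by (simp add: fn_def f_periodic)
  have gp: "gn (T j + \<tau>) y v = gn (T j) y v" if "v \<in> B" for y v by (simp add: gn_def g_periodic[OF B_U0[OF that]])
  have "AE \<omega> in M. Z' \<omega> = Z (\<theta> \<tau> \<omega>)"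
  proof (rule const_integral_\<theta>[OF _ _ _ _ Z(1)])
    show "random_op (T j) (\<lambda>\<omega>. gn (T j) (Y \<omega>))" using a(1) by (intro gn_random_op) (auto simp: adm_def)
    show "random_op (T j + \<tau>) (\<lambda>\<omega>. gn (T j + \<tau>) (Y' \<omega>))" using a(2) by (intro gn_random_op) (auto simp: adm_def T_shift)
    show "AE \<omega> in M. \<forall>v\<in>B. gn (T j + \<tau>) (Y' \<omega>) v = gn (T j) (Y (\<theta> \<tau> \<omega>)) v" using ae by eventually_elim (simp add: gp)
    have "T j + r + \<tau> = T j + \<tau> + r" by simp
    then show "has_ito_integral M F Q W (T j + \<tau>) (T j + r + \<tau>) (\<lambda>_ \<omega>. gn (T j + \<tau>) (Y' \<omega>)) Z'" using Z'(1) by metis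
  qed (use r in simp)
  with Z'(2) AE_\<theta>[OF Z(2)] ae show ?thesis by eventually_elim (simp add: fp)
qed

lemma orbit_\<theta>:
  assumes o: "orbit {j0..} Y" "orbit {j0 + int m..} Y'" and ae: "AE \<omega> in M. Y' (j0 + int m) \<omega> = Y j0 (\<theta> \<tau> \<omega>)" and j: "j0 \<le> j"
  shows "AE \<omega> in M. Y' (j + int m) \<omega> = Y j (\<theta> \<tau> \<omega>)"
  using j
proof (induction j rule: int_ge_induct)
  case base show ?case by (rule ae)
next
  case (step i)
  have "AE \<omega> in M. Y' (i + int m + 1) \<omega> = Y (i + 1) (\<theta> \<tau> \<omega>)"
    by (rule step_\<theta>[OF _ _ step.IH]) (use o step.hyps h_pos in \<open>auto simp: orbit_def\<close>)
  then show ?case by (simp add: algebra_simps)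
qed

section \<open>Solutions started from zero and the stationary orbit\<close>

definition start :: "nat \<Rightarrow> int" where "start k = - (int k * int m)"

lemma start_Suc: "start (Suc k) + int m = start k" by (simp add: start_def algebra_simps)

lemma start_le: "- int k \<ge> start k"
proof -
  have "int k * 1 \<le> int k * int m" using m by (intro mult_left_mono) auto
  then show ?thesis by (simp add: start_def)
qed

lemma T_start: "T (start k) = - (real k * \<tau>)" by (simp add: T_def start_def \<tau>)

definition zero_orbit :: "nat \<Rightarrow> int \<Rightarrow> 'w \<Rightarrow> 'h" where
  "zero_orbit k = (SOME Y. Y (start k) = (\<lambda>_. 0) \<and> orbit {start k..} Y)"

lemma zero_orbit: "zero_orbit k (start k) = (\<lambda>_. 0)" "orbit {start k..} (zero_orbit k)"
proof -
  have "\<exists>Y. Y (start k) = (\<lambda>_. 0) \<and> orbit {start k..} Y"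
    using orbit_exists[OF adm_const[OF subspace_0[OF Hn_subspace]]] by metis
  from someI_ex[OF this] show "zero_orbit k (start k) = (\<lambda>_. 0)" "orbit {start k..} (zero_orbit k)"
    unfolding zero_orbit_def by blast+
qed

lemma zero_orbit_adm: "start k \<le> j \<Longrightarrow> adm j (zero_orbit k j)"
  using zero_orbit(2)[of k] by (auto simp: orbit_def)

lemma zero_orbit_\<theta>: "start (Suc k) \<le> j \<Longrightarrow> AE \<omega> in M. zero_orbit k (j + int m) \<omega> = zero_orbit (Suc k) j (\<theta> \<tau> \<omega>)"
  by (rule orbit_\<theta>[OF zero_orbit(2)]) (use zero_orbit start_Suc in auto)

lemma nn_integral_AE_\<theta>:
  assumes "AE \<omega> in M. Y' \<omega> = Y (\<theta> \<tau> \<omega>)" "Y \<in> borel_measurable M"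
  shows "(\<integral>\<^sup>+\<omega>. ennreal ((norm (Y' \<omega> :: 'h))\<^sup>2) \<partial>M) = (\<integral>\<^sup>+\<omega>. ennreal ((norm (Y \<omega>))\<^sup>2) \<partial>M)"
proof -
  note [measurable] = assms(2)
  have "(\<integral>\<^sup>+\<omega>. ennreal ((norm (Y' \<omega>))\<^sup>2) \<partial>M) = (\<integral>\<^sup>+\<omega>. ennreal ((norm (Y (\<theta> \<tau> \<omega>)))\<^sup>2) \<partial>M)"
    by (rule nn_integral_cong_AE) (use assms(1) in eventually_elim, simp)
  also have "\<dots> = (\<integral>\<^sup>+\<omega>. ennreal ((norm (Y \<omega>))\<^sup>2) \<partial>M)"
    by (rule nn_integral_\<theta>[of "\<lambda>\<omega>. ennreal ((norm (Y \<omega>))\<^sup>2)"]) measurable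
  finally show ?thesis .
qed

text \<open>By stationarity one number bounds all the differences of successive zero orbits.\<close>

lemma zero_orbit_diff:
  obtains c where "0 \<le> c" "\<And>k j i. start k + int i \<le> j \<Longrightarrow>
    (\<integral>\<^sup>+\<omega>. ennreal ((norm (zero_orbit (Suc k) j \<omega> - zero_orbit k j \<omega>))\<^sup>2) \<partial>M) \<le> ennreal (c * \<rho> ^ i)"
proof -
  define c where "c = (\<integral>\<omega>. (norm (zero_orbit 1 0 \<omega>))\<^sup>2 \<partial>M)"
  have s1: "start (Suc k) \<le> start k" for k using start_Suc[of k] by simp
  have "square_integrable M (zero_orbit 1 0)" using zero_orbit_adm[of 1 0] by (simp add: adm_def start_def)
  from square_integrable_nn[OF this] have c1: "(\<integral>\<^sup>+\<omega>. ennreal ((norm (zero_orbit 1 0 \<omega>))\<^sup>2) \<partial>M) = ennreal c" by (simp add: c_def)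
  \<comment> \<open>When the \<open>k\<close>-th orbit starts at zero, the next one has already run
    for exactly one period; the shift makes its second moment there the same for all
    \<open>k\<close>.\<close>
  have mom: "(\<integral>\<^sup>+\<omega>. ennreal ((norm (zero_orbit (Suc k) (start k) \<omega>))\<^sup>2) \<partial>M) = ennreal c" for k
  proof (induction k)
    case 0 then show ?case using c1 by (simp add: start_def)
  next
    case (Suc k)
    have "AE \<omega> in M. zero_orbit (Suc k) (start (Suc k) + int m) \<omega> = zero_orbit (Suc (Suc k)) (start (Suc k)) (\<theta> \<tau> \<omega>)"
      by (rule zero_orbit_\<theta>) (rule s1)
    from nn_integral_AE_\<theta>[OF this adm_M[OF zero_orbit_adm[OF s1]]] Suc show ?case by (simp add: start_Suc)
  qed
  have "(\<integral>\<^sup>+\<omega>. ennreal ((norm (zero_orbit (Suc k) j \<omega> - zero_orbit k j \<omega>))\<^sup>2) \<partial>M) \<le> ennreal (c * \<rho> ^ i)"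
    if j: "start k + int i \<le> j" for k j i
  proof -
    define d where "d = nat (j - start k)"
    have d: "j = start k + int d" "i \<le> d" using j by (auto simp: d_def)
    have "(\<integral>\<^sup>+\<omega>. ennreal ((norm (zero_orbit (Suc k) j \<omega> - zero_orbit k j \<omega>))\<^sup>2) \<partial>M)
      \<le> ennreal (\<rho> ^ d) * (\<integral>\<^sup>+\<omega>. ennreal ((norm (zero_orbit (Suc k) (start k) \<omega> - zero_orbit k (start k) \<omega>))\<^sup>2) \<partial>M)"
      unfolding d(1) by (rule orbit_contraction[OF orbit_subset[OF zero_orbit(2) s1] zero_orbit(2), THEN conjunct2]) simp
    also have "\<dots> = ennreal (\<rho> ^ d) * ennreal c" using mom[of k] by (simp add: zero_orbit(1))
    also have "\<dots> \<le> ennreal (c * \<rho> ^ i)"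
    proof -
      have "c * \<rho> ^ d \<le> c * \<rho> ^ i" using \<rho> d(2) by (intro mult_left_mono power_decreasing) (auto simp: c_def)
      then show ?thesis using \<rho> by (simp add: ennreal_mult[symmetric] c_def mult.commute ennreal_leI)
    qed
    finally show ?thesis .
  qed
  then show ?thesis using that[of c] by (simp add: c_def)
qed

text \<open>The offset \<open>nat (- j)\<close> ensures that all orbits in the sequence have started
  by the index \<open>j\<close>, as \<open>start k \<le> - int k\<close>. The projection puts the
  value in \<open>Hn\<close> also where the sequence fails to converge.\<close>

definition Ystar :: "int \<Rightarrow> 'w \<Rightarrow> 'h" where
  "Ystar j \<omega> = P (lim (\<lambda>k. zero_orbit (k + nat (- j)) j \<omega>))"

lemma start_offset: "start (k + nat (- j)) + int k \<le> j"
proof -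
  have "start (k + nat (- j)) \<le> - int (k + nat (- j))" by (rule start_le)
  moreover have "- j \<le> int (nat (- j))" by simp
  ultimately show ?thesis unfolding of_nat_add by linarith
qed

text \<open>\<open>P\<close> fixes the orbits and does not increase distances, so projecting the
  pointwise limit does not spoil convergence in mean square.\<close>

lemma Ystar_limit: "(\<lambda>k. \<integral>\<^sup>+\<omega>. ennreal ((norm (zero_orbit (k + nat (- j)) j \<omega> - Ystar j \<omega>))\<^sup>2) \<partial>M) \<longlonglongrightarrow> 0"
proof -
  obtain c where c: "0 \<le> c" "\<And>k j i. start k + int i \<le> j \<Longrightarrow>
    (\<integral>\<^sup>+\<omega>. ennreal ((norm (zero_orbit (Suc k) j \<omega> - zero_orbit k j \<omega>))\<^sup>2) \<partial>M) \<le> ennreal (c * \<rho> ^ i)"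
    using zero_orbit_diff by blast
  have a: "adm j (zero_orbit (k + nat (- j)) j)" for k using start_offset[of k j] by (intro zero_orbit_adm) auto
  have l: "(\<lambda>k. \<integral>\<^sup>+\<omega>. ennreal ((norm (zero_orbit (k + nat (- j)) j \<omega> - lim (\<lambda>k. zero_orbit (k + nat (- j)) j \<omega>)))\<^sup>2) \<partial>M) \<longlonglongrightarrow> 0"
    by (rule L2_geometric_limit[OF adm_M[OF a] \<rho> c(1)]) (use c(2)[OF start_offset] in simp)
  have le: "(\<integral>\<^sup>+\<omega>. ennreal ((norm (zero_orbit (k + nat (- j)) j \<omega> - Ystar j \<omega>))\<^sup>2) \<partial>M)
    \<le> (\<integral>\<^sup>+\<omega>. ennreal ((norm (zero_orbit (k + nat (- j)) j \<omega> - lim (\<lambda>k. zero_orbit (k + nat (- j)) j \<omega>)))\<^sup>2) \<partial>M)" for k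
  proof (intro nn_integral_mono ennreal_leI power_mono)
    fix \<omega> assume "\<omega> \<in> space M"
    then have "zero_orbit (k + nat (- j)) j \<omega> = P (zero_orbit (k + nat (- j)) j \<omega>)" using a[of k] P_Hn by (simp add: adm_def)
    then have "zero_orbit (k + nat (- j)) j \<omega> - Ystar j \<omega> = P (zero_orbit (k + nat (- j)) j \<omega> - lim (\<lambda>k. zero_orbit (k + nat (- j)) j \<omega>))"
      by (simp add: Ystar_def linear_diff[OF P_linear])
    then show "norm (zero_orbit (k + nat (- j)) j \<omega> - Ystar j \<omega>) \<le> norm (zero_orbit (k + nat (- j)) j \<omega> - lim (\<lambda>k. zero_orbit (k + nat (- j)) j \<omega>))"
      using P_norm by simp
  qed simp
  show ?thesis by (rule tendsto_sandwich[OF _ _ tendsto_const l]) (auto intro: always_eventually le)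
qed

lemma Ystar_limit_ge:
  assumes "nat (- j) \<le> N"
  shows "(\<lambda>k. \<integral>\<^sup>+\<omega>. ennreal ((norm (zero_orbit (k + N) j \<omega> - Ystar j \<omega>))\<^sup>2) \<partial>M) \<longlonglongrightarrow> 0"
  using LIMSEQ_ignore_initial_segment[OF Ystar_limit[of j], of "N - nat (- j)"] assms by (simp add: add.assoc)

lemma zero_orbit_adm_ge: "nat (- j) \<le> N \<Longrightarrow> adm j (zero_orbit (k + N) j)"
  using start_le[of "k + N"] by (intro zero_orbit_adm) auto

lemma Ystar_adm: "adm j (Ystar j)"
  unfolding adm_def
proof (intro conjI ballI)
  have a: "adm j (zero_orbit (k + nat (- j)) j)" for k by (rule zero_orbit_adm_ge) simp
  have [measurable]: "zero_orbit (k + nat (- j)) j \<in> borel_measurable (F (T j))" for k using a[of k] by (simp add: adm_def)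
  show m: "Ystar j \<in> borel_measurable (F (T j))" unfolding Ystar_def[abs_def] by measurable
  note [measurable] = adm_M[OF a] measurable_F_M[OF m]
  have "eventually (\<lambda>k. (\<integral>\<^sup>+\<omega>. ennreal ((norm (zero_orbit (k + nat (- j)) j \<omega> - Ystar j \<omega>))\<^sup>2) \<partial>M) < 1) sequentially"
    by (rule order_tendstoD(2)[OF Ystar_limit]) simp
  then obtain k where k: "(\<integral>\<^sup>+\<omega>. ennreal ((norm (zero_orbit (k + nat (- j)) j \<omega> - Ystar j \<omega>))\<^sup>2) \<partial>M) < 1" by (auto simp: eventually_sequentially)
  have "square_integrable M (\<lambda>\<omega>. zero_orbit (k + nat (- j)) j \<omega> - (zero_orbit (k + nat (- j)) j \<omega> - Ystar j \<omega>))"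
  proof (rule square_integrable_diff)
    show "square_integrable M (zero_orbit (k + nat (- j)) j)" using a by (simp add: adm_def)
    show "square_integrable M (\<lambda>\<omega>. zero_orbit (k + nat (- j)) j \<omega> - Ystar j \<omega>)"
      by (rule square_integrable_mono_le) (use k in \<open>auto intro: less_trans\<close>)
  qed
  then show "square_integrable M (Ystar j)" by simp
  show "Ystar j \<omega> \<in> Hn" for \<omega> by (simp add: Ystar_def P_in)
qed

text \<open>A step is continuous in mean square by \<open>step_contraction\<close>. The step from
  \<open>Ystar j\<close> is therefore the limit of the steps of the zero orbits, and that limit is
  \<open>Ystar (j + 1)\<close>.\<close>

lemma Ystar_orbit: "orbit UNIV Ystar"
  unfolding orbit_def
proof (intro ballI conjI)
  fix j :: int
  show "adm j (Ystar j)" by (rule Ystar_adm)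
  obtain V where V: "step_path j (Ystar j) V" using step_path_exists[OF Ystar_adm] by blast
  have h: "h \<in> {0..h}" using h_pos by simp
  note Vs = step_pathD[OF V h]
  define N where "N = nat (- j) + 1"
  have N: "nat (- j) \<le> N" "nat (- (j + 1)) \<le> N" by (auto simp: N_def)
  have "AE \<omega> in M. V h \<omega> = Ystar (j + 1) \<omega>"
  proof (rule L2_tendsto_unique[of "\<lambda>k. zero_orbit (k + N) (j + 1)"])
    show "zero_orbit (k + N) (j + 1) \<in> borel_measurable M" for k by (rule adm_M[OF zero_orbit_adm_ge[OF N(2)]])
    show "V h \<in> borel_measurable M" by (rule measurable_F_M[OF Vs(2)])
    show "Ystar (j + 1) \<in> borel_measurable M" by (rule adm_M[OF Ystar_adm])
    show "(\<lambda>k. \<integral>\<^sup>+\<omega>. ennreal ((norm (zero_orbit (k + N) (j + 1) \<omega> - Ystar (j + 1) \<omega>))\<^sup>2) \<partial>M) \<longlonglongrightarrow> 0"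
      by (rule Ystar_limit_ge[OF N(2)])
    have le: "(\<integral>\<^sup>+\<omega>. ennreal ((norm (zero_orbit (k + N) (j + 1) \<omega> - V h \<omega>))\<^sup>2) \<partial>M)
       \<le> ennreal \<rho> * (\<integral>\<^sup>+\<omega>. ennreal ((norm (zero_orbit (k + N) j \<omega> - Ystar j \<omega>))\<^sup>2) \<partial>M)" for k
      unfolding \<rho>_def
    proof (rule step_contraction[OF _ Vs(1) zero_orbit_adm_ge[OF N(1)] Ystar_adm])
      have "start (k + N) \<le> j" using start_le[of "k + N"] N(1) by linarith
      then show "step j h (zero_orbit (k + N) j) (zero_orbit (k + N) (j + 1))"
        using zero_orbit(2)[of "k + N"] by (auto simp: orbit_def)
    qed (use h_pos in auto)
    have "(\<lambda>k. ennreal \<rho> * (\<integral>\<^sup>+\<omega>. ennreal ((norm (zero_orbit (k + N) j \<omega> - Ystar j \<omega>))\<^sup>2) \<partial>M)) \<longlonglongrightarrow> ennreal \<rho> * 0"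
      by (intro ennreal_tendsto_cmult Ystar_limit_ge[OF N(1)]) simp
    then have l: "(\<lambda>k. ennreal \<rho> * (\<integral>\<^sup>+\<omega>. ennreal ((norm (zero_orbit (k + N) j \<omega> - Ystar j \<omega>))\<^sup>2) \<partial>M)) \<longlonglongrightarrow> 0" by simp
    show "(\<lambda>k. \<integral>\<^sup>+\<omega>. ennreal ((norm (zero_orbit (k + N) (j + 1) \<omega> - V h \<omega>))\<^sup>2) \<partial>M) \<longlonglongrightarrow> 0"
      by (rule tendsto_sandwich[OF _ _ tendsto_const l]) (auto intro: always_eventually le)
  qed
  then show "step j h (Ystar j) (Ystar (j + 1))" by (rule step_cong_result[OF Vs(1)])
qed simp

text \<open>Going back one period under the shift raises the index of the zero orbit by one, which
  the limit does not notice.\<close>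

lemma Ystar_\<theta>: "AE \<omega> in M. Ystar (j + int m) \<omega> = Ystar j (\<theta> \<tau> \<omega>)"
proof -
  define N where "N = nat (- j)"
  have N: "nat (- j) \<le> N" "nat (- (j + int m)) \<le> N" "nat (- j) \<le> Suc N" by (auto simp: N_def)
  note [measurable] = adm_M[OF Ystar_adm] adm_M[OF zero_orbit_adm_ge[OF N(2)]] adm_M[OF zero_orbit_adm_ge[OF N(1)]] adm_M[OF zero_orbit_adm_ge[OF N(3)]]
  show ?thesis
  proof (rule L2_tendsto_unique[of "\<lambda>k. zero_orbit (k + N) (j + int m)"])
    show "(\<lambda>k. \<integral>\<^sup>+\<omega>. ennreal ((norm (zero_orbit (k + N) (j + int m) \<omega> - Ystar (j + int m) \<omega>))\<^sup>2) \<partial>M) \<longlonglongrightarrow> 0"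
      by (rule Ystar_limit_ge[OF N(2)])
    have "(\<integral>\<^sup>+\<omega>. ennreal ((norm (zero_orbit (k + N) (j + int m) \<omega> - Ystar j (\<theta> \<tau> \<omega>)))\<^sup>2) \<partial>M)
       = (\<integral>\<^sup>+\<omega>. ennreal ((norm (zero_orbit (k + Suc N) j \<omega> - Ystar j \<omega>))\<^sup>2) \<partial>M)" for k
    proof (rule nn_integral_AE_\<theta>[of "\<lambda>\<omega>. zero_orbit (k + N) (j + int m) \<omega> - Ystar j (\<theta> \<tau> \<omega>)" "\<lambda>\<omega>. zero_orbit (k + Suc N) j \<omega> - Ystar j \<omega>"])
      have "start (Suc (k + N)) \<le> j" using start_le[of "Suc (k + N)"] N(1) by linarith
      from zero_orbit_\<theta>[OF this]
      show "AE \<omega> in M. zero_orbit (k + N) (j + int m) \<omega> - Ystar j (\<theta> \<tau> \<omega>) = zero_orbit (k + Suc N) j (\<theta> \<tau> \<omega>) - Ystar j (\<theta> \<tau> \<omega>)"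
        by eventually_elim simp
    qed measurable
    then show "(\<lambda>k. \<integral>\<^sup>+\<omega>. ennreal ((norm (zero_orbit (k + N) (j + int m) \<omega> - Ystar j (\<theta> \<tau> \<omega>)))\<^sup>2) \<partial>M) \<longlonglongrightarrow> 0"
      using Ystar_limit_ge[OF N(3)] by simp
  qed measurable
qed

section \<open>Existence, attraction and uniqueness\<close>

abbreviation "rps \<equiv> random_periodic_solution M F Q W \<theta> S e f g n h \<tau>"

lemma grid_iff: "s \<in> time_grid h \<longleftrightarrow> (\<exists>j. s = T j)" by (auto simp: time_grid_def T_def)

lemma rps_exists: "\<exists>y. rps y \<and> (\<forall>t. square_integrable M (y t))"
proof -
  obtain y where y: "\<And>\<omega> t. y t \<omega> \<in> Hn" "\<And>t. y t \<in> borel_measurable M"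
    "\<And>j r. j \<in> UNIV \<Longrightarrow> r \<in> {0..h} \<Longrightarrow> step j r (Ystar j) (y (T j + r))"
    "\<And>j r. j \<in> UNIV \<Longrightarrow> r \<in> {0..h} \<Longrightarrow> square_integrable M (y (T j + r))"
    "\<And>j. j \<in> UNIV \<Longrightarrow> AE \<omega> in M. y (T j) \<omega> = Ystar j \<omega>"
    "\<And>j \<omega>. j \<in> UNIV \<Longrightarrow> \<omega> \<in> space M \<Longrightarrow> continuous_on {T j..T j + h} (\<lambda>t. y t \<omega>)"
    by (rule orbit_interpolation[OF Ystar_orbit]) blast
  have rep: "\<exists>j r. r \<in> {0..h} \<and> t = T j + r" for t
    using T_floor[of t] by (intro exI[of _ "\<lfloor>t / h\<rfloor>"] exI[of _ "t - T \<lfloor>t / h\<rfloor>"]) auto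
  have sq: "square_integrable M (y t)" for t using rep[of t] y(4) by auto
  have cg: "continuous_on {T j..} (\<lambda>t. y t \<omega>)" if "\<omega> \<in> space M" for j \<omega>
    by (rule continuous_on_grid) (use y(6) that in auto)
  have c: "continuous_on UNIV (\<lambda>t. y t \<omega>)" if w: "\<omega> \<in> space M" for \<omega>
    unfolding continuous_on_eq_continuous_at[OF open_UNIV]
  proof
    fix t
    \<comment> \<open>One cell further back, so that \<open>t\<close> is an interior point also when
      it is a grid time.\<close>
    have "T (\<lfloor>t / h\<rfloor> - 1) < t" using T_floor[of t] T_Suc[of "\<lfloor>t / h\<rfloor> - 1"] h_pos by simp
    then have "t \<in> interior {T (\<lfloor>t / h\<rfloor> - 1)..}" by (simp add: interior_Ici[of "T (\<lfloor>t / h\<rfloor> - 1) - 1"])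
    then show "isCont (\<lambda>t. y t \<omega>) t" by (rule continuous_on_interior[OF cg[OF w]])
  qed
  \<comment> \<open>At grid times \<open>y\<close> equals \<open>Ystar\<close> only almost surely,
    whereas the scheme must start from \<open>y s\<close> itself; so the orbit is read off from
    \<open>y\<close> anew.\<close>
  define Yg where "Yg j = y (T j)" for j
  have Yga: "adm j (Yg j)" for j
    unfolding Yg_def by (rule adm_cong_AE[OF Ystar_adm _ y(2) y(1)]) (use y(5)[of j] in auto)
  have Yst: "step j r (Yg j) (y (T j + r))" if "r \<in> {0..h}" for j r
    by (rule step_cong_start[OF y(3) Yga]) (use y(5)[of j] that in \<open>auto simp: Yg_def\<close>)
  have Ygo: "orbit UNIV Yg"
    unfolding orbit_def using Yga Yst[of h] h_pos by (auto simp: Yg_def T_Suc)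
  have cs: "continuous_scheme M F Q W S e f g n h s (y s) y" if "s \<in> time_grid h" for s
  proof -
    obtain j where j: "s = T j" using \<open>s \<in> time_grid h\<close> grid_iff by blast
    have "continuous_scheme M F Q W S e f g n h (T j) (Yg j) y"
      by (rule orbit_continuous_scheme[OF Ygo]) (use Yst cg in auto)
    then show ?thesis by (simp add: j Yg_def)
  qed
  have "AE \<omega> in M. y (t + \<tau>) \<omega> = y t (\<theta> \<tau> \<omega>)" for t
  proof -
    obtain j r where jr: "r \<in> {0..h}" "t = T j + r" using rep[of t] by blast
    have jr': "t + \<tau> = T (j + int m) + r" by (simp add: jr T_shift)
    have "AE \<omega> in M. Yg (j + int m) \<omega> = Yg j (\<theta> \<tau> \<omega>)"
      using Ystar_\<theta>[of j] y(5)[of "j + int m", OF UNIV_I] AE_\<theta>[OF y(5)[of j, OF UNIV_I]]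
      by eventually_elim (simp add: Yg_def)
    from step_\<theta>[OF Yga Yga this Yst[OF jr(1)] Yst[OF jr(1)]] jr(1) show ?thesis unfolding jr' unfolding jr(2) by simp
  qed
  then have per: "AE \<omega> in M. \<forall>t. y (t + \<tau>) \<omega> = y t (\<theta> \<tau> \<omega>)"
  proof (rule AE_continuous_eqI)
    show "AE \<omega> in M. continuous_on UNIV (\<lambda>t. y (t + \<tau>) \<omega>)"
      by (intro AE_I2 continuous_on_compose2[OF c]) (auto intro!: continuous_intros)
    show "AE \<omega> in M. continuous_on UNIV (\<lambda>t. y t (\<theta> \<tau> \<omega>))"
      by (intro AE_I2 c measurable_space[OF \<theta>_measurable])
  qed
  have "rps y"
    unfolding random_periodic_solution_def
  \<comment> \<open>The same process serves as the scheme from every grid time, so the flow identity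
    holds for every outcome.\<close>
  proof (intro conjI exI[of _ "\<lambda>s. y"])
    show "(\<lambda>(t, \<omega>). y t \<omega>) \<in> borel_measurable (borel \<Otimes>\<^sub>M M)" by (rule continuous_paths_jointly_measurable[OF y(2) c])
  qed (use y(1) cs per in auto)
  then show ?thesis using sq by blast
qed

text \<open>Adaptedness at grid times comes from \<open>discrete_scheme\<close>, whose initial value
  agrees with \<open>y\<close> for every outcome.\<close>

lemma rps_adm:
  assumes y: "rps y" "\<And>t. square_integrable M (y t)"
  shows "adm j (y (T j))" "\<exists>X. continuous_scheme M F Q W S e f g n h (T j) (y (T j)) X \<and> (AE \<omega> in M. \<forall>t\<ge>T j. X t \<omega> = y t \<omega>)"
proof -
  obtain X where X: "\<forall>s\<in>time_grid h. continuous_scheme M F Q W S e f g n h s (y s) (X s)"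
    "AE \<omega> in M. \<forall>s\<in>time_grid h. \<forall>t\<ge>s. X s t \<omega> = y t \<omega>" and Hn: "\<forall>t. \<forall>\<omega>\<in>space M. y t \<omega> \<in> Hn"
    using y(1) unfolding random_periodic_solution_def by blast
  have Tj: "T j \<in> time_grid h" by (auto simp: grid_iff)
  have "AE \<omega> in M. \<forall>t\<ge>T j. X (T j) t \<omega> = y t \<omega>" using X(2) by eventually_elim (use Tj in blast)
  with X(1) Tj show "\<exists>X. continuous_scheme M F Q W S e f g n h (T j) (y (T j)) X \<and> (AE \<omega> in M. \<forall>t\<ge>T j. X t \<omega> = y t \<omega>)" by blast
  have "continuous_scheme M F Q W S e f g n h (T j) (y (T j)) (X (T j))" using X(1) Tj by blast
  then obtain Y where Y: "discrete_scheme M F Q W S e f g n h (T j) (y (T j)) Y" unfolding continuous_scheme_def by blast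
  have Y0: "\<forall>\<omega>\<in>space M. Y 0 \<omega> = y (T j) \<omega>" and Ym: "\<forall>i. Y i \<in> borel_measurable (F (T j + real i * h))"
    using Y unfolding discrete_scheme_def Let_def by blast+
  have "Y 0 \<in> borel_measurable (F (T j))" using Ym[rule_format, of 0] by simp
  then have "y (T j) \<in> borel_measurable (F (T j))" by (rule measurable_cong[THEN iffD1, rotated]) (use Y0 in \<open>simp add: F_space\<close>)
  then show "adm j (y (T j))" using y(2) Hn by (simp add: adm_def)
qed

text \<open>Needed for uniqueness, where continuity turns equality almost surely at each time into
  equality at all times at once.\<close>

lemma rps_continuous:
  assumes y: "rps y"
  shows "AE \<omega> in M. continuous_on UNIV (\<lambda>t. y t \<omega>)"
proof -
  obtain X where X: "\<forall>s\<in>time_grid h. continuous_scheme M F Q W S e f g n h s (y s) (X s)"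
    "AE \<omega> in M. \<forall>s\<in>time_grid h. \<forall>t\<ge>s. X s t \<omega> = y t \<omega>" using y(1) unfolding random_periodic_solution_def by blast
  have "AE \<omega> in M. continuous_on {T j..} (\<lambda>t. X (T j) t \<omega>)" for j
  proof -
    have "continuous_scheme M F Q W S e f g n h (T j) (y (T j)) (X (T j))" using X(1) grid_iff by blast
    then show ?thesis unfolding continuous_scheme_def by blast
  qed
  then have "AE \<omega> in M. \<forall>j. continuous_on {T j..} (\<lambda>t. X (T j) t \<omega>)" by (simp add: AE_all_countable)
  with X(2) show ?thesis
  proof eventually_elim
    case (elim \<omega>)
    have cg: "continuous_on {T j..} (\<lambda>t. y t \<omega>)" for j
    proof (rule continuous_on_cong[THEN iffD1, OF refl])
      show "continuous_on {T j..} (\<lambda>t. X (T j) t \<omega>)" using elim(2) by blast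
      show "X (T j) t \<omega> = y t \<omega>" if "t \<in> {T j..}" for t using elim(1) that grid_iff by auto
    qed
    show ?case unfolding continuous_on_eq_continuous_at[OF open_UNIV]
    proof
      fix t
      have "T (\<lfloor>t / h\<rfloor> - 1) < t" using T_floor[of t] T_Suc[of "\<lfloor>t / h\<rfloor> - 1"] h_pos by simp
      then have "t \<in> interior {T (\<lfloor>t / h\<rfloor> - 1)..}" by (simp add: interior_Ici[of "T (\<lfloor>t / h\<rfloor> - 1) - 1"])
      then show "isCont (\<lambda>t. y t \<omega>) t" by (rule continuous_on_interior[OF cg])
    qed
  qed
qed

text \<open>This replaces an a priori moment bound: the data of any solution at the times -k\<tau>
  are bounded in mean square.\<close>

lemma rps_stationary:
  assumes y: "rps y" "\<And>t. square_integrable M (y t)"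
  shows "(\<integral>\<^sup>+\<omega>. ennreal ((norm (y (T (j + start k)) \<omega>))\<^sup>2) \<partial>M) = (\<integral>\<^sup>+\<omega>. ennreal ((norm (y (T j) \<omega>))\<^sup>2) \<partial>M)"
proof (induction k)
  case 0 then show ?case by (simp add: start_def)
next
  case (Suc k)
  have "AE \<omega> in M. \<forall>s. y (s + \<tau>) \<omega> = y s (\<theta> \<tau> \<omega>)" using y(1) unfolding random_periodic_solution_def by blast
  then have "AE \<omega> in M. y (T (j + start (Suc k)) + \<tau>) \<omega> = y (T (j + start (Suc k))) (\<theta> \<tau> \<omega>)" by eventually_elim blast
  moreover have "y (T (j + start (Suc k))) \<in> borel_measurable M" using y(2) by (simp add: square_integrable_def)
  ultimately have "(\<integral>\<^sup>+\<omega>. ennreal ((norm (y (T (j + start (Suc k)) + \<tau>) \<omega>))\<^sup>2) \<partial>M) = (\<integral>\<^sup>+\<omega>. ennreal ((norm (y (T (j + start (Suc k))) \<omega>))\<^sup>2) \<partial>M)"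
    by (rule nn_integral_AE_\<theta>)
  moreover have "T (j + start (Suc k)) + \<tau> = T (j + start k)" using T_shift[of "j + start (Suc k)"] start_Suc[of k] by (simp add: add.assoc)
  ultimately show ?case using Suc by simp
qed

lemma rho_tendsto: "(\<lambda>k. ennreal (\<rho> ^ k) * c) \<longlonglongrightarrow> 0" if c: "c < \<infinity>"
proof -
  obtain r where r: "c = ennreal r" "0 \<le> r" using c by (cases c) auto
  have "(\<lambda>k. ennreal (\<rho> ^ k * r)) \<longlonglongrightarrow> ennreal 0"
    using tendsto_mult_left_zero[OF LIMSEQ_realpow_zero[OF \<rho>]] by (intro tendsto_ennrealI)
  then show ?thesis using \<rho> r by (simp add: ennreal_mult)
qed

text \<open>Both processes are schemes started at the index \<open>j0 + start k\<close>, with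
  initial second moments bounded in \<open>k\<close>, and the number of steps up to \<open>t\<close>
  grows with \<open>k\<close>.\<close>

lemma scheme_attracted:
  assumes y: "rps y" "\<And>t. square_integrable M (y t)"
    and X: "\<And>k. continuous_scheme M F Q W S e f g n h (T (j0 + start k)) (\<eta> k) (X k)"
    and \<eta>: "\<And>k. adm (j0 + start k) (\<eta> k)" and C: "C < \<infinity>" "\<And>k. (\<integral>\<^sup>+\<omega>. ennreal ((norm (\<eta> k \<omega>))\<^sup>2) \<partial>M) \<le> C"
  shows "(\<lambda>k. \<integral>\<^sup>+\<omega>. ennreal ((norm (X k t \<omega> - y t \<omega>))\<^sup>2) \<partial>M) \<longlonglongrightarrow> 0"
proof -
  \<comment> \<open>Starting \<open>N\<close> periods earlier leaves at least \<open>k\<close> full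
    steps between the start with index \<open>k + N\<close> and the cell of
    \<open>t\<close>.\<close>
  define N where "N = nat (j0 - \<lfloor>t / h\<rfloor>)"
  let ?D = "2 * C + 2 * (\<integral>\<^sup>+\<omega>. ennreal ((norm (y (T j0) \<omega>))\<^sup>2) \<partial>M)"
  have D: "?D < \<infinity>" using C(1) square_int_le[OF y(2)]
    by (auto simp: ennreal_add_eq_top ennreal_mult_eq_top_iff less_top[symmetric])
  have le: "(\<integral>\<^sup>+\<omega>. ennreal ((norm (X (k + N) t \<omega> - y t \<omega>))\<^sup>2) \<partial>M) \<le> ennreal (\<rho> ^ k) * ?D" for k
  proof -
    let ?j = "j0 + start (k + N)"
    define i where "i = nat (\<lfloor>t / h\<rfloor> - ?j)"
    have jk: "?j + int k \<le> \<lfloor>t / h\<rfloor>"     proof -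
      have "j0 - \<lfloor>t / h\<rfloor> \<le> int N" by (simp add: N_def)
      with start_le[of "k + N"] show ?thesis unfolding of_nat_add by linarith
    qed
    then have i: "?j + int i = \<lfloor>t / h\<rfloor>" "k \<le> i" by (auto simp: i_def)
    obtain V where V: "continuous_scheme M F Q W S e f g n h (T ?j) (y (T ?j)) V" "AE \<omega> in M. \<forall>t\<ge>T ?j. V t \<omega> = y t \<omega>"
      using rps_adm(2)[OF y] by blast
    have "T ?j \<le> T \<lfloor>t / h\<rfloor>" using jk h_pos by (simp add: T_def)
    then have jt: "T ?j \<le> t" using T_floor(1)[of t] by linarith
    have "(\<integral>\<^sup>+\<omega>. ennreal ((norm (X (k + N) t \<omega> - y t \<omega>))\<^sup>2) \<partial>M) = (\<integral>\<^sup>+\<omega>. ennreal ((norm (X (k + N) t \<omega> - V t \<omega>))\<^sup>2) \<partial>M)"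
      by (rule nn_integral_cong_AE) (use V(2) in eventually_elim, use jt in simp)
    also have "\<dots> \<le> ennreal (\<rho> ^ i) * (\<integral>\<^sup>+\<omega>. ennreal ((norm (\<eta> (k + N) \<omega> - y (T ?j) \<omega>))\<^sup>2) \<partial>M)"
      by (rule scheme_contraction[OF X V(1) \<eta> rps_adm(1)[OF y]]) (use T_floor[of t] i(1) in auto)
    also have "\<dots> \<le> ennreal (\<rho> ^ k) * ?D"
    proof (rule mult_mono)
      show "ennreal (\<rho> ^ i) \<le> ennreal (\<rho> ^ k)" using \<rho> i(2) by (intro ennreal_leI power_decreasing) auto
      have "(\<integral>\<^sup>+\<omega>. ennreal ((norm (\<eta> (k + N) \<omega> - y (T ?j) \<omega>))\<^sup>2) \<partial>M)
         \<le> 2 * (\<integral>\<^sup>+\<omega>. ennreal ((norm (\<eta> (k + N) \<omega>))\<^sup>2) \<partial>M) + 2 * (\<integral>\<^sup>+\<omega>. ennreal ((norm (y (T ?j) \<omega>))\<^sup>2) \<partial>M)"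
        by (rule nn_integral_norm_sum_le2) (auto intro: norm_triangle_ineq4 adm_M[OF \<eta>] adm_M[OF rps_adm(1)[OF y]])
      also have "\<dots> \<le> ?D" unfolding rps_stationary[OF y] by (intro add_mono mult_left_mono C(2)) auto
      finally show "(\<integral>\<^sup>+\<omega>. ennreal ((norm (\<eta> (k + N) \<omega> - y (T ?j) \<omega>))\<^sup>2) \<partial>M) \<le> ?D" .
    qed auto
    finally show ?thesis .
  qed
  have "(\<lambda>k. \<integral>\<^sup>+\<omega>. ennreal ((norm (X (k + N) t \<omega> - y t \<omega>))\<^sup>2) \<partial>M) \<longlonglongrightarrow> 0"
    by (rule tendsto_sandwich[OF _ _ tendsto_const rho_tendsto[OF D]]) (auto intro: always_eventually le)
  then show ?thesis by (rule LIMSEQ_offset)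
qed

text \<open>The competitor \<open>z\<close> is itself a scheme started at the times -k\<tau> from
  data with bounded second moments, hence attracted by \<open>y\<close>.\<close>

lemma rps_unique:
  assumes y: "rps y" "\<And>t. square_integrable M (y t)" and z: "rps z" "\<And>t. square_integrable M (z t)"
  shows "AE \<omega> in M. \<forall>t. z t \<omega> = y t \<omega>"
proof (rule AE_continuous_eqI)
  fix t
  have "\<exists>X. \<forall>k. continuous_scheme M F Q W S e f g n h (T (0 + start k)) (z (T (0 + start k))) (X k) \<and> (AE \<omega> in M. \<forall>t\<ge>T (0 + start k). X k t \<omega> = z t \<omega>)"
    by (intro choice allI rps_adm(2)[OF z])
  then obtain X where X: "\<And>k. continuous_scheme M F Q W S e f g n h (T (0 + start k)) (z (T (0 + start k))) (X k)"
    "\<And>k. AE \<omega> in M. \<forall>t\<ge>T (0 + start k). X k t \<omega> = z t \<omega>" by blast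
  have l: "(\<lambda>k. \<integral>\<^sup>+\<omega>. ennreal ((norm (X k t \<omega> - y t \<omega>))\<^sup>2) \<partial>M) \<longlonglongrightarrow> 0"
    by (rule scheme_attracted[OF y X(1) rps_adm(1)[OF z], of "\<integral>\<^sup>+\<omega>. ennreal ((norm (z (T 0) \<omega>))\<^sup>2) \<partial>M"])
       (use square_int_le[OF z(2)] rps_stationary[OF z, of 0] in auto)
  \<comment> \<open>Once -k\<tau> lies before \<open>t\<close>, the scheme from there has the value
    of \<open>z\<close> at \<open>t\<close>; the sequence is eventually constant and so its value is
    0.\<close>
  have "eventually (\<lambda>k. (\<integral>\<^sup>+\<omega>. ennreal ((norm (X k t \<omega> - y t \<omega>))\<^sup>2) \<partial>M) = (\<integral>\<^sup>+\<omega>. ennreal ((norm (z t \<omega> - y t \<omega>))\<^sup>2) \<partial>M)) sequentially"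
  proof (rule eventually_sequentiallyI)
    fix k assume k: "nat (- \<lfloor>t / h\<rfloor>) \<le> k"
    then have "0 + start k \<le> \<lfloor>t / h\<rfloor>" using start_le[of k] by linarith
    then have "T (0 + start k) \<le> T \<lfloor>t / h\<rfloor>" using h_pos by (simp add: T_def)
    then have "T (0 + start k) \<le> t" using T_floor(1)[of t] by linarith
    with X(2)[of k] show "(\<integral>\<^sup>+\<omega>. ennreal ((norm (X k t \<omega> - y t \<omega>))\<^sup>2) \<partial>M) = (\<integral>\<^sup>+\<omega>. ennreal ((norm (z t \<omega> - y t \<omega>))\<^sup>2) \<partial>M)"
      by (intro nn_integral_cong_AE) (elim eventually_mono, simp)
  qed
  from Lim_transform_eventually[OF l this] have "(\<integral>\<^sup>+\<omega>. ennreal ((norm (z t \<omega> - y t \<omega>))\<^sup>2) \<partial>M) = 0"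
    using LIMSEQ_unique tendsto_const by blast
  moreover have [measurable]: "y t \<in> borel_measurable M" "z t \<in> borel_measurable M" using y(2) z(2) by (auto simp: square_integrable_def)
  ultimately have "AE \<omega> in M. ennreal ((norm (z t \<omega> - y t \<omega>))\<^sup>2) = 0" by (subst (asm) nn_integral_0_iff_AE) auto
  then show "AE \<omega> in M. z t \<omega> = y t \<omega>" by eventually_elim simp
qed (use rps_continuous y z in auto)

end

theorem theorem4p1:
  fixes A :: "'h::{real_inner, banach, second_countable_topology} \<Rightarrow> 'h"
    and D :: "'h set"
    and S :: "real \<Rightarrow> 'h \<Rightarrow>\<^sub>L 'h"
    and e :: "nat \<Rightarrow> 'h"
    and lam :: "nat \<Rightarrow> real"
    and M :: "'w measure"
    and F :: "real \<Rightarrow> 'w measure"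
    and Q :: "'u::{real_inner, banach, second_countable_topology} \<Rightarrow>\<^sub>L 'u"
    and W :: "real \<Rightarrow> 'u \<Rightarrow> 'w \<Rightarrow> real"
    and \<theta> :: "real \<Rightarrow> 'w \<Rightarrow> 'w"
    and f :: "real \<Rightarrow> 'h \<Rightarrow> 'h"
    and g :: "real \<Rightarrow> 'h \<Rightarrow> 'u \<Rightarrow> 'h"
    and \<tau> \<kappa> Cf Cg Cfg Lfg h Cn cn :: real
    and \<xi> :: "'w \<Rightarrow> 'h"
    and n :: nat
  assumes A_linear: "linear_on_domain D A"
    and A_dense: "closure D = UNIV"
    and A_self_adjoint: "self_adjoint_on_domain D A"
    and A_positive: "positive_definite_on_domain D A"
    and A_compact: "has_compact_inverse D A"
    and basis: "orthonormal_basis e"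
    and eigen: "\<And>i. i \<ge> 1 \<Longrightarrow> e i \<in> D \<and> A (e i) = lam i *\<^sub>R e i"
    and lam_pos: "0 < lam 1"
    and lam_mono: "\<And>i j. 1 \<le> i \<Longrightarrow> i \<le> j \<Longrightarrow> lam i \<le> lam j"
    and lam_lim: "filterlim lam at_top sequentially"
    and semigroup: "generates_contraction_semigroup D (\<lambda>x. - A x) S"
    and M_prob: "prob_space M"
    and F_usual: "usual_filtration M F"
    and Q_cov: "positive_op Q"
    and W_wiener: "two_sided_wiener M F Q W"
    and shift: "ergodic_wiener_shift M W \<theta>"
    and \<tau>_pos: "0 < \<tau>"
    and g_L20: "\<And>t u. g t u \<in> L20 Q"
    and f_cont: "continuous_on UNIV (\<lambda>(t, u). f t u)"
    and g_cont: "\<And>t u. ((\<lambda>(t', u'). L20_dist Q (g t' u') (g t u)) \<longlongrightarrow> 0) (at (t, u))"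
    and f_periodic: "\<And>t u. f (t + \<tau>) u = f t u"
    and g_periodic: "\<And>t u v. v \<in> U0 Q \<Longrightarrow> g (t + \<tau>) u v = g t u v"
    and \<kappa>: "0 < \<kappa>" "\<kappa> \<le> 1/2"
    and C_pos: "0 < Cf" "0 < Cg" "0 < Cfg"
    and f_lip: "\<And>t u1 u2. t \<in> {0..<\<tau>} \<Longrightarrow> norm (f t u1 - f t u2) \<le> Cf * norm (u1 - u2)"
    and f_hoelder: "\<And>t1 t2 u. t1 \<in> {0..<\<tau>} \<Longrightarrow> t2 \<in> {0..<\<tau>} \<Longrightarrow>
           norm (f t1 u - f t2 u) \<le> Cf * (1 + norm u) * \<bar>t1 - t2\<bar> powr \<kappa>"
    and g_lip: "\<And>t u1 u2. t \<in> {0..<\<tau>} \<Longrightarrow>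
           L20_dist Q (g t u1) (g t u2) \<le> Cg * norm (u1 - u2)"
    and g_hoelder: "\<And>t1 t2 u. t1 \<in> {0..<\<tau>} \<Longrightarrow> t2 \<in> {0..<\<tau>} \<Longrightarrow>
           L20_dist Q (g t1 u) (g t2 u) \<le> Cg * (1 + norm u) * \<bar>t1 - t2\<bar> powr \<kappa>"
    and dissipative: "\<And>t u1 u2. t \<in> {0..<\<tau>} \<Longrightarrow>
           2 * inner (f t u1 - f t u2) (u1 - u2) + (L20_dist Q (g t u1) (g t u2))\<^sup>2
             \<le> - Cfg * (norm (u1 - u2))\<^sup>2"
    and Lfg: "Lfg = norm (f 0 0) + L20_norm Q (g 0 0) + (Cf + Cg) * (1 + sqrt \<tau>)"
    and Cf_lam: "Cf < lam 1"
    and Lfg_lam: "Lfg < 2 * lam 1"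
    and Cf_Cg_lam: "Cf / lam 1 + Cg / sqrt (lam 1) < 1"
    and \<xi>_meas: "\<And>k::nat. \<xi> \<in> borel_measurable (F (- (real k * \<tau>)))"
    and \<xi>_L2: "square_integrable M \<xi>"
    and n: "n \<ge> 1"
    and Cn: "Cn = 3 * ((lam n)\<^sup>2 + 4 * Lfg\<^sup>2)"
    and cn: "cn = 3 * ((lam n)\<^sup>2 + Cf\<^sup>2 + Cg\<^sup>2)"
    and h: "0 < h" "h < 1"
    and h_grid: "\<exists>m::nat. \<tau> = real m * h"
    and h_small1: "2 * Cf * (sqrt h * lam n + sqrt cn) * sqrt h \<le> Cfg"
    and h_small2: "(5 * Lfg * sqrt (h * lam n) * (1 + Cn * h) + 2 * Cf * sqrt Cn) * sqrt h
                     \<le> 2 * Cfg"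
  shows "\<exists>Xstar.
     random_periodic_solution M F Q W \<theta> S e f g n h \<tau> Xstar \<and>
     (\<forall>t. square_integrable M (Xstar t)) \<and>
     (\<forall>y. random_periodic_solution M F Q W \<theta> S e f g n h \<tau> y \<and>
          (\<forall>t. square_integrable M (y t)) \<longrightarrow>
          (AE \<omega> in M. \<forall>t. y t \<omega> = Xstar t \<omega>)) \<and>
     (\<exists>X. \<forall>k::nat. continuous_scheme M F Q W S e f g n h (- (real k * \<tau>))
                     (\<lambda>\<omega>. galerkin_proj e n (\<xi> \<omega>)) (X k)) \<and>
     (\<forall>X. (\<forall>k::nat. continuous_scheme M F Q W S e f g n h (- (real k * \<tau>))
                      (\<lambda>\<omega>. galerkin_proj e n (\<xi> \<omega>)) (X k)) \<longrightarrow>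
          (\<forall>t. (\<lambda>k. \<integral>\<^sup>+ \<omega>. ennreal ((norm (X k t \<omega> - Xstar t \<omega>))\<^sup>2) \<partial>M) \<longlonglongrightarrow> 0))"
proof -
  interpret cov: covariance Q by unfold_locales (rule Q_cov)
  obtain m :: nat where m: "\<tau> = real m * h" using h_grid by blast
  have m1: "1 \<le> m" using m \<tau>_pos by (cases m) auto
  \<comment> \<open>The conditions are given on \<open>{0..<\<tau>}\<close> and are extended to all
    times through the residue \<open>r t\<close> of \<open>t\<close> modulo
    \<open>\<tau>\<close>.\<close>
  define fl where "fl t = \<lfloor>t / \<tau>\<rfloor>" for t
  define r where "r t = t - of_int (fl t) * \<tau>" for t
  have r: "r t \<in> {0..<\<tau>}" for t
  proof -
    have "of_int (fl t) * \<tau> \<le> t" "t < (of_int (fl t) + 1) * \<tau>"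
      using \<tau>_pos by (simp_all add: fl_def pos_le_divide_eq[symmetric] pos_divide_less_eq[symmetric])
    then show ?thesis by (simp add: r_def algebra_simps)
  qed
  have per: "p (t + of_int k * \<tau>) = p t" if p: "\<And>t. p (t + \<tau>) = p t" for p :: "real \<Rightarrow> 'c" and k t
  proof (induction k rule: int_induct[where k = 0])
    case base show ?case by simp
  next
    case (step1 i) then show ?case using p[of "t + of_int i * \<tau>"] by (simp add: algebra_simps)
  next
    case (step2 i) then show ?case using p[of "t + of_int (i - 1) * \<tau>"] by (simp add: algebra_simps)
  qed
  have rt: "r t + of_int (fl t) * \<tau> = t" for t by (simp add: r_def)
  have fr: "f t u = f (r t) u" for t u using per[of "\<lambda>t. f t u" "r t" "fl t"] f_periodic by (simp add: rt)
  have gr: "g t u v = g (r t) u v" if "v \<in> U0 Q" for t u v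
    using per[of "\<lambda>t. g t u v" "r t" "fl t"] g_periodic[OF that] by (simp add: rt)
  \<comment> \<open>The norm sees only basis vectors, and these lie in \<open>U0 Q\<close>, where
    \<open>g\<close> is periodic.\<close>
  have dr: "L20_dist Q (g t u1) (g t u2) = L20_dist Q (g (r t) u1) (g (r t) u2)" for t u1 u2
    by (rule cov.L20_norm_cong) (simp add: gr[OF cov.B_U0, of _ t])
  have sg: "S 0 = id_blinfun" "\<forall>s\<ge>0. \<forall>t\<ge>0. S (s + t) = S s o\<^sub>L S t" "\<forall>t\<ge>0. norm (S t) \<le> 1"
    using semigroup unfolding generates_contraction_semigroup_def by blast+
  \<comment> \<open>This follows from \<open>h_small1\<close>: \<open>sqrt cn\<close> is at least
    \<open>Cf\<close>, since \<open>Cf\<^sup>2\<close> is one of the terms in \<open>cn\<close>, and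
    \<open>sqrt h \<ge> h\<close> because \<open>h < 1\<close>.\<close>
  have "Cf\<^sup>2 * h \<le> Cfg / 2"
  proof -
    have "0 < lam n" using lam_pos lam_mono[of 1 n] n by simp
    then have l: "0 \<le> sqrt h * lam n" using h by simp
    have "Cf = sqrt (Cf\<^sup>2)" using C_pos by simp
    also have "\<dots> \<le> sqrt cn" unfolding cn by (rule real_sqrt_le_mono) (simp add: add_increasing)
    finally have c: "Cf \<le> sqrt h * lam n + sqrt cn" using l by simp
    have "h = sqrt h * sqrt h" using h by simp
    also have "\<dots> \<le> 1 * sqrt h" using h by (intro mult_right_mono) auto
    finally have s: "h \<le> sqrt h" by simp
    have "2 * (Cf\<^sup>2 * h) = 2 * Cf * Cf * h" by (simp add: power2_eq_square)
    also have "\<dots> \<le> 2 * Cf * (sqrt h * lam n + sqrt cn) * sqrt h"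
      using c s C_pos h by (intro mult_mono mult_left_mono) auto
    finally show ?thesis using h_small1 by simp
  qed
  moreover have "blinfun_apply (S t) (e i) = exp (- lam i * t) *\<^sub>R e i" if "1 \<le> i" "0 \<le> t" for i t
    by (rule semigroup_eigenvector[OF semigroup]) (use eigen[OF that(1)] that lam_mono[OF _ that(1)] lam_pos in auto)
  moreover have "norm (f t u1 - f t u2) \<le> Cf * norm (u1 - u2)" for t u1 u2
    using f_lip[OF r] by (simp add: fr[of t])
  moreover have "2 * inner (f t u1 - f t u2) (u1 - u2) + (L20_dist Q (g t u1) (g t u2))\<^sup>2 \<le> - Cfg * (norm (u1 - u2))\<^sup>2" for t u1 u2
    unfolding dr[of t] using dissipative[OF r] by (simp add: fr[of t])
  moreover have "L20_dist Q (g t u1) (g t u2) \<le> Cg * norm (u1 - u2)" for t u1 u2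
    unfolding dr[of t] by (rule g_lip[OF r])
  ultimately interpret gp: galerkin_periodic Q M F W S e lam f g n h Cf Cg Cfg \<theta> \<tau> m
    using basis sg g_L20 C_pos h(1) shift f_periodic g_periodic m m1 F_usual W_wiener M_prob
    by (intro galerkin_periodic.intro galerkin_scheme.intro wiener_space.intro wiener_space_axioms.intro
        galerkin_scheme_axioms.intro galerkin_periodic_axioms.intro cov.covariance_axioms)
      (simp_all add: orthonormal_basis_def)
  obtain y where y: "random_periodic_solution M F Q W \<theta> S e f g n h \<tau> y" "\<And>t. square_integrable M (y t)"
    using gp.rps_exists by blast
  have \<xi>[measurable]: "\<xi> \<in> borel_measurable M" using \<xi>_L2 by (simp add: square_integrable_def)
  have le: "ennreal ((norm (galerkin_proj e n (\<xi> \<omega>)))\<^sup>2) \<le> ennreal ((norm (\<xi> \<omega>))\<^sup>2)" for \<omega>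
    by (intro ennreal_leI power_mono gp.P_norm) simp
  have "square_integrable M (\<lambda>\<omega>. galerkin_proj e n (\<xi> \<omega>))"
    unfolding square_integrable_def
  proof
    show Pm: "(\<lambda>\<omega>. galerkin_proj e n (\<xi> \<omega>)) \<in> borel_measurable M"
      by (rule measurable_compose[OF \<xi> gp.P_measurable])
    show "integrable M (\<lambda>\<omega>. (norm (galerkin_proj e n (\<xi> \<omega>)))\<^sup>2)"
    proof (rule Bochner_Integration.integrable_bound)
      show "integrable M (\<lambda>\<omega>. (norm (\<xi> \<omega>))\<^sup>2)" using \<xi>_L2 by (simp add: square_integrable_def)
      show "AE \<omega> in M. norm ((norm (galerkin_proj e n (\<xi> \<omega>)))\<^sup>2) \<le> norm ((norm (\<xi> \<omega>))\<^sup>2)"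
        by (intro AE_I2) (simp add: power_mono gp.P_norm)
    qed (use Pm in measurable)
  qed
  then have adm: "gp.adm (gp.start k) (\<lambda>\<omega>. galerkin_proj e n (\<xi> \<omega>))" for k
    unfolding gp.adm_def gp.T_start using \<xi>_meas[of k] gp.P_in by (auto intro: measurable_compose[OF _ gp.P_measurable])
  have "\<exists>X. continuous_scheme M F Q W S e f g n h (- (real k * \<tau>)) (\<lambda>\<omega>. galerkin_proj e n (\<xi> \<omega>)) X" for k
    using gp.scheme_exists[OF adm[of k]] unfolding gp.T_start by blast
  then have ex: "\<exists>X. \<forall>k::nat. continuous_scheme M F Q W S e f g n h (- (real k * \<tau>))
                     (\<lambda>\<omega>. galerkin_proj e n (\<xi> \<omega>)) (X k)"
    by (intro choice) blast
  have lim: "(\<lambda>k. \<integral>\<^sup>+ \<omega>. ennreal ((norm (X k t \<omega> - y t \<omega>))\<^sup>2) \<partial>M) \<longlonglongrightarrow> 0"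
    if X: "\<forall>k::nat. continuous_scheme M F Q W S e f g n h (- (real k * \<tau>)) (\<lambda>\<omega>. galerkin_proj e n (\<xi> \<omega>)) (X k)" for X t
  \<comment> \<open>With \<open>j0 = 0\<close> the starts are the times -k\<tau>, and the second
    moment of \<open>\<xi>\<close> bounds that of the projected data.\<close>
  proof (rule gp.scheme_attracted[OF y, where ?j0.0 = 0])
    show "continuous_scheme M F Q W S e f g n h (gp.T (0 + gp.start k)) (\<lambda>\<omega>. galerkin_proj e n (\<xi> \<omega>)) (X k)" for k
      using X by (simp add: gp.T_start)
    show "gp.adm (0 + gp.start k) (\<lambda>\<omega>. galerkin_proj e n (\<xi> \<omega>))" for k using adm by simp
    show "(\<integral>\<^sup>+\<omega>. ennreal ((norm (\<xi> \<omega>))\<^sup>2) \<partial>M) < \<infinity>"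
      using \<xi>_L2 by (simp add: square_integrable_nn)
    show "(\<integral>\<^sup>+\<omega>. ennreal ((norm (galerkin_proj e n (\<xi> \<omega>)))\<^sup>2) \<partial>M) \<le> (\<integral>\<^sup>+\<omega>. ennreal ((norm (\<xi> \<omega>))\<^sup>2) \<partial>M)" for k :: nat
      by (rule nn_integral_mono) (rule le)
  qed
  show ?thesis
  proof (intro exI[of _ y] conjI allI impI)
    fix z assume z: "random_periodic_solution M F Q W \<theta> S e f g n h \<tau> z \<and> (\<forall>t. square_integrable M (z t))"
    show "AE \<omega> in M. \<forall>t. z t \<omega> = y t \<omega>" by (rule gp.rps_unique[OF y]) (use z in blast)+
  qed (fact y(1), fact y(2), fact ex, fact lim)
qed

end
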